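(* Let $k$ be an algebraically closed field of characteristic zero, let $A_0$ be a commutative $k$-algebra which is a domain, and let $A$ be a quantum formal deformation of $A_0$ over $k[[\hbar]]$. Let $H_0$ be a finite dimensional Hopf algebra over $k$ which acts on $A$. Equip the fraction field $Q(A_0)$ with the Poisson bracket $\{\,,\}$ induced by the deformation $A$. If the Poisson center of $Q(A_0)$ is trivial (i.e., for $f\in Q(A_0)$, $\{f,g\}=0$ for all $g\in Q(A_0)$ implies $f\in k$), then the action of $H_0$ on $A$ factors through a group action.
   Context: All algebras are associative and unital. A (flat) formal deformation of a $k$-algebra $A_0$ is a $k[[\hbar]]$-algebra $A$ which is topologically free over $k[[\hbar]]$ (i.e., $A\cong A_0[[\hbar]]$ as $k[[\hbar]]$-modules) and equipped with an algebra isomorphism $A/\hbar A\cong A_0$. If $A_0$ is commutative, such an $A$ (not necessarily commutative) is called a quantum formal deformation of $A_0$. Induced Poisson bracket: for $a_0,b_0\in A_0$, $\{a_0,b_0\}$ is the image of $[a,b]=ab-ba$ in $\hbar A/\hbar^2A\cong A_0$, where $a,b\in A$ are any lifts of $a_0,b_0$. This is a well defined Poisson bracket on $A_0$, and, being a biderivation, it extends uniquely to the fraction field $Q(A_0)$. A Hopf algebra $H$ acts on an algebra $B$ if $B$ is a left $H$-module algebra: $B$ is a left $H$-module with $h\cdot(ab)=\sum (h_{(1)}\cdot a)(h_{(2)}\cdot b)$ and $h\cdot 1=\varepsilon(h)1$. Actions of a Hopf algebra on a $k[[\hbar]]$-algebra are by $k[[\hbar]]$-linear maps. An action of a finite dimensional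 Hopf algebra $H$ over $k$ on $B$ factors through a group action (equivalently, through a group algebra) if there is a Hopf ideal $I\subset H$ with $I\cdot B=0$ such that $H/I\cong kG$ as Hopf algebras for some finite group $G$. *)

theory Defs
  imports
    "HOL-Algebra.Algebraic_Closure_Type"
    "HOL-Library.Poly_Mapping"
begin

unbundle fps_syntax

section \<open>Algebras over a commutative ring\<close>

text \<open>
  Scalars form a type of class \<^class>\<open>comm_ring_1\<close>, algebras are \<^type>\<open>module_scheme\<close> records with
  an explicit carrier.  The locale of HOL-Algebra called \<open>algebra\<close> only covers commutative algebras.
\<close>

definition assoc_algebra :: "('r::comm_ring_1, 'b, 'm) module_scheme \<Rightarrow> bool" where
  "assoc_algebra B \<longleftrightarrow> ring B \<and> Module.module (ring_of_type_algebra :: 'r ring) B \<and>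
     (\<forall>c. \<forall>x\<in>carrier B. \<forall>y\<in>carrier B.
        (c \<odot>\<^bsub>B\<^esub> x) \<otimes>\<^bsub>B\<^esub> y = c \<odot>\<^bsub>B\<^esub> (x \<otimes>\<^bsub>B\<^esub> y) \<and>
        x \<otimes>\<^bsub>B\<^esub> (c \<odot>\<^bsub>B\<^esub> y) = c \<odot>\<^bsub>B\<^esub> (x \<otimes>\<^bsub>B\<^esub> y))"

definition type_algebra :: "('r \<Rightarrow> 'a \<Rightarrow> 'a) \<Rightarrow> ('r, 'a::ring_1) module" where
  "type_algebra s = ring.extend ring_of_type_algebra (module.fields s)"

definition linear_maps :: "('r, 'b, 'm) module_scheme \<Rightarrow> ('r, 'c, 'n) module_scheme \<Rightarrow> ('b \<Rightarrow> 'c) set" where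
  "linear_maps M N = {f \<in> carrier M \<rightarrow> carrier N.
     (\<forall>x\<in>carrier M. \<forall>y\<in>carrier M. f (x \<oplus>\<^bsub>M\<^esub> y) = f x \<oplus>\<^bsub>N\<^esub> f y) \<and>
     (\<forall>c. \<forall>x\<in>carrier M. f (c \<odot>\<^bsub>M\<^esub> x) = c \<odot>\<^bsub>N\<^esub> f x)}"

definition algebra_homs :: "('r, 'b, 'm) module_scheme \<Rightarrow> ('r, 'c, 'n) module_scheme \<Rightarrow> ('b \<Rightarrow> 'c) set" where
  "algebra_homs B C = ring_hom B C \<inter> linear_maps B C"

definition algebra_isos :: "('r, 'b, 'm) module_scheme \<Rightarrow> ('r, 'c, 'n) module_scheme \<Rightarrow> ('b \<Rightarrow> 'c) set" where
  "algebra_isos B C = {f \<in> algebra_homs B C. bij_betw f (carrier B) (carrier C)}"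

definition modules_isomorphic :: "('r, 'b, 'm) module_scheme \<Rightarrow> ('r, 'c, 'n) module_scheme \<Rightarrow> bool" where
  "modules_isomorphic M N \<longleftrightarrow> (\<exists>f \<in> linear_maps M N. bij_betw f (carrier M) (carrier N))"

definition finite_dimensional :: "('k::field, 'b, 'm) module_scheme \<Rightarrow> bool" where
  "finite_dimensional M \<longleftrightarrow> (\<exists>E. finite E \<and> E \<subseteq> carrier M \<and>
     (\<forall>x\<in>carrier M. \<exists>c. x = (\<Oplus>\<^bsub>M\<^esub>e\<in>E. c e \<odot>\<^bsub>M\<^esub> e)))"

text \<open>The scalar \<open>c\<close> acts on the coset \<open>I + x\<close> by \<open>I + c x\<close>.\<close>

definition quot_algebra :: "('r, 'b, 'm) module_scheme \<Rightarrow> 'b set \<Rightarrow> ('r, 'b set) module" where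
  "quot_algebra B I =
     ring.extend (B Quot I) (module.fields (\<lambda>c C. \<Union>x\<in>C. I +>\<^bsub>B\<^esub> (c \<odot>\<^bsub>B\<^esub> x)))"


section \<open>Tensor products\<close>

text \<open>
  \<open>tensor V W\<close> is the free vector space on \<open>carrier V \<times> carrier W\<close>, that is, the finitely supported
  functions \<^typ>\<open>('v \<times> 'w) \<Rightarrow>\<^sub>0 'k\<close> with keys in that set, modulo the span \<open>tensor_null V W\<close> of the
  bilinearity relations.  Its elements are equivalence classes.
\<close>

definition pm_scale :: "'k::field \<Rightarrow> ('p \<Rightarrow>\<^sub>0 'k) \<Rightarrow> ('p \<Rightarrow>\<^sub>0 'k)" where
  "pm_scale c t = Poly_Mapping.map ((*) c) t"

inductive_set tensor_null ::
  "('k::field, 'v, 'm) module_scheme \<Rightarrow> ('k, 'w, 'n) module_scheme \<Rightarrow> (('v \<times> 'w) \<Rightarrow>\<^sub>0 'k) set"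
  for V :: "('k, 'v, 'm) module_scheme" and W :: "('k, 'w, 'n) module_scheme" where
  zero: "0 \<in> tensor_null V W"
| add: "\<lbrakk>s \<in> tensor_null V W; t \<in> tensor_null V W\<rbrakk> \<Longrightarrow> s + t \<in> tensor_null V W"
| scale: "t \<in> tensor_null V W \<Longrightarrow> pm_scale c t \<in> tensor_null V W"
| add_left: "\<lbrakk>x \<in> carrier V; x' \<in> carrier V; y \<in> carrier W\<rbrakk> \<Longrightarrow>
    Poly_Mapping.single (x \<oplus>\<^bsub>V\<^esub> x', y) 1 - Poly_Mapping.single (x, y) 1
      - Poly_Mapping.single (x', y) 1 \<in> tensor_null V W"
| add_right: "\<lbrakk>x \<in> carrier V; y \<in> carrier W; y' \<in> carrier W\<rbrakk> \<Longrightarrow>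
    Poly_Mapping.single (x, y \<oplus>\<^bsub>W\<^esub> y') 1 - Poly_Mapping.single (x, y) 1
      - Poly_Mapping.single (x, y') 1 \<in> tensor_null V W"
| scale_left: "\<lbrakk>x \<in> carrier V; y \<in> carrier W\<rbrakk> \<Longrightarrow>
    Poly_Mapping.single (c \<odot>\<^bsub>V\<^esub> x, y) 1 - Poly_Mapping.single (x, y) c \<in> tensor_null V W"
| scale_right: "\<lbrakk>x \<in> carrier V; y \<in> carrier W\<rbrakk> \<Longrightarrow>
    Poly_Mapping.single (x, c \<odot>\<^bsub>W\<^esub> y) 1 - Poly_Mapping.single (x, y) c \<in> tensor_null V W"

definition tensor_class :: "('k::field, 'v, 'm) module_scheme \<Rightarrow> ('k, 'w, 'n) module_scheme \<Rightarrow>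
    (('v \<times> 'w) \<Rightarrow>\<^sub>0 'k) \<Rightarrow> (('v \<times> 'w) \<Rightarrow>\<^sub>0 'k) set" where
  "tensor_class V W t =
     {s. Poly_Mapping.keys s \<subseteq> carrier V \<times> carrier W \<and> s - t \<in> tensor_null V W}"

definition pure_tensor :: "('k::field, 'v, 'm) module_scheme \<Rightarrow> ('k, 'w, 'n) module_scheme \<Rightarrow>
    'v \<Rightarrow> 'w \<Rightarrow> (('v \<times> 'w) \<Rightarrow>\<^sub>0 'k) set" where
  "pure_tensor V W x y = tensor_class V W (Poly_Mapping.single (x, y) 1)"

text \<open>The product on classes is the one with \<open>(x \<otimes> y)(x' \<otimes> y') = x x' \<otimes> y y'\<close>.\<close>

definition tensor :: "('k::field, 'v, 'm) module_scheme \<Rightarrow> ('k, 'w, 'n) module_scheme \<Rightarrow>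
    ('k, (('v \<times> 'w) \<Rightarrow>\<^sub>0 'k) set) module" where
  "tensor V W =
    \<lparr>carrier = tensor_class V W ` {t. Poly_Mapping.keys t \<subseteq> carrier V \<times> carrier W},
     monoid.mult = (\<lambda>S T. \<Union>s\<in>S. \<Union>t\<in>T. tensor_class V W
       (\<Sum>p\<in>Poly_Mapping.keys s. \<Sum>q\<in>Poly_Mapping.keys t.
          Poly_Mapping.single (fst p \<otimes>\<^bsub>V\<^esub> fst q, snd p \<otimes>\<^bsub>W\<^esub> snd q)
            (Poly_Mapping.lookup s p * Poly_Mapping.lookup t q))),
     one = pure_tensor V W \<one>\<^bsub>V\<^esub> \<one>\<^bsub>W\<^esub>,
     ring.zero = tensor_class V W 0,
     add = (\<lambda>S T. \<Union>s\<in>S. \<Union>t\<in>T. tensor_class V W (s + t)),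
     module.smult = (\<lambda>c T. \<Union>t\<in>T. tensor_class V W (pm_scale c t))\<rparr>"

text \<open>
  The linear map \<open>tensor V W \<rightarrow> U\<close> induced by a bilinear map \<open>b\<close>, evaluated at the class \<open>T\<close> through an
  arbitrary representative (for bilinear \<open>b\<close> the value does not depend on the choice).  In Sweedler
  notation, \<open>tensor_lift U b (comul H h)\<close> is the sum of the terms \<open>b h\<^sub>(\<^sub>1\<^sub>) h\<^sub>(\<^sub>2\<^sub>)\<close>.
\<close>

definition tensor_lift :: "('k::field, 'u, 'l) module_scheme \<Rightarrow> ('v \<Rightarrow> 'w \<Rightarrow> 'u) \<Rightarrow>
    (('v \<times> 'w) \<Rightarrow>\<^sub>0 'k) set \<Rightarrow> 'u" where
  "tensor_lift U b T = (let t = (SOME t. t \<in> T) in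
     \<Oplus>\<^bsub>U\<^esub>p\<in>Poly_Mapping.keys t. Poly_Mapping.lookup t p \<odot>\<^bsub>U\<^esub> b (fst p) (snd p))"


section \<open>Hopf algebras\<close>

record (overloaded) ('k::zero, 'h) hopf = "('k, 'h) module" +
  comul :: "'h \<Rightarrow> (('h \<times> 'h) \<Rightarrow>\<^sub>0 'k) set"
  counit :: "'h \<Rightarrow> 'k"
  antipode :: "'h \<Rightarrow> 'h"

definition hopf_algebra :: "('k::field, 'h, 'm) hopf_scheme \<Rightarrow> bool" where
  "hopf_algebra H \<longleftrightarrow> assoc_algebra H \<and>
     comul H \<in> algebra_homs H (tensor H H) \<and>
     counit H \<in> algebra_homs H (type_algebra (*)) \<and>
     antipode H \<in> linear_maps H H \<and>
     (\<forall>h\<in>carrier H.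
        tensor_lift (tensor H (tensor H H))
          (\<lambda>x z. tensor_lift (tensor H (tensor H H))
             (\<lambda>u v. pure_tensor H (tensor H H) u (pure_tensor H H v z)) (comul H x)) (comul H h)
        = tensor_lift (tensor H (tensor H H))
            (\<lambda>x y. pure_tensor H (tensor H H) x (comul H y)) (comul H h)) \<and>
     (\<forall>h\<in>carrier H.
        tensor_lift H (\<lambda>x y. counit H x \<odot>\<^bsub>H\<^esub> y) (comul H h) = h \<and>
        tensor_lift H (\<lambda>x y. counit H y \<odot>\<^bsub>H\<^esub> x) (comul H h) = h) \<and>
     (\<forall>h\<in>carrier H.
        tensor_lift H (\<lambda>x y. antipode H x \<otimes>\<^bsub>H\<^esub> y) (comul H h) = counit H h \<odot>\<^bsub>H\<^esub> \<one>\<^bsub>H\<^esub> \<and>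
        tensor_lift H (\<lambda>x y. x \<otimes>\<^bsub>H\<^esub> antipode H y) (comul H h) = counit H h \<odot>\<^bsub>H\<^esub> \<one>\<^bsub>H\<^esub>)"

text \<open>The condition on \<^const>\<open>comul\<close> says that \<open>I\<close> is mapped into \<open>I \<otimes> H + H \<otimes> I\<close>.\<close>

definition hopf_ideal :: "('k::field, 'h, 'm) hopf_scheme \<Rightarrow> 'h set \<Rightarrow> bool" where
  "hopf_ideal H I \<longleftrightarrow> ideal I H \<and> (\<forall>c. \<forall>x\<in>I. c \<odot>\<^bsub>H\<^esub> x \<in> I) \<and>
     (\<forall>x\<in>I. \<exists>t\<in>comul H x. Poly_Mapping.keys t \<subseteq> I \<times> carrier H \<union> carrier H \<times> I) \<and>
     (\<forall>x\<in>I. counit H x = 0) \<and> (\<forall>x\<in>I. antipode H x \<in> I)"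

definition quot_hopf :: "('k::field, 'h, 'm) hopf_scheme \<Rightarrow> 'h set \<Rightarrow> ('k, 'h set) hopf" where
  "quot_hopf H I = (let Q = quot_algebra H I in module.extend Q (hopf.fields
     (\<lambda>C. tensor_lift (tensor Q Q)
        (\<lambda>x y. pure_tensor Q Q (I +>\<^bsub>H\<^esub> x) (I +>\<^bsub>H\<^esub> y)) (comul H (SOME x. x \<in> C)))
     (\<lambda>C. counit H (SOME x. x \<in> C))
     (\<lambda>C. I +>\<^bsub>H\<^esub> antipode H (SOME x. x \<in> C))))"

definition hopf_isos :: "('k::field, 'h, 'm) hopf_scheme \<Rightarrow> ('k, 'g, 'n) hopf_scheme \<Rightarrow> ('h \<Rightarrow> 'g) set" where
  "hopf_isos H K = {f \<in> algebra_isos H K. \<forall>h\<in>carrier H.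
     comul K (f h) = tensor_lift (tensor K K) (\<lambda>x y. pure_tensor K K (f x) (f y)) (comul H h) \<and>
     counit K (f h) = counit H h \<and>
     antipode K (f h) = f (antipode H h)}"

definition group_algebra :: "('g, 'm) monoid_scheme \<Rightarrow> ('k::field, 'g \<Rightarrow>\<^sub>0 'k) module" where
  "group_algebra G =
    \<lparr>carrier = {f. Poly_Mapping.keys f \<subseteq> carrier G},
     monoid.mult = (\<lambda>f f'. \<Sum>g\<in>Poly_Mapping.keys f. \<Sum>g'\<in>Poly_Mapping.keys f'.
       Poly_Mapping.single (g \<otimes>\<^bsub>G\<^esub> g') (Poly_Mapping.lookup f g * Poly_Mapping.lookup f' g')),
     one = Poly_Mapping.single \<one>\<^bsub>G\<^esub> 1,
     ring.zero = 0,
     add = (+),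
     module.smult = pm_scale\<rparr>"

definition group_hopf :: "('g, 'm) monoid_scheme \<Rightarrow> ('k::field, 'g \<Rightarrow>\<^sub>0 'k) hopf" where
  "group_hopf G = (let K = group_algebra G in module.extend K (hopf.fields
     (\<lambda>f. tensor_class K K (\<Sum>g\<in>Poly_Mapping.keys f.
        Poly_Mapping.single (Poly_Mapping.single g 1, Poly_Mapping.single g 1)
          (Poly_Mapping.lookup f g)))
     (\<lambda>f. \<Sum>g\<in>Poly_Mapping.keys f. Poly_Mapping.lookup f g)
     (\<lambda>f. \<Sum>g\<in>Poly_Mapping.keys f.
        Poly_Mapping.single (inv\<^bsub>G\<^esub> g) (Poly_Mapping.lookup f g))))"


section \<open>Quantum formal deformations\<close>

definition const_algebra :: "('k::field fps, 'b, 'm) module_scheme \<Rightarrow> ('k, 'b) module" where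
  "const_algebra A =
     ring.extend (ring.truncate A) (module.fields (\<lambda>c x. fps_const c \<odot>\<^bsub>A\<^esub> x))"

definition hbar_ideal :: "('k::field fps, 'b, 'm) module_scheme \<Rightarrow> 'b set" where
  "hbar_ideal A = (\<lambda>x. fps_X \<odot>\<^bsub>A\<^esub> x) ` carrier A"

definition power_series_module :: "('k::field \<Rightarrow> 'a \<Rightarrow> 'a) \<Rightarrow> ('k fps, 'a::idom fps) module" where
  "power_series_module s =
     type_algebra (\<lambda>c x. Abs_fps (\<lambda>n. \<Sum>i\<le>n. s (c $ i) (x $ (n - i))))"

text \<open>
  The commutative algebra being deformed is a type \<open>'a\<close> of class \<^class>\<open>idom\<close> with scalar
  multiplication \<open>s\<close>; \<open>\<theta>\<close> is the given isomorphism from \<open>A / \<hbar>A\<close> to it.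
\<close>

definition quantum_deformation ::
  "('k::field \<Rightarrow> 'a::idom \<Rightarrow> 'a) \<Rightarrow> ('k fps, 'b, 'm) module_scheme \<Rightarrow> ('b set \<Rightarrow> 'a) \<Rightarrow> bool" where
  "quantum_deformation s A \<theta> \<longleftrightarrow> assoc_algebra A \<and>
     modules_isomorphic A (power_series_module s) \<and>
     \<theta> \<in> algebra_isos (quot_algebra (const_algebra A) (hbar_ideal A)) (type_algebra s)"

definition reduction :: "('k::field fps, 'b, 'm) module_scheme \<Rightarrow> ('b set \<Rightarrow> 'a) \<Rightarrow> 'b \<Rightarrow> 'a" where
  "reduction A \<theta> x = \<theta> (hbar_ideal A +>\<^bsub>A\<^esub> x)"

text \<open>
  The identification of \<open>\<hbar>A / \<hbar>\<^sup>2A\<close> with \<open>A / \<hbar>A\<close> used for the bracket sends the class of \<open>\<hbar>x\<close>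
  to the class of \<open>x\<close>.
\<close>

definition poisson_bracket ::
  "('k::field fps, 'b, 'm) module_scheme \<Rightarrow> ('b set \<Rightarrow> 'a) \<Rightarrow> 'a \<Rightarrow> 'a \<Rightarrow> 'a" where
  "poisson_bracket A \<theta> a0 b0 = (THE c0. \<exists>a\<in>carrier A. \<exists>b\<in>carrier A. \<exists>x\<in>carrier A.
     reduction A \<theta> a = a0 \<and> reduction A \<theta> b = b0 \<and>
     (a \<otimes>\<^bsub>A\<^esub> b) \<ominus>\<^bsub>A\<^esub> (b \<otimes>\<^bsub>A\<^esub> a) = fps_X \<odot>\<^bsub>A\<^esub> x \<and> c0 = reduction A \<theta> x)"

definition fract_const :: "('k \<Rightarrow> 'a::idom \<Rightarrow> 'a) \<Rightarrow> 'k \<Rightarrow> 'a fract" where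
  "fract_const s c = Fract (s c 1) 1"

definition fract_derivation :: "('k \<Rightarrow> 'a::idom \<Rightarrow> 'a) \<Rightarrow> ('a fract \<Rightarrow> 'a fract) \<Rightarrow> bool" where
  "fract_derivation s D \<longleftrightarrow> (\<forall>f g. D (f + g) = D f + D g) \<and>
     (\<forall>c f. D (fract_const s c * f) = fract_const s c * D f) \<and>
     (\<forall>f g. D (f * g) = D f * g + f * D g)"

definition fract_poisson_bracket :: "('k::field \<Rightarrow> 'a::idom \<Rightarrow> 'a) \<Rightarrow> ('k fps, 'b, 'm) module_scheme \<Rightarrow>
    ('b set \<Rightarrow> 'a) \<Rightarrow> 'a fract \<Rightarrow> 'a fract \<Rightarrow> 'a fract" where
  "fract_poisson_bracket s A \<theta> = (THE P.
     (\<forall>g. fract_derivation s (\<lambda>f. P f g)) \<and> (\<forall>f. fract_derivation s (P f)) \<and>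
     (\<forall>a b. P (Fract a 1) (Fract b 1) = Fract (poisson_bracket A \<theta> a b) 1))"

definition trivial_poisson_center :: "('k::field \<Rightarrow> 'a::idom \<Rightarrow> 'a) \<Rightarrow> ('k fps, 'b, 'm) module_scheme \<Rightarrow>
    ('b set \<Rightarrow> 'a) \<Rightarrow> bool" where
  "trivial_poisson_center s A \<theta> \<longleftrightarrow>
     (\<forall>f. (\<forall>g. fract_poisson_bracket s A \<theta> f g = 0) \<longrightarrow> f \<in> range (fract_const s))"


section \<open>Actions of Hopf algebras\<close>

definition hopf_action :: "('k::field, 'h, 'm) hopf_scheme \<Rightarrow> ('k fps, 'b, 'n) module_scheme \<Rightarrow>
    ('h \<Rightarrow> 'b \<Rightarrow> 'b) \<Rightarrow> bool" where
  "hopf_action H A act \<longleftrightarrow>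
     (\<forall>h\<in>carrier H. act h \<in> linear_maps A A) \<and>
     (\<forall>a\<in>carrier A.
        (\<lambda>h. act h a) \<in> linear_maps H (const_algebra A) \<and>
        act \<one>\<^bsub>H\<^esub> a = a \<and>
        (\<forall>g\<in>carrier H. \<forall>h\<in>carrier H. act (g \<otimes>\<^bsub>H\<^esub> h) a = act g (act h a))) \<and>
     (\<forall>h\<in>carrier H.
        (\<forall>a\<in>carrier A. \<forall>b\<in>carrier A. act h (a \<otimes>\<^bsub>A\<^esub> b) =
           tensor_lift (const_algebra A) (\<lambda>x y. act x a \<otimes>\<^bsub>A\<^esub> act y b) (comul H h)) \<and>
        act h \<one>\<^bsub>A\<^esub> = counit H h \<odot>\<^bsub>const_algebra A\<^esub> \<one>\<^bsub>A\<^esub>)"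

text \<open>
  Every finite group is isomorphic to one whose elements are natural numbers, so it suffices to let
  the existential quantifier range over those.
\<close>

definition factors_through_group :: "('k::field, 'h, 'm) hopf_scheme \<Rightarrow>
    ('k fps, 'b, 'n) module_scheme \<Rightarrow> ('h \<Rightarrow> 'b \<Rightarrow> 'b) \<Rightarrow> bool" where
  "factors_through_group H A act \<longleftrightarrow> (\<exists>I. hopf_ideal H I \<and>
     (\<forall>h\<in>I. \<forall>a\<in>carrier A. act h a = \<zero>\<^bsub>A\<^esub>) \<and>
     (\<exists>G :: nat monoid. group G \<and> finite (carrier G) \<and>
        hopf_isos (quot_hopf H I) (group_hopf G) \<noteq> {}))"

end

theory Submission
  imports Defs "HOL-Library.Function_Algebras"
begin

text \<open>
  Modulo any power of \<open>\<hbar>\<close> the algebra \<open>A\<close> satisfies the Ore condition, so fractions can be manipulated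
  there.  Artin's argument, applied to the \<open>H\<close>-action on the powers of a lift of \<open>a \<in> A\<^sub>0\<close>, shows that \<open>a\<close> is
  algebraic over the reductions \<open>f\<close> of \<open>H\<close>-invariant fractions modulo \<open>\<hbar>\<^sup>n\<close>.  Commuting with such a fraction
  gives the operators \<open>T\<close> on \<open>A\<^sub>0\<close> induced by \<open>H\<close>, or by \<open>\<hbar>\<^sup>-\<^sup>m x\<close> when \<open>x\<close> maps \<open>A\<close> to \<open>\<hbar>\<^sup>m A\<close>, the
  identity \<open>T {f, a} = {f, T a}\<close>; and anything that Poisson commutes with all \<open>f\<close> is a Casimir, that is, a scalar.

  Hence \<open>k\<close>-independent induced operators are independent over \<open>Q(A\<^sub>0)\<close>.  As \<open>A\<^sub>0\<close> is commutative, the left legs of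
  the comultiplication commute on it, and common eigenvectors show that the image of \<open>H\<close> in
  \<open>End A\<^sub>0\<close> is spanned by the finite group \<open>\<Gamma>\<close> of automorphisms which it contains.
  If some \<open>x\<close> in the kernel of \<open>H \<rightarrow> k\<Gamma>\<close> acted on \<open>A\<close> nontrivially, then for \<open>m\<close> maximal the leading terms of
  the elements divisible by \<open>\<hbar>\<^sup>m\<close> would be combinations of skew derivations, which are multiples of \<open>g - g'\<close>,
  and so form a nonzero left ideal of \<open>k\<Gamma>\<close>; by Maschke's theorem it contains a nonzero idempotent, which is
  impossible for the leading term of an element of a finite dimensional algebra.
\<close>

section \<open>Derivations on fraction fields\<close>

text \<open>No algebra of fractions of A is built. A fraction modulo \<hbar>^n is a numerator and a
  denominator in A, and each identity is multiplied out until it is a congruence modulo \<hbar>^n in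
  A. Elements with nonzero reduction can then be cancelled, because A_0 is a domain. A finite
  precision n suffices each time, so no fraction has to be invariant to all orders. The price is
  bookkeeping: dividing by \<hbar>^m costs m orders, reducing costs one, and reading a bracket off a
  commutator costs one more. This is the origin of the levels \<open>Suc m\<close> and
  \<open>Suc (Suc m)\<close>.

  Clearing denominators also has a side effect on A_0: the identities with brackets come out only on
  an ideal tA_0, with t a product of denominators. Two facts repair this. A relation between
  operators of H on tA_0 extends to A_0, and two distinct characters can already be separated on
  tA_0.

  The two halves have to come in this order: the leading terms of the kernel can be called skew
  derivations only once the image of H in End A_0 is known to be spanned by characters.\<close>

definition inj_ring_hom :: "('a::comm_ring_1 \<Rightarrow> 'f::comm_ring_1) \<Rightarrow> bool" where
  "inj_ring_hom \<sigma> \<longleftrightarrow> (\<forall>a b. \<sigma> (a + b) = \<sigma> a + \<sigma> b) \<and> (\<forall>a b. \<sigma> (a * b) = \<sigma> a * \<sigma> b) \<and>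
     \<sigma> 1 = 1 \<and> (\<forall>a. \<sigma> a = 0 \<longrightarrow> a = 0)"

lemma inj_ring_homD:
  assumes "inj_ring_hom \<sigma>"
  shows "\<sigma> (a + b) = \<sigma> a + \<sigma> b" "\<sigma> (a * b) = \<sigma> a * \<sigma> b" "\<sigma> 1 = 1" "\<sigma> 0 = 0"
    "\<sigma> a = 0 \<longleftrightarrow> a = 0" "\<sigma> (- a) = - \<sigma> a" "\<sigma> (a - b) = \<sigma> a - \<sigma> b"
    "\<sigma> (a ^ n) = \<sigma> a ^ n" "\<sigma> (sum f I) = (\<Sum>i\<in>I. \<sigma> (f i))" "\<sigma> (of_nat n) = of_nat n"
proof -
  show add: "\<sigma> (a + b) = \<sigma> a + \<sigma> b" for a b using assms by (simp add: inj_ring_hom_def)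
  show "\<sigma> (a * b) = \<sigma> a * \<sigma> b" for a b using assms by (simp add: inj_ring_hom_def)
  show one: "\<sigma> 1 = 1" using assms by (simp add: inj_ring_hom_def)
  show z: "\<sigma> 0 = 0" using add[of 0 0] by simp
  show "\<sigma> a = 0 \<longleftrightarrow> a = 0" using assms z by (auto simp: inj_ring_hom_def)
  show m: "\<sigma> (- a) = - \<sigma> a" for a using add[of a "- a"] z by (simp add: eq_neg_iff_add_eq_0 add.commute)
  show "\<sigma> (a - b) = \<sigma> a - \<sigma> b" using add[of a "- b"] m[of b] by simp
  show "\<sigma> (a ^ n) = \<sigma> a ^ n" using assms by (induction n) (auto simp: inj_ring_hom_def)
  show "\<sigma> (sum f I) = (\<Sum>i\<in>I. \<sigma> (f i))"
    by (induction I rule: infinite_finite_induct) (auto simp: add z)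
  show "\<sigma> (of_nat n) = of_nat n" by (induction n) (auto simp: add z one)
qed

text \<open>For a ring homomorphism \<sigma> this says that \<sigma> + \<epsilon> D is
  multiplicative into the dual numbers. Source and target may differ, so derivations from A_0 to its
  fraction field are included through \<open>\<sigma> = Fr\<close>.\<close>

definition twisted_derivation :: "('a::comm_ring_1 \<Rightarrow> 'f::comm_ring_1) \<Rightarrow> ('a \<Rightarrow> 'f) \<Rightarrow> bool" where
  "twisted_derivation \<sigma> D \<longleftrightarrow> (\<forall>a b. D (a + b) = D a + D b) \<and>
     (\<forall>a b. D (a * b) = D a * \<sigma> b + \<sigma> a * D b)"

lemma twisted_derivationD:
  assumes "twisted_derivation \<sigma> D"
  shows "D (a + b) = D a + D b" "D (a * b) = D a * \<sigma> b + \<sigma> a * D b" "D 0 = 0"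
    "D (- a) = - D a" "D (a - b) = D a - D b" "D (sum f I) = (\<Sum>i\<in>I. D (f i))"
proof -
  show add: "D (a + b) = D a + D b" for a b using assms by (simp add: twisted_derivation_def)
  show "D (a * b) = D a * \<sigma> b + \<sigma> a * D b" using assms by (simp add: twisted_derivation_def)
  show z: "D 0 = 0" using add[of 0 0] by simp
  show m: "D (- a) = - D a" for a using add[of a "- a"] z by (simp add: eq_neg_iff_add_eq_0 add.commute)
  show "D (a - b) = D a - D b" using add[of a "- b"] m[of b] by simp
  show "D (sum f I) = (\<Sum>i\<in>I. D (f i))"
    by (induction I rule: infinite_finite_induct) (auto simp: add z)
qed

lemma twisted_derivation_one:
  assumes "twisted_derivation \<sigma> D" "\<sigma> 1 = 1"
  shows "D 1 = 0"
  using twisted_derivationD(2)[OF assms(1), of 1 1] assms(2) by simp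

lemma twisted_derivation_power:
  fixes \<sigma> :: "'f::comm_ring_1 \<Rightarrow> 'g::comm_ring_1"
  assumes D: "twisted_derivation \<sigma> D" and s: "inj_ring_hom \<sigma>"
  shows "D (a ^ n) = of_nat n * \<sigma> a ^ (n - 1) * D a"
proof (induction n)
  case 0
  then show ?case using twisted_derivation_one[OF D] inj_ring_homD(3)[OF s] by simp
next
  case (Suc n)
  then show ?case
    using inj_ring_homD(8)[OF s, of a n]
    by (cases n) (auto simp: twisted_derivationD(2)[OF D] twisted_derivation_one[OF D]
        inj_ring_homD[OF s] algebra_simps)
qed

text \<open>Differentiating p(a) = 0 gives p'(\<sigma> a) D a = 0. If D a is nonzero, then \<sigma>
  (p'(a)) = p'(\<sigma> a) vanishes, so a is a root of p', which satisfies the same hypotheses.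
  Descent on the degree replaces the choice of a separable minimal polynomial.\<close>

lemma twisted_derivation_algebraic:
  fixes \<sigma> D :: "'f::field \<Rightarrow> 'f"
  assumes s: "inj_ring_hom \<sigma>" and D: "twisted_derivation \<sigma> D"
    and char0: "\<And>n. n > 0 \<Longrightarrow> (of_nat n :: 'f) \<noteq> 0"
    and p: "p \<noteq> 0" "poly p a = 0" "\<And>j. \<sigma> (coeff p j) = coeff p j" "\<And>j. D (coeff p j) = 0"
  shows "D a = 0"
  using p
proof (induction "degree p" arbitrary: p rule: less_induct)
  case less
  have deg: "degree p \<noteq> 0"
  proof
    assume "degree p = 0"
    then obtain c where "p = [:c:]" using degree_eq_zeroE by blast
    with less.prems show False by simp
  qed
  \<comment> \<open>\<open>q\<close> is the formal derivative of \<open>p\<close>; characteristic 0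
    keeps it nonzero.\<close>
  define q where "q = (\<Sum>j\<le>degree p. monom (of_nat j * coeff p j) (j - 1))"
  have q_coeff: "coeff q i = of_nat (Suc i) * coeff p (Suc i)" for i
  proof -
    have "coeff q i = (\<Sum>j\<le>degree p. if j = Suc i then of_nat j * coeff p j else 0)"
      unfolding q_def coeff_sum coeff_monom
      by (rule sum.cong[OF refl], rename_tac j, case_tac j) auto
    also have "\<dots> = of_nat (Suc i) * coeff p (Suc i)"
      by (cases "Suc i \<le> degree p") (auto simp: coeff_eq_0)
    finally show ?thesis .
  qed
  have Dcoeff: "D (of_nat n * coeff p j) = 0" for n j
    by (induction n) (auto simp: twisted_derivationD[OF D] distrib_right less.prems)
  have scoeff: "\<sigma> (of_nat n * coeff p j) = of_nat n * coeff p j" for n j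
    by (simp add: inj_ring_homD[OF s] less.prems)
  have qdeg: "degree q < degree p"
  proof -
    have "degree q \<le> degree p - 1"
      unfolding q_def by (rule degree_sum_le) (auto intro: order.trans[OF degree_monom_le])
    then show ?thesis using deg by simp
  qed
  have q0: "q \<noteq> 0"
  proof
    assume "q = 0"
    then have "of_nat (Suc (degree p - 1)) * coeff p (Suc (degree p - 1)) = 0"
      using q_coeff[of "degree p - 1"] by simp
    then show False using deg char0 less.prems(1) by simp
  qed
  have sq: "\<sigma> (coeff q i) = coeff q i" for i unfolding q_coeff by (rule scoeff)
  have spoly: "\<sigma> (poly q a) = poly q (\<sigma> a)"
    unfolding poly_altdef[of q] inj_ring_homD(9)[OF s]
    by (rule sum.cong) (simp_all only: inj_ring_homD(2,8)[OF s] sq)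
  have "0 = D (poly p a)" using less.prems by (simp add: twisted_derivationD[OF D])
  also have "\<dots> = (\<Sum>j\<le>degree p. of_nat j * coeff p j * \<sigma> a ^ (j - 1) * D a)"
    unfolding poly_altdef twisted_derivationD(6)[OF D]
    by (rule sum.cong) (auto simp: twisted_derivationD(2)[OF D] less.prems
        twisted_derivation_power[OF D s] algebra_simps)
  also have "\<dots> = poly q (\<sigma> a) * D a"
    by (simp add: q_def poly_sum poly_monom sum_distrib_right)
  finally have "poly q (\<sigma> a) * D a = 0" by simp
  then consider "D a = 0" | "poly q (\<sigma> a) = 0" by auto
  then show ?case
  proof cases
    case 2
    then have "poly q a = 0" using spoly inj_ring_homD(5)[OF s] by simp
    then show ?thesis
      by (rule less.hyps[OF qdeg q0]) (simp_all only: q_coeff scoeff Dcoeff)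
  qed
qed

section \<open>Extension of homomorphisms and derivations to the fraction field\<close>

declare divide_fract [simp del] mult_fract [simp del] add_fract [simp del] diff_fract [simp del]
  minus_fract [simp del] inverse_fract [simp del]

abbreviation Fr :: "'a::idom \<Rightarrow> 'a fract" where "Fr a \<equiv> Fract a 1"

lemma inj_ring_hom_Fr: "inj_ring_hom (Fr :: 'a::idom \<Rightarrow> _)"
  by (auto simp: inj_ring_hom_def One_fract_def Zero_fract_def eq_fract add_fract mult_fract)

lemma Fr_simps:
  "Fr (a + b) = Fr a + Fr b" "Fr (a * b) = Fr a * Fr b" "Fr (a - b) = Fr a - Fr b"
  "Fr (- a) = - Fr a" "Fr 0 = 0" "Fr 1 = 1" "Fr (a ^ n) = Fr a ^ n"
  using inj_ring_homD(1,2,7)[OF inj_ring_hom_Fr, of a b] inj_ring_homD(6)[OF inj_ring_hom_Fr, of a]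
    inj_ring_homD(8)[OF inj_ring_hom_Fr, of a n] inj_ring_homD(3,4)[OF inj_ring_hom_Fr]
  by (simp_all only:)

lemma Fr_eq_iff: "Fr a = Fr b \<longleftrightarrow> a = b" and Fr_eq_0_iff: "Fr a = 0 \<longleftrightarrow> a = 0"
  by (auto simp: eq_fract Zero_fract_def)

lemma Fr_sum: "Fr (sum f I) = (\<Sum>i\<in>I. Fr (f i))"
  by (rule inj_ring_homD(9)[OF inj_ring_hom_Fr])

lemma Fract_eq_divide: "Fract a b = Fr a / Fr b"
  by (simp add: divide_fract)

lemma fract_obtain:
  obtains a b where "q = Fr a / Fr b" "b \<noteq> 0"
proof (cases q)
  case (Fract a b)
  then show ?thesis using that[of a b] by (simp add: Fract_eq_divide[of a b])
qed

text \<open>The map \<sigma> already takes values in a field, so one construction serves both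
  \<open>Fr\<close> itself and \<open>Fr\<close> composed with an endomorphism of A_0. Independence
  of the chosen fraction is \<open>hom_ext_divide\<close>.\<close>

definition hom_ext :: "('a::idom \<Rightarrow> 'f::field) \<Rightarrow> 'a fract \<Rightarrow> 'f" where
  "hom_ext \<sigma> q = (let p = SOME p. snd p \<noteq> 0 \<and> q = Fr (fst p) / Fr (snd p) in \<sigma> (fst p) / \<sigma> (snd p))"

definition der_ext :: "('a::idom \<Rightarrow> 'f::field) \<Rightarrow> ('a \<Rightarrow> 'f) \<Rightarrow> 'a fract \<Rightarrow> 'f" where
  "der_ext \<sigma> D q = (let p = SOME p. snd p \<noteq> 0 \<and> q = Fr (fst p) / Fr (snd p)
     in (D (fst p) * \<sigma> (snd p) - \<sigma> (fst p) * D (snd p)) / \<sigma> (snd p) ^ 2)"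

lemma fract_SOME:
  assumes "b \<noteq> 0"
  obtains a' b' where "b' \<noteq> 0" "a * b' = a' * b"
    "(SOME p. snd p \<noteq> 0 \<and> Fr a / Fr b = Fr (fst p) / Fr (snd p)) = (a', b')"
proof -
  let ?p = "SOME p. snd p \<noteq> 0 \<and> Fr a / Fr b = Fr (fst p) / Fr (snd p)"
  have "snd ?p \<noteq> 0 \<and> Fr a / Fr b = Fr (fst ?p) / Fr (snd ?p)"
    by (rule someI[of _ "(a, b)"]) (use assms in auto)
  then have "snd ?p \<noteq> 0" "a * snd ?p = fst ?p * b"
    using assms by (auto simp: eq_fract divide_fract)
  then show ?thesis using that[of "snd ?p" "fst ?p"] by auto
qed

lemma hom_ext_divide:
  assumes s: "inj_ring_hom \<sigma>" and b: "b \<noteq> 0"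
  shows "hom_ext \<sigma> (Fr a / Fr b) = \<sigma> a / \<sigma> b"
proof -
  obtain a' b' where 1: "b' \<noteq> 0" "a * b' = a' * b"
    "(SOME p. snd p \<noteq> 0 \<and> Fr a / Fr b = Fr (fst p) / Fr (snd p)) = (a', b')"
    by (rule fract_SOME[OF b, of a])
  have "\<sigma> a * \<sigma> b' = \<sigma> a' * \<sigma> b" using 1(2) by (simp flip: inj_ring_homD(2)[OF s])
  then show ?thesis unfolding hom_ext_def 1(3)
    using b 1(1) inj_ring_homD(5)[OF s] by (simp add: Let_def field_simps)
qed

lemma der_ext_divide:
  assumes s: "inj_ring_hom \<sigma>" and D: "twisted_derivation \<sigma> D" and b: "b \<noteq> 0"
  shows "der_ext \<sigma> D (Fr a / Fr b) = (D a * \<sigma> b - \<sigma> a * D b) / \<sigma> b ^ 2"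
proof -
  obtain a' b' where 1: "b' \<noteq> 0" "a * b' = a' * b"
    "(SOME p. snd p \<noteq> 0 \<and> Fr a / Fr b = Fr (fst p) / Fr (snd p)) = (a', b')"
    by (rule fract_SOME[OF b, of a])
  have e1: "\<sigma> a * \<sigma> b' = \<sigma> a' * \<sigma> b" using 1(2) by (simp flip: inj_ring_homD(2)[OF s])
  have e2: "D a * \<sigma> b' + \<sigma> a * D b' = D a' * \<sigma> b + \<sigma> a' * D b"
    using arg_cong[OF 1(2), of D] by (simp add: twisted_derivationD(2)[OF D])
  have nz: "\<sigma> b \<noteq> 0" "\<sigma> b' \<noteq> 0" using b 1(1) inj_ring_homD(5)[OF s] by auto
  have a': "\<sigma> a' = \<sigma> a * \<sigma> b' / \<sigma> b" using e1 nz by (simp add: field_simps)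
  have Da': "D a' = (D a * \<sigma> b' + \<sigma> a * D b' - \<sigma> a' * D b) / \<sigma> b"
    using e2 nz by (simp add: field_simps)
  show ?thesis unfolding der_ext_def 1(3)
    using nz by (simp add: Let_def Da' a' field_simps power2_eq_square)
qed

lemma hom_ext_Fr: "inj_ring_hom \<sigma> \<Longrightarrow> hom_ext \<sigma> (Fr a) = \<sigma> a"
  using hom_ext_divide[of \<sigma> 1 a] inj_ring_homD(3)[of \<sigma>] by (simp add: Fr_simps)

lemma der_ext_Fr: "inj_ring_hom \<sigma> \<Longrightarrow> twisted_derivation \<sigma> D \<Longrightarrow> der_ext \<sigma> D (Fr a) = D a"
  using der_ext_divide[of \<sigma> D 1 a] inj_ring_homD(3)[of \<sigma>] twisted_derivation_one[of \<sigma> D]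
  by (simp add: Fr_simps)

lemma Fr_add_divide:
  assumes "b \<noteq> 0" "d \<noteq> 0"
  shows "Fr a / Fr b + Fr c / Fr d = Fr (a * d + c * b) / Fr (b * d)"
  using assms by (simp add: divide_fract add_fract algebra_simps)

lemma Fr_mult_divide: "Fr a / Fr b * (Fr c / Fr d) = Fr (a * c) / Fr (b * d)"
  by (simp add: Fr_simps)

lemma inj_ring_hom_hom_ext:
  assumes s: "inj_ring_hom (\<sigma> :: 'a::idom \<Rightarrow> 'f::field)"
  shows "inj_ring_hom (hom_ext \<sigma>)"
  unfolding inj_ring_hom_def
proof (intro conjI allI impI)
  fix p q :: "'a fract"
  obtain a b where p: "p = Fr a / Fr b" "b \<noteq> 0" by (rule fract_obtain)
  obtain c d where q: "q = Fr c / Fr d" "d \<noteq> 0" by (rule fract_obtain)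
  have nz: "\<sigma> b \<noteq> 0" "\<sigma> d \<noteq> 0" using p q inj_ring_homD(5)[OF s] by auto
  have bd: "b * d \<noteq> 0" using p q by simp
  show "hom_ext \<sigma> (p + q) = hom_ext \<sigma> p + hom_ext \<sigma> q"
    unfolding p(1) q(1) Fr_add_divide[OF p(2) q(2)] hom_ext_divide[OF s bd] hom_ext_divide[OF s p(2)]
      hom_ext_divide[OF s q(2)] using nz by (simp add: inj_ring_homD[OF s] field_simps)
  show "hom_ext \<sigma> (p * q) = hom_ext \<sigma> p * hom_ext \<sigma> q"
    unfolding p(1) q(1) Fr_mult_divide hom_ext_divide[OF s bd] hom_ext_divide[OF s p(2)]
      hom_ext_divide[OF s q(2)] using nz by (simp add: inj_ring_homD[OF s] field_simps)
  assume "hom_ext \<sigma> p = 0"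
  then have "\<sigma> a = 0" using nz unfolding p(1) hom_ext_divide[OF s p(2)] by simp
  then show "p = 0" using inj_ring_homD(5)[OF s] by (simp add: p(1) Fr_simps)
next
  show "hom_ext \<sigma> 1 = 1" using hom_ext_Fr[OF s, of 1] inj_ring_homD(3)[OF s] by (simp add: Fr_simps)
qed

lemma twisted_derivation_der_ext:
  assumes s: "inj_ring_hom (\<sigma> :: 'a::idom \<Rightarrow> 'f::field)" and D: "twisted_derivation \<sigma> D"
  shows "twisted_derivation (hom_ext \<sigma>) (der_ext \<sigma> D)"
  unfolding twisted_derivation_def
proof (intro conjI allI)
  fix p q :: "'a fract"
  obtain a b where p: "p = Fr a / Fr b" "b \<noteq> 0" by (rule fract_obtain)
  obtain c d where q: "q = Fr c / Fr d" "d \<noteq> 0" by (rule fract_obtain)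
  have nz: "\<sigma> b \<noteq> 0" "\<sigma> d \<noteq> 0" using p q inj_ring_homD(5)[OF s] by auto
  have bd: "b * d \<noteq> 0" using p q by simp
  show "der_ext \<sigma> D (p + q) = der_ext \<sigma> D p + der_ext \<sigma> D q"
    unfolding p(1) q(1) Fr_add_divide[OF p(2) q(2)] der_ext_divide[OF s D bd] der_ext_divide[OF s D p(2)]
      der_ext_divide[OF s D q(2)] using nz
    by (simp add: twisted_derivationD[OF D] inj_ring_homD[OF s] field_simps power2_eq_square)
  show "der_ext \<sigma> D (p * q) = der_ext \<sigma> D p * hom_ext \<sigma> q + hom_ext \<sigma> p * der_ext \<sigma> D q"
    unfolding p(1) q(1) Fr_mult_divide der_ext_divide[OF s D bd] der_ext_divide[OF s D p(2)]
      der_ext_divide[OF s D q(2)] hom_ext_divide[OF s p(2)] hom_ext_divide[OF s q(2)] using nz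
    by (simp add: twisted_derivationD[OF D] inj_ring_homD[OF s] field_simps power2_eq_square)
qed

lemma hom_ext_Fr_id: "hom_ext Fr q = q"
  by (rule fract_obtain[of q]) (simp add: hom_ext_divide[OF inj_ring_hom_Fr])

text \<open>The Leibniz rule for a = q b determines the value at q = a/b from those at a and
  b.\<close>

lemma derivation_fract_eqI:
  assumes D: "twisted_derivation (\<lambda>q. q) D" and E: "twisted_derivation (\<lambda>q. q) E"
    and eq: "\<And>a. D (Fr a) = E (Fr a)"
  shows "D q = E q"
proof -
  obtain a b where q: "q = Fr a / Fr b" "b \<noteq> 0" by (rule fract_obtain)
  have nz: "Fr b \<noteq> 0" using q by (simp add: Fr_eq_0_iff)
  have *: "F q * Fr b = F (Fr a) - q * F (Fr b)" if F: "twisted_derivation (\<lambda>q. q) F" for F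
  proof -
    have "Fr a = q * Fr b" using q nz by simp
    then show ?thesis using twisted_derivationD(2)[OF F, of q "Fr b"] by simp
  qed
  show ?thesis using *[OF D] *[OF E] eq nz by (metis mult_right_cancel)
qed

section \<open>Biderivations and their unique extension to the fraction field\<close>

definition biderivation :: "('a::comm_ring_1 \<Rightarrow> 'a \<Rightarrow> 'a) \<Rightarrow> bool" where
  "biderivation br \<longleftrightarrow> (\<forall>a b c. br (a + b) c = br a c + br b c) \<and> (\<forall>a b c. br a (b + c) = br a b + br a c) \<and>
     (\<forall>a b c. br (a * b) c = br a c * b + a * br b c) \<and> (\<forall>a b c. br a (b * c) = br a b * c + b * br a c)"

text \<open>The first argument is extended while the second stays in A_0. The result is again a
  derivation in the second argument, which is extended afterwards.\<close>

definition fract_bracket :: "('a::idom \<Rightarrow> 'a \<Rightarrow> 'a) \<Rightarrow> 'a fract \<Rightarrow> 'a fract \<Rightarrow> 'a fract" where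
  "fract_bracket br f g = der_ext Fr (\<lambda>b. der_ext Fr (\<lambda>a. Fr (br a b)) f) g"

lemma
  assumes br: "biderivation br"
  shows twisted_derivation_bracket_left: "twisted_derivation Fr (\<lambda>a. Fr (br a b))"
    and twisted_derivation_bracket_right: "twisted_derivation Fr (\<lambda>b. der_ext Fr (\<lambda>a. Fr (br a b)) f)"
proof -
  have left: "twisted_derivation Fr (\<lambda>a. Fr (br a b))" for b
    using br by (simp add: twisted_derivation_def biderivation_def Fr_simps)
  then show "twisted_derivation Fr (\<lambda>a. Fr (br a b))" .
  obtain u v where f: "f = Fr u / Fr v" "v \<noteq> 0" by (rule fract_obtain)
  have nz: "Fr v \<noteq> 0" using f by (simp add: Fr_eq_0_iff)
  show "twisted_derivation Fr (\<lambda>b. der_ext Fr (\<lambda>a. Fr (br a b)) f)"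
    using br nz unfolding twisted_derivation_def f(1) der_ext_divide[OF inj_ring_hom_Fr left f(2)] biderivation_def
    by (simp add: Fr_simps field_simps power2_eq_square)
qed

lemma fract_bracket_Fr:
  assumes br: "biderivation br"
  shows "fract_bracket br (Fr a) (Fr b) = Fr (br a b)"
    and fract_bracket_Fr_right: "fract_bracket br f (Fr b) = der_ext Fr (\<lambda>a. Fr (br a b)) f"
proof -
  have "twisted_derivation Fr (\<lambda>b. Fr (br a b))" for a
    using br by (simp add: twisted_derivation_def biderivation_def Fr_simps)
  note [simp] = der_ext_Fr[OF inj_ring_hom_Fr this]
  show "fract_bracket br (Fr a) (Fr b) = Fr (br a b)"
    "fract_bracket br f (Fr b) = der_ext Fr (\<lambda>a. Fr (br a b)) f"
    unfolding fract_bracket_def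
    by (simp_all add: der_ext_Fr[OF inj_ring_hom_Fr twisted_derivation_bracket_right[OF br]]
      der_ext_Fr[OF inj_ring_hom_Fr twisted_derivation_bracket_left[OF br]])
qed

lemma derivation_der_ext_Fr:
  assumes "twisted_derivation Fr D"
  shows "twisted_derivation (\<lambda>q. q) (der_ext Fr D)"
  using twisted_derivation_der_ext[OF inj_ring_hom_Fr assms]
  by (simp add: twisted_derivation_def hom_ext_Fr_id)

lemma derivation_fract_bracket_right:
  assumes br: "biderivation br"
  shows "twisted_derivation (\<lambda>q. q) (fract_bracket br f)"
  unfolding fract_bracket_def
  by (rule derivation_der_ext_Fr[OF twisted_derivation_bracket_right[OF br]])

lemma derivation_fract_bracket_left:
  assumes br: "biderivation br"
  shows "twisted_derivation (\<lambda>q. q) (\<lambda>f. fract_bracket br f g)"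
proof -
  obtain u v where g: "g = Fr u / Fr v" "v \<noteq> 0" by (rule fract_obtain)
  have nz: "Fr v \<noteq> 0" using g by (simp add: Fr_eq_0_iff)
  have *: "twisted_derivation (\<lambda>q. q) (der_ext Fr (\<lambda>a. Fr (br a b)))" for b
    by (rule derivation_der_ext_Fr[OF twisted_derivation_bracket_left[OF br]])
  show ?thesis
    using nz unfolding fract_bracket_def g(1) der_ext_divide[OF inj_ring_hom_Fr twisted_derivation_bracket_right[OF br] g(2)]
    by (simp add: twisted_derivation_def twisted_derivationD[OF *] field_simps power2_eq_square)
qed

lemma fract_bracket_eqI:
  assumes br: "biderivation br"
    and P: "\<And>g. twisted_derivation (\<lambda>q. q) (\<lambda>f. P f g)" "\<And>f. twisted_derivation (\<lambda>q. q) (P f)"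
    and eq: "\<And>a b. P (Fr a) (Fr b) = Fr (br a b)"
  shows "P = fract_bracket br"
proof (intro ext)
  fix f g
  have 1: "P (Fr a) g = fract_bracket br (Fr a) g" for a g
    by (rule derivation_fract_eqI[OF P(2) derivation_fract_bracket_right[OF br]])
      (simp add: eq fract_bracket_Fr(1)[OF br])
  show "P f g = fract_bracket br f g"
    by (rule derivation_fract_eqI[OF P(1) derivation_fract_bracket_left[OF br]]) (rule 1)
qed

lemma fract_bracket_antisym:
  assumes br: "biderivation br" and anti: "\<And>a b. br a b = - br b a"
  shows "fract_bracket br f g = - fract_bracket br g f"
proof -
  \<comment> \<open>The swapped and negated extension restricts to the same bracket on A_0, so
    uniqueness identifies the two.\<close>
  have "(\<lambda>f g. - fract_bracket br g f) = fract_bracket br"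
  proof (rule fract_bracket_eqI[OF br])
    show "twisted_derivation (\<lambda>q. q) (\<lambda>f. - fract_bracket br g f)" for g
      using derivation_fract_bracket_right[OF br, of g] by (simp add: twisted_derivation_def algebra_simps)
    show "twisted_derivation (\<lambda>q. q) (\<lambda>g. - fract_bracket br g f)" for f
      using derivation_fract_bracket_left[OF br, of f] by (simp add: twisted_derivation_def algebra_simps)
    show "- fract_bracket br (Fr b) (Fr a) = Fr (br a b)" for a b
      using anti[of a b] by (simp add: fract_bracket_Fr(1)[OF br] Fr_simps)
  qed
  then show ?thesis by metis
qed

section \<open>Filtered quantizations\<close>

text \<open>A as a type: the scalars in k[[\<hbar>]] act through \<open>sc\<close> and
  \<open>hb\<close>, and \<open>red\<close> is reduction modulo \<hbar>. Topological freeness enters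
  through injectivity of \<open>hb\<close> and through \<open>separated\<close>.\<close>

locale quantization =
  fixes s :: "'k::field \<Rightarrow> 'a::idom \<Rightarrow> 'a" and sc :: "'k \<Rightarrow> 'u::ab_group_add \<Rightarrow> 'u"
    and mul :: "'u \<Rightarrow> 'u \<Rightarrow> 'u" (infixl \<open>\<star>\<close> 70) and unit :: 'u
    and hb :: "'u \<Rightarrow> 'u" and red :: "'u \<Rightarrow> 'a"
  assumes s_space: "vector_space s" and sc_space: "vector_space sc"
    and s_mult: "s c a * b = s c (a * b)"
    and mul_add_left: "(x + y) \<star> z = x \<star> z + y \<star> z"
    and mul_add_right: "x \<star> (y + z) = x \<star> y + x \<star> z"
    and mul_assoc: "(x \<star> y) \<star> z = x \<star> (y \<star> z)"
    and unit_left: "unit \<star> x = x" and unit_right: "x \<star> unit = x"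
    and sc_mul_left: "sc c x \<star> y = sc c (x \<star> y)" and sc_mul_right: "x \<star> sc c y = sc c (x \<star> y)"
    and hb_add: "hb (x + y) = hb x + hb y" and hb_inj: "hb x = hb y \<Longrightarrow> x = y"
    and hb_mul_left: "hb x \<star> y = hb (x \<star> y)" and hb_mul_right: "x \<star> hb y = hb (x \<star> y)"
    and hb_sc: "hb (sc c x) = sc c (hb x)"
    and red_add: "red (x + y) = red x + red y" and red_mul: "red (x \<star> y) = red x * red y"
    and red_unit: "red unit = 1" and red_sc: "red (sc c x) = s c (red x)"
    and red_surj: "\<exists>x. red x = a" and red_eq_0: "red x = 0 \<longleftrightarrow> x \<in> range hb"
    and separated: "(\<And>n. x \<in> range (hb ^^ n)) \<Longrightarrow> x = 0"
begin

sublocale S: vector_space s by (rule s_space)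
sublocale U: vector_space sc by (rule sc_space)

lemma mul_zero [simp]: "0 \<star> x = 0" "x \<star> 0 = 0"
  using mul_add_left[of 0 0 x] mul_add_right[of x 0 0] by simp_all

lemma mul_minus: "(- x) \<star> y = - (x \<star> y)" "x \<star> (- y) = - (x \<star> y)"
  using mul_add_left[of x "- x" y] mul_add_right[of x y "- y"] by (simp_all add: eq_neg_iff_add_eq_0 add.commute)

lemma mul_diff: "(x - y) \<star> z = x \<star> z - y \<star> z" "x \<star> (y - z) = x \<star> y - x \<star> z"
  using mul_add_left[of x "- y" z] mul_add_right[of x y "- z"] by (simp_all add: mul_minus)

lemma mul_sum: "sum f I \<star> y = (\<Sum>i\<in>I. f i \<star> y)" "y \<star> sum f I = (\<Sum>i\<in>I. y \<star> f i)"
  by (induction I rule: infinite_finite_induct; simp add: mul_add_left mul_add_right)+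

lemma hb_zero [simp]: "hb 0 = 0" using hb_add[of 0 0] by simp

lemma hb_minus: "hb (- x) = - hb x"
  using hb_add[of x "- x"] by (simp add: eq_neg_iff_add_eq_0 add.commute)

lemma red_zero [simp]: "red 0 = 0" by (metis add_0 add_cancel_left_left red_add)

lemma red_minus: "red (- x) = - red x"
  using red_add[of x "- x"] by (simp add: eq_neg_iff_add_eq_0 add.commute)

lemma red_diff: "red (x - y) = red x - red y"
  using red_add[of x "- y"] by (simp add: red_minus)

lemma red_sum: "red (sum f I) = (\<Sum>i\<in>I. red (f i))"
  by (induction I rule: infinite_finite_induct) (auto simp: red_add)

lemma red_hb [simp]: "red (hb x) = 0" by (simp add: red_eq_0)

section \<open>The \<hbar>-adic filtration; \<open>dv n\<close> is \<hbar>^n A\<close>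

definition hbn :: "nat \<Rightarrow> 'u \<Rightarrow> 'u" where "hbn n = hb ^^ n"
definition dv :: "nat \<Rightarrow> 'u set" where "dv n = range (hbn n)"

lemma hbn_0 [simp]: "hbn 0 x = x" and hbn_Suc: "hbn (Suc n) x = hb (hbn n x)"
  and hbn_1 [simp]: "hbn (Suc 0) x = hb x"
  by (simp_all add: hbn_def)

lemma hbn_hbn: "hbn m (hbn n x) = hbn (m + n) x"
  by (simp add: hbn_def funpow_add)

lemma hbn_add: "hbn n (x + y) = hbn n x + hbn n y"
  by (induction n) (auto simp: hbn_Suc hb_add)

lemma hbn_minus: "hbn n (- x) = - hbn n x"
  by (induction n) (auto simp: hbn_Suc hb_minus)

lemma hbn_diff: "hbn n (x - y) = hbn n x - hbn n y"
  using hbn_add[of n x "- y"] by (simp add: hbn_minus)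

lemma hbn_zero [simp]: "hbn n 0 = 0"
  by (induction n) (auto simp: hbn_Suc)

lemma hbn_sc: "hbn n (sc c x) = sc c (hbn n x)"
  by (induction n) (auto simp: hbn_Suc hb_sc)

lemma hbn_sum: "hbn n (sum f I) = (\<Sum>i\<in>I. hbn n (f i))"
  by (induction I rule: infinite_finite_induct) (auto simp: hbn_add)

lemma hbn_inj: "hbn n x = hbn n y \<longleftrightarrow> x = y"
  by (induction n) (auto simp: hbn_Suc dest: hb_inj)

lemma hbn_mul: "hbn n x \<star> y = hbn n (x \<star> y)" "x \<star> hbn n y = hbn n (x \<star> y)"
  by (induction n) (auto simp: hbn_Suc hb_mul_left hb_mul_right)

lemma dvI: "hbn n x \<in> dv n" by (simp add: dv_def)

lemma dvE: assumes "x \<in> dv n" obtains y where "x = hbn n y"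
  using assms by (auto simp: dv_def)

lemma dv_0 [simp]: "dv 0 = UNIV" by (auto simp: dv_def)

lemma dv_1: "x \<in> dv (Suc 0) \<longleftrightarrow> red x = 0"
  by (simp add: dv_def red_eq_0 image_def)

lemma dv_zero [simp]: "0 \<in> dv n" using dvI[of n 0] by simp

lemma dv_add: "x \<in> dv n \<Longrightarrow> y \<in> dv n \<Longrightarrow> x + y \<in> dv n"
  by (metis dvE dvI hbn_add)

lemma dv_minus: "x \<in> dv n \<Longrightarrow> - x \<in> dv n"
  by (metis dvE dvI hbn_minus)

lemma dv_diff: "x \<in> dv n \<Longrightarrow> y \<in> dv n \<Longrightarrow> x - y \<in> dv n"
  by (metis dvE dvI hbn_diff)

lemma dv_sc: "x \<in> dv n \<Longrightarrow> sc c x \<in> dv n"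
  by (metis dvE dvI hbn_sc)

lemma dv_sum: "(\<And>i. i \<in> I \<Longrightarrow> f i \<in> dv n) \<Longrightarrow> sum f I \<in> dv n"
  by (induction I rule: infinite_finite_induct) (auto simp: dv_add)

lemma dv_mul: "x \<in> dv n \<Longrightarrow> x \<star> y \<in> dv n" "y \<in> dv n \<Longrightarrow> x \<star> y \<in> dv n"
  by (metis dvE dvI hbn_mul(1), metis dvE dvI hbn_mul(2))

lemma dv_mono: "x \<in> dv n \<Longrightarrow> m \<le> n \<Longrightarrow> x \<in> dv m"
  by (metis dvE dvI hbn_hbn le_add_diff_inverse)

lemma hbn_dv: "x \<in> dv n \<Longrightarrow> hbn m x \<in> dv (m + n)"
  by (metis dvE dvI hbn_hbn)

lemma hbn_in_dvD: "hbn m x \<in> dv (m + n) \<Longrightarrow> x \<in> dv n"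
  by (metis dvE dvI hbn_hbn hbn_inj)

text \<open>Factors \<hbar> are split off t one at a time: the next coefficient of t is multiplied
  by the nonzero element red c of a domain.\<close>

lemma dv_cancel_left:
  assumes c: "red c \<noteq> 0" and t: "c \<star> t \<in> dv n"
  shows "t \<in> dv n"
  using t
proof (induction n)
  case (Suc n)
  then have "t \<in> dv n" using dv_mono by (metis le_SucI order_refl)
  then obtain u where u: "t = hbn n u" by (rule dvE)
  then have "c \<star> u \<in> dv (Suc 0)" using hbn_in_dvD[of n "c \<star> u" "Suc 0"] Suc.prems by (simp add: hbn_mul)
  then have "u \<in> dv (Suc 0)" using c by (simp add: dv_1 red_mul)
  then show ?case using hbn_dv[of u "Suc 0" n] u by simp
qed simp

lemma dv_cancel_right:
  assumes c: "red c \<noteq> 0" and t: "t \<star> c \<in> dv n"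
  shows "t \<in> dv n"
  using t
proof (induction n)
  case (Suc n)
  then have "t \<in> dv n" using dv_mono by (metis le_SucI order_refl)
  then obtain u where u: "t = hbn n u" by (rule dvE)
  then have "u \<star> c \<in> dv (Suc 0)" using hbn_in_dvD[of n "u \<star> c" "Suc 0"] Suc.prems by (simp add: hbn_mul)
  then have "u \<in> dv (Suc 0)" using c by (simp add: dv_1 red_mul)
  then show ?case using hbn_dv[of u "Suc 0" n] u by simp
qed simp

lemma commutator_dv: "x \<star> y - y \<star> x \<in> dv (Suc 0)"
  by (simp add: dv_1 red_diff red_mul mult.commute)

lemma dv_eq_0: "(\<And>n. x \<in> dv n) \<Longrightarrow> x = 0"
  by (rule separated) (simp add: dv_def hbn_def)

text \<open>Multiplying a common multiple modulo \<open>\<hbar>\<^sup>n\<close> by \<open>p\<close> turns the error into a commutator with \<open>p\<close>.\<close>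

lemma ore_left:
  assumes p: "red p \<noteq> 0"
  shows "\<exists>c c'. red c \<noteq> 0 \<and> c \<star> q - c' \<star> p \<in> dv n"
proof (induction n)
  case 0
  show ?case by (rule exI[of _ unit]) (simp add: red_unit)
next
  case (Suc n)
  then obtain c c' where c: "red c \<noteq> 0" "c \<star> q - c' \<star> p \<in> dv n" by blast
  then obtain r where r: "c \<star> q - c' \<star> p = hbn n r" using dvE by metis
  have "(p \<star> c) \<star> q - (p \<star> c' + hbn n r) \<star> p = p \<star> (c \<star> q - c' \<star> p) - hbn n (r \<star> p)"
    by (simp add: mul_add_left mul_diff mul_assoc hbn_mul algebra_simps)
  also have "\<dots> = hbn n (p \<star> r - r \<star> p)" by (simp add: r hbn_mul hbn_diff)
  also have "\<dots> \<in> dv (Suc n)" using hbn_dv[OF commutator_dv, of n p r] by simp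
  finally show ?case using p c(1) by (metis red_mul mult_eq_0_iff)
qed

lemma ore_right:
  assumes p: "red p \<noteq> 0"
  shows "\<exists>c c'. red c \<noteq> 0 \<and> q \<star> c - p \<star> c' \<in> dv n"
proof (induction n)
  case 0
  show ?case by (rule exI[of _ unit]) (simp add: red_unit)
next
  case (Suc n)
  then obtain c c' where c: "red c \<noteq> 0" "q \<star> c - p \<star> c' \<in> dv n" by blast
  then obtain r where r: "q \<star> c - p \<star> c' = hbn n r" using dvE by metis
  have "q \<star> (c \<star> p) - p \<star> (c' \<star> p + hbn n r) = (q \<star> c - p \<star> c') \<star> p - hbn n (p \<star> r)"
    by (simp add: mul_add_right mul_diff mul_assoc hbn_mul algebra_simps)
  also have "\<dots> = hbn n (r \<star> p - p \<star> r)" by (simp add: r hbn_mul hbn_diff)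
  also have "\<dots> \<in> dv (Suc n)" using hbn_dv[OF commutator_dv, of n r p] by simp
  finally show ?case using p c(1) by (metis red_mul mult_eq_0_iff)
qed

text \<open>Denominators are treated one after the other; a new factor on the right preserves the
  congruences found before.\<close>

lemma ore_right_family:
  assumes p: "red p \<noteq> 0" and fin: "finite I"
  shows "\<exists>c c'. red c \<noteq> 0 \<and> (\<forall>i\<in>I. q i \<star> c - p \<star> c' i \<in> dv n)"
  using fin
proof induction
  case empty
  show ?case by (rule exI[of _ unit]) (simp add: red_unit)
next
  case (insert i I)
  then obtain c c' where c: "red c \<noteq> 0" "\<And>i. i \<in> I \<Longrightarrow> q i \<star> c - p \<star> c' i \<in> dv n" by blast
  obtain d d' where d: "red d \<noteq> 0" "(q i \<star> c) \<star> d - p \<star> d' \<in> dv n" using ore_right[OF p] by blast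
  have "q j \<star> (c \<star> d) - p \<star> ((\<lambda>j. c' j \<star> d)(i := d')) j \<in> dv n" if "j \<in> insert i I" for j
  proof (cases "j = i")
    case True
    then show ?thesis using d by (simp add: mul_assoc)
  next
    case False
    then have "(q j \<star> c - p \<star> c' j) \<star> d \<in> dv n" using that c by (intro dv_mul(1)) auto
    then show ?thesis using False by (simp add: mul_assoc mul_diff)
  qed
  moreover have "red (c \<star> d) \<noteq> 0" using c d by (simp add: red_mul)
  ultimately show ?case by blast
qed

text \<open>Gaussian elimination over the columns, with the Ore condition in place of division. The
  relation must be nontrivial modulo \<hbar>, since multiples of \<hbar>^n satisfy every
  congruence.\<close>

lemma unimodular_relation:
  assumes "finite I" "finite J" "card I < card J"
  shows "\<exists>x. (\<exists>j\<in>J. red (x j) \<noteq> 0) \<and> (\<forall>i\<in>I. (\<Sum>j\<in>J. x j \<star> v j i) \<in> dv n)"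
  using assms
proof (induction I arbitrary: J v rule: finite_induct)
  case empty
  then have "J \<noteq> {}" by auto
  then show ?case by (intro exI[of _ "\<lambda>_. unit"]) (auto simp: red_unit)
next
  case (insert i I)
  show ?case
  proof (cases "\<forall>j\<in>J. v j i \<in> dv n")
    case True
    have "card I < card J" using insert by simp
    then obtain x where x: "\<exists>j\<in>J. red (x j) \<noteq> 0" "\<forall>i\<in>I. (\<Sum>j\<in>J. x j \<star> v j i) \<in> dv n"
      using insert.IH[OF insert.prems(1), of v] by blast
    have "(\<Sum>j\<in>J. x j \<star> v j i) \<in> dv n" using True by (intro dv_sum dv_mul) auto
    then show ?thesis using x by blast
  next
    case False
    \<comment> \<open>The pivot is an entry of least \<hbar>-order l in column i, so all entries of
      the column can be divided by \<hbar>^l and the divided pivot has nonzero reduction.\<close>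
    define L where "L = {l. l \<le> n \<and> (\<forall>j\<in>J. v j i \<in> dv l)}"
    define l where "l = Max L"
    have L: "finite L" "0 \<in> L" by (auto simp: L_def)
    then have lL: "l \<in> L" unfolding l_def by (intro Max_in) auto
    then have "l \<noteq> n" using False by (auto simp: L_def)
    then have ln: "Suc l \<le> n" using lL by (auto simp: L_def)
    have "Suc l \<notin> L" using Max_ge[OF L(1), of "Suc l"] by (auto simp: l_def)
    then obtain j0 where j0: "j0 \<in> J" "v j0 i \<notin> dv (Suc l)" using ln by (auto simp: L_def)
    have "\<forall>j\<in>J. \<exists>q. v j i = hbn l q" using lL by (auto simp: L_def elim: dvE)
    then obtain q where q: "\<And>j. j \<in> J \<Longrightarrow> v j i = hbn l (q j)" by metis
    have q0: "red (q j0) \<noteq> 0" using hbn_dv[of "q j0" "Suc 0" l] j0 q by (auto simp: dv_1)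
    obtain c c' where c: "\<And>j. red (c j) \<noteq> 0" "\<And>j. c j \<star> q j - c' j \<star> q j0 \<in> dv n"
      using ore_left[OF q0, of "q _" n] by metis
    define v' where "v' = (\<lambda>j i. c j \<star> v j i - c' j \<star> v j0 i)"
    let ?J = "J - {j0}"
    have "card I < card ?J" using insert j0 by simp
    then obtain y where y: "\<exists>j\<in>?J. red (y j) \<noteq> 0" "\<forall>i\<in>I. (\<Sum>j\<in>?J. y j \<star> v' j i) \<in> dv n"
      using insert.IH[of ?J v'] insert.prems(1) by blast
    \<comment> \<open>The other rows are scaled by \<open>c j\<close>, whose reduction is nonzero,
      so unimodularity survives. The coefficient of the pivot row absorbs what was subtracted from
      the others.\<close>
    define x where "x = (\<lambda>j. if j = j0 then - (\<Sum>j\<in>?J. y j \<star> c' j) else y j \<star> c j)"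
    have eq: "(\<Sum>j\<in>J. x j \<star> v j i') = (\<Sum>j\<in>?J. y j \<star> v' j i')" for i'
    proof -
      have "(\<Sum>j\<in>J. x j \<star> v j i') = x j0 \<star> v j0 i' + (\<Sum>j\<in>?J. x j \<star> v j i')"
        using insert.prems(1) j0(1) by (simp add: sum.remove)
      also have "(\<Sum>j\<in>?J. x j \<star> v j i') = (\<Sum>j\<in>?J. y j \<star> (c j \<star> v j i'))"
        by (rule sum.cong) (auto simp: x_def mul_assoc)
      also have "x j0 \<star> v j0 i' = - (\<Sum>j\<in>?J. y j \<star> (c' j \<star> v j0 i'))"
        by (simp add: x_def mul_minus mul_sum mul_assoc)
      finally show ?thesis by (simp add: v'_def mul_diff sum_subtractf)
    qed
    have "v' j i \<in> dv n" if "j \<in> ?J" for j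
    proof -
      have "v' j i = hbn l (c j \<star> q j - c' j \<star> q j0)"
        using that j0 by (simp add: v'_def q hbn_mul hbn_diff)
      then show ?thesis using hbn_dv[OF c(2), of l j] dv_mono by (metis le_add2)
    qed
    then have "(\<Sum>j\<in>J. x j \<star> v j i) \<in> dv n" unfolding eq by (intro dv_sum dv_mul) auto
    then have "\<forall>i\<in>insert i I. (\<Sum>j\<in>J. x j \<star> v j i) \<in> dv n" using y(2) by (simp add: eq)
    moreover have "\<exists>j\<in>J. red (x j) \<noteq> 0" using y(1) c(1) by (auto simp: x_def red_mul)
    ultimately show ?thesis by blast
  qed
qed

section \<open>The induced Poisson bracket\<close>

definition bracket :: "'a \<Rightarrow> 'a \<Rightarrow> 'a" where
  "bracket a b = (THE c. \<exists>x y z. red x = a \<and> red y = b \<and> x \<star> y - y \<star> x = hb z \<and> c = red z)"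

text \<open>Other lifts change the commutator by \<hbar> times commutators, and these vanish in the
  commutative reduction.\<close>

lemma bracket_eqI:
  assumes "x \<star> y - y \<star> x = hb z"
  shows "bracket (red x) (red y) = red z"
  unfolding bracket_def
proof (rule the_equality)
  show "\<exists>x' y' z'. red x' = red x \<and> red y' = red y \<and> x' \<star> y' - y' \<star> x' = hb z' \<and> red z = red z'"
    using assms by blast
next
  fix c assume "\<exists>x' y' z'. red x' = red x \<and> red y' = red y \<and> x' \<star> y' - y' \<star> x' = hb z' \<and> c = red z'"
  then obtain x' y' z' where *: "red x' = red x" "red y' = red y" "x' \<star> y' - y' \<star> x' = hb z'" "c = red z'"
    by blast
  have "red (x' - x) = 0" "red (y' - y) = 0" using * by (simp_all add: red_diff)
  then obtain u v where uv: "x' - x = hb u" "y' - y = hb v" unfolding red_eq_0 by auto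
  then have x': "x' = x + hb u" and y': "y' = y + hb v" by (auto simp: algebra_simps)
  have "hb z' - hb z = hb (u \<star> y' - y' \<star> u) + hb (x \<star> v - v \<star> x)"
    unfolding *(3)[symmetric] assms[symmetric] x' y'
    by (simp add: mul_add_left mul_add_right hb_mul_left hb_mul_right hb_add hb_minus algebra_simps
        flip: hb_add diff_conv_add_uminus)
      (simp add: hb_add diff_conv_add_uminus hb_minus del: add_uminus_conv_diff)
  then have "hb (z' - z) = hb ((u \<star> y' - y' \<star> u) + (x \<star> v - v \<star> x))"
    using hbn_diff[of "Suc 0"] by (simp add: hb_add)
  then have "z' - z = (u \<star> y' - y' \<star> u) + (x \<star> v - v \<star> x)" by (rule hb_inj)
  then have "red z' - red z = 0" by (simp flip: red_diff) (simp add: red_add red_diff red_mul mult.commute)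
  then show "c = red z" using * by simp
qed

lemma bracket_lift:
  obtains z where "x \<star> y - y \<star> x = hb z" "bracket (red x) (red y) = red z"
proof -
  obtain z where "x \<star> y - y \<star> x = hb z" using commutator_dv[of x y] by (auto elim!: dvE)
  then show ?thesis using that bracket_eqI by blast
qed

lemma bracket_antisym: "bracket a b = - bracket b a"
proof -
  obtain x y where xy: "red x = a" "red y = b" using red_surj by metis
  obtain z where z: "x \<star> y - y \<star> x = hb z" "bracket (red x) (red y) = red z" by (rule bracket_lift)
  have "y \<star> x - x \<star> y = hb (- z)" using z(1) by (metis hb_minus minus_diff_eq)
  then show ?thesis using bracket_eqI[of y x "- z"] z(2) xy by (simp add: red_minus)
qed

lemma bracket_right:
  shows bracket_add_right: "bracket a (b + c) = bracket a b + bracket a c"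
    and bracket_mult_right: "bracket a (b * c) = bracket a b * c + b * bracket a c"
    and bracket_sc_right: "bracket a (s r b) = s r (bracket a b)"
proof -
  obtain x y w where xy: "red x = a" "red y = b" "red w = c" using red_surj by metis
  obtain z where z: "x \<star> y - y \<star> x = hb z" "bracket (red x) (red y) = red z" by (rule bracket_lift)
  obtain z' where z': "x \<star> w - w \<star> x = hb z'" "bracket (red x) (red w) = red z'" by (rule bracket_lift)
  have "x \<star> (y + w) - (y + w) \<star> x = hb (z + z')"
    by (simp add: mul_add_left mul_add_right hb_add flip: z(1) z'(1))
  then show "bracket a (b + c) = bracket a b + bracket a c"
    using bracket_eqI z z' xy by (metis red_add)
  have "x \<star> (y \<star> w) - (y \<star> w) \<star> x = hb (z \<star> w + y \<star> z')"
  proof -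
    have "hb (z \<star> w + y \<star> z') = hb z \<star> w + y \<star> hb z'" by (simp add: hb_add hb_mul_left hb_mul_right)
    then show ?thesis by (simp add: mul_diff mul_assoc flip: z(1) z'(1))
  qed
  then show "bracket a (b * c) = bracket a b * c + b * bracket a c"
    using bracket_eqI z z' xy by (metis red_add red_mul)
  have "x \<star> sc r y - sc r y \<star> x = hb (sc r z)"
    by (simp add: sc_mul_left sc_mul_right hb_sc U.scale_right_diff_distrib flip: z(1))
  then show "bracket a (s r b) = s r (bracket a b)"
    using bracket_eqI z xy by (metis red_sc)
qed

lemma biderivation_bracket: "biderivation bracket"
proof -
  have "bracket (a + b) c = bracket a c + bracket b c" for a b c
    using bracket_add_right[of c a b] bracket_antisym[of c] bracket_antisym[of _ c]
    by (metis minus_add_distrib)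
  moreover have "bracket (a * b) c = bracket a c * b + a * bracket b c" for a b c
    unfolding bracket_antisym[of _ c] bracket_mult_right by (simp add: algebra_simps)
  ultimately show ?thesis
    by (simp add: biderivation_def bracket_add_right bracket_mult_right)
qed

abbreviation Pois :: "'a fract \<Rightarrow> 'a fract \<Rightarrow> 'a fract" where
  "Pois \<equiv> fract_bracket bracket"

lemmas Pois_Fr = fract_bracket_Fr[OF biderivation_bracket]
lemmas Pois_right = derivation_fract_bracket_right[OF biderivation_bracket]
lemmas Pois_left = derivation_fract_bracket_left[OF biderivation_bracket]
lemmas Pois_antisym = fract_bracket_antisym[OF biderivation_bracket bracket_antisym]

end

section \<open>Linear functionals on tensor products\<close>

text \<open>The linear extension of \<open>b\<close> to formal sums of pairs. The target is a vector
  space given by a type, so identities between tensors can be tested without sums over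
  carriers.\<close>

definition pm_sum :: "('k::zero \<Rightarrow> 'x::comm_monoid_add \<Rightarrow> 'x) \<Rightarrow> (('v \<times> 'w) \<Rightarrow>\<^sub>0 'k) \<Rightarrow> ('v \<Rightarrow> 'w \<Rightarrow> 'x) \<Rightarrow> 'x" where
  "pm_sum sc t b = (\<Sum>p\<in>Poly_Mapping.keys t. sc (Poly_Mapping.lookup t p) (b (fst p) (snd p)))"

definition linear_on :: "('k, 'v, 'm) module_scheme \<Rightarrow> ('k \<Rightarrow> 'x::plus \<Rightarrow> 'x) \<Rightarrow> ('v \<Rightarrow> 'x) \<Rightarrow> bool" where
  "linear_on V sc F \<longleftrightarrow> (\<forall>x\<in>carrier V. \<forall>y\<in>carrier V. F (x \<oplus>\<^bsub>V\<^esub> y) = F x + F y) \<and>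
     (\<forall>c. \<forall>x\<in>carrier V. F (c \<odot>\<^bsub>V\<^esub> x) = sc c (F x))"

definition bilinear_on :: "('k, 'v, 'm) module_scheme \<Rightarrow> ('k, 'w, 'n) module_scheme \<Rightarrow>
    ('k \<Rightarrow> 'x::plus \<Rightarrow> 'x) \<Rightarrow> ('v \<Rightarrow> 'w \<Rightarrow> 'x) \<Rightarrow> bool" where
  "bilinear_on V W sc b \<longleftrightarrow> (\<forall>x\<in>carrier V. linear_on W sc (b x)) \<and> (\<forall>y\<in>carrier W. linear_on V sc (\<lambda>x. b x y))"

lemma lookup_pm_scale [simp]: "Poly_Mapping.lookup (pm_scale c t) p = c * Poly_Mapping.lookup t p"
  by (simp add: pm_scale_def Poly_Mapping.map.rep_eq when_def)

lemma keys_pm_scale: "Poly_Mapping.keys (pm_scale c t) \<subseteq> Poly_Mapping.keys t"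
  by (auto simp: in_keys_iff)

lemma pm_scale_single: "pm_scale c (Poly_Mapping.single p a) = Poly_Mapping.single p (c * a)"
  by (rule poly_mapping_eqI) (simp add: lookup_single when_def)

lemma pm_scale_minus_1: "pm_scale (- 1) t = - t"
  by (rule poly_mapping_eqI) simp

context vector_space
begin

lemma pm_sum_superset:
  assumes "finite S" "Poly_Mapping.keys t \<subseteq> S"
  shows "pm_sum scale t b = (\<Sum>p\<in>S. scale (Poly_Mapping.lookup t p) (b (fst p) (snd p)))"
  unfolding pm_sum_def using assms
  by (intro sum.mono_neutral_left) (auto simp: in_keys_iff)

lemma pm_sum_add: "pm_sum scale (t + u) b = pm_sum scale t b + pm_sum scale u b"
proof -
  let ?S = "Poly_Mapping.keys t \<union> Poly_Mapping.keys u"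
  have "finite ?S" "Poly_Mapping.keys (t + u) \<subseteq> ?S" using keys_add[of t u] by auto
  then show ?thesis
    by (simp add: pm_sum_superset[of ?S] lookup_add scale_left_distrib sum.distrib)
qed

lemma pm_sum_scale: "pm_sum scale (pm_scale c t) b = scale c (pm_sum scale t b)"
  using pm_sum_superset[OF finite_keys keys_pm_scale, of c t b]
  by (simp add: pm_sum_def scale_sum_right)

lemma pm_sum_zero [simp]: "pm_sum scale 0 b = 0"
  by (simp add: pm_sum_def)

lemma pm_sum_minus: "pm_sum scale (- t) b = - pm_sum scale t b"
  using pm_sum_scale[of "- 1" t b] by (simp add: pm_scale_minus_1)

lemma pm_sum_diff: "pm_sum scale (t - u) b = pm_sum scale t b - pm_sum scale u b"
  using pm_sum_add[of t "- u" b] by (simp add: pm_sum_minus)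

lemma pm_sum_single [simp]: "pm_sum scale (Poly_Mapping.single p c) b = scale c (b (fst p) (snd p))"
  by (simp add: pm_sum_def)

text \<open>A bilinear map kills each generating relation, hence evaluation descends to tensor
  classes.\<close>

lemma pm_sum_tensor_null:
  assumes "bilinear_on V W scale b" "t \<in> tensor_null V W"
  shows "pm_sum scale t b = 0"
  using assms(2)
proof induction
  case (add s t)
  then show ?case by (simp add: pm_sum_add)
next
  case (scale t c)
  then show ?case by (simp add: pm_sum_scale)
next
  case (scale_left x y c)
  then show ?case using assms(1) by (simp add: pm_sum_diff bilinear_on_def linear_on_def)
next
  case (scale_right x y c)
  then show ?case using assms(1) by (simp add: pm_sum_diff bilinear_on_def linear_on_def)
qed (use assms(1) in \<open>auto simp: pm_sum_diff bilinear_on_def linear_on_def\<close>)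

definition tensor_eval :: "(('v \<times> 'w) \<Rightarrow>\<^sub>0 'a) set \<Rightarrow> ('v \<Rightarrow> 'w \<Rightarrow> 'b) \<Rightarrow> 'b" where
  "tensor_eval T b = pm_sum scale (SOME t. t \<in> T) b"

end

lemma tensor_null_minus: "t \<in> tensor_null V W \<Longrightarrow> - t \<in> tensor_null V W"
  using tensor_null.scale[of t V W "- 1"] by (simp add: pm_scale_minus_1)

lemma tensor_null_diff: "t \<in> tensor_null V W \<Longrightarrow> u \<in> tensor_null V W \<Longrightarrow> t - u \<in> tensor_null V W"
  using tensor_null.add[OF _ tensor_null_minus, of t V W u] by simp

lemma tensor_null_sum: "(\<And>i. i \<in> I \<Longrightarrow> f i \<in> tensor_null V W) \<Longrightarrow> sum f I \<in> tensor_null V W"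
  by (induction I rule: infinite_finite_induct) (auto intro: tensor_null.zero tensor_null.add)

lemma mem_tensor_class: "Poly_Mapping.keys t \<subseteq> carrier V \<times> carrier W \<Longrightarrow> t \<in> tensor_class V W t"
  by (simp add: tensor_class_def tensor_null.zero)

lemma tensor_class_eqI:
  assumes "t - u \<in> tensor_null V W"
  shows "tensor_class V W t = tensor_class V W u"
proof -
  have "r - t \<in> tensor_null V W \<longleftrightarrow> r - u \<in> tensor_null V W" for r
    using tensor_null.add[of "r - t" V W "t - u"] tensor_null_diff[of "r - u" V W "t - u"] assms by auto
  then show ?thesis by (auto simp: tensor_class_def)
qed

lemma tensor_class_mem_eq: "t \<in> tensor_class V W u \<Longrightarrow> tensor_class V W t = tensor_class V W u"
  by (rule tensor_class_eqI) (simp add: tensor_class_def)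

lemma tensor_carrierE:
  assumes "T \<in> carrier (tensor V W)"
  obtains t where "Poly_Mapping.keys t \<subseteq> carrier V \<times> carrier W" "T = tensor_class V W t"
  using assms by (auto simp: tensor_def)

lemma tensor_class_carrier:
  "Poly_Mapping.keys t \<subseteq> carrier V \<times> carrier W \<Longrightarrow> tensor_class V W t \<in> carrier (tensor V W)"
  by (auto simp: tensor_def)

lemma tensor_mem_SOME:
  assumes "T \<in> carrier (tensor V W)"
  shows "(SOME t. t \<in> T) \<in> T" "Poly_Mapping.keys (SOME t. t \<in> T) \<subseteq> carrier V \<times> carrier W"
    "tensor_class V W (SOME t. t \<in> T) = T"
proof -
  obtain t where t: "Poly_Mapping.keys t \<subseteq> carrier V \<times> carrier W" "T = tensor_class V W t"
    using assms by (rule tensor_carrierE)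
  show 1: "(SOME t. t \<in> T) \<in> T" using someI[of "\<lambda>t. t \<in> T" t] mem_tensor_class[OF t(1)] t(2) by simp
  then show "Poly_Mapping.keys (SOME t. t \<in> T) \<subseteq> carrier V \<times> carrier W"
    using t(2) by (auto simp: tensor_class_def)
  show "tensor_class V W (SOME t. t \<in> T) = T" using 1 t(2) tensor_class_mem_eq by metis
qed

lemma tensor_add_class:
  assumes "Poly_Mapping.keys t \<subseteq> carrier V \<times> carrier W" "Poly_Mapping.keys u \<subseteq> carrier V \<times> carrier W"
  shows "tensor_class V W t \<oplus>\<^bsub>tensor V W\<^esub> tensor_class V W u = tensor_class V W (t + u)"
proof -
  have "tensor_class V W (t' + u') = tensor_class V W (t + u)"
    if "t' \<in> tensor_class V W t" "u' \<in> tensor_class V W u" for t' u'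
  proof (rule tensor_class_eqI)
    have eq: "t' + u' - (t + u) = (t' - t) + (u' - u)" by (simp add: algebra_simps)
    show "t' + u' - (t + u) \<in> tensor_null V W"
      unfolding eq using that by (intro tensor_null.add) (simp_all add: tensor_class_def)
  qed
  then have "(\<Union>t'\<in>tensor_class V W t. \<Union>u'\<in>tensor_class V W u. tensor_class V W (t' + u')) =
      (\<Union>t'\<in>tensor_class V W t. \<Union>u'\<in>tensor_class V W u. tensor_class V W (t + u))"
    by (intro SUP_cong refl)
  also have "\<dots> = tensor_class V W (t + u)"
    using mem_tensor_class[OF assms(1)] mem_tensor_class[OF assms(2)] by blast
  finally show ?thesis by (simp add: tensor_def)
qed

lemma tensor_smult_class:
  assumes "Poly_Mapping.keys t \<subseteq> carrier V \<times> carrier W"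
  shows "c \<odot>\<^bsub>tensor V W\<^esub> tensor_class V W t = tensor_class V W (pm_scale c t)"
proof -
  have "tensor_class V W (pm_scale c t') = tensor_class V W (pm_scale c t)"
    if "t' \<in> tensor_class V W t" for t'
  proof (rule tensor_class_eqI)
    have "pm_scale c t' - pm_scale c t = pm_scale c (t' - t)"
      by (rule poly_mapping_eqI) (simp add: lookup_minus algebra_simps)
    then show "pm_scale c t' - pm_scale c t \<in> tensor_null V W"
      using that tensor_null.scale[of "t' - t" V W c] by (simp add: tensor_class_def)
  qed
  then have "(\<Union>t'\<in>tensor_class V W t. tensor_class V W (pm_scale c t')) =
      (\<Union>t'\<in>tensor_class V W t. tensor_class V W (pm_scale c t))"
    by (intro SUP_cong refl)
  also have "\<dots> = tensor_class V W (pm_scale c t)"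
    using mem_tensor_class[OF assms] by blast
  finally show ?thesis by (simp add: tensor_def)
qed

lemma tensor_zero_class: "\<zero>\<^bsub>tensor V W\<^esub> = tensor_class V W 0"
  by (simp add: tensor_def)

lemma keys_add_subset:
  "Poly_Mapping.keys t \<subseteq> S \<Longrightarrow> Poly_Mapping.keys u \<subseteq> S \<Longrightarrow> Poly_Mapping.keys (t + u) \<subseteq> S"
  using keys_add[of t u] by blast

lemma keys_pm_scale_subset: "Poly_Mapping.keys t \<subseteq> S \<Longrightarrow> Poly_Mapping.keys (pm_scale c t) \<subseteq> S"
  using keys_pm_scale[of c t] by blast

lemma keys_sum_subset:
  "(\<And>i. i \<in> I \<Longrightarrow> Poly_Mapping.keys (f i) \<subseteq> S) \<Longrightarrow> Poly_Mapping.keys (sum f I) \<subseteq> S"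
  by (induction I rule: infinite_finite_induct) (simp_all add: keys_add_subset)

lemma tensor_abelian_group: "abelian_group (tensor V W)"
proof (rule abelian_groupI)
  fix S T assume S: "S \<in> carrier (tensor V W)" and T: "T \<in> carrier (tensor V W)"
  obtain t where t: "Poly_Mapping.keys t \<subseteq> carrier V \<times> carrier W" "S = tensor_class V W t"
    using S by (rule tensor_carrierE)
  obtain u where u: "Poly_Mapping.keys u \<subseteq> carrier V \<times> carrier W" "T = tensor_class V W u"
    using T by (rule tensor_carrierE)
  show "S \<oplus>\<^bsub>tensor V W\<^esub> T \<in> carrier (tensor V W)"
    unfolding t(2) u(2) tensor_add_class[OF t(1) u(1)]
    by (rule tensor_class_carrier[OF keys_add_subset[OF t(1) u(1)]])
  show "S \<oplus>\<^bsub>tensor V W\<^esub> T = T \<oplus>\<^bsub>tensor V W\<^esub> S"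
    unfolding t(2) u(2) tensor_add_class[OF t(1) u(1)] tensor_add_class[OF u(1) t(1)] by (simp add: add.commute)
  fix R assume R: "R \<in> carrier (tensor V W)"
  obtain r where r: "Poly_Mapping.keys r \<subseteq> carrier V \<times> carrier W" "R = tensor_class V W r"
    using R by (rule tensor_carrierE)
  show "S \<oplus>\<^bsub>tensor V W\<^esub> T \<oplus>\<^bsub>tensor V W\<^esub> R = S \<oplus>\<^bsub>tensor V W\<^esub> (T \<oplus>\<^bsub>tensor V W\<^esub> R)"
    unfolding t(2) u(2) r(2) using t(1) u(1) r(1)
    by (simp add: tensor_add_class keys_add_subset add.assoc)
next
  show "\<zero>\<^bsub>tensor V W\<^esub> \<in> carrier (tensor V W)"
    by (simp add: tensor_zero_class tensor_class_carrier)
  fix S assume S: "S \<in> carrier (tensor V W)"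
  obtain t where t: "Poly_Mapping.keys t \<subseteq> carrier V \<times> carrier W" "S = tensor_class V W t"
    using S by (rule tensor_carrierE)
  show "\<zero>\<^bsub>tensor V W\<^esub> \<oplus>\<^bsub>tensor V W\<^esub> S = S"
    unfolding t(2) tensor_zero_class using t(1) by (simp add: tensor_add_class)
  have mt: "Poly_Mapping.keys (- t) \<subseteq> carrier V \<times> carrier W" using t(1) by (auto simp: in_keys_iff)
  show "\<exists>T\<in>carrier (tensor V W). T \<oplus>\<^bsub>tensor V W\<^esub> S = \<zero>\<^bsub>tensor V W\<^esub>"
    using tensor_class_carrier[OF mt] tensor_add_class[OF mt t(1)]
    by (auto simp: t(2) tensor_zero_class)
qed

text \<open>The bridge from sums in a record to sums in a type. For infinite \<open>A\<close> both
  sums are zero by convention.\<close>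

lemma finsum_linear:
  fixes F :: "_ \<Rightarrow> 'x::ab_group_add"
  assumes "abelian_group M" "linear_on M sc F" "f \<in> A \<rightarrow> carrier M"
    and [simp]: "vector_space sc"
  shows "F (finsum M f A) = (\<Sum>a\<in>A. F (f a))" 
proof (cases "finite A")
  case False
  interpret abelian_group M by fact
  have "F \<zero>\<^bsub>M\<^esub> + F \<zero>\<^bsub>M\<^esub> = F (\<zero>\<^bsub>M\<^esub> \<oplus>\<^bsub>M\<^esub> \<zero>\<^bsub>M\<^esub>)"
    using assms(2) zero_closed unfolding linear_on_def by metis
  then have "F \<zero>\<^bsub>M\<^esub> = 0" by simp
  then show ?thesis using False by (simp add: finsum_def finprod_def)
next
  case True
  interpret abelian_group M by fact
  have "F \<zero>\<^bsub>M\<^esub> + F \<zero>\<^bsub>M\<^esub> = F (\<zero>\<^bsub>M\<^esub> \<oplus>\<^bsub>M\<^esub> \<zero>\<^bsub>M\<^esub>)"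
    using assms(2) zero_closed unfolding linear_on_def by metis
  then have z: "F \<zero>\<^bsub>M\<^esub> = 0" by simp
  show ?thesis using True assms(3)
  proof induction
    case (insert a A)
    have "F (finsum M f (insert a A)) = F (f a \<oplus>\<^bsub>M\<^esub> finsum M f A)"
      using insert by (simp add: finsum_insert Pi_def)
    also have "\<dots> = F (f a) + F (finsum M f A)"
      using insert assms(2) finsum_closed[of f A] by (simp add: linear_on_def Pi_def)
    finally show ?case using insert by (simp add: Pi_def)
  qed (simp add: z)
qed

context vector_space
begin

lemma tensor_eval_class:
  assumes "bilinear_on V W scale b" "Poly_Mapping.keys t \<subseteq> carrier V \<times> carrier W"
  shows "tensor_eval (tensor_class V W t) b = pm_sum scale t b"
proof -
  let ?u = "SOME u. u \<in> tensor_class V W t"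
  have "?u \<in> tensor_class V W t" using tensor_mem_SOME(1)[OF tensor_class_carrier[OF assms(2)]] .
  then have "?u - t \<in> tensor_null V W" by (simp add: tensor_class_def)
  then show ?thesis using pm_sum_tensor_null[OF assms(1)] by (fastforce simp: tensor_eval_def pm_sum_diff)
qed

lemma tensor_eval_pure:
  assumes "bilinear_on V W scale b" "x \<in> carrier V" "y \<in> carrier W"
  shows "tensor_eval (pure_tensor V W x y) b = b x y"
  unfolding pure_tensor_def using assms by (simp add: tensor_eval_class)

lemma tensor_eval_linear:
  assumes b: "bilinear_on V W scale b"
  shows "linear_on (tensor V W) scale (\<lambda>T. tensor_eval T b)"
  unfolding linear_on_def
proof (intro conjI ballI allI)
  fix S T assume S: "S \<in> carrier (tensor V W)" and T: "T \<in> carrier (tensor V W)"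
  obtain t where t: "Poly_Mapping.keys t \<subseteq> carrier V \<times> carrier W" "S = tensor_class V W t"
    using S by (rule tensor_carrierE)
  obtain u where u: "Poly_Mapping.keys u \<subseteq> carrier V \<times> carrier W" "T = tensor_class V W u"
    using T by (rule tensor_carrierE)
  show "tensor_eval (S \<oplus>\<^bsub>tensor V W\<^esub> T) b = tensor_eval S b + tensor_eval T b"
    using t u keys_add_subset[OF t(1) u(1)] by (simp add: tensor_add_class tensor_eval_class[OF b] pm_sum_add)
next
  fix c S assume S: "S \<in> carrier (tensor V W)"
  obtain t where t: "Poly_Mapping.keys t \<subseteq> carrier V \<times> carrier W" "S = tensor_class V W t"
    using S by (rule tensor_carrierE)
  show "tensor_eval (c \<odot>\<^bsub>tensor V W\<^esub> S) b = scale c (tensor_eval S b)"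
    using t keys_pm_scale_subset[OF t(1)] by (simp add: tensor_smult_class tensor_eval_class[OF b] pm_sum_scale)
qed

end

lemma tensor_smult_closed:
  assumes "S \<in> carrier (tensor V W)"
  shows "c \<odot>\<^bsub>tensor V W\<^esub> S \<in> carrier (tensor V W)"
  using assms by (elim tensor_carrierE)
    (simp add: tensor_smult_class tensor_class_carrier keys_pm_scale_subset)

lemma pure_tensor_carrier: "x \<in> carrier V \<Longrightarrow> y \<in> carrier W \<Longrightarrow> pure_tensor V W x y \<in> carrier (tensor V W)"
  unfolding pure_tensor_def by (rule tensor_class_carrier) simp

text \<open>Turns equations between values of \<open>tensor_lift\<close>, the form of the Hopf
  axioms, into equations between Sweedler sums in a type.\<close>

lemma tensor_lift_linear:
  assumes "vector_space sc" "abelian_group M" "linear_on M sc F"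
    and "\<And>c x. x \<in> carrier M \<Longrightarrow> c \<odot>\<^bsub>M\<^esub> x \<in> carrier M"
    and "\<And>p. p \<in> Poly_Mapping.keys (SOME t. t \<in> T) \<Longrightarrow> f (fst p) (snd p) \<in> carrier M"
  shows "F (tensor_lift M f T) = pm_sum sc (SOME t. t \<in> T) (\<lambda>x y. F (f x y))"
  unfolding tensor_lift_def Let_def pm_sum_def
  by (subst finsum_linear[OF assms(2,3) _ assms(1)]) (use assms in \<open>auto simp: linear_on_def intro!: sum.cong\<close>)

lemma tensor_lift_closed:
  assumes "abelian_group M"
    and "\<And>c x. x \<in> carrier M \<Longrightarrow> c \<odot>\<^bsub>M\<^esub> x \<in> carrier M"
    and "\<And>p. p \<in> Poly_Mapping.keys (SOME t. t \<in> T) \<Longrightarrow> f (fst p) (snd p) \<in> carrier M"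
  shows "tensor_lift M f T \<in> carrier M"
proof -
  interpret abelian_group M by fact
  show ?thesis unfolding tensor_lift_def Let_def using assms by (intro finsum_closed) auto
qed

section \<open>Sweedler sums\<close>

text \<open>\<open>sw H sc h b\<close> is the Sweedler sum of the terms \<open>b h\<^sub>(\<^sub>1\<^sub>) h\<^sub>(\<^sub>2\<^sub>)\<close> in a vector space given by a type.\<close>

definition sw :: "('k::field, 'h, 'm) hopf_scheme \<Rightarrow> ('k \<Rightarrow> 'x::comm_monoid_add \<Rightarrow> 'x) \<Rightarrow> 'h \<Rightarrow> ('h \<Rightarrow> 'h \<Rightarrow> 'x) \<Rightarrow> 'x" where
  "sw H sc h b = pm_sum sc (SOME t. t \<in> comul H h) b"

definition trilinear_on :: "('k, 'h, 'm) module_scheme \<Rightarrow> ('k \<Rightarrow> 'x::plus \<Rightarrow> 'x) \<Rightarrow> ('h \<Rightarrow> 'h \<Rightarrow> 'h \<Rightarrow> 'x) \<Rightarrow> bool" where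
  "trilinear_on H sc \<beta> \<longleftrightarrow> (\<forall>x\<in>carrier H. bilinear_on H H sc (\<beta> x)) \<and>
     (\<forall>y\<in>carrier H. \<forall>z\<in>carrier H. linear_on H sc (\<lambda>x. \<beta> x y z))"

locale hopf =
  fixes H :: "('k::field, 'h, 'm) hopf_scheme"
  assumes hopf_algebra: "hopf_algebra H"
begin

abbreviation "C \<equiv> carrier H"

lemma assoc_algebra: "assoc_algebra H" using hopf_algebra by (simp add: hopf_algebra_def)

sublocale ring H using assoc_algebra by (simp add: assoc_algebra_def)

sublocale M: Module.module "ring_of_type_algebra :: 'k ring" H
  using assoc_algebra by (simp add: assoc_algebra_def)

lemma smult_closed [simp, intro]: "x \<in> C \<Longrightarrow> c \<odot>\<^bsub>H\<^esub> x \<in> C"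
  using M.smult_closed[of c x] by (simp add: ring_of_type_algebra_def)

lemma smult_add_left: "x \<in> C \<Longrightarrow> (c + d) \<odot>\<^bsub>H\<^esub> x = c \<odot>\<^bsub>H\<^esub> x \<oplus>\<^bsub>H\<^esub> d \<odot>\<^bsub>H\<^esub> x"
  using M.smult_l_distr[of c d x] by (simp add: ring_of_type_algebra_def)

lemma smult_add_right: "x \<in> C \<Longrightarrow> y \<in> C \<Longrightarrow> c \<odot>\<^bsub>H\<^esub> (x \<oplus>\<^bsub>H\<^esub> y) = c \<odot>\<^bsub>H\<^esub> x \<oplus>\<^bsub>H\<^esub> c \<odot>\<^bsub>H\<^esub> y"
  using M.smult_r_distr[of c x y] by (simp add: ring_of_type_algebra_def)

lemma smult_smult: "x \<in> C \<Longrightarrow> (c * d) \<odot>\<^bsub>H\<^esub> x = c \<odot>\<^bsub>H\<^esub> (d \<odot>\<^bsub>H\<^esub> x)"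
  using M.smult_assoc1[of c d x] by (simp add: ring_of_type_algebra_def)

lemma smult_mult: "x \<in> C \<Longrightarrow> y \<in> C \<Longrightarrow> (c \<odot>\<^bsub>H\<^esub> x) \<otimes>\<^bsub>H\<^esub> y = c \<odot>\<^bsub>H\<^esub> (x \<otimes>\<^bsub>H\<^esub> y)"
    "x \<in> C \<Longrightarrow> y \<in> C \<Longrightarrow> x \<otimes>\<^bsub>H\<^esub> (c \<odot>\<^bsub>H\<^esub> y) = c \<odot>\<^bsub>H\<^esub> (x \<otimes>\<^bsub>H\<^esub> y)"
  using assoc_algebra by (simp_all add: assoc_algebra_def)

lemma antipode_closed [simp, intro]: "x \<in> C \<Longrightarrow> antipode H x \<in> C"
  and antipode_add: "x \<in> C \<Longrightarrow> y \<in> C \<Longrightarrow> antipode H (x \<oplus>\<^bsub>H\<^esub> y) = antipode H x \<oplus>\<^bsub>H\<^esub> antipode H y"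
  and antipode_smult: "x \<in> C \<Longrightarrow> antipode H (c \<odot>\<^bsub>H\<^esub> x) = c \<odot>\<^bsub>H\<^esub> antipode H x"
  using hopf_algebra by (auto simp: hopf_algebra_def linear_maps_def)

lemma linear_on_counit: "linear_on H (*) (counit H)"
  using hopf_algebra
  by (auto simp: hopf_algebra_def algebra_homs_def linear_maps_def linear_on_def type_algebra_def
      ring_of_type_algebra_def ring.defs module.defs)

lemma comul_closed: "h \<in> C \<Longrightarrow> comul H h \<in> carrier (tensor H H)"
  and comul_add: "x \<in> C \<Longrightarrow> y \<in> C \<Longrightarrow> comul H (x \<oplus>\<^bsub>H\<^esub> y) = comul H x \<oplus>\<^bsub>tensor H H\<^esub> comul H y"
  and comul_smult: "x \<in> C \<Longrightarrow> comul H (c \<odot>\<^bsub>H\<^esub> x) = c \<odot>\<^bsub>tensor H H\<^esub> comul H x"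
  using hopf_algebra by (auto simp: hopf_algebra_def algebra_homs_def linear_maps_def)

lemma keys_comul:
  assumes "h \<in> C" "p \<in> Poly_Mapping.keys (SOME t. t \<in> comul H h)"
  shows "fst p \<in> C" "snd p \<in> C"
  using tensor_mem_SOME(2)[OF comul_closed[OF assms(1)]] assms(2) by auto

lemma sw_cong:
  assumes "h \<in> C" "\<And>x y. x \<in> C \<Longrightarrow> y \<in> C \<Longrightarrow> b x y = b' x y"
  shows "sw H sc h b = sw H sc h b'"
  unfolding sw_def pm_sum_def using assms keys_comul[OF assms(1)] by (intro sum.cong) auto

lemma sw_map:
  assumes "h \<in> C" "\<And>x y. F (x + y) = F x + F y" "F 0 = 0" "\<And>c x. F (sc c x) = sc' c (F x)"
  shows "F (sw H sc h b) = sw H sc' h (\<lambda>x y. F (b x y))"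
proof -
  have "F (sum f I) = (\<Sum>i\<in>I. F (f i))" for f :: "'h \<times> 'h \<Rightarrow> _" and I
    by (induction I rule: infinite_finite_induct) (auto simp: assms)
  then show ?thesis unfolding sw_def pm_sum_def by (simp add: assms)
qed

lemma linear_on_sw:
  assumes "vector_space sc" "bilinear_on H H sc b"
  shows "linear_on H sc (\<lambda>h. sw H sc h b)"
proof -
  interpret V: vector_space sc by fact
  have "sw H sc h b = V.tensor_eval (comul H h) b" for h by (simp add: sw_def V.tensor_eval_def)
  then show ?thesis using V.tensor_eval_linear[OF assms(2)] comul_closed comul_add comul_smult
    by (simp add: linear_on_def)
qed

lemma linear_on_sw_param:
  assumes "vector_space sc" "h \<in> C" "\<And>x y. x \<in> C \<Longrightarrow> y \<in> C \<Longrightarrow> linear_on H sc (\<lambda>z. b z x y)"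
  shows "linear_on H sc (\<lambda>z. sw H sc h (b z))"
proof -
  interpret V: vector_space sc by fact
  show ?thesis
    unfolding linear_on_def sw_def pm_sum_def sum.distrib[symmetric] V.scale_sum_right
    using assms(3)[OF keys_comul[OF assms(2)]]
    by (auto intro!: sum.cong simp: linear_on_def V.scale_right_distrib V.scale_left_commute)
qed

text \<open>A trilinear map induces a functional on the triple tensor product, and the
  coassociativity axiom is evaluated with it.\<close>

lemma sw_coassoc:
  assumes sc: "vector_space sc" and h: "h \<in> C" and \<beta>: "trilinear_on H sc \<beta>"
  shows "sw H sc h (\<lambda>x z. sw H sc x (\<lambda>u v. \<beta> u v z)) = sw H sc h (\<lambda>u x. sw H sc x (\<lambda>v z. \<beta> u v z))"
proof -
  interpret V: vector_space sc by fact
  let ?HH = "tensor H H" and ?T = "tensor H (tensor H H)"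
  \<comment> \<open>The triple product is bracketed to the right, so the last two arguments of
    \<beta> are evaluated first; \<open>b\<close> is then bilinear on H and
    \<open>tensor H H\<close>.\<close>
  define b where "b = (\<lambda>x Y. V.tensor_eval Y (\<beta> x))"
  have b: "bilinear_on H ?HH sc b"
    unfolding bilinear_on_def
  proof (intro conjI ballI)
    fix x assume "x \<in> C"
    then show "linear_on ?HH sc (b x)"
      unfolding b_def using \<beta> by (intro V.tensor_eval_linear) (simp add: trilinear_on_def)
  next
    fix Y assume Y: "Y \<in> carrier ?HH"
    have "linear_on H sc (\<lambda>z. pm_sum sc (SOME t. t \<in> Y) (\<beta> z))"
      unfolding linear_on_def pm_sum_def sum.distrib[symmetric] V.scale_sum_right
      using \<beta> tensor_mem_SOME(2)[OF Y]
      by (auto intro!: sum.cong simp: trilinear_on_def linear_on_def V.scale_right_distrib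
          V.scale_left_commute subset_iff)
    then show "linear_on H sc (\<lambda>x. b x Y)" by (simp add: b_def V.tensor_eval_def)
  qed
  have \<beta>1: "bilinear_on H H sc (\<beta> x)" if "x \<in> C" for x using \<beta> that by (simp add: trilinear_on_def)
  have pure: "V.tensor_eval (pure_tensor H ?HH u (pure_tensor H H v z)) b = \<beta> u v z"
    if "u \<in> C" "v \<in> C" "z \<in> C" for u v z
    using that unfolding V.tensor_eval_pure[OF b that(1) pure_tensor_carrier[OF that(2,3)]]
    by (simp add: b_def V.tensor_eval_pure[OF \<beta>1])
  have F: "linear_on ?T sc (\<lambda>S. V.tensor_eval S b)" by (rule V.tensor_eval_linear[OF b])
  have lift: "V.tensor_eval (tensor_lift ?T f (comul H x)) b = sw H sc x (\<lambda>u v. V.tensor_eval (f u v) b)"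
    "tensor_lift ?T f (comul H x) \<in> carrier ?T"
    if "x \<in> C" "\<And>u v. u \<in> C \<Longrightarrow> v \<in> C \<Longrightarrow> f u v \<in> carrier ?T" for f x
    unfolding sw_def
    by (rule tensor_lift_linear[OF sc tensor_abelian_group F tensor_smult_closed],
        auto intro!: tensor_lift_closed[OF tensor_abelian_group tensor_smult_closed] that keys_comul)
  have "sw H sc h (\<lambda>x z. sw H sc x (\<lambda>u v. \<beta> u v z)) =
    V.tensor_eval (tensor_lift ?T (\<lambda>x z. tensor_lift ?T
      (\<lambda>u v. pure_tensor H ?HH u (pure_tensor H H v z)) (comul H x)) (comul H h)) b"
    by (subst lift(1), use h in \<open>auto intro!: lift(2) pure_tensor_carrier\<close>,
        intro sw_cong[OF h], subst lift(1))
      (auto intro!: pure_tensor_carrier sw_cong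
        simp: pure pure_tensor_carrier)
  also have "\<dots> = V.tensor_eval (tensor_lift ?T (\<lambda>x y. pure_tensor H ?HH x (comul H y)) (comul H h)) b"
    using hopf_algebra h by (simp add: hopf_algebra_def)
  also have "\<dots> = sw H sc h (\<lambda>u x. sw H sc x (\<lambda>v z. \<beta> u v z))"
    by (subst lift(1), use h in \<open>auto intro!: pure_tensor_carrier comul_closed\<close>, intro sw_cong[OF h])
      (simp add: V.tensor_eval_pure[OF b] comul_closed, simp add: b_def sw_def V.tensor_eval_def)
  finally show ?thesis .
qed

lemma
  assumes sc: "vector_space sc" and h: "h \<in> C" and F: "linear_on H sc F"
  shows sw_counit_left: "sw H sc h (\<lambda>x y. sc (counit H x) (F y)) = F h"
    and sw_counit_right: "sw H sc h (\<lambda>x y. sc (counit H y) (F x)) = F h"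
    and sw_antipode_left: "sw H sc h (\<lambda>x y. F (antipode H x \<otimes>\<^bsub>H\<^esub> y)) = sc (counit H h) (F \<one>\<^bsub>H\<^esub>)"
    and sw_antipode_right: "sw H sc h (\<lambda>x y. F (x \<otimes>\<^bsub>H\<^esub> antipode H y)) = sc (counit H h) (F \<one>\<^bsub>H\<^esub>)"
proof -
  have ag: "abelian_group H" by unfold_locales
  have lift: "F (tensor_lift H f (comul H h)) = sw H sc h (\<lambda>x y. F (f x y))"
    if "\<And>x y. x \<in> C \<Longrightarrow> y \<in> C \<Longrightarrow> f x y \<in> C" for f
    unfolding sw_def by (rule tensor_lift_linear[OF sc ag F]) (auto intro: that keys_comul[OF h])
  have F': "\<And>x c. x \<in> C \<Longrightarrow> F (c \<odot>\<^bsub>H\<^esub> x) = sc c (F x)" using F by (simp add: linear_on_def)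
  have "sw H sc h (\<lambda>x y. sc (counit H x) (F y)) = F (tensor_lift H (\<lambda>x y. counit H x \<odot>\<^bsub>H\<^esub> y) (comul H h))"
    by (subst lift) (auto intro!: sw_cong simp: h F')
  also have "\<dots> = F h" using hopf_algebra h by (simp add: hopf_algebra_def)
  finally show "sw H sc h (\<lambda>x y. sc (counit H x) (F y)) = F h" .
  have "sw H sc h (\<lambda>x y. sc (counit H y) (F x)) = F (tensor_lift H (\<lambda>x y. counit H y \<odot>\<^bsub>H\<^esub> x) (comul H h))"
    by (subst lift) (auto intro!: sw_cong simp: h F')
  also have "\<dots> = F h" using hopf_algebra h by (simp add: hopf_algebra_def)
  finally show "sw H sc h (\<lambda>x y. sc (counit H y) (F x)) = F h" .
  have "sw H sc h (\<lambda>x y. F (antipode H x \<otimes>\<^bsub>H\<^esub> y)) = F (tensor_lift H (\<lambda>x y. antipode H x \<otimes>\<^bsub>H\<^esub> y) (comul H h))"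
    by (subst lift) auto
  also have "\<dots> = sc (counit H h) (F \<one>\<^bsub>H\<^esub>)" using hopf_algebra h F' by (simp add: hopf_algebra_def)
  finally show "sw H sc h (\<lambda>x y. F (antipode H x \<otimes>\<^bsub>H\<^esub> y)) = sc (counit H h) (F \<one>\<^bsub>H\<^esub>)" .
  have "sw H sc h (\<lambda>x y. F (x \<otimes>\<^bsub>H\<^esub> antipode H y)) = F (tensor_lift H (\<lambda>x y. x \<otimes>\<^bsub>H\<^esub> antipode H y) (comul H h))"
    by (subst lift) auto
  also have "\<dots> = sc (counit H h) (F \<one>\<^bsub>H\<^esub>)" using hopf_algebra h F' by (simp add: hopf_algebra_def)
  finally show "sw H sc h (\<lambda>x y. F (x \<otimes>\<^bsub>H\<^esub> antipode H y)) = sc (counit H h) (F \<one>\<^bsub>H\<^esub>)" .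
qed

end

section \<open>Hopf actions on filtered quantizations\<close>

lemma bilinear_onI:
  assumes "\<And>x. x \<in> carrier V \<Longrightarrow> linear_on W sc (b x)" "\<And>y. y \<in> carrier W \<Longrightarrow> linear_on V sc (\<lambda>x. b x y)"
  shows "bilinear_on V W sc b"
  using assms by (simp add: bilinear_on_def)

lemma trilinear_onI:
  assumes "\<And>x y. x \<in> carrier H \<Longrightarrow> y \<in> carrier H \<Longrightarrow> linear_on H sc (\<beta> x y)"
    "\<And>x z. x \<in> carrier H \<Longrightarrow> z \<in> carrier H \<Longrightarrow> linear_on H sc (\<lambda>y. \<beta> x y z)"
    "\<And>y z. y \<in> carrier H \<Longrightarrow> z \<in> carrier H \<Longrightarrow> linear_on H sc (\<lambda>x. \<beta> x y z)"
  shows "trilinear_on H sc \<beta>"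
  using assms by (simp add: trilinear_on_def bilinear_on_def)

text \<open>\<open>E\<close> and \<open>cf\<close> express finite dimensionality by linear
  coordinate functions, so that a statement linear in h can be checked on \<open>E\<close>.\<close>

locale hopf_quantization = quantization s sc mul unit hb red + hopf H
  for s :: "'k::field \<Rightarrow> 'a::idom \<Rightarrow> 'a" and sc :: "'k \<Rightarrow> 'u::ab_group_add \<Rightarrow> 'u"
    and mul :: "'u \<Rightarrow> 'u \<Rightarrow> 'u" (infixl \<open>\<star>\<close> 70) and unit :: 'u
    and hb :: "'u \<Rightarrow> 'u" and red :: "'u \<Rightarrow> 'a"
    and H :: "('k, 'h, 'm) hopf_scheme" +
  fixes act :: "'h \<Rightarrow> 'u \<Rightarrow> 'u" and E :: "'h set" and cf :: "'h \<Rightarrow> 'h \<Rightarrow> 'k"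
  assumes act_add: "h \<in> C \<Longrightarrow> act h (a + b) = act h a + act h b"
    and act_hb: "h \<in> C \<Longrightarrow> act h (hb a) = hb (act h a)"
    and act_sc: "h \<in> C \<Longrightarrow> act h (sc c a) = sc c (act h a)"
    and act_linear: "linear_on H sc (\<lambda>h. act h a)"
    and act_one: "act \<one>\<^bsub>H\<^esub> a = a"
    and act_mult: "g \<in> C \<Longrightarrow> h \<in> C \<Longrightarrow> act (g \<otimes>\<^bsub>H\<^esub> h) a = act g (act h a)"
    and act_mul: "h \<in> C \<Longrightarrow> act h (a \<star> b) = sw H sc h (\<lambda>x y. act x a \<star> act y b)"
    and act_unit: "h \<in> C \<Longrightarrow> act h unit = sc (counit H h) unit"
    and E: "finite E" "E \<subseteq> C" and cf_linear: "e \<in> E \<Longrightarrow> linear_on H (*) (cf e)"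
    and cf_expand: "h \<in> C \<Longrightarrow> h = (\<Oplus>\<^bsub>H\<^esub>e\<in>E. cf e h \<odot>\<^bsub>H\<^esub> e)"
begin

abbreviation S :: "'h \<Rightarrow> 'h" where "S \<equiv> antipode H"
abbreviation "SW \<equiv> sw H sc"
abbreviation "lin \<equiv> linear_on H sc"

lemma act_zero [simp]: "h \<in> C \<Longrightarrow> act h 0 = 0"
  using act_add[of h 0 0] by simp

lemma act_minus: "h \<in> C \<Longrightarrow> act h (- a) = - act h a"
  using act_add[of h a "- a"] by (simp add: eq_neg_iff_add_eq_0 add.commute)

lemma act_diff: "h \<in> C \<Longrightarrow> act h (a - b) = act h a - act h b"
  using act_add[of h a "- b"] by (simp add: act_minus)

lemma act_sum: "h \<in> C \<Longrightarrow> act h (sum f I) = (\<Sum>i\<in>I. act h (f i))"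
  by (induction I rule: infinite_finite_induct) (auto simp: act_add)

lemma act_hbn: "h \<in> C \<Longrightarrow> act h (hbn n a) = hbn n (act h a)"
  by (induction n) (auto simp: hbn_Suc act_hb)

lemma act_dv: "h \<in> C \<Longrightarrow> a \<in> dv n \<Longrightarrow> act h a \<in> dv n"
  by (metis act_hbn dvE dvI)

lemma act_sw: "g \<in> C \<Longrightarrow> h \<in> C \<Longrightarrow> act g (SW h b) = SW h (\<lambda>x y. act g (b x y))"
  by (rule sw_map) (auto simp: act_add act_sc)

lemma mul_sw: "h \<in> C \<Longrightarrow> a \<star> SW h b = SW h (\<lambda>x y. a \<star> b x y)" "h \<in> C \<Longrightarrow> SW h b \<star> a = SW h (\<lambda>x y. b x y \<star> a)"
  by (rule sw_map; simp add: mul_add_left mul_add_right sc_mul_left sc_mul_right)+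

lemma sw_dv: "h \<in> C \<Longrightarrow> (\<And>x y. x \<in> C \<Longrightarrow> y \<in> C \<Longrightarrow> b x y \<in> dv n) \<Longrightarrow> SW h b \<in> dv n"
  unfolding sw_def pm_sum_def using keys_comul by (intro dv_sum dv_sc) auto

lemma sw_sum: "SW h (\<lambda>x y. \<Sum>j\<in>J. b j x y) = (\<Sum>j\<in>J. SW h (b j))"
  unfolding sw_def pm_sum_def U.scale_sum_right by (rule sum.swap)

lemma sw_diff: "SW h (\<lambda>x y. b x y - c x y) = SW h b - SW h c"
  unfolding sw_def pm_sum_def U.scale_right_diff_distrib by (rule sum_subtractf)

lemma lin_intros:
  "lin (\<lambda>h. act h a)"
  "lin (\<lambda>h. act (S h) a)"
  "g \<in> C \<Longrightarrow> lin F \<Longrightarrow> lin (\<lambda>h. act g (F h))"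
  "lin F \<Longrightarrow> lin (\<lambda>h. F h \<star> y)"
  "lin F \<Longrightarrow> lin (\<lambda>h. y \<star> F h)"
  "lin F \<Longrightarrow> lin (\<lambda>h. sc c (F h))"
  "lin (\<lambda>h. sc (counit H h) y)"
  "lin F \<Longrightarrow> lin G \<Longrightarrow> lin (\<lambda>h. F h - G h)"
  using act_linear[of a] linear_on_counit
  by (auto simp: linear_on_def antipode_add antipode_smult mul_add_left mul_add_right sc_mul_left sc_mul_right
      act_add act_sc U.scale_right_distrib U.scale_left_commute U.scale_left_distrib
      U.scale_right_diff_distrib)

lemmas lin_sw = linear_on_sw[OF sc_space]
lemmas lin_sw_param = linear_on_sw_param[OF sc_space]
lemmas coassoc = sw_coassoc[OF sc_space]
lemmas counit_left = sw_counit_left[OF sc_space] and counit_right = sw_counit_right[OF sc_space]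

lemmas lin_rules = lin_intros lin_sw lin_sw_param bilinear_onI trilinear_onI

lemma antipode_cancel_left:
  assumes "h \<in> C" "lin F" shows "SW h (\<lambda>x y. F (S x \<otimes>\<^bsub>H\<^esub> y)) = sc (counit H h) (F \<one>\<^bsub>H\<^esub>)"
  using sw_antipode_left[OF sc_space assms] .

lemma antipode_cancel_right:
  assumes "h \<in> C" "lin F" shows "SW h (\<lambda>x y. F (x \<otimes>\<^bsub>H\<^esub> S y)) = sc (counit H h) (F \<one>\<^bsub>H\<^esub>)"
  using sw_antipode_right[OF sc_space assms] .

text \<open>Uniqueness of convolution inverses, carried out on values. The right-hand side
  \<open>G\<close> satisfies h1 (G h2) = \<epsilon>(h) ab, whence S(h) (ab) = S(h1) (h2 (G h3)) = G
  h.\<close>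

lemma act_antipode_mul:
  assumes h: "h \<in> C"
  shows "act (S h) (a \<star> b) = SW h (\<lambda>x y. act (S y) a \<star> act (S x) b)"
proof -
  define G where "G = (\<lambda>r. SW r (\<lambda>x y. act (S y) a \<star> act (S x) b))"
  have G: "lin G" unfolding G_def by (auto intro!: lin_rules)
  have Z: "SW r (\<lambda>x y. act x (G y)) = sc (counit H r) (a \<star> b)" if r: "r \<in> C" for r
  proof -
    have "SW r (\<lambda>x y. act x (G y)) =
        SW r (\<lambda>x y. SW x (\<lambda>p q. SW y (\<lambda>u v. act p (act (S v) a) \<star> act q (act (S u) b))))"
    proof (rule sw_cong[OF r])
      fix x y assume "x \<in> C" "y \<in> C"
      have "act x (G y) = SW y (\<lambda>u v. SW x (\<lambda>p q. act p (act (S v) a) \<star> act q (act (S u) b)))"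
        unfolding G_def act_sw[OF \<open>x \<in> C\<close> \<open>y \<in> C\<close>] act_mul[OF \<open>x \<in> C\<close>] ..
      also have "\<dots> = SW x (\<lambda>p q. SW y (\<lambda>u v. act p (act (S v) a) \<star> act q (act (S u) b)))"
        unfolding sw_def pm_sum_def U.scale_sum_right
        by (subst sum.swap) (simp add: mult.commute)
      finally show "act x (G y) = \<dots>" .
    qed
    also have "\<dots> = SW r (\<lambda>p y. SW y (\<lambda>q t. SW t (\<lambda>u v. act p (act (S v) a) \<star> act q (act (S u) b))))"
      by (rule coassoc[OF r]) (auto intro!: lin_rules)
    also have "\<dots> = SW r (\<lambda>p y. act p (act (S y) a) \<star> b)"
    proof (rule sw_cong[OF r])
      fix p y assume p: "p \<in> C" and y: "y \<in> C"
      have "SW y (\<lambda>q t. SW t (\<lambda>u v. act p (act (S v) a) \<star> act q (act (S u) b))) =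
          SW y (\<lambda>z v. SW z (\<lambda>q u. act p (act (S v) a) \<star> act q (act (S u) b)))"
        by (rule coassoc[OF y, symmetric]) (use p in \<open>auto intro!: lin_rules\<close>)
      also have "\<dots> = SW y (\<lambda>z v. sc (counit H z) (act p (act (S v) a) \<star> b))"
      proof (rule sw_cong[OF y])
        fix z v assume z: "z \<in> C" and v: "v \<in> C"
        have "SW z (\<lambda>q u. act p (act (S v) a) \<star> act q (act (S u) b)) =
            SW z (\<lambda>q u. (\<lambda>w. act p (act (S v) a) \<star> act w b) (q \<otimes>\<^bsub>H\<^esub> S u))"
          by (rule sw_cong[OF z]) (simp add: act_mult)
        also have "\<dots> = sc (counit H z) (act p (act (S v) a) \<star> b)"
          by (subst antipode_cancel_right[OF z]) (auto intro!: lin_rules simp: act_one)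
        finally show "SW z (\<lambda>q u. act p (act (S v) a) \<star> act q (act (S u) b)) = \<dots>" .
      qed
      also have "\<dots> = act p (act (S y) a) \<star> b"
        by (rule counit_left[OF y]) (use p in \<open>auto intro!: lin_rules\<close>)
      finally show "SW y (\<lambda>q t. SW t (\<lambda>u v. act p (act (S v) a) \<star> act q (act (S u) b))) = \<dots>" .
    qed
    also have "\<dots> = SW r (\<lambda>p y. (\<lambda>w. act w a \<star> b) (p \<otimes>\<^bsub>H\<^esub> S y))"
      by (rule sw_cong[OF r]) (simp add: act_mult)
    also have "\<dots> = sc (counit H r) (a \<star> b)"
      by (subst antipode_cancel_right[OF r]) (auto intro!: lin_rules simp: act_one)
    finally show ?thesis .
  qed
  have "act (S h) (a \<star> b) = SW h (\<lambda>x y. sc (counit H y) (act (S x) (a \<star> b)))"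
    by (rule counit_right[OF h, symmetric]) (rule lin_intros)
  also have "\<dots> = SW h (\<lambda>x r. SW r (\<lambda>u v. act (S x) (act u (G v))))"
    by (rule sw_cong[OF h]) (simp add: act_sc Z flip: act_sw)
  also have "\<dots> = SW h (\<lambda>y v. SW y (\<lambda>x u. act (S x) (act u (G v))))"
    by (rule coassoc[OF h, symmetric]) (auto intro!: lin_rules G)
  also have "\<dots> = SW h (\<lambda>y v. sc (counit H y) (G v))"
  proof (rule sw_cong[OF h])
    fix y v assume y: "y \<in> C"
    have "SW y (\<lambda>x u. act (S x) (act u (G v))) = SW y (\<lambda>x u. (\<lambda>w. act w (G v)) (S x \<otimes>\<^bsub>H\<^esub> u))"
      by (rule sw_cong[OF y]) (simp add: act_mult)
    also have "\<dots> = sc (counit H y) (G v)"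
      by (subst antipode_cancel_left[OF y]) (auto intro!: lin_rules simp: act_one)
    finally show "SW y (\<lambda>x u. act (S x) (act u (G v))) = \<dots>" .
  qed
  also have "\<dots> = G h" by (rule counit_left[OF h G])
  finally show ?thesis by (simp add: G_def)
qed

text \<open>Left multiplication by \<open>\<rho>(Y)\<close>, for the coaction \<open>\<rho>\<close> dual to the action, is injective modulo \<open>\<hbar>\<^sup>n\<close>.\<close>

lemma coaction_cancel:
  assumes Y: "red Y \<noteq> 0" and \<xi>: "lin \<xi>"
    and dv: "\<And>h. h \<in> C \<Longrightarrow> SW h (\<lambda>x y. act x Y \<star> \<xi> y) \<in> dv n" and h: "h \<in> C"
  shows "\<xi> h \<in> dv n"
proof -
  define P where "P = (\<lambda>h. SW h (\<lambda>x y. act x Y \<star> \<xi> y))"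
  \<comment> \<open>Applying S(h1) to h2(Y) \<xi>(h3) leaves Y Z(h), from which Y can be cancelled.
    Conversely \<xi>(h) = h1 Z(h2), so divisibility of Z passes to \<xi>.\<close>
  define Z where "Z = (\<lambda>h. SW h (\<lambda>x y. act (S x) (\<xi> y)))"
  have Zdv: "Z h \<in> dv n" if h: "h \<in> C" for h
  proof -
    have "SW h (\<lambda>x y. act (S x) (P y)) =
        SW h (\<lambda>x y. SW y (\<lambda>u v. SW x (\<lambda>p q. act (S q) (act u Y) \<star> act (S p) (\<xi> v))))"
      by (rule sw_cong[OF h]) (auto simp: P_def act_sw act_antipode_mul intro!: sw_cong)
    also have "\<dots> = SW h (\<lambda>w v. SW w (\<lambda>x u. SW x (\<lambda>p q. act (S q) (act u Y) \<star> act (S p) (\<xi> v))))"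
      by (rule coassoc[OF h, symmetric]) (auto intro!: lin_rules \<xi>)
    also have "\<dots> = SW h (\<lambda>w v. Y \<star> act (S w) (\<xi> v))"
    proof (rule sw_cong[OF h])
      fix w v assume w: "w \<in> C" and v: "v \<in> C"
      have "SW w (\<lambda>x u. SW x (\<lambda>p q. act (S q) (act u Y) \<star> act (S p) (\<xi> v))) =
          SW w (\<lambda>p t. SW t (\<lambda>q u. act (S q) (act u Y) \<star> act (S p) (\<xi> v)))"
        by (rule coassoc[OF w]) (auto intro!: lin_rules)
      also have "\<dots> = SW w (\<lambda>p t. sc (counit H t) (Y \<star> act (S p) (\<xi> v)))"
      proof (rule sw_cong[OF w])
        fix p t assume p: "p \<in> C" and t: "t \<in> C"
        have "SW t (\<lambda>q u. act (S q) (act u Y) \<star> act (S p) (\<xi> v)) =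
            SW t (\<lambda>q u. (\<lambda>z. act z Y \<star> act (S p) (\<xi> v)) (S q \<otimes>\<^bsub>H\<^esub> u))"
          by (rule sw_cong[OF t]) (simp add: act_mult)
        also have "\<dots> = sc (counit H t) (Y \<star> act (S p) (\<xi> v))"
          by (subst antipode_cancel_left[OF t]) (auto intro!: lin_rules simp: act_one)
        finally show "SW t (\<lambda>q u. act (S q) (act u Y) \<star> act (S p) (\<xi> v)) = \<dots>" .
      qed
      also have "\<dots> = Y \<star> act (S w) (\<xi> v)"
        by (rule counit_right[OF w]) (auto intro!: lin_rules)
      finally show "SW w (\<lambda>x u. SW x (\<lambda>p q. act (S q) (act u Y) \<star> act (S p) (\<xi> v))) = \<dots>" .
    qed
    also have "\<dots> = Y \<star> Z h" unfolding Z_def mul_sw(1)[OF h] ..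
    finally have "Y \<star> Z h = SW h (\<lambda>x y. act (S x) (P y))" by simp
    moreover have "\<dots> \<in> dv n" using dv by (intro sw_dv h act_dv) (auto simp: P_def)
    ultimately show ?thesis using dv_cancel_left[OF Y] by simp
  qed
  have "\<xi> h = SW h (\<lambda>w v. sc (counit H w) (\<xi> v))" by (rule counit_left[OF h \<xi>, symmetric])
  also have "\<dots> = SW h (\<lambda>w v. SW w (\<lambda>x u. act x (act (S u) (\<xi> v))))"
  proof (rule sw_cong[OF h])
    fix w v assume w: "w \<in> C"
    have "SW w (\<lambda>x u. act x (act (S u) (\<xi> v))) = SW w (\<lambda>x u. (\<lambda>z. act z (\<xi> v)) (x \<otimes>\<^bsub>H\<^esub> S u))"
      by (rule sw_cong[OF w]) (simp add: act_mult)
    also have "\<dots> = sc (counit H w) (\<xi> v)"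
      by (subst antipode_cancel_right[OF w]) (auto intro!: lin_rules simp: act_one)
    finally show "sc (counit H w) (\<xi> v) = SW w (\<lambda>x u. act x (act (S u) (\<xi> v)))" by simp
  qed
  also have "\<dots> = SW h (\<lambda>x y. SW y (\<lambda>u v. act x (act (S u) (\<xi> v))))"
    by (rule coassoc[OF h]) (auto intro!: lin_rules \<xi>)
  also have "\<dots> = SW h (\<lambda>x y. act x (Z y))"
    by (rule sw_cong[OF h]) (simp add: Z_def act_sw)
  also have "\<dots> \<in> dv n" by (intro sw_dv h act_dv Zdv)
  finally show ?thesis .
qed

text \<open>Because (u a)(h b) = u1 (a (S(u2) h) b), the transformed relation follows from the given
  ones at the elements S(u2) h. This is why a relation is required for all h at once.\<close>

lemma relations_stable:
  assumes rel: "\<And>h. h \<in> C \<Longrightarrow> (\<Sum>j\<in>J. x j \<star> act h (d j)) \<in> dv n" and u: "u \<in> C" and h: "h \<in> C"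
  shows "(\<Sum>j\<in>J. act u (x j) \<star> act h (d j)) \<in> dv n"
proof -
  have "act u a \<star> act h b = SW u (\<lambda>v w. act v (a \<star> act (S w \<otimes>\<^bsub>H\<^esub> h) b))" for a b
  proof -
    have "SW u (\<lambda>v w. act v (a \<star> act (S w \<otimes>\<^bsub>H\<^esub> h) b)) =
        SW u (\<lambda>v w. SW v (\<lambda>p q. act p a \<star> act q (act (S w) (act h b))))"
      by (rule sw_cong[OF u]) (simp add: act_mul act_mult h)
    also have "\<dots> = SW u (\<lambda>p y. SW y (\<lambda>q w. act p a \<star> act q (act (S w) (act h b))))"
      by (rule coassoc[OF u]) (auto intro!: lin_rules)
    also have "\<dots> = SW u (\<lambda>p y. sc (counit H y) (act p a \<star> act h b))"
    proof (rule sw_cong[OF u])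
      fix p y assume p: "p \<in> C" and y: "y \<in> C"
      have "SW y (\<lambda>q w. act p a \<star> act q (act (S w) (act h b))) =
          SW y (\<lambda>q w. (\<lambda>z. act p a \<star> act z (act h b)) (q \<otimes>\<^bsub>H\<^esub> S w))"
        by (rule sw_cong[OF y]) (simp add: act_mult)
      also have "\<dots> = sc (counit H y) (act p a \<star> act h b)"
        by (subst antipode_cancel_right[OF y]) (auto intro!: lin_rules simp: act_one)
      finally show "SW y (\<lambda>q w. act p a \<star> act q (act (S w) (act h b))) = \<dots>" .
    qed
    also have "\<dots> = act u a \<star> act h b"
      by (rule counit_right[OF u]) (auto intro!: lin_rules)
    finally show ?thesis by simp
  qed
  then have "(\<Sum>j\<in>J. act u (x j) \<star> act h (d j)) =
      SW u (\<lambda>v w. \<Sum>j\<in>J. act v (x j \<star> act (S w \<otimes>\<^bsub>H\<^esub> h) (d j)))"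
    by (simp add: sw_sum)
  also have "\<dots> = SW u (\<lambda>v w. act v (\<Sum>j\<in>J. x j \<star> act (S w \<otimes>\<^bsub>H\<^esub> h) (d j)))"
    by (rule sw_cong[OF u]) (simp add: act_sum)
  also have "\<dots> \<in> dv n" using h by (intro sw_dv u act_dv rel) auto
  finally show ?thesis .
qed

lemma expand:
  assumes "vector_space sc'" "linear_on H sc' F" "h \<in> C"
  shows "F h = (\<Sum>e\<in>E. sc' (cf e h) (F e))"
proof -
  have "abelian_group H" by unfold_locales
  then have "F h = (\<Sum>e\<in>E. F (cf e h \<odot>\<^bsub>H\<^esub> e))"
    using E cf_expand[OF assms(3)] finsum_linear[OF _ assms(2) _ assms(1), of "\<lambda>e. cf e h \<odot>\<^bsub>H\<^esub> e" E]
    by (auto simp: subset_iff)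
  then show ?thesis using assms(2) E by (auto simp: linear_on_def subset_iff)
qed

lemma lin_expand:
  assumes "\<And>e. e \<in> E \<Longrightarrow> linear_on H (*) (cf e)"
  shows "lin (\<lambda>h. \<Sum>e\<in>E. sc (cf e h) (b e))"
  using assms by (auto simp: linear_on_def U.scale_left_distrib sum.distrib U.scale_sum_right)

text \<open>\<open>Y\<^sup>-\<^sup>1 W = W' Y'\<^sup>-\<^sup>1\<close> is an \<open>H\<close>-invariant fraction modulo \<open>\<hbar>\<^sup>n\<close>.\<close>

definition inv_fraction :: "nat \<Rightarrow> 'u \<Rightarrow> 'u \<Rightarrow> 'u \<Rightarrow> 'u \<Rightarrow> bool" where
  "inv_fraction n Y W Y' W' \<longleftrightarrow> red Y \<noteq> 0 \<and> red Y' \<noteq> 0 \<and> Y \<star> W' - W \<star> Y' \<in> dv n \<and>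
     (\<forall>u\<in>C. act u W \<star> Y' - act u Y \<star> W' \<in> dv n) \<and> (\<forall>u\<in>C. Y \<star> act u W' - W \<star> act u Y' \<in> dv n)"

text \<open>The coaction \<rho> is multiplicative, so \<rho>(Y) \<rho>(W') = \<rho>(W) \<rho>(Y') up
  to the given precision. Inserting the invariance of Y^-1 W and cancelling \<rho>(Y) on the left
  gives the invariance of W' Y'^-1.\<close>

lemma inv_fractionI:
  assumes Y: "red Y \<noteq> 0" "red Y' \<noteq> 0" and YW: "Y \<star> W' - W \<star> Y' \<in> dv n"
    and right: "\<And>u. u \<in> C \<Longrightarrow> act u W \<star> Y' - act u Y \<star> W' \<in> dv n"
  shows "inv_fraction n Y W Y' W'"
proof -
  have "Y \<star> act u W' - W \<star> act u Y' \<in> dv n" if u: "u \<in> C" for u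
  proof -
    \<comment> \<open>The values \<open>b e\<close> play the role of Y'^-1 e(Y') t, with one right
      denominator t for all e in \<open>E\<close>; \<open>B\<close> extends them linearly to
      H.\<close>
    obtain t b where t: "red t \<noteq> 0" and b: "\<And>e. e \<in> E \<Longrightarrow> act e Y' \<star> t - Y' \<star> b e \<in> dv n"
      using ore_right_family[OF Y(2) E(1), of "\<lambda>e. act e Y'" n] by blast
    define B where "B = (\<lambda>h. \<Sum>e\<in>E. sc (cf e h) (b e))"
    have B: "lin B" unfolding B_def by (rule lin_expand) (rule cf_linear)
    have tB: "act h Y' \<star> t - Y' \<star> B h \<in> dv n" if "h \<in> C" for h
    proof -
      have "lin (\<lambda>h. act h Y' \<star> t)" by (auto intro!: lin_rules)
      from expand[OF sc_space this that]
      have "act h Y' \<star> t - Y' \<star> B h = (\<Sum>e\<in>E. sc (cf e h) (act e Y' \<star> t - Y' \<star> b e))"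
        by (simp add: B_def mul_sum sc_mul_right U.scale_right_diff_distrib sum_subtractf)
      also have "\<dots> \<in> dv n" using b by (intro dv_sum dv_sc)
      finally show ?thesis .
    qed
    \<comment> \<open>The vanishing of \<xi> modulo \<hbar>^n is the equation h(W') = W' Y'^-1
      h(Y'), multiplied by t on the right.\<close>
    define \<xi> where "\<xi> = (\<lambda>h. act h W' \<star> t - W' \<star> B h)"
    have \<xi>: "lin \<xi>" unfolding \<xi>_def by (auto intro!: lin_rules B)
    have "SW h (\<lambda>x y. act x Y \<star> \<xi> y) \<in> dv n" if h: "h \<in> C" for h
    proof -
      have "SW h (\<lambda>x y. act x Y \<star> \<xi> y) = act h (Y \<star> W' - W \<star> Y') \<star> t
          + SW h (\<lambda>x y. act x W \<star> (act y Y' \<star> t - Y' \<star> B y) + (act x W \<star> Y' - act x Y \<star> W') \<star> B y)"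
        unfolding act_diff[OF h] mul_diff(1) act_mul[OF h] mul_sw(2)[OF h] \<xi>_def
        by (simp add: mul_diff mul_assoc sw_diff sw_def pm_sum_def U.scale_right_diff_distrib
            U.scale_right_distrib sum_subtractf sum.distrib)
      also have "\<dots> \<in> dv n" using YW right tB
        by (intro dv_add[OF dv_mul(1)[OF act_dv[OF h]] sw_dv[OF h]])
          (auto intro!: dv_add dv_mul(2)[OF tB] dv_mul(1)[OF right])
      finally show ?thesis .
    qed
    then have Xu: "\<xi> u \<in> dv n" using u by (rule coaction_cancel[OF Y(1) \<xi>])
    have "(Y \<star> act u W' - W \<star> act u Y') \<star> t =
        Y \<star> \<xi> u + (Y \<star> W' - W \<star> Y') \<star> B u - W \<star> (act u Y' \<star> t - Y' \<star> B u)"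
      by (simp add: \<xi>_def mul_diff mul_assoc)
    also have "\<dots> \<in> dv n" 
      by (rule dv_diff[OF dv_add[OF dv_mul(2)[OF Xu] dv_mul(1)[OF YW]] dv_mul(2)[OF tB[OF u]]])
    finally show ?thesis by (rule dv_cancel_right[OF t])
  qed
  then show ?thesis using assms by (simp add: inv_fraction_def)
qed

end

section \<open>Invariant fractions\<close>

context quantization
begin

text \<open>Dividing a family by its largest common power of \<hbar> below n makes it nontrivial
  modulo \<hbar> again.\<close>

lemma common_hbar_power:
  assumes "finite J" "\<not> (\<forall>j\<in>J. y j \<in> dv n)"
  shows "\<exists>l z. l < n \<and> (\<forall>j\<in>J. y j = hbn l (z j)) \<and> (\<exists>j\<in>J. red (z j) \<noteq> 0)"
proof -
  define L where "L = {l. l \<le> n \<and> (\<forall>j\<in>J. y j \<in> dv l)}"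
  define l where "l = Max L"
  have L: "finite L" "0 \<in> L" by (auto simp: L_def)
  then have lL: "l \<in> L" unfolding l_def by (intro Max_in) auto
  then have "l \<noteq> n" using assms(2) by (auto simp: L_def)
  then have ln: "Suc l \<le> n" using lL by (auto simp: L_def)
  have "Suc l \<notin> L" using Max_ge[OF L(1), of "Suc l"] by (auto simp: l_def)
  then obtain j0 where j0: "j0 \<in> J" "y j0 \<notin> dv (Suc l)" using ln by (auto simp: L_def)
  have "\<forall>j\<in>J. \<exists>q. y j = hbn l q" using lL by (auto simp: L_def elim: dvE)
  then obtain z where z: "\<And>j. j \<in> J \<Longrightarrow> y j = hbn l (z j)" by metis
  have "red (z j0) \<noteq> 0" using hbn_dv[of "z j0" "Suc 0" l] j0 z by (auto simp: dv_1)
  then show ?thesis using z j0 ln by (intro exI[of _ l] exI[of _ z]) auto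
qed

definition pw :: "'u \<Rightarrow> nat \<Rightarrow> 'u" where "pw a n = ((\<star>) a ^^ n) unit"

lemma pw_simps: "pw a 0 = unit" "pw a (Suc n) = a \<star> pw a n"
  by (simp_all add: pw_def)

lemma red_pw: "red (pw a n) = red a ^ n"
  by (induction n) (auto simp: pw_simps red_unit red_mul)

lemma pw_add: "pw a (m + n) = pw a m \<star> pw a n"
  by (induction m) (auto simp: pw_simps unit_left mul_assoc)

end

section \<open>Relations between coactions, and algebraicity over invariant fractions\<close>

context hopf_quantization
begin

definition coaction_relation :: "(nat \<Rightarrow> 'u) \<Rightarrow> nat \<Rightarrow> nat set \<Rightarrow> (nat \<Rightarrow> 'u) \<Rightarrow> bool" where
  "coaction_relation d n J x \<longleftrightarrow> (\<exists>j\<in>J. red (x j) \<noteq> 0) \<and> (\<forall>h\<in>C. (\<Sum>j\<in>J. x j \<star> act h (d j)) \<in> dv n)"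

text \<open>By linearity in h only the equations at \<open>E\<close> matter, and
  \<open>{..card E}\<close> has one more element than there are such equations.\<close>

lemma coaction_relation_exists:
  "\<exists>x. coaction_relation d n {..card E} x"
proof -
  have "card E < card {..card E}" by simp
  then obtain x where x: "\<exists>j\<in>{..card E}. red (x j) \<noteq> 0"
      "\<forall>e\<in>E. (\<Sum>j\<in>{..card E}. x j \<star> act e (d j)) \<in> dv n"
    using unimodular_relation[OF E(1) finite_atMost, of "card E" "\<lambda>j e. act e (d j)" n] by metis
  have "(\<Sum>j\<in>{..card E}. x j \<star> act h (d j)) \<in> dv n" if h: "h \<in> C" for h
  proof -
    have "lin (\<lambda>h. \<Sum>j\<in>{..card E}. x j \<star> act h (d j))"
      using act_linear by (simp add: linear_on_def mul_add_right sum.distrib sc_mul_right U.scale_sum_right)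
    from expand[OF sc_space this h] show ?thesis
      by (simp only:) (intro dv_sum dv_sc bspec[OF x(2)])
  qed
  then show ?thesis using x(1) by (auto simp: coaction_relation_def)
qed

lemma coaction_relation_mono:
  "coaction_relation d n J x \<Longrightarrow> m \<le> n \<Longrightarrow> coaction_relation d m J x"
  unfolding coaction_relation_def using dv_mono by blast

text \<open>Artin's argument: by minimality of the support \<open>J\<close>, the coefficients of a normalized relation are invariant.\<close>

lemma invariant_relation:
  "\<exists>J x j0. finite J \<and> j0 \<in> J \<and> red (x j0) \<noteq> 0 \<and> (\<Sum>j\<in>J. red (x j) * red a ^ j) = 0 \<and>
     (\<forall>j\<in>J. \<exists>Y' W'. inv_fraction M (x j0) (x j) Y' W')"
proof -
  define d where "d = pw a"
  \<comment> \<open>Relations are demanded at every precision, so each proper subset of a minimal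
    \<open>J\<close> with one index removed fails from some precision on.\<close>
  define good where "good = (\<lambda>J. finite J \<and> (\<forall>n. \<exists>x. coaction_relation d n J x))"
  have "good {..card E}" using coaction_relation_exists by (auto simp: good_def)
  then obtain J where J: "good J" "\<And>J'. good J' \<Longrightarrow> card J \<le> card J'"
    using ex_has_least_nat[of good "{..card E}" card] by blast
  have fin: "finite J" using J(1) by (simp add: good_def)
  have "\<exists>n. \<forall>x. \<not> coaction_relation d n (J - {j}) x" if "j \<in> J" for j
  proof -
    have "card (J - {j}) < card J" using that fin by (intro psubset_card_mono) auto
    then have "\<not> good (J - {j})" using J(2)[of "J - {j}"] by auto
    then show ?thesis using fin by (auto simp: good_def)
  qed
  then obtain N where N: "\<And>j x. j \<in> J \<Longrightarrow> \<not> coaction_relation d (N j) (J - {j}) x" by metis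
  \<comment> \<open>The sum dominates every \<open>N j\<close>, so at precision \<open>n0\<close> no
    J - {j} supports a relation.\<close>
  define n0 where "n0 = sum N J"
  have n0: "\<not> coaction_relation d n0 (J - {j}) x" if "j \<in> J" for j x
    using N[OF that] coaction_relation_mono[of d n0 "J - {j}" x "N j"] member_le_sum[of j J N] that fin
    by (auto simp: n0_def)
  \<comment> \<open>The margin \<open>Suc M\<close> pays for a later division by \<hbar>^l with l
    \<le> M.\<close>
  define n where "n = n0 + Suc M"
  obtain x where x: "coaction_relation d n J x" using J(1) by (auto simp: good_def)
  then obtain j0 where j0: "j0 \<in> J" "red (x j0) \<noteq> 0" by (auto simp: coaction_relation_def)
  have rel: "\<And>h. h \<in> C \<Longrightarrow> (\<Sum>j\<in>J. x j \<star> act h (d j)) \<in> dv n" using x by (simp add: coaction_relation_def)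
  have key: "\<exists>c c'. red c \<noteq> 0 \<and> (\<forall>j\<in>J. c \<star> act u (x j) - c' \<star> x j \<in> dv M)" if u: "u \<in> C" for u
  proof -
    obtain c c' where c: "red c \<noteq> 0" "c \<star> act u (x j0) - c' \<star> x j0 \<in> dv n"
      using ore_left[OF j0(2)] by blast
    \<comment> \<open>Comparing the relation with its transform under u kills the coefficient at
      \<open>j0\<close> modulo \<hbar>^n. If the others were not all divisible by \<hbar>^(M+1),
      dividing by their common power of \<hbar> would give a relation on J - {j0} at precision
      \<open>n0\<close>.\<close>
    define y where "y = (\<lambda>j. c \<star> act u (x j) - c' \<star> x j)"
    have "\<forall>j\<in>J - {j0}. y j \<in> dv (Suc M)"
    proof (rule ccontr)
      assume "\<not> ?thesis"
      then obtain l z where z: "l < Suc M" "\<And>j. j \<in> J - {j0} \<Longrightarrow> y j = hbn l (z j)" "\<exists>j\<in>J - {j0}. red (z j) \<noteq> 0"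
        using common_hbar_power[of "J - {j0}" y "Suc M"] fin by blast
      have "(\<Sum>j\<in>J - {j0}. z j \<star> act h (d j)) \<in> dv n0" if h: "h \<in> C" for h
      proof -
        have "(\<Sum>j\<in>J. y j \<star> act h (d j)) = c \<star> (\<Sum>j\<in>J. act u (x j) \<star> act h (d j)) - c' \<star> (\<Sum>j\<in>J. x j \<star> act h (d j))"
          by (simp add: y_def mul_diff mul_assoc mul_sum sum_subtractf)
        also have "\<dots> \<in> dv n" 
          by (rule dv_diff[OF dv_mul(2)[OF relations_stable[OF rel u h]] dv_mul(2)[OF rel[OF h]]])
        finally have "(\<Sum>j\<in>J. y j \<star> act h (d j)) - y j0 \<star> act h (d j0) \<in> dv n"
          using c(2) by (intro dv_diff dv_mul(1)) (simp_all add: y_def)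
        also have "(\<Sum>j\<in>J. y j \<star> act h (d j)) - y j0 \<star> act h (d j0) = (\<Sum>j\<in>J - {j0}. y j \<star> act h (d j))"
          using fin j0(1) by (simp add: sum.remove)
        also have "\<dots> = hbn l (\<Sum>j\<in>J - {j0}. z j \<star> act h (d j))"
          unfolding hbn_sum by (rule sum.cong) (simp_all add: z(2) hbn_mul)
        finally have "hbn l (\<Sum>j\<in>J - {j0}. z j \<star> act h (d j)) \<in> dv (l + (n - l))"
          using z(1) by (simp add: n_def)
        then have "(\<Sum>j\<in>J - {j0}. z j \<star> act h (d j)) \<in> dv (n - l)" by (rule hbn_in_dvD)
        then show ?thesis by (rule dv_mono) (use z(1) in \<open>simp add: n_def\<close>)
      qed
      then have "coaction_relation d n0 (J - {j0}) z" using z(3) by (simp add: coaction_relation_def)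
      then show False using n0[OF j0(1)] by blast
    qed
    then have "\<forall>j\<in>J. y j \<in> dv M"
      using c(2) dv_mono[of "y j0" n M] dv_mono[of _ "Suc M" M] by (auto simp: y_def n_def)
    then show ?thesis using c(1) by (auto simp: y_def)
  qed
  have "\<exists>Y' W'. inv_fraction M (x j0) (x j) Y' W'" if j: "j \<in> J" for j
  proof -
    obtain Y' W' where YW: "red Y' \<noteq> 0" "x j \<star> Y' - x j0 \<star> W' \<in> dv M"
      using ore_right[OF j0(2)] by blast
    have "inv_fraction M (x j0) (x j) Y' W'"
    proof (rule inv_fractionI[OF j0(2) YW(1)])
      show "x j0 \<star> W' - x j \<star> Y' \<in> dv M" using dv_minus[OF YW(2)] by simp
      fix u assume "u \<in> C"
      then obtain c c' where c: "red c \<noteq> 0" "\<forall>j\<in>J. c \<star> act u (x j) - c' \<star> x j \<in> dv M" using key by blast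
      have "c \<star> (act u (x j) \<star> Y' - act u (x j0) \<star> W') = (c \<star> act u (x j) - c' \<star> x j) \<star> Y'
          + c' \<star> (x j \<star> Y' - x j0 \<star> W') - (c \<star> act u (x j0) - c' \<star> x j0) \<star> W'"
        by (simp add: mul_diff mul_assoc)
      also have "\<dots> \<in> dv M" 
          by (rule dv_diff[OF dv_add[OF dv_mul(1) dv_mul(2)[OF YW(2)]] dv_mul(1)]) (use c(2) j j0(1) in auto)
      finally show "act u (x j) \<star> Y' - act u (x j0) \<star> W' \<in> dv M" by (rule dv_cancel_left[OF c(1)])
    qed
    then show ?thesis by blast
  qed
  moreover have "(\<Sum>j\<in>J. red (x j) * red a ^ j) = 0"
  proof -
    \<comment> \<open>At h = 1 and modulo \<hbar> the relation becomes a polynomial equation for red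
      a.\<close>
    have "(\<Sum>j\<in>J. x j \<star> d j) \<in> dv n" using rel[of "\<one>\<^bsub>H\<^esub>"] by (simp add: act_one)
    then have "(\<Sum>j\<in>J. x j \<star> d j) \<in> dv (Suc 0)" by (rule dv_mono) (simp add: n_def)
    then show ?thesis by (simp add: dv_1 red_sum red_mul d_def red_pw)
  qed
  ultimately show ?thesis using fin j0 by blast
qed

lemma inv_fraction_mono: "inv_fraction n Y W Y' W' \<Longrightarrow> m \<le> n \<Longrightarrow> inv_fraction m Y W Y' W'"
  unfolding inv_fraction_def using dv_mono by blast

definition inv_fract :: "nat \<Rightarrow> 'a fract set" where
  "inv_fract n = {Fr (red W) / Fr (red Y) | Y W Y' W'. inv_fraction n Y W Y' W'}"

text \<open>Dividing the relation by its coefficient at \<open>j0\<close> makes all coefficients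
  invariant fractions. The coefficient at \<open>j0\<close> becomes 1, so the polynomial is
  nonzero.\<close>

lemma inv_fract_algebraic:
  "\<exists>p. p \<noteq> 0 \<and> poly p (Fr a) = 0 \<and> (\<forall>j. poly.coeff p j = 0 \<or> poly.coeff p j \<in> inv_fract n)"
proof -
  obtain a' where a': "red a' = a" using red_surj by blast
  obtain J x j0 where J: "finite J" "j0 \<in> J" and x0: "red (x j0) \<noteq> 0"
    and sum0: "(\<Sum>j\<in>J. red (x j) * red a' ^ j) = 0"
    and inv: "\<forall>j\<in>J. \<exists>Y' W'. inv_fraction n (x j0) (x j) Y' W'"
    using invariant_relation[of a' n] by blast
  define f where "f = (\<lambda>j. Fr (red (x j)) / Fr (red (x j0)))"
  define p where "p = (\<Sum>j\<in>J. Polynomial.monom (f j) j)"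
  have cp: "poly.coeff p j = (if j \<in> J then f j else 0)" for j
    using J(1) by (simp add: p_def coeff_sum)
  have "poly.coeff p j0 = 1" using J(2) x0 by (simp add: cp f_def Fr_eq_0_iff)
  then have "p \<noteq> 0" by auto
  moreover have "poly p (Fr a) = Fr (\<Sum>j\<in>J. red (x j) * red a' ^ j) / Fr (red (x j0))"
    by (simp add: p_def poly_sum poly_monom f_def Fr_sum Fr_simps a' sum_divide_distrib)
  then have "poly p (Fr a) = 0" by (simp add: sum0 Fr_simps)
  moreover have "poly.coeff p j = 0 \<or> poly.coeff p j \<in> inv_fract n" for j
    using inv by (auto simp: cp f_def inv_fract_def)
  ultimately show ?thesis by blast
qed

section \<open>Leading operators and their behaviour with respect to invariant fractions\<close>

definition divs :: "nat \<Rightarrow> 'h set" where "divs m = {x \<in> C. \<forall>a. act x a \<in> dv m}"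

text \<open>The operator on A_0 induced by \<hbar>^-m x. Lift and quotient are chosen arbitrarily;
  on \<open>divs m\<close> the choices do not matter by \<open>lead_eq\<close>.\<close>

definition lead :: "nat \<Rightarrow> 'h \<Rightarrow> 'a \<Rightarrow> 'a" where
  "lead m x a = red (SOME c. act x (SOME a'. red a' = a) = hbn m c)"

lemma lead_eq:
  assumes x: "x \<in> divs m" and c: "act x a = hbn m c"
  shows "lead m x (red a) = red c"
proof -
  let ?a = "SOME a'. red a' = red a"
  let ?c = "SOME c. act x ?a = hbn m c"
  have a: "red ?a = red a" by (rule someI) simp
  have "\<exists>c. act x ?a = hbn m c" using x by (auto simp: divs_def elim: dvE)
  then have c': "act x ?a = hbn m ?c" by (rule someI_ex)
  have "red (?a - a) = 0" using a by (simp add: red_diff)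
  then obtain b where b: "?a - a = hb b" by (auto simp: red_eq_0)
  have "hbn m (?c - c) = hb (act x b)"
    using x by (simp add: hbn_diff flip: c c' act_diff) (simp add: divs_def act_diff[symmetric] b act_hb)
  also obtain e where "act x b = hbn m e" using x by (auto simp: divs_def elim: dvE)
  finally have "hbn m (?c - c) = hbn m (hb e)" using hbn_hbn[of "Suc 0" m] hbn_hbn[of m "Suc 0"] by simp
  then have "?c - c = hb e" by (simp add: hbn_inj)
  then have "red ?c = red c" using red_diff[of ?c c] by simp
  then show ?thesis by (simp add: lead_def)
qed

lemma leadE:
  assumes "x \<in> divs m"
  obtains a' c where "red a' = a" "act x a' = hbn m c" "lead m x a = red c"
proof -
  obtain a' where a': "red a' = a" using red_surj by blast
  obtain c where "act x a' = hbn m c" using assms by (auto simp: divs_def elim: dvE)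
  then show ?thesis using that lead_eq[OF assms] a' by blast
qed

lemma one_divs: "\<one>\<^bsub>H\<^esub> \<in> divs 0"
  by (simp add: divs_def)

lemma lead_one: "lead 0 \<one>\<^bsub>H\<^esub> a = a"
  by (rule leadE[OF one_divs, of a]) (simp add: act_one)

text \<open>The factor c on the left meets only the first leg of the comultiplication of x;
  invariance is applied to the second leg.\<close>

lemma inv_fraction_right:
  assumes inv: "inv_fraction n Y W Y' W'" and x: "x \<in> C"
  shows "act x (c \<star> W) \<star> Y' - act x (c \<star> Y) \<star> W' \<in> dv n"
proof -
  have "act x (c \<star> W) \<star> Y' - act x (c \<star> Y) \<star> W' = SW x (\<lambda>u v. act u c \<star> (act v W \<star> Y' - act v Y \<star> W'))"
    by (simp add: act_mul[OF x] mul_sw[OF x] mul_diff mul_assoc sw_diff)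
  also have "\<dots> \<in> dv n" using inv by (intro sw_dv x, rule_tac dv_mul(2)) (simp add: inv_fraction_def)
  finally show ?thesis .
qed

lemma inv_fraction_left:
  assumes inv: "inv_fraction n Y W Y' W'" and x: "x \<in> C"
  shows "Y \<star> act x (W' \<star> c) - W \<star> act x (Y' \<star> c) \<in> dv n"
proof -
  have "Y \<star> act x (W' \<star> c) - W \<star> act x (Y' \<star> c) = SW x (\<lambda>u v. (Y \<star> act u W' - W \<star> act u Y') \<star> act v c)"
    by (simp add: act_mul[OF x] mul_sw[OF x] mul_diff mul_assoc sw_diff)
  also have "\<dots> \<in> dv n" using inv by (intro sw_dv x, rule_tac dv_mul(1)) (simp add: inv_fraction_def)
  finally show ?thesis .
qed

lemma inv_fraction_red:
  assumes "inv_fraction (Suc n) Y W Y' W'"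
  shows "red Y * red W' = red W * red Y'" "red Y \<noteq> 0" "red Y' \<noteq> 0"
proof -
  have "Y \<star> W' - W \<star> Y' \<in> dv (Suc 0)" using assms dv_mono[of _ "Suc n" "Suc 0"] by (simp add: inv_fraction_def)
  then show "red Y * red W' = red W * red Y'" by (simp add: dv_1 red_diff red_mul)
  show "red Y \<noteq> 0" "red Y' \<noteq> 0" using assms by (simp_all add: inv_fraction_def)
qed

text \<open>After dividing by \<hbar>^m, the level \<open>Suc m\<close> leaves the one order needed
  to reduce the invariance congruence. The result is linearity of \<open>lead m x\<close> over the
  reduced fraction.\<close>

lemma lead_inv_fraction:
  assumes x: "x \<in> divs m" and inv: "inv_fraction (Suc m) Y W Y' W'"
  shows "lead m x (b * red W) * red Y = lead m x (b * red Y) * red W"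
proof -
  have xC: "x \<in> C" using x by (simp add: divs_def)
  obtain c where c: "red c = b" using red_surj by blast
  obtain p where p: "act x (c \<star> W) = hbn m p" using x by (auto simp: divs_def elim: dvE)
  obtain q where q: "act x (c \<star> Y) = hbn m q" using x by (auto simp: divs_def elim: dvE)
  have "hbn m (p \<star> Y' - q \<star> W') \<in> dv (m + Suc 0)"
    using inv_fraction_right[OF inv xC, of c] by (simp add: p q hbn_mul hbn_diff)
  then have "red p * red Y' = red q * red W'" 
    using hbn_in_dvD[of m "p \<star> Y' - q \<star> W'" "Suc 0"] by (simp add: dv_1 red_diff red_mul)
  then have "red p * red Y' * red Y = red q * red W * red Y'"
    using inv_fraction_red[OF inv] by (metis mult.assoc mult.commute)
  then have "red p * red Y = red q * red W" using inv_fraction_red(3)[OF inv] by (metis mult.assoc mult.commute mult_right_cancel)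
  then show ?thesis using lead_eq[OF x p] lead_eq[OF x q] by (simp add: red_mul c)
qed

text \<open>
  With \<open>f = Y\<^sup>-\<^sup>1 W\<close>, compare \<open>[f, x(a)]\<close> and \<open>x([f, a])\<close> for \<open>a = Y' b Y\<close>, where \<open>[f, a] = W' b Y - Y' b W\<close>
  has no denominators.
\<close>

lemma lead_Pois:
  assumes inv: "inv_fraction (Suc (Suc m)) Y W Y' W'"
  shows "\<exists>v. \<forall>l\<le>m. \<forall>x\<in>divs l. Fr (lead l x v) =
    Pois (Fr (red W) / Fr (red Y)) (Fr (lead l x (red Y * red Y' * b)))"
proof -
  obtain b' where b': "red b' = b" using red_surj by blast
  define a where "a = Y' \<star> (b' \<star> Y)"
  define V where "V = W' \<star> (b' \<star> Y) - (Y' \<star> b') \<star> W"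
  note red = inv_fraction_red[OF inv]
  have "red V = 0" using red(1) by (simp add: V_def red_diff red_mul b' mult_ac)
  \<comment> \<open>The reduction of \<open>V1\<close> is the witness. It depends on the fraction
    and on b alone, which is why one v serves all levels l and all x.\<close>
  then obtain V1 where V1: "V = hb V1" by (auto simp: red_eq_0)
  have "Fr (lead l x (red V1)) = Pois (Fr (red W) / Fr (red Y)) (Fr (lead l x (red Y * red Y' * b)))"
    if lm: "l \<le> m" and x: "x \<in> divs l" for l x
  proof -
    have xC: "x \<in> C" using x by (simp add: divs_def)
    obtain c where c: "act x a = hbn l c" using x by (auto simp: divs_def elim: dvE)
    obtain c1 where c1: "act x V1 = hbn l c1" using x by (auto simp: divs_def elim: dvE)
    \<comment> \<open>Beyond l two orders are needed: one to divide a commutator by \<hbar>, one to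
      reduce.\<close>
    have inv': "inv_fraction (l + Suc (Suc 0)) Y W Y' W'" by (rule inv_fraction_mono[OF inv]) (use lm in simp)
    \<comment> \<open>This is x([f, a]) - [f, x(a)], multiplied by Y on the left and by Y' on the
      right to clear denominators. Invariance of the right fraction handles the summand f a of
      [f, a], that of the left fraction the summand a f.\<close>
    have "Y \<star> act x V \<star> Y' - (W \<star> act x a \<star> Y' - Y \<star> act x a \<star> W') =
        (Y \<star> act x (W' \<star> (b' \<star> Y)) - W \<star> act x (Y' \<star> (b' \<star> Y))) \<star> Y' -
        Y \<star> (act x ((Y' \<star> b') \<star> W) \<star> Y' - act x ((Y' \<star> b') \<star> Y) \<star> W')"
      by (simp add: V_def a_def act_diff[OF xC] mul_diff mul_assoc)
    also have "\<dots> \<in> dv (l + Suc (Suc 0))"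
      by (rule dv_diff[OF dv_mul(1)[OF inv_fraction_left[OF inv' xC]] dv_mul(2)[OF inv_fraction_right[OF inv' xC]]])
    also have "Y \<star> act x V \<star> Y' - (W \<star> act x a \<star> Y' - Y \<star> act x a \<star> W') =
        hbn l (hb (Y \<star> c1 \<star> Y') - (W \<star> c \<star> Y' - Y \<star> c \<star> W'))"
      using hbn_hbn[of l "Suc 0"] hbn_hbn[of "Suc 0" l]
      by (simp add: V1 act_hb[OF xC] c1 c hbn_mul hbn_diff hb_mul_left hb_mul_right)
    finally have 1: "hb (Y \<star> c1 \<star> Y') - (W \<star> c \<star> Y' - Y \<star> c \<star> W') \<in> dv (Suc (Suc 0))"
      by (rule hbn_in_dvD)
    obtain p where p: "W \<star> c - c \<star> W = hb p" "bracket (red W) (red c) = red p" by (rule bracket_lift)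
    obtain q where q: "Y \<star> c - c \<star> Y = hb q" "bracket (red Y) (red c) = red q" by (rule bracket_lift)
    have "Y \<star> W' - W \<star> Y' \<in> dv (Suc (Suc 0))"
      using inv' dv_mono[of _ "l + Suc (Suc 0)" "Suc (Suc 0)"] by (simp add: inv_fraction_def)
    then have 2: "c \<star> (Y \<star> W' - W \<star> Y') \<in> dv (Suc (Suc 0))" by (rule dv_mul(2))
    \<comment> \<open>Inserting c times Y W' - W Y' produces the commutators of W and Y with c,
      hence their brackets.\<close>
    have "W \<star> c \<star> Y' - Y \<star> c \<star> W' = (W \<star> c - c \<star> W) \<star> Y' - (Y \<star> c - c \<star> Y) \<star> W' - c \<star> (Y \<star> W' - W \<star> Y')"
      by (simp add: mul_diff mul_assoc)
    also have "\<dots> = hb (p \<star> Y' - q \<star> W') - c \<star> (Y \<star> W' - W \<star> Y')"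
      unfolding p(1) q(1) hb_mul_left using hbn_diff[of "Suc 0"] by simp
    finally have "hb (Y \<star> c1 \<star> Y') - hb (p \<star> Y' - q \<star> W') \<in> dv (Suc (Suc 0))"
      using dv_diff[OF 1 2] by simp
    then have "hbn (Suc 0) (Y \<star> c1 \<star> Y' - (p \<star> Y' - q \<star> W')) \<in> dv (Suc 0 + Suc 0)"
      using hbn_diff[of "Suc 0" "Y \<star> c1 \<star> Y'" "p \<star> Y' - q \<star> W'"] by simp
    then have "Y \<star> c1 \<star> Y' - (p \<star> Y' - q \<star> W') \<in> dv (Suc 0)" by (rule hbn_in_dvD)
    then have 3: "red Y * red c1 * red Y' = bracket (red W) (red c) * red Y' - bracket (red Y) (red c) * red W'"
      by (simp add: dv_1 red_diff red_mul p(2) q(2))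
    have "lead l x (red Y * red Y' * b) = red c"
      using lead_eq[OF x c] by (simp add: a_def red_mul b' mult_ac)
    moreover have "lead l x (red V1) = red c1" by (rule lead_eq[OF x c1])
    moreover have "Fr (red c1) = Pois (Fr (red W) / Fr (red Y)) (Fr (red c))"
    proof -
      have nz: "Fr (red Y) \<noteq> 0" "Fr (red Y') \<noteq> 0" using red by (simp_all add: Fr_eq_0_iff)
      \<comment> \<open>With W'/Y' = W/Y, equation 3 becomes the quotient rule for the bracket of
        W/Y with red c.\<close>
      have W': "Fr (red W') = Fr (red W) * Fr (red Y') / Fr (red Y)"
        using red(1) nz by (simp add: field_simps flip: Fr_simps)
      have "Fr (red Y) * Fr (red c1) * Fr (red Y') = Fr (bracket (red W) (red c)) * Fr (red Y') - Fr (bracket (red Y) (red c)) * Fr (red W')"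
        using 3 by (simp flip: Fr_simps)
      then have "Fr (red Y') * (Fr (red Y) * (Fr (red Y) * Fr (red c1)) + Fr (red W) * Fr (bracket (red Y) (red c))
          - Fr (red Y) * Fr (bracket (red W) (red c))) = 0"
        using nz by (simp add: W' field_simps)
      then have "Fr (red Y) * (Fr (red Y) * Fr (red c1)) + Fr (red W) * Fr (bracket (red Y) (red c)) =
          Fr (red Y) * Fr (bracket (red W) (red c))"
        using nz by simp
      then show ?thesis
        unfolding Pois_Fr(2) der_ext_divide[OF inj_ring_hom_Fr twisted_derivation_bracket_left[OF biderivation_bracket] red(2)]
        using nz by (simp add: field_simps power2_eq_square)
    qed
    ultimately show ?thesis by simp
  qed
  then show ?thesis by blast
qed

end

section \<open>Linear independence over the fraction field\<close>

locale central_hopf_quantization = hopf_quantization s sc mul unit hb red H act E cf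
  for s :: "'k::field \<Rightarrow> 'a::idom \<Rightarrow> 'a" and sc :: "'k \<Rightarrow> 'u::ab_group_add \<Rightarrow> 'u"
    and mul :: "'u \<Rightarrow> 'u \<Rightarrow> 'u" (infixl \<open>\<star>\<close> 70) and unit :: 'u
    and hb :: "'u \<Rightarrow> 'u" and red :: "'u \<Rightarrow> 'a"
    and H :: "('k, 'h, 'm) hopf_scheme" and act :: "'h \<Rightarrow> 'u \<Rightarrow> 'u" and E cf +
  assumes char0: "n > 0 \<Longrightarrow> (of_nat n :: 'k) \<noteq> 0"
    and center: "(\<And>g. Pois q g = 0) \<Longrightarrow> \<exists>c. q = Fr (s c 1)"
begin

lemma s_one_mult: "s c 1 * a = s c a"
  by (simp add: s_mult)

lemma Fr_s: "Fr (s c a) = Fr (s c 1) * Fr a"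
  by (simp add: s_one_mult flip: Fr_simps)

lemma char0_fract: "n > 0 \<Longrightarrow> (of_nat n :: 'a fract) \<noteq> 0"
proof -
  assume n: "n > 0"
  have "(of_nat n :: 'a) = s (of_nat n) 1"
    by (induction n) (simp_all add: S.scale_left_distrib)
  then have "Fr (of_nat n :: 'a) \<noteq> 0" using char0[OF n] by (simp add: Fr_eq_0_iff)
  then show ?thesis by (simp add: of_nat_fract)
qed

text \<open>The derivation \<open>Pois q\<close> kills the reduced invariant fractions, over which
  all of A_0 is algebraic; hence q is a Casimir.\<close>

lemma Pois_zero_imp_const:
  assumes "\<And>f. f \<in> inv_fract n \<Longrightarrow> Pois f q = 0"
  shows "\<exists>c. q = Fr (s c 1)"
proof (rule center)
  fix g
  have 0: "Pois q f = 0" if "f \<in> inv_fract n" for f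
    using assms[OF that] Pois_antisym[of q f] by simp
  have "Pois q (Fr a) = 0" for a
  proof -
    obtain p where p: "p \<noteq> 0" "poly p (Fr a) = 0" "\<And>j. poly.coeff p j = 0 \<or> poly.coeff p j \<in> inv_fract n"
      using inv_fract_algebraic by blast
    show ?thesis
      by (rule twisted_derivation_algebraic[OF _ Pois_right char0_fract p(1,2)])
        (use p(3) 0 in \<open>auto simp: inj_ring_hom_def twisted_derivationD(3)[OF Pois_right] dest: spec\<close>, metis p(3) 0 twisted_derivationD(3)[OF Pois_right])
  qed
  moreover have "twisted_derivation (\<lambda>q. q) (\<lambda>_. 0 :: 'a fract)" by (simp add: twisted_derivation_def)
  ultimately show "Pois q g = 0" using derivation_fract_eqI[OF Pois_right] by metis
qed

text \<open>By linearity over invariant fractions the extension of g fixes them and that of d kills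
  them, so d vanishes on everything algebraic over them.\<close>

lemma twisted_derivation_zero:
  fixes g d :: "'a \<Rightarrow> 'a"
  assumes g: "inj_ring_hom g" and d: "twisted_derivation g d"
    and lin_g: "\<And>Y W Y' W'. inv_fraction n Y W Y' W' \<Longrightarrow> g (red W) * red Y = g (red Y) * red W"
    and lin_d: "\<And>Y W Y' W'. inv_fraction n Y W Y' W' \<Longrightarrow> d (red W) * red Y = d (red Y) * red W"
  shows "d a = 0"
proof -
  define \<sigma> where "\<sigma> = (\<lambda>a. Fr (g a))"
  define \<delta> where "\<delta> = (\<lambda>a. Fr (d a))"
  have s: "inj_ring_hom \<sigma>" using g by (simp add: \<sigma>_def inj_ring_hom_def Fr_simps Fr_eq_0_iff)
  have D: "twisted_derivation \<sigma> \<delta>" using d by (simp add: \<sigma>_def \<delta>_def twisted_derivation_def Fr_simps)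
  have inv: "hom_ext \<sigma> f = f" "der_ext \<sigma> \<delta> f = 0" if f: "f \<in> inv_fract n" for f
  proof -
    obtain Y W Y' W' where YW: "inv_fraction n Y W Y' W'" "f = Fr (red W) / Fr (red Y)"
      using f by (auto simp: inv_fract_def)
    have Y: "red Y \<noteq> 0" using YW(1) by (simp add: inv_fraction_def)
    then have nz: "Fr (red Y) \<noteq> 0" "\<sigma> (red Y) \<noteq> 0" using inj_ring_homD(5)[OF s] by (simp_all add: Fr_eq_0_iff)
    have 1: "\<sigma> (red W) * Fr (red Y) = \<sigma> (red Y) * Fr (red W)"
      using lin_g[OF YW(1)] by (simp add: \<sigma>_def flip: Fr_simps)
    have 2: "\<delta> (red W) * Fr (red Y) = \<delta> (red Y) * Fr (red W)"
      using lin_d[OF YW(1)] by (simp add: \<delta>_def flip: Fr_simps)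
    show "hom_ext \<sigma> f = f" using 1 nz by (simp add: YW(2) hom_ext_divide[OF s Y] field_simps)
    have "\<delta> (red W) = \<delta> (red Y) * f" "\<sigma> (red W) = \<sigma> (red Y) * f"
      using 1 2 nz by (simp_all add: YW(2) field_simps)
    then show "der_ext \<sigma> \<delta> f = 0" unfolding YW(2) der_ext_divide[OF s D Y] by simp
  qed
  have D': "twisted_derivation (hom_ext \<sigma>) (der_ext \<sigma> \<delta>)" by (rule twisted_derivation_der_ext[OF s D])
  obtain p where p: "p \<noteq> 0" "poly p (Fr a) = 0" "\<And>j. poly.coeff p j = 0 \<or> poly.coeff p j \<in> inv_fract n"
    using inv_fract_algebraic by blast
  have "der_ext \<sigma> \<delta> (Fr a) = 0"
    by (rule twisted_derivation_algebraic[OF inj_ring_hom_hom_ext[OF s] D' char0_fract p(1,2)])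
      (metis p(3) inv inj_ring_homD(4)[OF inj_ring_hom_hom_ext[OF s]] twisted_derivationD(3)[OF D'])+
  then have "\<delta> a = 0" unfolding der_ext_Fr[OF s D] .
  then show "d a = 0" by (simp add: \<delta>_def Fr_eq_0_iff)
qed

lemma divs_0: "divs 0 = C" by (auto simp: divs_def)

abbreviation op :: "'h \<Rightarrow> 'a \<Rightarrow> 'a" where "op \<equiv> lead 0"

lemma op_red: "h \<in> C \<Longrightarrow> op h (red a) = red (act h a)"
  by (rule lead_eq) (simp_all add: divs_0)

text \<open>In a relation between the powers of \<rho>(t) modulo \<hbar> the lowest occurring power
  is cancelled, which makes the constant coefficient nonzero. Coefficients commute with \<rho>(a)
  modulo \<hbar>, so the result can be multiplied by \<rho>(a) for any a.\<close>

lemma coaction_annihilator: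
  assumes t: "t \<noteq> 0"
  shows "\<exists>N c. c 0 \<noteq> 0 \<and> (\<forall>h\<in>C. \<forall>a. (\<Sum>i\<le>N. c i * op h (a * t ^ i)) = 0)"
proof -
  obtain t' where t': "red t' = t" using red_surj by blast
  obtain x where x: "coaction_relation (pw t') (Suc 0) {..card E} x" using coaction_relation_exists by blast
  \<comment> \<open>The terms below the least index with nonzero reduction vanish modulo
    \<hbar>.\<close>
  define j0 where "j0 = (LEAST j. j \<le> card E \<and> red (x j) \<noteq> 0)"
  have ex: "\<exists>j. j \<le> card E \<and> red (x j) \<noteq> 0" using x by (auto simp: coaction_relation_def)
  then have j0: "j0 \<le> card E" "red (x j0) \<noteq> 0" using LeastI_ex[OF ex] by (simp_all add: j0_def)
  have least: "red (x j) = 0" if "j < j0" for j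
    using not_less_Least[OF that[unfolded j0_def]] that j0(1) by simp
  define N where "N = card E - j0"
  define \<xi> where "\<xi> = (\<lambda>h. \<Sum>i\<le>N. x (i + j0) \<star> act h (pw t' i))"
  have \<xi>: "lin \<xi>"
    using act_linear unfolding \<xi>_def
    by (simp add: linear_on_def mul_add_right sum.distrib sc_mul_right U.scale_sum_right)
  have swap: "SW h (\<lambda>u v. act u a \<star> \<xi> v) - (\<Sum>i\<le>N. x (i + j0) \<star> act h (a \<star> pw t' i)) \<in> dv (Suc 0)"
    if h: "h \<in> C" for h a
  proof -
    have "SW h (\<lambda>u v. act u a \<star> \<xi> v) - (\<Sum>i\<le>N. x (i + j0) \<star> act h (a \<star> pw t' i)) =
        SW h (\<lambda>u v. \<Sum>i\<le>N. (act u a \<star> x (i + j0) - x (i + j0) \<star> act u a) \<star> act v (pw t' i))"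
      by (simp add: act_mul[OF h] mul_sw[OF h] \<xi>_def mul_sum mul_diff mul_assoc sw_diff sum_subtractf flip: sw_sum)
    also have "\<dots> \<in> dv (Suc 0)"
      by (intro sw_dv h dv_sum, rule_tac dv_mul(1)) (rule commutator_dv)
    finally show ?thesis .
  qed
  have \<xi>0: "\<xi> h \<in> dv (Suc 0)" if h: "h \<in> C" for h
  proof (rule coaction_cancel[OF _ \<xi> _ h])
    show "red (pw t' j0) \<noteq> 0" using t by (simp add: red_pw t')
    fix h assume h: "h \<in> C"
    have "(\<Sum>j\<le>card E. x j \<star> act h (pw t' j)) =
        (\<Sum>j<j0. x j \<star> act h (pw t' j)) + (\<Sum>i\<le>N. x (i + j0) \<star> act h (pw t' (i + j0)))"
    proof -
      have eq: "{..card E} = {..<j0} \<union> {j0..card E}" "{..<j0} \<inter> {j0..card E} = {}" using j0(1) by auto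
      have reindex: "(\<Sum>j\<in>{j0..card E}. x j \<star> act h (pw t' j)) = (\<Sum>i\<le>N. x (i + j0) \<star> act h (pw t' (i + j0)))"
        using j0(1) by (intro sum.reindex_bij_witness[of _ "\<lambda>i. i + j0" "\<lambda>j. j - j0"]) (auto simp: N_def)
      show ?thesis unfolding reindex[symmetric] unfolding eq(1)
        by (rule sum.union_disjoint) (use eq(2) in auto)
    qed
    moreover have "(\<Sum>j\<le>card E. x j \<star> act h (pw t' j)) \<in> dv (Suc 0)"
      using x h by (simp add: coaction_relation_def)
    moreover have "(\<Sum>j<j0. x j \<star> act h (pw t' j)) \<in> dv (Suc 0)"
      by (intro dv_sum, rule dv_mul(1)) (simp add: dv_1 least)
    ultimately have "(\<Sum>i\<le>N. x (i + j0) \<star> act h (pw t' (i + j0))) \<in> dv (Suc 0)"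
      using dv_diff[of "\<Sum>j\<le>card E. x j \<star> act h (pw t' j)" "Suc 0" "\<Sum>j<j0. x j \<star> act h (pw t' j)"] by simp
    then have "(\<Sum>i\<le>N. x (i + j0) \<star> act h (pw t' j0 \<star> pw t' i)) \<in> dv (Suc 0)"
      by (simp add: add.commute flip: pw_add)
    from dv_add[OF swap[OF h, of "pw t' j0"] this]
    show "SW h (\<lambda>u v. act u (pw t' j0) \<star> \<xi> v) \<in> dv (Suc 0)" by simp
  qed
  have "(\<Sum>i\<le>N. red (x (i + j0)) * op h (a * t ^ i)) = 0" if h: "h \<in> C" for h a
  proof -
    obtain a' where a': "red a' = a" using red_surj by blast
    have "SW h (\<lambda>u v. act u a' \<star> \<xi> v) \<in> dv (Suc 0)" using \<xi>0 by (intro sw_dv h, rule_tac dv_mul(2))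
    from dv_diff[OF this swap[OF h, of a']]
    have "red (\<Sum>i\<le>N. x (i + j0) \<star> act h (a' \<star> pw t' i)) = 0" by (simp add: dv_1)
    then show ?thesis by (simp add: red_sum red_mul red_pw t' a' flip: op_red[OF h])
  qed
  then show ?thesis using j0(2) by (intro exI[of _ N] exI[of _ "\<lambda>i. red (x (i + j0))"]) auto
qed

text \<open>In the equation of \<open>coaction_annihilator\<close> all terms except the one for t^0
  concern arguments in tA_0, where the relation is given; the constant coefficient can be
  cancelled.\<close>

lemma op_relation_extend:
  assumes t: "t \<noteq> 0" and I: "I \<subseteq> C" and rel: "\<And>b. (\<Sum>h\<in>I. q h * Fr (op h (t * b))) = 0"
  shows "(\<Sum>h\<in>I. q h * Fr (op h b)) = 0"
proof -
  obtain N c where c: "c 0 \<noteq> 0" "\<And>h a. h \<in> C \<Longrightarrow> (\<Sum>i\<le>N. c i * op h (a * t ^ i)) = 0"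
    using coaction_annihilator[OF t] by blast
  have "0 = (\<Sum>h\<in>I. q h * Fr (\<Sum>i\<le>N. c i * op h (b * t ^ i)))"
    using c(2) I by (simp add: Fr_simps subset_iff)
  also have "\<dots> = (\<Sum>i\<le>N. Fr (c i) * (\<Sum>h\<in>I. q h * Fr (op h (b * t ^ i))))"
    unfolding Fr_sum Fr_simps sum_distrib_left
    by (subst sum.swap) (simp add: mult_ac)
  also have "\<dots> = (\<Sum>i\<le>N. if i = 0 then Fr (c 0) * (\<Sum>h\<in>I. q h * Fr (op h b)) else 0)"
  proof (rule sum.cong[OF refl])
    fix i
    show "Fr (c i) * (\<Sum>h\<in>I. q h * Fr (op h (b * t ^ i))) =
        (if i = 0 then Fr (c 0) * (\<Sum>h\<in>I. q h * Fr (op h b)) else 0)"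
      using rel[of "t ^ (i - 1) * b"] by (cases i) (simp_all add: mult_ac)
  qed
  also have "\<dots> = Fr (c 0) * (\<Sum>h\<in>I. q h * Fr (op h b))" by simp
  finally show ?thesis using c(1) by (simp add: Fr_eq_0_iff)
qed

text \<open>
  A shortest relation over the fraction field, normalized to have a coefficient \<open>1\<close>, becomes shorter
  under the derivations \<open>{f, -}\<close> for invariant \<open>f\<close>, so its coefficients are Casimirs, that is, scalars.
\<close>

lemma op_independent:
  assumes "finite I" "I \<subseteq> C"
    and "\<And>c. (\<And>a. (\<Sum>h\<in>I. s (c h) (op h a)) = 0) \<Longrightarrow> \<forall>h\<in>I. c h = 0"
    and "\<And>a. (\<Sum>h\<in>I. q h * Fr (op h a)) = 0"
  shows "\<forall>h\<in>I. q h = 0"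
  using assms
proof (induction "card I" arbitrary: I q rule: less_induct)
  case less
  note fin = less.prems(1) and IC = less.prems(2) and indep = less.prems(3) and rel = less.prems(4)
  show ?case
  proof (rule ccontr)
    assume "\<not> ?thesis"
    then obtain h0 where h0: "h0 \<in> I" "q h0 \<noteq> 0" by blast
    define r where "r = (\<lambda>h. q h / q h0)"
    have r_rel: "(\<Sum>h\<in>I. r h * Fr (op h a)) = 0" for a
      using rel[of a] by (simp add: r_def flip: sum_divide_distrib)
    have indep': "\<forall>h\<in>I - {h0}. c h = 0" if c: "\<And>a. (\<Sum>h\<in>I - {h0}. s (c h) (op h a)) = 0" for c
    proof -
      have "(\<Sum>h\<in>I. s ((c(h0 := 0)) h) (op h a)) = 0" for a
        using c[of a] fin h0(1) by (simp add: sum.remove)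
      from indep[OF this] show ?thesis by (metis Diff_iff fun_upd_other singletonI)
    qed
    have "Pois f (r h) = 0" if f: "f \<in> inv_fract (Suc (Suc 0))" and h: "h \<in> I" for f h
    proof -
      obtain Y W Y' W' where YW: "inv_fraction (Suc (Suc 0)) Y W Y' W'" "f = Fr (red W) / Fr (red Y)"
        using f by (auto simp: inv_fract_def)
      \<comment> \<open>\<open>lead_Pois\<close> describes {f, h(a)} only for multiples a of this t,
        so the differentiated relation appears on tA_0 first.\<close>
      define t where "t = red Y * red Y'"
      have t: "t \<noteq> 0" using YW(1) by (simp add: t_def inv_fraction_def)
      have "(\<Sum>h\<in>I. Pois f (r h) * Fr (op h (t * b))) = 0" for b
      proof -
        obtain v where v: "\<And>h. h \<in> C \<Longrightarrow> Fr (op h v) = Pois f (Fr (op h (t * b)))"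
          using lead_Pois[OF YW(1), of b] by (auto simp: divs_0 t_def YW(2))
        have "0 = Pois f (\<Sum>h\<in>I. r h * Fr (op h (t * b)))"
          by (simp add: r_rel twisted_derivationD(3)[OF Pois_right])
        also have "\<dots> = (\<Sum>h\<in>I. Pois f (r h) * Fr (op h (t * b))) + (\<Sum>h\<in>I. r h * Fr (op h v))"
          using IC v by (simp add: twisted_derivationD(2,6)[OF Pois_right] sum.distrib subset_iff)
        finally show ?thesis by (simp add: r_rel)
      qed
      then have *: "(\<Sum>h\<in>I. Pois f (r h) * Fr (op h b)) = 0" for b
        by (rule op_relation_extend[OF t IC])
      have 1: "Pois f (r h0) = 0"
        using h0 twisted_derivation_one[OF Pois_right] by (simp add: r_def)
      have "\<forall>h\<in>I - {h0}. Pois f (r h) = 0"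
      proof (rule less.hyps)
        show "card (I - {h0}) < card I" using fin h0(1) by (intro psubset_card_mono) auto
        show "(\<Sum>h\<in>I - {h0}. Pois f (r h) * Fr (op h a)) = 0" for a
          using *[of a] fin h0(1) 1 by (simp add: sum.remove)
      qed (use fin IC indep' in auto)
      then show ?thesis using 1 h by auto
    qed
    then have "\<forall>h\<in>I. \<exists>c. r h = Fr (s c 1)" using Pois_zero_imp_const by metis
    then obtain c where c: "\<And>h. h \<in> I \<Longrightarrow> r h = Fr (s (c h) 1)" by metis
    have "(\<Sum>h\<in>I. s (c h) (op h a)) = 0" for a
    proof -
      have "Fr (\<Sum>h\<in>I. s (c h) (op h a)) = (\<Sum>h\<in>I. r h * Fr (op h a))"
        unfolding Fr_sum by (rule sum.cong[OF refl]) (simp add: c Fr_s[of _ "op _ a"])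
      then show ?thesis by (simp add: r_rel Fr_eq_0_iff)
    qed
    then have "c h0 = 0" using indep h0(1) by blast
    then show False using c[OF h0(1)] h0(2) by (simp add: r_def Fr_simps)
  qed
qed

end

section \<open>Eigenvectors modulo a subspace\<close>

text \<open>Take p of least degree with p(D) x0 in V' and a root l of p. For p = (X - l) q the
  vector q(D) x0 lies outside V' by minimality.\<close>

lemma eigenvector_modulo:
  fixes scale :: "'k::alg_closed_field \<Rightarrow> 'v::ab_group_add \<Rightarrow> 'v"
  assumes vs: "vector_space scale" and V: "module.subspace scale V" and V': "module.subspace scale V'"
    and B: "finite B" "V \<subseteq> module.span scale B"
    and D: "\<And>x. x \<in> V \<Longrightarrow> D x \<in> V" "\<And>x y. x \<in> V \<Longrightarrow> y \<in> V \<Longrightarrow> D (x + y) = D x + D y"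
      "\<And>c x. x \<in> V \<Longrightarrow> D (scale c x) = scale c (D x)"
    and x0: "x0 \<in> V" "x0 \<notin> V'"
  shows "\<exists>l x. x \<in> V \<and> x \<notin> V' \<and> D x - scale l x \<in> V'"
proof -
  interpret vector_space scale by fact
  \<comment> \<open>\<open>ev p\<close> is p(D) x0, in Horner form.\<close>
  define ev where "ev = (\<lambda>p. fold_coeffs (\<lambda>a x. scale a x0 + D x) p 0)"
  have D0: "D 0 = 0" using D(3)[OF x0(1), of 0] by simp
  have ev_pCons: "ev (pCons a p) = scale a x0 + D (ev p)" for a p
    by (cases "a = 0 \<and> p = 0") (auto simp: ev_def D0)
  have ev_0: "ev 0 = 0" by (simp add: ev_def)
  have evV: "ev p \<in> V" for p
    by (induction p) (auto simp: ev_0 ev_pCons subspace_0[OF V] intro!: subspace_add[OF V] subspace_scale[OF V] x0 D)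
  have ev_add: "ev (p + q) = ev p + ev q" for p q
    by (induction p q rule: poly_induct2) (simp_all add: ev_0 ev_pCons scale_left_distrib D(2)[OF evV evV] algebra_simps)
  have ev_smult: "ev (smult c p) = scale c (ev p)" for c p
    by (induction p) (simp_all add: ev_0 ev_pCons scale_right_distrib D(3)[OF evV])
  have ev_sum: "ev (sum f I) = (\<Sum>i\<in>I. ev (f i))" for f :: "nat \<Rightarrow> 'k poly" and I
    by (induction I rule: infinite_finite_induct) (auto simp: ev_0 ev_add)
  have ev_monom: "ev (monom c i) = scale c ((D ^^ i) x0)" for c i
  proof (induction i)
    case (Suc i)
    have "(D ^^ i) x0 \<in> V" by (induction i) (auto simp: x0 D)
    then show ?case using Suc by (simp add: monom_Suc ev_pCons D(3))
  qed (simp add: monom_0 ev_pCons ev_0 D0)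
  \<comment> \<open>If the iterates of x0 are distinct, \<open>card B + 1\<close> of them are
    linearly dependent; if two coincide, a difference of two monomials works.\<close>
  have "\<exists>p. p \<noteq> 0 \<and> ev p = 0"
  proof (cases "inj_on (\<lambda>i. (D ^^ i) x0) {..card B}")
    case False
    then obtain i j where ij: "i \<noteq> j" "(D ^^ i) x0 = (D ^^ j) x0" by (auto simp: inj_on_def)
    have "coeff (monom (1 :: 'k) i + monom (- 1) j) i \<noteq> 0" using ij(1) by simp
    then have "monom (1 :: 'k) i + monom (- 1) j \<noteq> 0" by (metis coeff_0)
    then show ?thesis using ij by (intro exI[of _ "monom 1 i + monom (- 1) j"]) (simp add: ev_add ev_monom)
  next
    case True
    let ?S = "(\<lambda>i. (D ^^ i) x0) ` {..card B}"
    have "(D ^^ i) x0 \<in> V" for i by (induction i) (auto simp: x0 D)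
    then have "?S \<subseteq> span B" using B(2) by blast
    then have "dependent ?S"
      using independent_span_bound[OF B(1), of ?S] card_image[OF True] by auto
    then obtain u where u: "\<exists>v\<in>?S. u v \<noteq> 0" "(\<Sum>v\<in>?S. scale (u v) v) = 0"
      using dependent_finite[of ?S] by auto
    define p where "p = (\<Sum>i\<le>card B. monom (u ((D ^^ i) x0)) i)"
    have cp: "coeff p i = (if i \<le> card B then u ((D ^^ i) x0) else 0)" for i
      by (simp add: p_def coeff_sum)
    have "p \<noteq> 0" using u(1) cp by (metis (no_types, lifting) atMost_iff coeff_0 imageE)
    moreover have "ev p = 0"
      using u(2) by (simp add: p_def ev_sum ev_monom sum.reindex[OF True])
    ultimately show ?thesis by blast
  qed
  then obtain p0 where "p0 \<noteq> 0 \<and> ev p0 \<in> V'" using subspace_0[OF V'] by metis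
  from ex_has_least_nat[of "\<lambda>p. p \<noteq> 0 \<and> ev p \<in> V'", OF this, of degree]
  obtain p where p: "p \<noteq> 0" "ev p \<in> V'" and least: "\<And>q. q \<noteq> 0 \<Longrightarrow> ev q \<in> V' \<Longrightarrow> degree p \<le> degree q"
    by blast
  have "degree p > 0"
  proof (rule ccontr)
    assume "\<not> degree p > 0"
    then obtain c where c: "p = [:c:]" using degree_eq_zeroE by blast
    then have "c \<noteq> 0" "scale c x0 \<in> V'" using p by (auto simp: ev_pCons ev_0 D0)
    then show False using x0(2) subspace_scale[OF V', of "scale c x0" "inverse c"] by simp
  qed
  then obtain l where "poly p l = 0" using alg_closed_imp_poly_has_root by blast
  then obtain q where q: "p = [:- l, 1:] * q" by (metis dvdE poly_eq_0_iff_dvd)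
  then have q0: "q \<noteq> 0" using p by auto
  have "degree p = degree [:- l, 1:] + degree q" unfolding q using q0 by (intro degree_mult_eq) auto
  then have "degree q < degree p" by simp
  then have nq: "ev q \<notin> V'" using least[OF q0] by auto
  have "p = pCons 0 q + smult (- l) q" by (simp add: q)
  then have "ev p = D (ev q) - scale l (ev q)" by (simp only: ev_add ev_smult ev_pCons) simp
  then show ?thesis using nq evV p(2) by metis
qed

lemma sum_fun_apply: "(sum f I) x = (\<Sum>i\<in>I. f i x)" for f :: "'i \<Rightarrow> 'x \<Rightarrow> 'y::comm_monoid_add"
  by (induction I rule: infinite_finite_induct) auto

section \<open>The image of the Hopf algebra in the endomorphisms of the commutative quotient\<close>

context central_hopf_quantization
begin

lemma mult_s: "a * s c b = s c (a * b)"
  by (metis mult.commute s_mult)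

definition fs :: "'k \<Rightarrow> ('a \<Rightarrow> 'a) \<Rightarrow> 'a \<Rightarrow> 'a" where "fs c T = (\<lambda>a. s c (T a))"

lemma vector_space_fs: "vector_space fs"
  by unfold_locales
    (auto simp: fs_def fun_eq_iff S.scale_right_distrib S.scale_left_distrib)

sublocale F: vector_space fs by (rule vector_space_fs)

lemma divs_obtain:
  assumes "x \<in> divs m"
  obtains c where "act x a = hbn m c"
  using assms by (auto simp: divs_def elim: dvE)

lemma lead_linear:
  assumes x: "x \<in> divs m"
  shows lead_add: "lead m x (a + b) = lead m x a + lead m x b"
    and lead_s: "lead m x (s r a) = s r (lead m x a)"
proof -
  have xC: "x \<in> C" using x by (simp add: divs_def)
  obtain a' c where a: "red a' = a" "act x a' = hbn m c" "lead m x a = red c" by (rule leadE[OF x])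
  obtain b' d where b: "red b' = b" "act x b' = hbn m d" "lead m x b = red d" by (rule leadE[OF x])
  have "act x (a' + b') = hbn m (c + d)" by (simp add: act_add[OF xC] a b hbn_add)
  from lead_eq[OF x this] show "lead m x (a + b) = lead m x a + lead m x b" by (simp add: red_add a b)
  have "act x (sc r a') = hbn m (sc r c)" by (simp add: act_sc[OF xC] a hbn_sc)
  from lead_eq[OF x this] show "lead m x (s r a) = s r (lead m x a)" by (simp add: red_sc a)
qed

lemma act_plus: "x \<in> C \<Longrightarrow> y \<in> C \<Longrightarrow> act (x \<oplus>\<^bsub>H\<^esub> y) a = act x a + act y a"
  and act_smult: "x \<in> C \<Longrightarrow> act (c \<odot>\<^bsub>H\<^esub> x) a = sc c (act x a)"
  using act_linear by (simp_all add: linear_on_def)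

lemma divs_add: "x \<in> divs m \<Longrightarrow> y \<in> divs m \<Longrightarrow> x \<oplus>\<^bsub>H\<^esub> y \<in> divs m"
  by (auto simp: divs_def act_plus dv_add)

lemma divs_smult: "x \<in> divs m \<Longrightarrow> c \<odot>\<^bsub>H\<^esub> x \<in> divs m"
  by (auto simp: divs_def act_smult dv_sc)

lemma lead_plus:
  assumes "x \<in> divs m" "y \<in> divs m"
  shows "lead m (x \<oplus>\<^bsub>H\<^esub> y) = lead m x + lead m y"
proof (rule ext)
  fix a
  obtain a' where a': "red a' = a" using red_surj by blast
  obtain c where c: "act x a' = hbn m c" by (rule divs_obtain[OF assms(1)])
  obtain d where d: "act y a' = hbn m d" by (rule divs_obtain[OF assms(2)])
  have "act (x \<oplus>\<^bsub>H\<^esub> y) a' = hbn m (c + d)" using assms by (simp add: divs_def act_plus c d hbn_add)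
  then show "lead m (x \<oplus>\<^bsub>H\<^esub> y) a = (lead m x + lead m y) a"
    using lead_eq[OF divs_add[OF assms], of a'] lead_eq[OF assms(1) c] lead_eq[OF assms(2) d]
    by (simp add: red_add flip: a')
qed

lemma lead_smult:
  assumes "x \<in> divs m"
  shows "lead m (r \<odot>\<^bsub>H\<^esub> x) = fs r (lead m x)"
proof (rule ext)
  fix a
  obtain a' where a': "red a' = a" using red_surj by blast
  obtain c where c: "act x a' = hbn m c" by (rule divs_obtain[OF assms])
  have "act (r \<odot>\<^bsub>H\<^esub> x) a' = hbn m (sc r c)" using assms by (simp add: divs_def act_smult c hbn_sc)
  then show "lead m (r \<odot>\<^bsub>H\<^esub> x) a = fs r (lead m x) a"
    using lead_eq[OF divs_smult[OF assms], of _ a'] lead_eq[OF assms c] by (simp add: fs_def red_sc flip: a')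
qed

lemma op_mult: "g \<in> C \<Longrightarrow> h \<in> C \<Longrightarrow> op (g \<otimes>\<^bsub>H\<^esub> h) a = op g (op h a)"
  by (metis act_mult m_closed op_red red_surj)

lemma op_one: "op \<one>\<^bsub>H\<^esub> = (\<lambda>a. a)"
  by (rule ext) (rule lead_one)

lemma op_unit: "h \<in> C \<Longrightarrow> op h 1 = s (counit H h) 1"
  using op_red[of h unit] by (simp add: red_unit act_unit red_sc)

lemma red_sw: "h \<in> C \<Longrightarrow> red (SW h b) = sw H s h (\<lambda>x y. red (b x y))"
  by (rule sw_map) (auto simp: red_add red_sc)

lemma op_mul:
  assumes h: "h \<in> C"
  shows "op h (a * b) = sw H s h (\<lambda>x y. op x a * op y b)"
proof -
  obtain a' b' where ab: "red a' = a" "red b' = b" using red_surj by metis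
  have "op h (a * b) = red (act h (a' \<star> b'))" by (simp add: ab red_mul flip: op_red[OF h])
  also have "\<dots> = sw H s h (\<lambda>x y. op x a * op y b)"
    unfolding act_mul[OF h] red_sw[OF h] by (rule sw_cong[OF h]) (simp add: red_mul op_red flip: ab)
  finally show ?thesis .
qed

text \<open>The image of H in End A_0, kept as a set of maps because distinct elements of H may act
  equally.\<close>

definition ops :: "('a \<Rightarrow> 'a) set" where "ops = op ` C"

lemma subspace_ops: "F.subspace ops"
proof (rule F.subspaceI)
  show "0 \<in> ops"
    unfolding ops_def
  proof
    show "0 = op \<zero>\<^bsub>H\<^esub>"
      using lead_smult[of "\<one>\<^bsub>H\<^esub>" 0 0] one_closed lead_plus[of "\<zero>\<^bsub>H\<^esub>" 0 "\<zero>\<^bsub>H\<^esub>"] by (simp add: divs_0)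
  qed simp
qed (auto simp: ops_def simp flip: lead_plus lead_smult simp: divs_0 intro!: imageI)

lemma opsD:
  assumes "T \<in> ops"
  shows "T (a + b) = T a + T b" "T (s c a) = s c (T a)" "\<exists>c. T 1 = s c 1"
  using assms lead_add[of _ 0] lead_s[of _ 0] op_unit by (auto simp: ops_def divs_0)

lemma ops_span: "ops \<subseteq> F.span (op ` E)"
proof
  fix T assume "T \<in> ops"
  then obtain h where h: "h \<in> C" "T = op h" by (auto simp: ops_def)
  have "linear_on H fs op" by (simp add: linear_on_def lead_plus lead_smult divs_0)
  then have "T = (\<Sum>e\<in>E. fs (cf e h) (op e))" using expand[OF vector_space_fs _ h(1), of op] h(2) by simp
  also have "\<dots> \<in> F.span (op ` E)" by (intro F.span_sum F.span_scale F.span_base) auto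
  finally show "T \<in> F.span (op ` E)" .
qed

lemma finite_op_E: "finite (op ` E)" using E by simp

lemma fs_sum_apply: "(\<Sum>T\<in>Xs. fs (c T) (f T)) a = (\<Sum>T\<in>Xs. s (c T) (f T a))"
  by (simp add: sum_fun_apply fs_def)

text \<open>Transfers \<open>op_independent\<close> from elements of H to operators by choosing
  preimages.\<close>

lemma ops_independent:
  assumes Xs: "Xs \<subseteq> ops" "finite Xs" "F.independent Xs" and q: "\<And>a. (\<Sum>T\<in>Xs. q T * Fr (T a)) = 0" and T: "T \<in> Xs"
  shows "q T = 0"
proof -
  have "\<forall>T\<in>Xs. \<exists>h. h \<in> C \<and> T = op h" using Xs(1) by (auto simp: ops_def)
  then obtain i where i: "\<And>T. T \<in> Xs \<Longrightarrow> i T \<in> C \<and> T = op (i T)" by metis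
  have inj: "inj_on i Xs" using i by (metis inj_onI)
  have "\<forall>h\<in>i ` Xs. q (op h) = 0"
  proof (rule op_independent)
    show "finite (i ` Xs)" "i ` Xs \<subseteq> C" using Xs i by auto
    fix c assume "\<And>a. (\<Sum>h\<in>i ` Xs. s (c h) (op h a)) = 0"
    then have "(\<Sum>T\<in>Xs. s (c (i T)) (T a)) = 0" for a
      using i by (simp add: sum.reindex[OF inj] cong: sum.cong)
    then have "(\<Sum>T\<in>Xs. fs (c (i T)) T) = 0" by (simp add: fun_eq_iff fs_sum_apply)
    then have "c (i T) = 0" if "T \<in> Xs" for T
      using F.independentD[OF Xs(3,2), of "\<lambda>T. c (i T)"] that by auto
    then show "\<forall>h\<in>i ` Xs. c h = 0" by auto
  next
    fix a
    show "(\<Sum>h\<in>i ` Xs. q (op h) * Fr (op h a)) = 0"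
      using q[of a] i by (simp add: sum.reindex[OF inj] cong: sum.cong)
  qed
  then show ?thesis using i T by auto
qed

section \<open>The characters in the image of H and their independence\<close>

definition chars :: "('a \<Rightarrow> 'a) set" where
  "chars = {g \<in> ops. (\<forall>a b. g (a * b) = g a * g b) \<and> g 1 = 1}"

lemma charsD:
  assumes "g \<in> chars"
  shows "g \<in> ops" "g (a * b) = g a * g b" "g 1 = 1" "g (a + b) = g a + g b" "g (s c a) = s c (g a)"
  using assms opsD by (auto simp: chars_def)

text \<open>If g t = 0 with t nonzero, then g vanishes on tA_0, and
  \<open>op_relation_extend\<close> makes it vanish at 1.\<close>

lemma chars_inj_ring_hom:
  assumes g: "g \<in> chars"
  shows "inj_ring_hom g"
proof -
  obtain h where h: "h \<in> C" "g = op h" using g by (auto simp: chars_def ops_def)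
  have "t = 0" if t: "g t = 0" for t
  proof (rule ccontr)
    assume "t \<noteq> 0"
    then have "(\<Sum>h\<in>{h}. 1 * Fr (op h 1)) = 0"
      by (rule op_relation_extend) (use h t charsD(2)[OF g] in \<open>auto simp: Fr_simps\<close>)
    then show False using charsD(3)[OF g] h by (simp add: Fr_simps)
  qed
  then show ?thesis using charsD[OF g] by (auto simp: inj_ring_hom_def)
qed

text \<open>Dedekind's argument: the relation at b a minus g b times the relation at a no longer
  involves g, and some b separates g from any other character.\<close>

lemma characters_independent:
  assumes "finite Xs" "\<And>g a b. g \<in> Xs \<Longrightarrow> g (a * b) = g a * (g b :: 'a)" "\<And>g. g \<in> Xs \<Longrightarrow> g 1 = 1"
    and "\<And>a. (\<Sum>g\<in>Xs. q g * Fr (g a)) = 0"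
  shows "\<forall>g\<in>Xs. q g = 0"
  using assms
proof (induction Xs arbitrary: q rule: finite_induct)
  case (insert g Xs)
  have shorter: "\<forall>h\<in>Xs. q h * (Fr (h b) - Fr (g b)) = 0" for b
  proof (rule insert.IH)
    fix a
    have "0 = (\<Sum>h\<in>insert g Xs. q h * Fr (h (b * a))) - Fr (g b) * (\<Sum>h\<in>insert g Xs. q h * Fr (h a))"
      by (simp add: insert.prems(3))
    also have "\<dots> = (\<Sum>h\<in>insert g Xs. q h * (Fr (h b) - Fr (g b)) * Fr (h a))"
      unfolding sum_distrib_left sum_subtractf[symmetric]
      by (rule sum.cong[OF refl]) (simp add: insert.prems(1) Fr_simps algebra_simps)
    also have "\<dots> = (\<Sum>h\<in>Xs. q h * (Fr (h b) - Fr (g b)) * Fr (h a))"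
      using insert.hyps by simp
    finally show "\<dots> = 0" by simp
  qed (use insert.prems in auto)
  then have Xs0: "q h = 0" if "h \<in> Xs" for h
  proof -
    have "h \<noteq> g" using that insert.hyps(2) by auto
    then obtain b where "h b \<noteq> g b" by auto
    then show ?thesis using bspec[OF shorter[of b] that] by (simp add: Fr_eq_iff)
  qed
  have "(\<Sum>h\<in>insert g Xs. q h * Fr (h 1)) = q g * Fr (g 1)"
    using insert.hyps Xs0 by simp
  then have "q g = 0" using insert.prems(2)[of g] insert.prems(3)[of 1] by (simp add: Fr_simps)
  then show ?case using Xs0 by auto
qed simp

lemma chars_independent: "F.independent chars"
  unfolding F.independent_explicit_module
proof (intro allI impI)
  fix Xs u g assume Xs: "finite Xs" "Xs \<subseteq> chars" "(\<Sum>v\<in>Xs. fs (u v) v) = 0" "g \<in> Xs"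
  have "\<forall>g\<in>Xs. Fr (s (u g) 1) = 0"
  proof (rule characters_independent[OF Xs(1)])
    fix a
    have "(\<Sum>g\<in>Xs. s (u g) (g a)) = 0" using fun_cong[OF Xs(3), of a] fs_sum_apply[of u "\<lambda>T. T"] by simp
    then have "Fr (\<Sum>g\<in>Xs. s (u g) (g a)) = 0" by (simp add: Fr_simps)
    then show "(\<Sum>g\<in>Xs. Fr (s (u g) 1) * Fr (g a)) = 0" unfolding Fr_sum Fr_s[of _ "_ a", symmetric] .
  qed (use Xs charsD in blast)+
  then show "u g = 0" using Xs(4) by (simp add: Fr_eq_0_iff)
qed

lemma chars_subset: "chars \<subseteq> ops" by (auto simp: chars_def)

lemma finite_chars: "finite chars"
  using F.independent_span_bound[OF finite_op_E chars_independent] chars_subset ops_span by blast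

lemma span_chars_subset: "F.span chars \<subseteq> ops"
  by (rule F.span_minimal[OF chars_subset subspace_ops])

text \<open>
  If \<open>T\<close> spans an eigenline for the comultiplication modulo \<open>k\<Gamma>\<close>, \<open>\<Gamma>\<close> the characters, then coassociativity
  and commutativity of \<open>A\<^sub>0\<close> determine \<open>T(ab)\<close> up to a twisted derivation, which vanishes.
\<close>

lemma eigen_in_span_chars:
  assumes T: "T \<in> ops" and \<chi>: "\<chi> \<in> ops" and d: "\<And>g. g \<in> chars \<Longrightarrow> d g \<in> ops"
    and eq: "\<And>a b. T (a * b) = \<chi> a * T b + (\<Sum>g\<in>chars. d g a * g b)"
  shows "T \<in> F.span chars"
proof (rule ccontr)
  assume nT: "T \<notin> F.span chars"
  then have Tn: "T \<notin> chars" using F.span_base by blast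
  \<comment> \<open>Being outside the k-span, T is independent of the characters over the fraction
    field as well, so coefficients can be compared.\<close>
  have ind: "q = 0 \<and> (\<forall>g\<in>chars. r g = 0)"
    if *: "\<And>c. Fr q * Fr (T c) + (\<Sum>g\<in>chars. Fr (r g) * Fr (g c)) = 0" for q r
  proof -
    let ?q = "\<lambda>g. if g = T then Fr q else Fr (r g)"
    have "(\<Sum>g\<in>insert T chars. ?q g * Fr (g c)) = Fr q * Fr (T c) + (\<Sum>g\<in>chars. Fr (r g) * Fr (g c))" for c
      using finite_chars Tn by (auto intro!: sum.cong)
    then have z: "\<And>g. g \<in> insert T chars \<Longrightarrow> ?q g = 0"
      using * by (intro ops_independent[of "insert T chars" ?q])
        (use T chars_subset finite_chars F.independent_insertI[OF nT chars_independent] in auto)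
    from z[of T] have "q = 0" by (simp add: Fr_eq_0_iff)
    moreover have "r g = 0" if "g \<in> chars" for g using z[of g] that Tn by (auto simp: Fr_eq_0_iff split: if_splits)
    ultimately show ?thesis by blast
  qed
  have coeffs: "x = x' \<and> (\<forall>g\<in>chars. y g = y' g)"
    if "\<And>c. x * T c + (\<Sum>g\<in>chars. y g * g c) = x' * T c + (\<Sum>g\<in>chars. y' g * g c)" for x x' y y'
  proof -
    have "x - x' = 0 \<and> (\<forall>g\<in>chars. y g - y' g = 0)"
    proof (rule ind)
      fix c
      have "(x - x') * T c + (\<Sum>g\<in>chars. (y g - y' g) * g c) = 0"
        using that[of c] by (simp add: algebra_simps sum_subtractf)
      then have "Fr ((x - x') * T c + (\<Sum>g\<in>chars. (y g - y' g) * g c)) = 0" by (simp add: Fr_simps)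
      then show "Fr (x - x') * Fr (T c) + (\<Sum>g\<in>chars. Fr (y g - y' g) * Fr (g c)) = 0"
        by (simp add: Fr_simps Fr_sum)
    qed
    then show ?thesis by auto
  qed
  \<comment> \<open>Expanding T (a b c) in two ways makes \<chi> multiplicative and
    \<open>d g\<close> a skew derivation with respect to \<chi> and g.\<close>
  have assoc: "\<chi> (a * b) = \<chi> a * \<chi> b \<and> (\<forall>g\<in>chars. d g (a * b) = \<chi> a * d g b + d g a * g b)" for a b
  proof (rule coeffs)
    fix c
    have "\<chi> (a * b) * T c + (\<Sum>g\<in>chars. d g (a * b) * g c) = T (a * (b * c))"
      by (simp add: mult.assoc[symmetric] eq[of "a * b" c])
    also have "\<dots> = \<chi> a * (\<chi> b * T c + (\<Sum>g\<in>chars. d g b * g c)) + (\<Sum>g\<in>chars. d g a * (g b * g c))"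
      unfolding eq[of a] eq[of b c] by (simp add: charsD(2))
    also have "\<dots> = \<chi> a * \<chi> b * T c + (\<Sum>g\<in>chars. (\<chi> a * d g b + d g a * g b) * g c)"
      by (simp add: algebra_simps sum.distrib sum_distrib_left)
    finally show "\<chi> (a * b) * T c + (\<Sum>g\<in>chars. d g (a * b) * g c) = \<dots>" .
  qed
  have one: "\<chi> 1 = 1"
    using coeffs[of "\<chi> 1" "\<lambda>g. d g 1" 1 "\<lambda>_. 0"] eq[of 1] by simp
  have \<chi>c: "\<chi> \<in> chars" using \<chi> assoc one by (simp add: chars_def)
  \<comment> \<open>For g = \<chi> both twists agree, and operators of H are linear over invariant
    fractions.\<close>
  have d\<chi>: "d \<chi> a = 0" for a
  proof (rule twisted_derivation_zero[where n = "Suc 0" and g = \<chi> and d = "d \<chi>"])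
    show "inj_ring_hom \<chi>" by (rule chars_inj_ring_hom[OF \<chi>c])
    show "twisted_derivation \<chi> (d \<chi>)"
      using assoc \<chi>c opsD(1)[OF d[OF \<chi>c]] by (auto simp: twisted_derivation_def algebra_simps)
    have *: "T (red W) * red Y = T (red Y) * red W" if "inv_fraction (Suc 0) Y W Y' W'" "T \<in> ops" for T Y W Y' W'
      using lead_inv_fraction[OF _ that(1), of _ 1] that(2) by (auto simp: ops_def divs_0)
    show "\<chi> (red W) * red Y = \<chi> (red Y) * red W" "d \<chi> (red W) * red Y = d \<chi> (red Y) * red W"
      if "inv_fraction (Suc 0) Y W Y' W'" for Y W Y' W'
      using *[OF that] \<chi> d[OF \<chi>c] by auto
  qed
  have "\<exists>c. \<forall>a. d g a = s c (g a - \<chi> a)" if g: "g \<in> chars" "g \<noteq> \<chi>" for g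
  proof -
    \<comment> \<open>Comparing \<open>d g\<close> at a b and at b a; consequently
      \<open>d g\<close> is q (g - \<chi>) with q in the fraction field.\<close>
    have sym: "d g a * (g b - \<chi> b) = d g b * (g a - \<chi> a)" for a b
      using bspec[OF conjunct2[OF assoc[of a b]] g(1)] bspec[OF conjunct2[OF assoc[of b a]] g(1)]
      by (simp add: mult.commute[of b a] algebra_simps)
    obtain b where b: "g b \<noteq> \<chi> b" using g(2) by auto
    define q where "q = Fr (d g b) / Fr (g b - \<chi> b)"
    have nz: "Fr (g b - \<chi> b) \<noteq> 0" using b by (simp add: Fr_eq_0_iff)
    have dq: "Fr (d g a) = q * Fr (g a) - q * Fr (\<chi> a)" for a
    proof -
      have "Fr (d g a) * Fr (g b - \<chi> b) = Fr (d g b) * Fr (g a - \<chi> a)"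
        using sym[of a b] by (simp flip: Fr_simps(2))
      then have "Fr (d g a) = q * Fr (g a - \<chi> a)" using nz by (simp add: q_def eq_divide_eq)
      then show ?thesis by (simp add: Fr_simps(3) right_diff_distrib)
    qed
    \<comment> \<open>The relation d g = q g - q \<chi> over the fraction field forces a relation
      over k.\<close>
    have dspan: "d g \<in> F.span chars"
    proof (rule ccontr)
      assume n: "d g \<notin> F.span chars"
      then have dn: "d g \<notin> chars" using F.span_base by blast
      let ?q = "\<lambda>T. if T = d g then 1 else if T = g then - q else if T = \<chi> then q else 0"
      have "?q (d g) = 0"
      proof (rule ops_independent[where q = ?q and Xs = "insert (d g) chars"])
        show "insert (d g) chars \<subseteq> ops" "finite (insert (d g) chars)" "F.independent (insert (d g) chars)"
          using d[OF g(1)] chars_subset finite_chars F.independent_insertI[OF n chars_independent] by auto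
        fix a
        have "(\<Sum>T\<in>chars. ?q T * Fr (T a)) = (\<Sum>T\<in>chars. (if T = g then - q * Fr (g a) else 0) + (if T = \<chi> then q * Fr (\<chi> a) else 0))"
          using dn g(2) by (intro sum.cong) auto
        also have "\<dots> = - q * Fr (g a) + q * Fr (\<chi> a)"
          using g(1) \<chi>c finite_chars by (simp add: sum.distrib)
        finally show "(\<Sum>T\<in>insert (d g) chars. ?q T * Fr (T a)) = 0"
          using finite_chars dn by (simp add: dq)
      qed simp
      then show False by simp
    qed
    define r where "r = F.representation chars (d g)"
    have rep: "d g = (\<Sum>h\<in>chars. fs (r h) h)"
      unfolding r_def by (rule F.sum_representation_eq[OF chars_independent dspan finite_chars subset_refl, symmetric])
    have rep_a: "Fr (d g a) = (\<Sum>h\<in>chars. Fr (s (r h) 1) * Fr (h a))" for a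
      using fun_cong[OF rep, of a] fs_sum_apply[of r "\<lambda>h. h" chars a]
      by (simp add: Fr_sum Fr_s[of _ "_ a", symmetric])
    \<comment> \<open>The difference of the two expansions of \<open>d g\<close> in characters, over
      k and over the fraction field. Its vanishing at g says that q is the scalar
      \<open>r g\<close>.\<close>
    let ?q = "\<lambda>h. Fr (s (r h) 1) - (if h = g then q else 0) + (if h = \<chi> then q else 0)"
    have "\<forall>h\<in>chars. ?q h = 0"
    proof (rule characters_independent[OF finite_chars])
      fix a
      have "(\<Sum>h\<in>chars. ?q h * Fr (h a)) = (\<Sum>h\<in>chars. Fr (s (r h) 1) * Fr (h a)
          - (if h = g then q * Fr (g a) else 0) + (if h = \<chi> then q * Fr (\<chi> a) else 0))"
        by (rule sum.cong[OF refl]) (auto simp: algebra_simps)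
      also have "\<dots> = Fr (d g a) - q * Fr (g a) + q * Fr (\<chi> a)"
        using g(1) \<chi>c finite_chars by (simp add: sum.distrib sum_subtractf rep_a)
      finally show "(\<Sum>h\<in>chars. ?q h * Fr (h a)) = 0" by (simp add: dq)
    qed (use charsD in blast)+
    then have "q = Fr (s (r g) 1)" using g by auto
    then have "Fr (d g a) = Fr (s (r g) (g a - \<chi> a))" for a
      unfolding dq Fr_s[of _ "g a - \<chi> a"] by (simp add: Fr_simps algebra_simps)
    then show ?thesis using Fr_eq_iff by blast
  qed
  then obtain c where c: "\<And>g a. g \<in> chars \<Longrightarrow> g \<noteq> \<chi> \<Longrightarrow> d g a = s (c g) (g a - \<chi> a)" by metis
  obtain t where t: "T 1 = s t 1" using opsD(3)[OF T] by blast
  define r where "r = (\<lambda>g. if g = \<chi> then 0 else c g)"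
  have "T a = s t (\<chi> a) + (\<Sum>g\<in>chars. s (r g) (g a - \<chi> a))" for a
  proof -
    \<comment> \<open>Putting b = 1 expresses T by \<chi> and the maps \<open>d g\<close>.\<close>
    have "T a = \<chi> a * T 1 + (\<Sum>g\<in>chars. d g a * g 1)" using eq[of a 1] by simp
    also have "\<chi> a * T 1 = s t (\<chi> a)" by (simp add: t mult_s)
    also have "(\<Sum>g\<in>chars. d g a * g 1) = (\<Sum>g\<in>chars. s (r g) (g a - \<chi> a))"
      by (rule sum.cong) (auto simp: r_def charsD(3) c d\<chi>)
    finally show ?thesis .
  qed
  then have "T = fs t \<chi> + (\<Sum>g\<in>chars. fs (r g) (g - \<chi>))"
    by (simp add: fun_eq_iff sum_fun_apply fs_def)
  also have "\<dots> \<in> F.span chars"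
    using \<chi>c by (intro F.span_add F.span_sum F.span_scale F.span_diff F.span_base)
  finally show False using nT by blast
qed

end

section \<open>Common eigenvectors of the contracted comultiplication\<close>

locale closed_hopf_quantization = central_hopf_quantization s sc mul unit hb red H act E cf
  for s :: "'k::alg_closed_field \<Rightarrow> 'a::idom \<Rightarrow> 'a" and sc :: "'k \<Rightarrow> 'u::ab_group_add \<Rightarrow> 'u"
    and mul :: "'u \<Rightarrow> 'u \<Rightarrow> 'u" (infixl \<open>\<star>\<close> 70) and unit :: 'u
    and hb :: "'u \<Rightarrow> 'u" and red :: "'u \<Rightarrow> 'a"
    and H :: "('k, 'h, 'm) hopf_scheme" and act :: "'h \<Rightarrow> 'u \<Rightarrow> 'u" and E cf
begin

theorem ops_eq_span_chars: "ops = F.span chars"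
proof (rule ccontr)
  assume neq: "ops \<noteq> F.span chars"
  let ?W = "F.span chars"
  obtain B where B: "B \<subseteq> ops" "F.independent B" "ops \<subseteq> F.span B"
    by (rule F.basis_exists[of ops])
  have finB: "finite B" using F.independent_span_bound[OF finite_op_E B(2) subset_trans[OF B(1) ops_span]] by blast
  \<comment> \<open>A k-basis of the image remains independent over the fraction field, so
    coefficients in A_0 are unique.\<close>
  have uniq: "x e = y e" if eq: "\<And>a. (\<Sum>e\<in>B. e a * x e) = (\<Sum>e\<in>B. e a * y e)" and e: "e \<in> B" for x y e
  proof -
    have "Fr (x e - y e) = 0"
    proof (rule ops_independent[OF B(1) finB B(2) _ e])
      fix a
      have "(\<Sum>e\<in>B. (x e - y e) * e a) = 0"
        using eq[of a] by (simp add: algebra_simps sum_subtractf)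
      then have "Fr (\<Sum>e\<in>B. (x e - y e) * e a) = 0" by (simp add: Fr_simps)
      then show "(\<Sum>e\<in>B. Fr (x e - y e) * Fr (e a)) = 0" unfolding Fr_sum Fr_simps(2) .
    qed
    then show ?thesis by (simp add: Fr_eq_0_iff)
  qed
  have rep: "T a = (\<Sum>e\<in>B. s (F.representation B T e) (e a))" if "T \<in> ops" for T a
  proof -
    have "T = (\<Sum>e\<in>B. fs (F.representation B T e) e)"
      using F.sum_representation_eq[OF B(2) _ finB subset_refl, of T] that B(3) by auto
    then show ?thesis using fs_sum_apply[of "F.representation B T" "\<lambda>e. e" B a] by metis
  qed
  \<comment> \<open>\<open>D e\<close> contracts the first leg of the comultiplication with the
    coordinate function of e.\<close>
  have "\<exists>D. \<forall>e\<in>B. D e \<in> ops \<and> (\<forall>a b. T (a * b) = (\<Sum>e\<in>B. e a * D e b))" if T: "T \<in> ops" for T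
  proof -
    obtain h where h: "h \<in> C" "T = op h" using T by (auto simp: ops_def)
    let ?t = "SOME t. t \<in> comul H h"
    let ?r = "\<lambda>p e. F.representation B (op (fst p)) e"
    define D where "D = (\<lambda>e. \<Sum>p\<in>Poly_Mapping.keys ?t. fs (Poly_Mapping.lookup ?t p * ?r p e) (op (snd p)))"
    have opk: "op (fst p) \<in> ops" "op (snd p) \<in> ops" if "p \<in> Poly_Mapping.keys ?t" for p
      using keys_comul[OF h(1) that] by (auto simp: ops_def)
    have "D e \<in> ops" for e
      unfolding D_def using opk by (intro F.subspace_sum[OF subspace_ops] F.subspace_scale[OF subspace_ops]) auto
    moreover have "T (a * b) = (\<Sum>e\<in>B. e a * D e b)" for a b
    proof -
      have "T (a * b) = (\<Sum>p\<in>Poly_Mapping.keys ?t. s (Poly_Mapping.lookup ?t p) (op (fst p) a * op (snd p) b))"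
        unfolding h(2) op_mul[OF h(1)] sw_def pm_sum_def ..
      also have "\<dots> = (\<Sum>p\<in>Poly_Mapping.keys ?t. \<Sum>e\<in>B. e a * s (Poly_Mapping.lookup ?t p * ?r p e) (op (snd p) b))"
      proof (rule sum.cong[OF refl])
        fix p assume "p \<in> Poly_Mapping.keys ?t"
        then have "op (fst p) a = (\<Sum>e\<in>B. s (?r p e) (e a))" using rep opk by blast
        then show "s (Poly_Mapping.lookup ?t p) (op (fst p) a * op (snd p) b) =
            (\<Sum>e\<in>B. e a * s (Poly_Mapping.lookup ?t p * ?r p e) (op (snd p) b))"
          by (simp add: sum_distrib_right S.scale_sum_right s_mult mult_s)
      qed
      also have "\<dots> = (\<Sum>e\<in>B. e a * D e b)"
        by (subst sum.swap) (simp add: D_def fs_sum_apply sum_distrib_left)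
      finally show ?thesis .
    qed
    ultimately show ?thesis by blast
  qed
  then obtain D where D: "\<And>T e. T \<in> ops \<Longrightarrow> e \<in> B \<Longrightarrow> D T e \<in> ops"
    and Dmul: "\<And>T a b. T \<in> ops \<Longrightarrow> T (a * b) = (\<Sum>e\<in>B. e a * D T e b)"
  proof -
    assume *: "\<And>D. (\<And>T e. T \<in> ops \<Longrightarrow> e \<in> B \<Longrightarrow> D T e \<in> ops) \<Longrightarrow>
      (\<And>T a b. T \<in> ops \<Longrightarrow> T (a * b) = (\<Sum>e\<in>B. e a * D T e b)) \<Longrightarrow> thesis"
    assume ex: "\<And>T. T \<in> ops \<Longrightarrow> \<exists>D. \<forall>e\<in>B. D e \<in> ops \<and> (\<forall>a b. T (a * b) = (\<Sum>e\<in>B. e a * D e b))"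
    have B0: "B \<noteq> {}"
    proof
      assume "B = {}"
      then have "ops \<subseteq> {0}" using B(3) by simp
      then have "ops = ?W" using subset_antisym[OF _ span_chars_subset] F.span_zero by blast
      then show False using neq by simp
    qed
    then have "\<exists>D. \<forall>T\<in>ops. (\<forall>e\<in>B. D T e \<in> ops) \<and> (\<forall>a b. T (a * b) = (\<Sum>e\<in>B. e a * D T e b))"
      using ex by (intro bchoice) blast
    then show thesis using * by blast
  qed
  have DI: "D T e = T'" if "T \<in> ops" "e \<in> B" "\<And>a b. T (a * b) = (\<Sum>e\<in>B. e a * f e b)" "f e = T'" for T e f T'
  proof (rule ext)
    fix b
    have "D T e b = f e b" by (rule uniq[OF _ that(2)]) (simp add: Dmul[OF that(1), symmetric] that(3))
    then show "D T e b = T' b" using that(4) by simp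
  qed
  have D_add: "D (T + T') e = D T e + D T' e" if "T \<in> ops" "T' \<in> ops" "e \<in> B" for T T' e
    by (rule DI[of "T + T'" e "\<lambda>e. D T e + D T' e"])
      (use that in \<open>auto simp: Dmul sum.distrib algebra_simps F.subspace_add[OF subspace_ops]\<close>)
  have D_scale: "D (fs c T) e = fs c (D T e)" if "T \<in> ops" "e \<in> B" for c T e
    by (rule DI[of "fs c T" e "\<lambda>e. fs c (D T e)"])
      (use that in \<open>auto simp: Dmul fs_def S.scale_sum_right s_mult mult_s F.subspace_scale[OF subspace_ops, unfolded fs_def]\<close>)
  \<comment> \<open>From T (a (b c)) = T (b (a c)): coefficients are compared in a and then in
    b.\<close>
  have D_comm: "D (D T e) e' = D (D T e') e" if T: "T \<in> ops" and e: "e \<in> B" "e' \<in> B" for T e e'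
  proof (rule ext)
    fix c
    have 1: "(\<Sum>e'\<in>B. e' b * D (D T e) e' c) = (\<Sum>e'\<in>B. e' b * D (D T e') e c)" if e: "e \<in> B" for b e
    proof (rule uniq[OF _ e])
      fix a
      have "(\<Sum>e\<in>B. e a * (\<Sum>e'\<in>B. e' b * D (D T e) e' c)) = T (a * (b * c))"
        unfolding Dmul[OF T, of a] by (rule sum.cong[OF refl]) (simp add: Dmul[OF D[OF T]])
      also have "\<dots> = T (b * (a * c))" by (simp add: mult_ac)
      also have "\<dots> = (\<Sum>e'\<in>B. e' b * (\<Sum>e\<in>B. e a * D (D T e') e c))"
        unfolding Dmul[OF T, of b] by (rule sum.cong[OF refl]) (simp add: Dmul[OF D[OF T]])
      also have "\<dots> = (\<Sum>e\<in>B. e a * (\<Sum>e'\<in>B. e' b * D (D T e') e c))"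
        unfolding sum_distrib_left by (subst sum.swap) (simp add: mult_ac)
      finally show "(\<Sum>e\<in>B. e a * (\<Sum>e'\<in>B. e' b * D (D T e) e' c)) = \<dots>" .
    qed
    show "D (D T e) e' c = D (D T e') e c" by (rule uniq[OF 1[OF e(1)] e(2)])
  qed
  \<comment> \<open>Every character is an eigenvector of all contractions, so their span is
    stable.\<close>
  have D_span: "D T e \<in> ?W" if T: "T \<in> ?W" and e: "e \<in> B" for T e
  proof -
    have "chars \<subseteq> {T \<in> ops. D T e \<in> ?W}"
    proof
      fix g assume g: "g \<in> chars"
      have "D g e = fs (F.representation B g e) g"
      proof (rule DI[of g e "\<lambda>e. fs (F.representation B g e) g"])
        fix a b
        have "g (a * b) = (\<Sum>e\<in>B. s (F.representation B g e) (e a)) * g b"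
          using rep[of g a] charsD(1,2)[OF g] by simp
        then show "g (a * b) = (\<Sum>e\<in>B. e a * fs (F.representation B g e) g b)"
          by (simp add: sum_distrib_right s_mult fs_def mult.commute[of _ "s _ _"]) (simp add: mult.commute)
      qed (use g e charsD in auto)
      then show "g \<in> {T \<in> ops. D T e \<in> ?W}"
        using g charsD(1) by (auto intro: F.span_scale F.span_base)
    qed
    moreover have "F.subspace {T \<in> ops. D T e \<in> ?W}"
    proof (rule F.subspaceI)
      have 0: "(0 :: 'a \<Rightarrow> 'a) \<in> ops" by (rule F.subspace_0[OF subspace_ops])
      have "D 0 e = 0" using D_scale[OF 0 e, of 0] by simp
      then show "0 \<in> {T \<in> ops. D T e \<in> ?W}" using 0 F.span_zero by simp
    qed (auto simp: D_add D_scale e F.span_add F.span_scale F.subspace_add[OF subspace_ops] F.subspace_scale[OF subspace_ops])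
    ultimately have "?W \<subseteq> {T \<in> ops. D T e \<in> ?W}" by (rule F.span_minimal)
    then show ?thesis using T by blast
  qed
  \<comment> \<open>Induction over the basis: V properly contains the span of the characters, is
    stable under all contractions, and those treated so far act on the quotient by scalars.\<close>
  have "\<exists>V l. F.subspace V \<and> ?W \<subset> V \<and> V \<subseteq> ops \<and> (\<forall>e\<in>B. \<forall>T\<in>V. D T e \<in> V) \<and>
      (\<forall>e\<in>A. \<forall>T\<in>V. D T e - fs (l e) T \<in> ?W)" if "finite A" "A \<subseteq> B" for A
    using that
  proof (induction A rule: finite_induct)
    case empty
    show ?case
      by (rule exI[of _ ops]) (use subspace_ops span_chars_subset neq D in auto)
  next
    case (insert e A)
    have "A \<subseteq> B" using insert.prems by simp
    from insert.IH[OF this] obtain V l where V': "F.subspace V" "?W \<subset> V" "V \<subseteq> ops" "\<forall>e\<in>B. \<forall>T\<in>V. D T e \<in> V"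
      and l': "\<forall>e\<in>A. \<forall>T\<in>V. D T e - fs (l e) T \<in> ?W" by (elim exE conjE)
    have V4: "\<And>e T. e \<in> B \<Longrightarrow> T \<in> V \<Longrightarrow> D T e \<in> V"
      and l: "\<And>e T. e \<in> A \<Longrightarrow> T \<in> V \<Longrightarrow> D T e - fs (l e) T \<in> ?W" using V'(4) l' by blast+
    note V = V'(1-3) V4
    have e: "e \<in> B" using insert by simp
    obtain T0 where T0: "T0 \<in> V" "T0 \<notin> ?W" using V(2) by blast
    have DV: "\<And>T. T \<in> V \<Longrightarrow> T \<in> ops" using V(3) by blast
    have "\<exists>m T. T \<in> V \<and> T \<notin> ?W \<and> D T e - fs m T \<in> ?W"
      by (rule eigenvector_modulo[OF vector_space_fs V(1) F.subspace_span finite_op_E subset_trans[OF V(3) ops_span] _ _ _ T0])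
        (simp_all add: V(4) e D_add D_scale DV)
    then obtain m T where T: "T \<in> V" "T \<notin> ?W" "D T e - fs m T \<in> ?W" by blast
    \<comment> \<open>The eigenspace of the next contraction modulo the span of the characters. The
      other contractions preserve it, since they commute with this one and preserve the
      span.\<close>
    define V1 where "V1 = {T \<in> V. D T e - fs m T \<in> ?W}"
    have "F.subspace V1"
    proof (rule F.subspaceI)
      have "D 0 e = 0" using D_scale[OF F.subspace_0[OF subspace_ops] e, of 0] by simp
      then show "0 \<in> V1" using F.subspace_0[OF V(1)] F.span_zero by (simp add: V1_def)
    next
      fix T T' assume T: "T \<in> V1" "T' \<in> V1"
      then have "D (T + T') e - fs m (T + T') = (D T e - fs m T) + (D T' e - fs m T')"
        by (simp add: V1_def D_add DV e F.scale_right_distrib algebra_simps)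
      also have "\<dots> \<in> ?W" using T by (intro F.span_add) (auto simp: V1_def)
      finally show "T + T' \<in> V1" using T F.subspace_add[OF V(1)] by (simp add: V1_def)
    next
      fix c T assume T: "T \<in> V1"
      then have "D (fs c T) e - fs m (fs c T) = fs c (D T e - fs m T)"
        by (simp add: V1_def D_scale DV e F.scale_right_diff_distrib F.scale_left_commute)
      also have "\<dots> \<in> ?W" using T by (intro F.span_scale) (auto simp: V1_def)
      finally show "fs c T \<in> V1" using T F.subspace_scale[OF V(1)] by (simp add: V1_def)
    qed
    moreover have "?W \<subset> V1"
    proof -
      have "?W \<subseteq> V1"
        using V(2) D_span[OF _ e] by (auto simp: V1_def intro: F.span_diff F.span_scale)
      then show ?thesis using T by (auto simp: V1_def)
    qed
    moreover have "V1 \<subseteq> ops" using V(3) by (auto simp: V1_def)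
    moreover have "D T e' \<in> V1" if "e' \<in> B" "T \<in> V1" for e' T
    proof -
      have T: "T \<in> V" "D T e - fs m T \<in> ?W" using that(2) by (auto simp: V1_def)
      have Tm: "D T e \<in> ops" "T \<in> ops" using T V(4)[OF e] DV by auto
      have "D (D T e') e - fs m (D T e') = D (D T e) e' + fs (- m) (D T e')"
        using D_comm[OF Tm(2) that(1) e] by (simp add: F.scale_minus_left)
      also have "\<dots> = D (D T e + fs (- m) T) e'"
        by (simp only: D_add[OF Tm(1) F.subspace_scale[OF subspace_ops Tm(2)] that(1)] D_scale[OF Tm(2) that(1)])
      also have "\<dots> \<in> ?W" using T(2) by (intro D_span that(1)) (simp add: F.scale_minus_left)
      finally show ?thesis using V(4)[OF that(1) T(1)] by (simp add: V1_def)
    qed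
    moreover have "D T e' - fs ((l(e := m)) e') T \<in> ?W" if "e' \<in> insert e A" "T \<in> V1" for e' T
      using that l[of e' T] by (auto simp: V1_def)
    ultimately show ?case by (intro exI[of _ V1] exI[of _ "l(e := m)"]) blast
  qed
  from this[OF finB subset_refl] obtain V l where V: "F.subspace V" "?W \<subset> V" "V \<subseteq> ops"
    and l: "\<And>e T. e \<in> B \<Longrightarrow> T \<in> V \<Longrightarrow> D T e - fs (l e) T \<in> ?W" by metis
  obtain T where T: "T \<in> V" "T \<notin> ?W" using V(2) by blast
  have To: "T \<in> ops" using T V by blast
  define r where "r = (\<lambda>e. F.representation chars (D T e - fs (l e) T))"
  have w: "D T e b = s (l e) (T b) + (\<Sum>g\<in>chars. s (r e g) (g b))" if e: "e \<in> B" for e b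
  proof -
    have "D T e - fs (l e) T = (\<Sum>g\<in>chars. fs (r e g) g)"
      unfolding r_def
      by (rule F.sum_representation_eq[OF chars_independent l[OF e T(1)] finite_chars subset_refl, symmetric])
    from fun_cong[OF this, of b] show ?thesis
      using fs_sum_apply[of "r e" "\<lambda>g. g" chars b] by (simp add: fs_def algebra_simps)
  qed
  \<comment> \<open>The eigenvalues \<open>l\<close> assemble to the operator \<chi> and the
    remainders \<open>r\<close> to the operators d of the eigenline lemma.\<close>
  have "T \<in> ?W"
  proof (rule eigen_in_span_chars[OF To])
    show "(\<Sum>e\<in>B. fs (l e) e) \<in> ops" "(\<Sum>e\<in>B. fs (r e g) e) \<in> ops" for g
      using B(1) by (auto intro!: F.subspace_sum[OF subspace_ops] F.subspace_scale[OF subspace_ops])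
    fix a b
    have "T (a * b) = (\<Sum>e\<in>B. e a * s (l e) (T b)) + (\<Sum>e\<in>B. \<Sum>g\<in>chars. e a * s (r e g) (g b))"
      by (simp add: Dmul[OF To] w distrib_left sum.distrib sum_distrib_left)
    also have "(\<Sum>e\<in>B. e a * s (l e) (T b)) = (\<Sum>e\<in>B. fs (l e) e) a * T b"
      by (simp add: sum_fun_apply fs_def sum_distrib_right s_mult mult_s)
    also have "(\<Sum>e\<in>B. \<Sum>g\<in>chars. e a * s (r e g) (g b)) = (\<Sum>g\<in>chars. (\<Sum>e\<in>B. fs (r e g) e) a * g b)"
      by (subst sum.swap)
        (simp add: sum_fun_apply fs_def sum_distrib_right s_mult mult_s)
    finally show "T (a * b) = (\<Sum>e\<in>B. fs (l e) e) a * T b + (\<Sum>g\<in>chars. (\<Sum>e\<in>B. fs (r e g) e) a * g b)" .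
  qed
  then show False using T by blast
qed

section \<open>The characters form a finite group\<close>

lemma chars_comp: "g \<in> chars \<Longrightarrow> h \<in> chars \<Longrightarrow> g \<circ> h \<in> chars"
proof -
  assume g: "g \<in> chars" and h: "h \<in> chars"
  obtain x y where xy: "x \<in> C" "g = op x" "y \<in> C" "h = op y" using g h by (auto simp: chars_def ops_def)
  then have "g \<circ> h = op (x \<otimes>\<^bsub>H\<^esub> y)" by (simp add: fun_eq_iff op_mult)
  then have "g \<circ> h \<in> ops" using xy by (simp add: ops_def)
  then show ?thesis using charsD(2,3)[OF g] charsD(2,3)[OF h] by (simp add: chars_def)
qed

lemma chars_id: "id \<in> chars"
proof -
  have "id = op \<one>\<^bsub>H\<^esub>" by (simp add: op_one id_def)
  then have "id \<in> ops" by (simp add: ops_def)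
  then show ?thesis by (simp add: chars_def)
qed

text \<open>Composition with the injective map g is injective on a finite set of characters, hence
  surjective, and reaches the identity.\<close>

lemma chars_inverse:
  assumes g: "g \<in> chars"
  obtains g' where "g' \<in> chars" "g \<circ> g' = id" "g' \<circ> g = id"
proof -
  have inj: "inj g"
  proof (rule injI)
    fix a b assume "g a = g b"
    then have "g (a - b) = 0" using inj_ring_homD(7)[OF chars_inj_ring_hom[OF g], of a b] by simp
    then show "a = b" using inj_ring_homD(5)[OF chars_inj_ring_hom[OF g], of "a - b"] by simp
  qed
  have "inj_on ((\<circ>) g) chars" 
  proof (rule inj_onI, rule ext)
    fix h h' a assume "g \<circ> h = g \<circ> h'"
    then have "g (h a) = g (h' a)" by (metis comp_apply)
    then show "h a = h' a" using inj by (simp add: inj_eq)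
  qed
  moreover have "(\<circ>) g ` chars \<subseteq> chars" using chars_comp[OF g] by auto
  ultimately have "(\<circ>) g ` chars = chars" using endo_inj_surj[OF finite_chars] by blast
  then obtain g' where g': "g' \<in> chars" "g \<circ> g' = id" using chars_id by (metis (no_types, lifting) imageE)
  have "g (g' (g a)) = g a" for a using g'(2) by (metis comp_apply id_apply)
  then have "g' (g a) = a" for a using inj by (simp add: inj_eq)
  then have "g' \<circ> g = id" by (simp add: fun_eq_iff)
  then show ?thesis using g' that by blast
qed

end

context hopf
begin

lemma sw_tensor_lift:
  assumes "vector_space sc" "linear_on H sc F" "h \<in> C" "\<And>x y. x \<in> C \<Longrightarrow> y \<in> C \<Longrightarrow> f x y \<in> C"
  shows "F (tensor_lift H f (comul H h)) = sw H sc h (\<lambda>x y. F (f x y))" "tensor_lift H f (comul H h) \<in> C"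
proof -
  have ag: "abelian_group H" by unfold_locales
  show "F (tensor_lift H f (comul H h)) = sw H sc h (\<lambda>x y. F (f x y))"
    unfolding sw_def by (rule tensor_lift_linear[OF assms(1) ag assms(2)]) (auto intro: assms(4) keys_comul[OF assms(3)])
  show "tensor_lift H f (comul H h) \<in> C"
    by (rule tensor_lift_closed[OF ag]) (auto intro: assms(4) keys_comul[OF assms(3)])
qed

end

lemma vector_space_mult: "vector_space ((*) :: 'k::field \<Rightarrow> 'k \<Rightarrow> 'k)"
  by unfold_locales (simp_all add: algebra_simps)

section \<open>Vanishing of the kernel\<close>

context closed_hopf_quantization
begin

definition cg :: "('a \<Rightarrow> 'a) \<Rightarrow> 'h \<Rightarrow> 'k" where "cg g h = F.representation chars (op h) g"

lemma op_in_span: "h \<in> C \<Longrightarrow> op h \<in> F.span chars"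
  unfolding ops_eq_span_chars[symmetric] ops_def by simp

lemma op_cg: "h \<in> C \<Longrightarrow> op h = (\<Sum>g\<in>chars. fs (cg g h) g)"
  unfolding cg_def
  by (rule F.sum_representation_eq[OF chars_independent op_in_span finite_chars subset_refl, symmetric])

lemma op_cg_apply: "h \<in> C \<Longrightarrow> op h a = (\<Sum>g\<in>chars. s (cg g h) (g a))"
  using fun_cong[OF op_cg, of h a] fs_sum_apply[of "\<lambda>g. cg g h" "\<lambda>g. g" chars a] by simp

lemma linear_cg: "linear_on H (*) (cg g)"
  using F.representation_add[OF chars_independent op_in_span op_in_span]
    F.representation_scale[OF chars_independent op_in_span]
  by (simp add: linear_on_def cg_def lead_plus lead_smult divs_0 fun_eq_iff)

lemma chars_coeff_unique:
  assumes "\<And>a. (\<Sum>g\<in>chars. g a * x g) = (\<Sum>g\<in>chars. g a * y g)" "g \<in> chars"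
  shows "x g = y g"
proof -
  have "\<forall>g\<in>chars. Fr (x g - y g) = 0"
  proof (rule characters_independent[OF finite_chars])
    fix a
    have "(\<Sum>g\<in>chars. (x g - y g) * g a) = 0"
      using assms(1)[of a] by (simp add: algebra_simps sum_subtractf)
    then have "Fr (\<Sum>g\<in>chars. (x g - y g) * g a) = 0" by (simp add: Fr_simps)
    then show "(\<Sum>g\<in>chars. Fr (x g - y g) * Fr (g a)) = 0" unfolding Fr_sum Fr_simps(2) .
  qed (use charsD in blast)+
  then show ?thesis using assms(2) by (simp add: Fr_eq_0_iff)
qed

lemma cg_unique:
  assumes "h \<in> C" "\<And>a. op h a = (\<Sum>g\<in>chars. s (c g) (g a))" "g \<in> chars"
  shows "cg g h = c g"
proof -
  have "s (cg g h) 1 = s (c g) 1"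
  proof (rule chars_coeff_unique[OF _ assms(3), where x = "\<lambda>g. s (cg g h) 1" and y = "\<lambda>g. s (c g) 1"])
    fix a show "(\<Sum>g\<in>chars. g a * s (cg g h) 1) = (\<Sum>g\<in>chars. g a * s (c g) 1)"
      using assms(2)[of a] op_cg_apply[OF assms(1), of a] by (simp add: mult_s)
  qed
  then show ?thesis by simp
qed

text \<open>The value at a b is expanded once through the comultiplication and once through
  multiplicativity of the characters; coefficients are compared in a and then in b. This makes H
  \<rightarrow> k\<Gamma> a coalgebra map.\<close>

lemma cg_comul:
  assumes h: "h \<in> C" and g: "g \<in> chars" "g' \<in> chars"
  shows "sw H (*) h (\<lambda>x y. cg g x * cg g' y) = (if g = g' then cg g h else 0)"
proof -
  let ?K = "\<lambda>g g'. sw H (*) h (\<lambda>x y. cg g x * cg g' y)"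
  have swap: "sw H s h (\<lambda>x y. op x a * op y b) = (\<Sum>g\<in>chars. g a * (\<Sum>g'\<in>chars. s (?K g g') (g' b)))" for a b
  proof -
    have "sw H s h (\<lambda>x y. op x a * op y b) =
        sw H s h (\<lambda>x y. \<Sum>g\<in>chars. \<Sum>g'\<in>chars. s (cg g x * cg g' y) (g a * g' b))"
      by (rule sw_cong[OF h]) (simp add: op_cg_apply sum_product mult_s s_mult mult.commute)
    also have "\<dots> = (\<Sum>g\<in>chars. \<Sum>g'\<in>chars. s (?K g g') (g a * g' b))"
      unfolding sw_def pm_sum_def S.scale_sum_right S.scale_sum_left S.scale_scale
      by (subst sum.swap, rule sum.cong[OF refl], rule sum.swap)
    finally show ?thesis by (simp add: sum_distrib_left mult_s)
  qed
  have 1: "(\<Sum>g'\<in>chars. s (?K g g') (g' b)) = s (cg g h) (g b)" for b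
  proof (rule chars_coeff_unique[OF _ g(1)])
    fix a
    have "(\<Sum>g\<in>chars. g a * (\<Sum>g'\<in>chars. s (?K g g') (g' b))) = op h (a * b)"
      by (simp add: op_mul[OF h] swap)
    also have "\<dots> = (\<Sum>g\<in>chars. g a * s (cg g h) (g b))"
      by (simp add: op_cg_apply[OF h] charsD(2) mult_s)
    finally show "(\<Sum>g\<in>chars. g a * (\<Sum>g'\<in>chars. s (?K g g') (g' b))) = \<dots>" .
  qed
  have "s (?K g g') 1 = s (if g' = g then cg g h else 0) 1"
  proof (rule chars_coeff_unique[OF _ g(2)])
    fix b
    have "(\<Sum>g'\<in>chars. g' b * s (if g' = g then cg g h else 0) 1) = (\<Sum>g'\<in>chars. if g' = g then s (cg g h) (g b) else 0)"
      by (rule sum.cong) (auto simp: mult_s)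
    also have "\<dots> = s (cg g h) (g b)" using finite_chars g(1) by simp
    finally show "(\<Sum>g'\<in>chars. g' b * s (?K g g') 1) = (\<Sum>g'\<in>chars. g' b * s (if g' = g then cg g h else 0) 1)"
      using 1[of b] by (simp add: mult_s)
  qed
  then show ?thesis by (auto split: if_splits)
qed

lemma cg_counit: "h \<in> C \<Longrightarrow> (\<Sum>g\<in>chars. cg g h) = counit H h"
proof -
  assume h: "h \<in> C"
  have "s (\<Sum>g\<in>chars. cg g h) 1 = op h 1"
    by (simp add: op_cg_apply[OF h] S.scale_sum_left charsD(3))
  then show ?thesis using op_unit[OF h] by simp
qed

text \<open>Identifies the kernel of H \<rightarrow> k\<Gamma> inside the \<hbar>-adic filtration of
  H given by \<open>divs\<close>.\<close>

lemma divs_1_iff: "x \<in> C \<Longrightarrow> x \<in> divs (Suc 0) \<longleftrightarrow> (\<forall>g\<in>chars. cg g x = 0)"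
proof -
  assume x: "x \<in> C"
  have "x \<in> divs (Suc 0) \<longleftrightarrow> (\<forall>a. op x a = 0)"
    using op_red[OF x] red_surj x by (auto simp: divs_def dv_1) metis
  also have "\<dots> \<longleftrightarrow> (\<forall>g\<in>chars. cg g x = 0)"
    using cg_unique[OF x, of "\<lambda>_. 0"] op_cg_apply[OF x] by auto
  finally show ?thesis .
qed

lemma unit_vector:
  assumes g: "g \<in> chars"
  obtains u where "u \<in> C" "op u = g" "\<And>g'. g' \<in> chars \<Longrightarrow> cg g' u = (if g' = g then 1 else 0)"
proof -
  obtain u where u: "u \<in> C" "op u = g" using g by (auto simp: chars_def ops_def)
  have "cg g' u = (if g' = g then 1 else 0)" if "g' \<in> chars" for g'
  proof (rule cg_unique[OF u(1) _ that])
    fix a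
    have "(\<Sum>h\<in>chars. s (if h = g then 1 else 0) (h a)) = (\<Sum>h\<in>chars. if h = g then g a else 0)"
      by (rule sum.cong) auto
    then show "op u a = (\<Sum>h\<in>chars. s (if h = g then 1 else 0) (h a))"
      using finite_chars g u(2) by simp
  qed
  then show ?thesis using that u by blast
qed

text \<open>The component of degree g of x under the left coaction of k\<Gamma> on H;
  \<open>right_part\<close> belongs to the right coaction.\<close>

definition left_part :: "('a \<Rightarrow> 'a) \<Rightarrow> 'h \<Rightarrow> 'h" where
  "left_part g x = tensor_lift H (\<lambda>y z. cg g y \<odot>\<^bsub>H\<^esub> z) (comul H x)"

definition right_part :: "('a \<Rightarrow> 'a) \<Rightarrow> 'h \<Rightarrow> 'h" where
  "right_part g x = tensor_lift H (\<lambda>y z. cg g z \<odot>\<^bsub>H\<^esub> y) (comul H x)"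

lemma part_closed: "x \<in> C \<Longrightarrow> left_part g x \<in> C" "x \<in> C \<Longrightarrow> right_part g x \<in> C"
  unfolding left_part_def right_part_def
  by (rule sw_tensor_lift(2)[OF sc_space act_linear]; simp)+

lemma part_linear:
  assumes "vector_space sc'" "linear_on H sc' F" "x \<in> C"
  shows "F (left_part g x) = sw H sc' x (\<lambda>y z. sc' (cg g y) (F z))"
    and "F (right_part g x) = sw H sc' x (\<lambda>y z. sc' (cg g z) (F y))"
proof -
  have F: "\<And>c y. y \<in> C \<Longrightarrow> F (c \<odot>\<^bsub>H\<^esub> y) = sc' c (F y)" using assms(2) by (simp add: linear_on_def)
  show "F (left_part g x) = sw H sc' x (\<lambda>y z. sc' (cg g y) (F z))"
    unfolding left_part_def
    by (subst sw_tensor_lift(1)[OF assms]) (auto simp: F intro!: sw_cong assms(3))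
  show "F (right_part g x) = sw H sc' x (\<lambda>y z. sc' (cg g z) (F y))"
    unfolding right_part_def
    by (subst sw_tensor_lift(1)[OF assms]) (auto simp: F intro!: sw_cong assms(3))
qed

lemma lin_cg: "lin (\<lambda>x. sc (cg g x) v)" "lin G \<Longrightarrow> lin (\<lambda>x. sc c (G x))"
  using linear_cg[of g] by (auto simp: linear_on_def U.scale_left_distrib U.scale_right_distrib U.scale_left_commute)

text \<open>Coassociativity moves both coordinate functions to the legs of one element, where
  \<open>cg_comul\<close> makes them orthogonal idempotents. A linear \<open>F\<close> is applied
  because Sweedler sums live in spaces given by types.\<close>

lemma left_left_part:
  assumes F: "lin F" and x: "x \<in> C" and g: "g \<in> chars" "g' \<in> chars"
  shows "F (left_part g' (left_part g x)) = (if g = g' then F (left_part g x) else 0)"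
proof -
  have "F (left_part g' (left_part g x)) = (\<lambda>w. SW w (\<lambda>y z. sc (cg g' y) (F z))) (left_part g x)"
    by (rule part_linear(1)[OF sc_space F part_closed(1)[OF x]])
  also have "\<dots> = SW x (\<lambda>p q. sc (cg g p) (SW q (\<lambda>y z. sc (cg g' y) (F z))))"
    by (rule part_linear(1)[OF sc_space _ x]) (auto intro!: lin_rules lin_cg F simp del: U.scale_scale)
  also have "\<dots> = SW x (\<lambda>p q. SW q (\<lambda>y z. sc (cg g p) (sc (cg g' y) (F z))))"
    unfolding sw_def pm_sum_def U.scale_sum_right by (simp add: mult_ac)
  also have "\<dots> = SW x (\<lambda>w z. SW w (\<lambda>p y. sc (cg g p) (sc (cg g' y) (F z))))"
    by (rule coassoc[OF x, symmetric]) (auto intro!: lin_rules lin_cg F simp del: U.scale_scale)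
  also have "\<dots> = SW x (\<lambda>w z. sc (sw H (*) w (\<lambda>p y. cg g p * cg g' y)) (F z))"
    unfolding sw_def pm_sum_def U.scale_sum_left by simp
  also have "\<dots> = SW x (\<lambda>w z. if g = g' then sc (cg g w) (F z) else 0)"
    by (rule sw_cong[OF x]) (simp add: cg_comul g)
  also have "\<dots> = (if g = g' then F (left_part g x) else 0)"
    using part_linear(1)[OF sc_space F x, of g] by (auto simp: sw_def pm_sum_def)
  finally show ?thesis .
qed

lemma right_right_part:
  assumes F: "lin F" and x: "x \<in> C" and g: "g \<in> chars" "g' \<in> chars"
  shows "F (right_part g' (right_part g x)) = (if g = g' then F (right_part g x) else 0)"
proof -
  have "F (right_part g' (right_part g x)) = (\<lambda>w. SW w (\<lambda>y z. sc (cg g' z) (F y))) (right_part g x)"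
    by (rule part_linear(2)[OF sc_space F part_closed(2)[OF x]])
  also have "\<dots> = SW x (\<lambda>p q. sc (cg g q) (SW p (\<lambda>y z. sc (cg g' z) (F y))))"
    by (rule part_linear(2)[OF sc_space _ x]) (auto intro!: lin_rules lin_cg F simp del: U.scale_scale)
  also have "\<dots> = SW x (\<lambda>p q. SW p (\<lambda>y z. sc (cg g q) (sc (cg g' z) (F y))))"
    unfolding sw_def pm_sum_def U.scale_sum_right by (simp add: mult_ac)
  also have "\<dots> = SW x (\<lambda>y w. SW w (\<lambda>z q. sc (cg g q) (sc (cg g' z) (F y))))"
    by (rule coassoc[OF x]) (auto intro!: lin_rules lin_cg F simp del: U.scale_scale)
  also have "\<dots> = SW x (\<lambda>y w. sc (sw H (*) w (\<lambda>z q. cg g' z * cg g q)) (F y))"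
    unfolding sw_def pm_sum_def U.scale_sum_left by (simp add: mult_ac)
  also have "\<dots> = SW x (\<lambda>y w. if g = g' then sc (cg g w) (F y) else 0)"
    by (rule sw_cong[OF x]) (auto simp: cg_comul g)
  also have "\<dots> = (if g = g' then F (right_part g x) else 0)"
    using part_linear(2)[OF sc_space F x, of g] by (auto simp: sw_def pm_sum_def)
  finally show ?thesis .
qed

text \<open>The left and right coactions commute by coassociativity; this is tested through the
  action on A.\<close>

lemma act_left_right:
  assumes x: "x \<in> C"
  shows "act (left_part g' (right_part g x)) a = act (right_part g (left_part g' x)) a"
proof -
  have "act (left_part g' (right_part g x)) a = (\<lambda>w. SW w (\<lambda>y z. sc (cg g' y) (act z a))) (right_part g x)"
    by (rule part_linear(1)[OF sc_space act_linear part_closed(2)[OF x]])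
  also have "\<dots> = SW x (\<lambda>p q. sc (cg g q) (SW p (\<lambda>y z. sc (cg g' y) (act z a))))"
    by (rule part_linear(2)[OF sc_space _ x]) (auto intro!: lin_rules lin_cg simp del: U.scale_scale)
  also have "\<dots> = SW x (\<lambda>p q. SW p (\<lambda>y z. sc (cg g q) (sc (cg g' y) (act z a))))"
    unfolding sw_def pm_sum_def U.scale_sum_right by (simp add: mult_ac)
  also have "\<dots> = SW x (\<lambda>y w. SW w (\<lambda>z q. sc (cg g q) (sc (cg g' y) (act z a))))"
    by (rule coassoc[OF x]) (auto intro!: lin_rules lin_cg simp del: U.scale_scale)
  also have "\<dots> = SW x (\<lambda>y w. sc (cg g' y) (SW w (\<lambda>z q. sc (cg g q) (act z a))))"
    unfolding sw_def pm_sum_def U.scale_sum_right by (simp add: mult_ac)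
  also have "\<dots> = (\<lambda>w. SW w (\<lambda>z q. sc (cg g q) (act z a))) (left_part g' x)"
    by (rule part_linear(1)[OF sc_space _ x, symmetric]) (auto intro!: lin_rules lin_cg simp del: U.scale_scale)
  also have "\<dots> = act (right_part g (left_part g' x)) a"
    by (rule part_linear(2)[OF sc_space act_linear part_closed(1)[OF x], symmetric])
  finally show ?thesis .
qed

lemma act_sum_parts:
  assumes x: "x \<in> C"
  shows "(\<Sum>g\<in>chars. act (left_part g x) a) = act x a" "(\<Sum>g\<in>chars. act (right_part g x) a) = act x a"
proof -
  have "(\<Sum>g\<in>chars. act (left_part g x) a) = SW x (\<lambda>y z. sc (\<Sum>g\<in>chars. cg g y) (act z a))"
    by (simp add: part_linear(1)[OF sc_space act_linear x] U.scale_sum_left sw_sum)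
  also have "\<dots> = SW x (\<lambda>y z. sc (counit H y) (act z a))" by (rule sw_cong[OF x]) (simp add: cg_counit)
  also have "\<dots> = act x a" by (rule counit_left[OF x act_linear])
  finally show "(\<Sum>g\<in>chars. act (left_part g x) a) = act x a" .
  have "(\<Sum>g\<in>chars. act (right_part g x) a) = SW x (\<lambda>y z. sc (\<Sum>g\<in>chars. cg g z) (act y a))"
    by (simp add: part_linear(2)[OF sc_space act_linear x] U.scale_sum_left sw_sum)
  also have "\<dots> = SW x (\<lambda>y z. sc (counit H z) (act y a))" by (rule sw_cong[OF x]) (simp add: cg_counit)
  also have "\<dots> = act x a" by (rule counit_right[OF x act_linear])
  finally show "(\<Sum>g\<in>chars. act (right_part g x) a) = act x a" .
qed

lemma divs_parts:
  assumes x: "x \<in> divs (Suc 0)" and g: "g \<in> chars"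
  shows "left_part g x \<in> divs (Suc 0)" "right_part g x \<in> divs (Suc 0)"
proof -
  have xC: "x \<in> C" using x by (simp add: divs_def)
  have 0: "cg g' x = 0" if "g' \<in> chars" for g' using x that divs_1_iff[OF xC] by blast
  have "cg g' (left_part g x) = 0" "cg g' (right_part g x) = 0" if "g' \<in> chars" for g'
    using cg_comul[OF xC g that] cg_comul[OF xC that g] 0 g that
    by (simp_all add: part_linear[OF vector_space_mult linear_cg xC] mult.commute[of "cg g _"] split: if_splits)
  then show "left_part g x \<in> divs (Suc 0)" "right_part g x \<in> divs (Suc 0)"
    using divs_1_iff part_closed[OF xC] by auto
qed

section \<open>Leading operators of the kernel as sums of skew derivations\<close>

lemma lead_cong: "(\<And>a. act x a = act y a) \<Longrightarrow> lead m x = lead m y"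
  by (simp add: lead_def fun_eq_iff)

lemma lead_zero:
  assumes "\<And>a. act x a = 0" "x \<in> C"
  shows "lead m x a = 0"
proof -
  have x: "x \<in> divs m" using assms by (simp add: divs_def)
  obtain a' where a': "red a' = a" using red_surj by blast
  show ?thesis using lead_eq[OF x, of a' 0] assms a' by simp
qed

text \<open>Each leg of the comultiplication is split into a lift of its image in k\<Gamma> and a
  rest divisible by \<hbar>^m. For x in the kernel the lifts contribute nothing together, and two
  rests together do not reach the leading term; the mixed products give the two sums.\<close>

lemma lead_mul:
  assumes m: "m > 0" and div: "divs (Suc 0) \<subseteq> divs m" and x: "x \<in> divs (Suc 0)"
  shows "lead m x (a * b) = (\<Sum>g\<in>chars. g a * lead m (left_part g x) b) + (\<Sum>g\<in>chars. lead m (right_part g x) a * g b)"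
proof -
  have xC: "x \<in> C" using x by (simp add: divs_def)
  have "\<forall>g\<in>chars. \<exists>u. u \<in> C \<and> op u = g \<and> (\<forall>g'\<in>chars. cg g' u = (if g' = g then 1 else 0))"
  proof
    fix g assume "g \<in> chars"
    then show "\<exists>u. u \<in> C \<and> op u = g \<and> (\<forall>g'\<in>chars. cg g' u = (if g' = g then 1 else 0))"
      by (rule unit_vector) blast
  qed
  from bchoice[OF this] obtain u where "\<forall>g\<in>chars. u g \<in> C \<and> op (u g) = g \<and> (\<forall>g'\<in>chars. cg g' (u g) = (if g' = g then 1 else 0))" ..
  then have u: "\<And>g. g \<in> chars \<Longrightarrow> u g \<in> C" "\<And>g. g \<in> chars \<Longrightarrow> op (u g) = g"
    and cu: "\<And>g g'. g \<in> chars \<Longrightarrow> g' \<in> chars \<Longrightarrow> cg g' (u g) = (if g' = g then 1 else 0)"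
    by blast+
  obtain a' b' where ab: "red a' = a" "red b' = b" using red_surj by metis
  \<comment> \<open>\<pi> is the action of the image in k\<Gamma>, lifted through the
    \<open>u g\<close>.\<close>
  define \<pi> where "\<pi> = (\<lambda>y c. \<Sum>g\<in>chars. sc (cg g y) (act (u g) c))"
  define \<iota> where "\<iota> = (\<lambda>y c. act y c - \<pi> y c)"
  have ag: "abelian_group H" by unfold_locales
  have \<pi>_lin: "lin (\<lambda>y. \<pi> y c)" for c
    unfolding \<pi>_def using linear_cg
    by (simp add: linear_on_def U.scale_left_distrib sum.distrib U.scale_sum_right)
  have \<iota>_lin: "lin (\<lambda>y. \<iota> y c)" for c
    unfolding \<iota>_def by (intro lin_intros \<pi>_lin)
  \<comment> \<open>An element of H minus its lift has vanishing coordinates, so it lies in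
    \<open>divs (Suc 0)\<close> and hence in \<open>divs m\<close>.\<close>
  have \<iota>_dv: "\<iota> y c \<in> dv m" if y: "y \<in> C" for y c
  proof -
    define w where "w = (\<Oplus>\<^bsub>H\<^esub>g\<in>chars. cg g y \<odot>\<^bsub>H\<^esub> u g)"
    have f: "(\<lambda>g. cg g y \<odot>\<^bsub>H\<^esub> u g) \<in> chars \<rightarrow> C" using u by auto
    have w: "w \<in> C" unfolding w_def using f by (rule finsum_closed)
    define z where "z = y \<oplus>\<^bsub>H\<^esub> (- 1) \<odot>\<^bsub>H\<^esub> w"
    have z: "z \<in> C" using y w by (simp add: z_def)
    have cgw: "cg g w = cg g y" if "g \<in> chars" for g
    proof -
      have "cg g w = (\<Sum>h\<in>chars. cg g (cg h y \<odot>\<^bsub>H\<^esub> u h))"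
        unfolding w_def by (rule finsum_linear[OF ag linear_cg f vector_space_mult])
      also have "\<dots> = (\<Sum>h\<in>chars. if h = g then cg g y else 0)"
        using linear_cg[of g] u that by (intro sum.cong) (auto simp: linear_on_def cu)
      also have "\<dots> = cg g y" using finite_chars that by simp
      finally show ?thesis .
    qed
    have "cg g z = 0" if "g \<in> chars" for g
      using linear_cg[of g] y w cgw[OF that] by (simp add: z_def linear_on_def)
    then have "z \<in> divs m" using div divs_1_iff[OF z] by blast
    moreover have "act w c = \<pi> y c"
      unfolding w_def \<pi>_def using finsum_linear[OF ag act_linear[of c] f sc_space] u by (simp add: act_smult)
    then have "act z c = \<iota> y c" using y w by (simp add: z_def \<iota>_def act_plus act_smult)
    ultimately show ?thesis by (metis (mono_tags, lifting) divs_def mem_Collect_eq)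
  qed
  have act_split: "act y c = \<pi> y c + \<iota> y c" for y c by (simp add: \<iota>_def)
  have "act x (a' \<star> b') = SW x (\<lambda>y z. \<pi> y a' \<star> \<pi> z b' + \<pi> y a' \<star> \<iota> z b' + \<iota> y a' \<star> \<pi> z b' + \<iota> y a' \<star> \<iota> z b')"
    unfolding act_mul[OF xC] by (rule sw_cong[OF xC]) (simp add: act_split[of _ a'] act_split[of _ b'] mul_add_left mul_add_right)
  also have "\<dots> = SW x (\<lambda>y z. \<pi> y a' \<star> \<pi> z b') + SW x (\<lambda>y z. \<pi> y a' \<star> \<iota> z b') +
      SW x (\<lambda>y z. \<iota> y a' \<star> \<pi> z b') + SW x (\<lambda>y z. \<iota> y a' \<star> \<iota> z b')"
    unfolding sw_def pm_sum_def by (simp add: U.scale_right_distrib sum.distrib)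
  \<comment> \<open>By \<open>cg_comul\<close> the coefficients are zero or coordinates of x, and
    those vanish for x in the kernel.\<close>
  also have "SW x (\<lambda>y z. \<pi> y a' \<star> \<pi> z b') = 0"
  proof -
    have "SW x (\<lambda>y z. \<pi> y a' \<star> \<pi> z b') =
        SW x (\<lambda>y z. \<Sum>g\<in>chars. \<Sum>g'\<in>chars. sc (cg g y * cg g' z) (act (u g) a' \<star> act (u g') b'))"
      unfolding \<pi>_def unfolding mul_sum(1) unfolding mul_sum(2) unfolding sc_mul_left unfolding sc_mul_right
      by simp
    also have "\<dots> = (\<Sum>g\<in>chars. \<Sum>g'\<in>chars. sc (sw H (*) x (\<lambda>y z. cg g y * cg g' z)) (act (u g) a' \<star> act (u g') b'))"
      unfolding sw_def pm_sum_def U.scale_sum_right U.scale_sum_left U.scale_scale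
      by (subst sum.swap, rule sum.cong[OF refl], rule sum.swap)
    also have "\<dots> = 0"
      using x divs_1_iff[OF xC] by (intro sum.neutral ballI) (simp add: cg_comul[OF xC])
    finally show ?thesis .
  qed
  also have "SW x (\<lambda>y z. \<pi> y a' \<star> \<iota> z b') = (\<Sum>g\<in>chars. act (u g) a' \<star> act (left_part g x) b')"
  proof -
    have "SW x (\<lambda>y z. \<pi> y a' \<star> \<iota> z b') = (\<Sum>g\<in>chars. act (u g) a' \<star> SW x (\<lambda>y z. sc (cg g y) (\<iota> z b')))"
      by (simp add: \<pi>_def mul_sum sc_mul_left sc_mul_right mul_sw[OF xC] flip: sw_sum)
    also have "\<dots> = (\<Sum>g\<in>chars. act (u g) a' \<star> \<iota> (left_part g x) b')"
      by (simp add: part_linear(1)[OF sc_space \<iota>_lin xC])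
    also have "\<dots> = (\<Sum>g\<in>chars. act (u g) a' \<star> act (left_part g x) b')"
    proof (rule sum.cong[OF refl])
      fix g assume "g \<in> chars"
      then have "\<pi> (left_part g x) b' = 0"
        unfolding \<pi>_def using divs_parts(1)[OF x] divs_1_iff[OF part_closed(1)[OF xC]] by (intro sum.neutral) auto
      then show "act (u g) a' \<star> \<iota> (left_part g x) b' = act (u g) a' \<star> act (left_part g x) b'" by (simp add: \<iota>_def)
    qed
    finally show ?thesis .
  qed
  also have "SW x (\<lambda>y z. \<iota> y a' \<star> \<pi> z b') = (\<Sum>g\<in>chars. act (right_part g x) a' \<star> act (u g) b')"
  proof -
    have "SW x (\<lambda>y z. \<iota> y a' \<star> \<pi> z b') = (\<Sum>g\<in>chars. SW x (\<lambda>y z. sc (cg g z) (\<iota> y a')) \<star> act (u g) b')"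
      by (simp add: \<pi>_def mul_sum sc_mul_left sc_mul_right mul_sw[OF xC] flip: sw_sum)
    also have "\<dots> = (\<Sum>g\<in>chars. \<iota> (right_part g x) a' \<star> act (u g) b')"
      by (simp add: part_linear(2)[OF sc_space \<iota>_lin xC])
    also have "\<dots> = (\<Sum>g\<in>chars. act (right_part g x) a' \<star> act (u g) b')"
    proof (rule sum.cong[OF refl])
      fix g assume "g \<in> chars"
      then have "\<pi> (right_part g x) a' = 0"
        unfolding \<pi>_def using divs_parts(2)[OF x] divs_1_iff[OF part_closed(2)[OF xC]] by (intro sum.neutral) auto
      then show "\<iota> (right_part g x) a' \<star> act (u g) b' = act (right_part g x) a' \<star> act (u g) b'" by (simp add: \<iota>_def)
    qed
    finally show ?thesis .
  qed
  finally have eq: "act x (a' \<star> b') = (\<Sum>g\<in>chars. act (u g) a' \<star> act (left_part g x) b') +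
      (\<Sum>g\<in>chars. act (right_part g x) a' \<star> act (u g) b') + SW x (\<lambda>y z. \<iota> y a' \<star> \<iota> z b')" by simp
  \<comment> \<open>One rest contributes \<hbar>^m, the other at least \<hbar> because m >
    0.\<close>
  have "SW x (\<lambda>y z. \<iota> y a' \<star> \<iota> z b') \<in> dv (m + Suc 0)"
  proof (rule sw_dv[OF xC])
    fix y z assume yz: "y \<in> C" "z \<in> C"
    obtain p where p: "\<iota> y a' = hbn m p" using \<iota>_dv[OF yz(1)] by (rule dvE)
    have "\<iota> z b' \<in> dv (Suc 0)" using dv_mono[OF \<iota>_dv[OF yz(2)], of "Suc 0"] m by simp
    then have "hbn m (p \<star> \<iota> z b') \<in> dv (m + Suc 0)" by (intro hbn_dv dv_mul(2))
    then show "\<iota> y a' \<star> \<iota> z b' \<in> dv (m + Suc 0)" by (simp add: p hbn_mul)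
  qed
  then obtain w where w: "SW x (\<lambda>y z. \<iota> y a' \<star> \<iota> z b') = hbn m (hbn (Suc 0) w)"
    by (metis dvE hbn_hbn)
  have lp: "left_part g x \<in> divs m" "right_part g x \<in> divs m" if "g \<in> chars" for g
    using divs_parts[OF x that] div by auto
  have ex: "\<exists>c. act y v = hbn m c" if "y \<in> divs m" for y v using that by (auto elim: divs_obtain)
  have "\<forall>g\<in>chars. \<exists>c. act (left_part g x) b' = hbn m c" using ex lp(1) by blast
  from bchoice[OF this] obtain l where "\<forall>g\<in>chars. act (left_part g x) b' = hbn m (l g)" ..
  then have l: "\<And>g. g \<in> chars \<Longrightarrow> act (left_part g x) b' = hbn m (l g)" by blast
  have "\<forall>g\<in>chars. \<exists>c. act (right_part g x) a' = hbn m c" using ex lp(2) by blast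
  from bchoice[OF this] obtain r where "\<forall>g\<in>chars. act (right_part g x) a' = hbn m (r g)" ..
  then have r: "\<And>g. g \<in> chars \<Longrightarrow> act (right_part g x) a' = hbn m (r g)" by blast
  have "act x (a' \<star> b') = hbn m ((\<Sum>g\<in>chars. act (u g) a' \<star> l g) + (\<Sum>g\<in>chars. r g \<star> act (u g) b') + hb w)"
    unfolding eq w hbn_add hbn_sum by (simp add: l r hbn_mul)
  from lead_eq[OF _ this] have "lead m x (a * b) = (\<Sum>g\<in>chars. red (act (u g) a') * red (l g)) + (\<Sum>g\<in>chars. red (r g) * red (act (u g) b'))"
    using div x by (auto simp: red_mul ab red_add red_sum)
  also have "(\<Sum>g\<in>chars. red (act (u g) a') * red (l g)) = (\<Sum>g\<in>chars. g a * lead m (left_part g x) b)"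
    using lead_eq[OF lp(1) l] by (intro sum.cong) (simp_all add: u ab flip: op_red)
  also have "(\<Sum>g\<in>chars. red (r g) * red (act (u g) b')) = (\<Sum>g\<in>chars. lead m (right_part g x) a * g b)"
    using lead_eq[OF lp(2) r] by (intro sum.cong) (simp_all add: u ab flip: op_red)
  finally show ?thesis .
qed

lemma lead_inv:
  assumes "x \<in> divs m" "inv_fraction (Suc m) Y W Y' W'"
  shows "lead m x (red W) * red Y = lead m x (red Y) * red W"
  using lead_inv_fraction[OF assms, of 1] by simp

lemma char_inv:
  assumes "g \<in> chars" "inv_fraction (Suc m) Y W Y' W'"
  shows "g (red W) * red Y = g (red Y) * red W"
proof -
  obtain u where "u \<in> C" "op u = g" using unit_vector[OF assms(1)] by blast
  then show ?thesis using lead_inv[of u 0] inv_fraction_mono[OF assms(2), of "Suc 0"] by (auto simp: divs_0)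
qed

text \<open>A skew derivation is a multiple of \<open>g - g'\<close>; that multiple is a Casimir because \<open>T\<close>, \<open>g\<close>, \<open>g'\<close> are Poisson-linear over invariants.\<close>

lemma skew_lead_in_ops:
  assumes y: "y \<in> divs m" and g: "g \<in> chars" "g' \<in> chars"
    and skew: "\<And>a b. lead m y (a * b) = g a * lead m y b + lead m y a * g' b"
  shows "lead m y \<in> ops"
proof (cases "g = g'")
  case True
  \<comment> \<open>Here no b separates g from g', so no quotient v can be formed; the operator is a
    twisted derivation and vanishes.\<close>
  have "lead m y a = 0" for a
  proof (rule twisted_derivation_zero[where n = "Suc m" and g = g and d = "lead m y"])
    show "inj_ring_hom g" by (rule chars_inj_ring_hom[OF g(1)])
    show "twisted_derivation g (lead m y)"
      by (simp add: twisted_derivation_def lead_add[OF y] skew True)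
  qed (fact char_inv[OF g(1)] lead_inv[OF y])+
  then have "lead m y = 0" by (simp add: fun_eq_iff)
  then show ?thesis using F.subspace_0[OF subspace_ops] by simp
next
  case False
  define T where "T = lead m y"
  have sym: "T a * (g b - g' b) = T b * (g a - g' a)" for a b
    using skew[of a b] skew[of b a] by (simp add: T_def mult.commute[of b a] algebra_simps)
  obtain b where b: "g b \<noteq> g' b" using False by auto
  define v where "v = Fr (T b) / Fr (g b - g' b)"
  have Tv: "Fr (T a) = v * Fr (g a - g' a)" for a
  proof -
    have "Fr (T a) * Fr (g b - g' b) = Fr (T b) * Fr (g a - g' a)"
      using sym[of a b] by (simp flip: Fr_simps(2))
    then show ?thesis using b by (simp add: v_def eq_divide_eq Fr_eq_0_iff)
  qed
  have "\<exists>c. v = Fr (s c 1)"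
  proof (rule Pois_zero_imp_const)
    fix f assume "f \<in> inv_fract (Suc (Suc m))"
    then obtain Y W Y' W' where YW: "inv_fraction (Suc (Suc m)) Y W Y' W'" "f = Fr (red W) / Fr (red Y)"
      by (auto simp: inv_fract_def)
    define t where "t = red Y * red Y'"
    have t: "t \<noteq> 0" using YW(1) by (simp add: t_def inv_fraction_def)
    \<comment> \<open>The bracket identity is available on tA_0 only, so g and g' are separated
      there: if they agreed on tA_0, cancelling g t would make them equal.\<close>
    have "\<exists>a. g (t * a) \<noteq> g' (t * a)"
    proof (rule ccontr)
      assume "\<not> ?thesis"
      then have eq: "g (t * a) = g' (t * a)" for a by blast
      have "g t \<noteq> 0" using inj_ring_homD(5)[OF chars_inj_ring_hom[OF g(1)]] t by simp
      moreover have "g t = g' t" using eq[of 1] by simp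
      ultimately have "g b = g' b" using eq[of b] charsD(2)[OF g(1)] charsD(2)[OF g(2)] by simp
      then show False using b by simp
    qed
    then obtain a where a: "g (t * a) \<noteq> g' (t * a)" by blast
    \<comment> \<open>One w serves y at level m and the elements acting as g and g' at level 0; this
      is where the uniformity of \<open>lead_Pois\<close> matters.\<close>
    obtain w where w: "\<And>l x. l \<le> m \<Longrightarrow> x \<in> divs l \<Longrightarrow> Fr (lead l x w) = Pois f (Fr (lead l x (t * a)))"
      using lead_Pois[OF YW(1), of a] by (auto simp: t_def YW(2))
    have gw: "Fr (h w) = Pois f (Fr (h (t * a)))" if "h \<in> chars" for h
    proof -
      obtain u where "u \<in> C" "op u = h" using unit_vector[OF \<open>h \<in> chars\<close>] by blast
      then show ?thesis using w[of 0 u] by (simp add: divs_0)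
    qed
    have "v * Fr (g w - g' w) = Pois f (v * Fr (g (t * a) - g' (t * a)))"
      using w[OF order_refl y] by (simp add: Tv[symmetric] T_def)
    also have "\<dots> = Pois f v * Fr (g (t * a) - g' (t * a)) + v * Fr (g w - g' w)"
      by (simp add: twisted_derivationD[OF Pois_right] Fr_simps gw g)
    finally have "Pois f v * Fr (g (t * a) - g' (t * a)) = 0" by simp
    then show "Pois f v = 0" using a by (simp add: Fr_eq_0_iff)
  qed
  then obtain c where c: "v = Fr (s c 1)" by blast
  have "T a = s c (g a - g' a)" for a
    using Tv[of a] unfolding c Fr_s[of c "g a - g' a", symmetric] by (simp add: Fr_eq_iff)
  then have "T = fs c (g - g')" by (simp add: fun_eq_iff fs_def)
  then show ?thesis
    using g charsD(1) F.subspace_scale[OF subspace_ops F.subspace_diff[OF subspace_ops]] by (simp add: T_def)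
qed

text \<open>For a component of x that is homogeneous for both coactions only one term survives in
  each sum of \<open>lead_mul\<close>, which leaves a skew derivation.\<close>

lemma lead_in_ops:
  assumes m: "m > 0" and div: "divs (Suc 0) \<subseteq> divs m" and x: "x \<in> divs (Suc 0)"
  shows "lead m x \<in> ops"
proof -
  have xC: "x \<in> C" using x by (simp add: divs_def)
  define y where "y = (\<lambda>g g'. left_part g (right_part g' x))"
  have y1: "y g g' \<in> divs (Suc 0)" if "g \<in> chars" "g' \<in> chars" for g g'
    unfolding y_def using that by (intro divs_parts x)
  have yC: "y g g' \<in> C" for g g' by (simp add: y_def part_closed xC)
  have ym: "y g g' \<in> divs m" if "g \<in> chars" "g' \<in> chars" for g g' using y1[OF that] div by blast
  have y_ops: "lead m (y g g') \<in> ops" if g: "g \<in> chars" "g' \<in> chars" for g g'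
  proof (rule skew_lead_in_ops[OF ym[OF g] g])
    fix a b
    let ?w = "right_part g' x"
    have w: "?w \<in> C" by (rule part_closed(2)[OF xC])
    have l: "act (left_part h (y g g')) c = (if h = g then act (y g g') c else 0)" if "h \<in> chars" for h c
      unfolding y_def using left_left_part[OF act_linear w g(1) that, of c] by auto
    have r: "act (right_part h (y g g')) c = (if h = g' then act (y g g') c else 0)" if "h \<in> chars" for h c
    proof -
      define F where "F = (\<lambda>v. SW v (\<lambda>y z. sc (cg g y) (act z c)))"
      have F: "lin F" unfolding F_def by (auto intro!: lin_rules lin_cg)
      have Fv: "act (left_part g v) c = F v" if "v \<in> C" for v
        unfolding F_def by (rule part_linear(1)[OF sc_space act_linear that])
      have "act (right_part h (y g g')) c = F (right_part h ?w)"
        unfolding y_def act_left_right[OF w, symmetric] by (rule Fv[OF part_closed(2)[OF w]])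
      also have "\<dots> = (if g' = h then F ?w else 0)" by (rule right_right_part[OF F xC g(2) that])
      finally show ?thesis using Fv[OF w] by (auto simp: y_def)
    qed
    have L: "lead m (left_part h (y g g')) c = (if h = g then lead m (y g g') c else 0)" if "h \<in> chars" for h c
      using l[OF that] lead_cong[of "left_part h (y g g')" "y g g'"] lead_zero[of "left_part h (y g g')"] part_closed(1)[OF yC]
      by (cases "h = g") auto
    have R: "lead m (right_part h (y g g')) c = (if h = g' then lead m (y g g') c else 0)" if "h \<in> chars" for h c
      using r[OF that] lead_cong[of "right_part h (y g g')" "y g g'"] lead_zero[of "right_part h (y g g')"] part_closed(2)[OF yC]
      by (cases "h = g'") auto
    have "(\<Sum>h\<in>chars. h a * lead m (left_part h (y g g')) b) = (\<Sum>h\<in>chars. if h = g then g a * lead m (y g g') b else 0)"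
      by (rule sum.cong) (auto simp: L)
    moreover have "(\<Sum>h\<in>chars. lead m (right_part h (y g g')) a * h b) = (\<Sum>h\<in>chars. if h = g' then lead m (y g g') a * g' b else 0)"
      by (rule sum.cong) (auto simp: R)
    ultimately show "lead m (y g g') (a * b) = g a * lead m (y g g') b + lead m (y g g') a * g' b"
      unfolding lead_mul[OF m div y1[OF g]] using finite_chars g by simp
  qed
  have "lead m x = (\<Sum>g'\<in>chars. \<Sum>g\<in>chars. lead m (y g g'))"
  proof (rule ext)
    fix a
    obtain a' where a': "red a' = a" using red_surj by blast
    have "\<forall>p\<in>chars \<times> chars. \<exists>c. act (y (fst p) (snd p)) a' = hbn m c"
    proof
      fix p assume "p \<in> chars \<times> chars"
      then have "y (fst p) (snd p) \<in> divs m" using ym by auto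
      then show "\<exists>c. act (y (fst p) (snd p)) a' = hbn m c" by (rule divs_obtain) blast
    qed
    from bchoice[OF this] obtain c where c: "\<And>g g'. g \<in> chars \<Longrightarrow> g' \<in> chars \<Longrightarrow> act (y g g') a' = hbn m (c (g, g'))"
      by auto
    have "act x a' = (\<Sum>g'\<in>chars. \<Sum>g\<in>chars. act (y g g') a')"
      by (simp add: y_def act_sum_parts part_closed xC)
    also have "\<dots> = hbn m (\<Sum>g'\<in>chars. \<Sum>g\<in>chars. c (g, g'))" by (simp add: c hbn_sum)
    finally have "lead m x a = (\<Sum>g'\<in>chars. \<Sum>g\<in>chars. red (c (g, g')))"
      using lead_eq[of x m a'] x div a' by (auto simp: red_sum)
    also have "\<dots> = (\<Sum>g'\<in>chars. \<Sum>g\<in>chars. lead m (y g g') a)"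
      using lead_eq[OF ym c] a' by (intro sum.cong refl) auto
    finally show "lead m x a = (\<Sum>g'\<in>chars. \<Sum>g\<in>chars. lead m (y g g')) a" by (simp add: sum_fun_apply)
  qed
  then show ?thesis using y_ops by (simp add: F.subspace_sum[OF subspace_ops])
qed

section \<open>Idempotents in left ideals of the span of the characters\<close>

lemma chars_comp_sum:
  assumes "g \<in> chars"
  shows "g \<circ> sum f I = (\<Sum>i\<in>I. g \<circ> f i)" "g \<circ> fs c T = fs c (g \<circ> T)"
  using inj_ring_homD(9)[OF chars_inj_ring_hom[OF assms]] charsD(5)[OF assms]
  by (auto simp: fun_eq_iff sum_fun_apply fs_def)

text \<open>Maschke's averaging argument.\<close>

lemma left_ideal_idempotent:
  assumes L: "F.subspace L" "L \<subseteq> ops" "L \<noteq> {0}" and left: "\<And>g T. g \<in> chars \<Longrightarrow> T \<in> L \<Longrightarrow> g \<circ> T \<in> L"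
  obtains e where "e \<in> L" "e \<noteq> 0" "e \<circ> e = e"
proof -
  interpret FF: vector_space_pair fs fs by unfold_locales
  \<comment> \<open>A linear projection onto L of all maps from A_0 to itself; averaging makes it
    compatible with the characters.\<close>
  obtain p where p: "range p \<subseteq> L" "Vector_Spaces.linear fs fs p" "\<And>v. v \<in> L \<Longrightarrow> p v = v"
    using FF.linear_exists_left_inverse_on[OF F.linear_id L(1)] by auto
  interpret p: Vector_Spaces.linear fs fs p by (rule p(2))
  have "\<forall>g\<in>chars. \<exists>g'. g' \<in> chars \<and> g \<circ> g' = id \<and> g' \<circ> g = id" using chars_inverse by metis
  from bchoice[OF this] obtain i where i: "\<And>g. g \<in> chars \<Longrightarrow> i g \<in> chars" "\<And>g. g \<in> chars \<Longrightarrow> g \<circ> i g = id"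
    "\<And>g. g \<in> chars \<Longrightarrow> i g \<circ> g = id" by blast
  define N where "N = (of_nat (card chars) :: 'k)"
  have N: "N \<noteq> 0" unfolding N_def using chars_id finite_chars by (intro char0) (auto simp: card_gt_0_iff)
  \<comment> \<open>The value at the identity of the averaged projection, which on the span of the
    characters is composition with e on the right.\<close>
  define e where "e = fs (1 / N) (\<Sum>g\<in>chars. g \<circ> p (i g))"
  have eL: "e \<in> L"
    unfolding e_def using p(1) by (intro F.subspace_scale[OF L(1)] F.subspace_sum[OF L(1)] left) auto
  have he: "h \<circ> e = fs (1 / N) (\<Sum>g\<in>chars. g \<circ> p (i g \<circ> h))" if h: "h \<in> chars" for h
  proof -
    have "(\<Sum>g\<in>chars. h \<circ> (g \<circ> p (i g))) = (\<Sum>g\<in>chars. g \<circ> p (i g \<circ> h))"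
    proof (rule sum.reindex_bij_witness[of _ "\<lambda>g. i h \<circ> g" "\<lambda>g. h \<circ> g"])
      fix g assume g: "g \<in> chars"
      show "i h \<circ> (h \<circ> g) = g" "h \<circ> (i h \<circ> g) = g" using i(2,3)[OF h] by (simp_all add: comp_assoc[symmetric])
      show "h \<circ> g \<in> chars" "i h \<circ> g \<in> chars" using chars_comp h g i by auto
      have hg: "h \<circ> g \<in> chars" by (rule chars_comp[OF h g])
      have "i (h \<circ> g) \<circ> h = i (h \<circ> g) \<circ> h \<circ> (g \<circ> i g)" using i(2)[OF g] by simp
      also have "\<dots> = (i (h \<circ> g) \<circ> (h \<circ> g)) \<circ> i g" by (simp only: comp_assoc)
      also have "\<dots> = i g" using i(3)[OF hg] by simp
      finally show "h \<circ> g \<circ> p (i (h \<circ> g) \<circ> h) = h \<circ> (g \<circ> p (i g))" by (simp add: comp_assoc)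
    qed
    then show ?thesis by (simp add: e_def chars_comp_sum[OF h])
  qed
  \<comment> \<open>Composing T with e averages g p(g^-1 T), and p fixes g^-1 T since L is a left
    ideal.\<close>
  have Te: "T \<circ> e = T" if T: "T \<in> L" for T
  proof -
    define r where "r = F.representation chars T"
    have rep: "T = (\<Sum>h\<in>chars. fs (r h) h)"
      unfolding r_def
      by (rule F.sum_representation_eq[OF chars_independent _ finite_chars subset_refl, symmetric])
        (use T L(2) ops_eq_span_chars in auto)
    have "T \<circ> e = (\<Sum>h\<in>chars. fs (r h) (h \<circ> e))"
      by (subst rep) (simp add: fun_eq_iff sum_fun_apply fs_def)
    also have "\<dots> = (\<Sum>h\<in>chars. fs (1 / N) (\<Sum>g\<in>chars. g \<circ> p (fs (r h) (i g \<circ> h))))"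
      by (rule sum.cong[OF refl]) (simp add: he F.scale_left_commute F.scale_sum_right p.scale chars_comp_sum)
    also have "\<dots> = fs (1 / N) (\<Sum>g\<in>chars. g \<circ> p (\<Sum>h\<in>chars. fs (r h) (i g \<circ> h)))"
      unfolding F.scale_sum_right[symmetric] by (subst sum.swap) (simp add: chars_comp_sum p.sum)
    also have "\<dots> = fs (1 / N) (\<Sum>g\<in>chars. T)"
    proof (intro arg_cong[where f = "fs (1 / N)"] sum.cong refl)
      fix g assume g: "g \<in> chars"
      have "(\<Sum>h\<in>chars. fs (r h) (i g \<circ> h)) = i g \<circ> T"
        by (subst rep) (simp add: chars_comp_sum i g)
      then have "g \<circ> p (\<Sum>h\<in>chars. fs (r h) (i g \<circ> h)) = g \<circ> (i g \<circ> T)"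
        using p(3)[OF left[OF i(1)[OF g] T]] by simp
      also have "\<dots> = T" using i(2)[OF g] by (simp add: comp_assoc[symmetric])
      finally show "g \<circ> p (\<Sum>h\<in>chars. fs (r h) (i g \<circ> h)) = T" .
    qed
    also have "\<dots> = T"
    proof -
      have "(\<Sum>g\<in>chars. T) = fs N T"
        unfolding N_def using F.scale_sum_left[of "\<lambda>_. 1" chars T] by simp
      then show ?thesis using N by simp
    qed
    finally show ?thesis .
  qed
  have "e \<noteq> 0"
  proof
    assume e0: "e = 0"
    have "T = 0" if T: "T \<in> L" for T
    proof -
      have "T 0 = 0" using opsD(2)[of T 0 0] T L(2) by auto
      then have "T \<circ> e = 0" by (simp add: e0 fun_eq_iff)
      then show ?thesis using Te[OF T] by simp
    qed
    then show False using L(3) F.subspace_0[OF L(1)] by blast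
  qed
  then show ?thesis using that eL Te[OF eL] by blast
qed

text \<open>
  An element \<open>x\<close> of \<open>H\<close> with \<open>x = \<hbar>\<^sup>m e + \<dots>\<close> for an idempotent \<open>e \<noteq> 0\<close> is not nilpotent, and its nonzero eigenvalues would have
  to be divisible by \<open>\<hbar>\<close>; but \<open>H\<close> is finite dimensional over the field \<open>k\<close>.
\<close>

lemma no_idempotent_lead:
  assumes m: "m > 0" and x: "x \<in> divs m" and e: "lead m x = e" "e \<circ> e = e" "e \<noteq> 0"
  shows False
proof -
  have xC: "x \<in> C" using x by (simp add: divs_def)
  define fu where "fu = (\<lambda>c (T :: 'u \<Rightarrow> 'u) a. sc c (T a))"
  have fu: "vector_space fu"
    by unfold_locales (auto simp: fu_def fun_eq_iff U.scale_right_distrib U.scale_left_distrib)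
  interpret FU: vector_space fu by (rule fu)
  \<comment> \<open>D is left multiplication by x on the image V of H in End A, and V' is the part
    of V on which D is nilpotent.\<close>
  define D where "D = (\<lambda>(T :: 'u \<Rightarrow> 'u) a. act x (T a))"
  define V where "V = act ` C"
  define V' where "V' = {T \<in> V. \<exists>n. (D ^^ n) T = 0}"
  have lin_act: "linear_on H fu act" using act_linear by (simp add: linear_on_def fun_eq_iff fu_def)
  have Da: "D T a = act x (T a)" for T a by (simp add: D_def)
  have D0: "D 0 = 0" by (simp add: D_def fun_eq_iff xC)
  have Dadd: "D (T + T') = D T + D T'" for T T' by (simp add: D_def fun_eq_iff act_add[OF xC])
  have Dsc: "D (fu c T) = fu c (D T)" for c T by (simp add: D_def fu_def act_sc[OF xC])
  have Dn0: "(D ^^ n) 0 = 0" for n by (induction n) (simp_all only: funpow.simps comp_apply id_apply D0)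
  have Dnadd: "(D ^^ n) (T + T') = (D ^^ n) T + (D ^^ n) T'" for n T T' by (induction n) (simp_all only: funpow.simps comp_apply id_apply Dadd)
  have Dnsc: "(D ^^ n) (fu c T) = fu c ((D ^^ n) T)" for n c T by (induction n) (simp_all only: funpow.simps comp_apply id_apply Dsc)
  have DV: "D T \<in> V" if "T \<in> V" for T
  proof -
    obtain h where h: "h \<in> C" "T = act h" using \<open>T \<in> V\<close> by (auto simp: V_def)
    then have "D T = act (x \<otimes>\<^bsub>H\<^esub> h)" by (simp add: D_def fun_eq_iff act_mult xC)
    then show ?thesis using xC h by (simp add: V_def)
  qed
  have V: "FU.subspace V"
  proof (rule FU.subspaceI)
    have "act \<zero>\<^bsub>H\<^esub> = 0"
      using act_plus[of "\<zero>\<^bsub>H\<^esub>" "\<zero>\<^bsub>H\<^esub>"] by (simp add: fun_eq_iff)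
    then show "0 \<in> V" unfolding V_def by (metis imageI zero_closed)
  next
    fix T T' assume "T \<in> V" "T' \<in> V"
    then show "T + T' \<in> V" using lin_act unfolding V_def linear_on_def by (metis (no_types, lifting) imageE imageI a_closed)
  next
    fix c T assume "T \<in> V"
    then show "fu c T \<in> V" using lin_act unfolding V_def linear_on_def by (metis (no_types, lifting) imageE imageI smult_closed)
  qed
  have V': "FU.subspace V'"
  proof (rule FU.subspaceI)
    show "0 \<in> V'" using FU.subspace_0[OF V] Dn0 by (auto simp: V'_def)
  next
    fix T T' assume T: "T \<in> V'" "T' \<in> V'"
    then obtain n n' where n: "(D ^^ n) T = 0" "(D ^^ n') T' = 0" by (auto simp: V'_def)
    have "(D ^^ (n' + n)) T = 0" "(D ^^ (n + n')) T' = 0" using n by (simp_all only: funpow_add comp_apply Dn0)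
    then have "(D ^^ (n + n')) (T + T') = 0" by (simp add: Dnadd add.commute)
    then show "T + T' \<in> V'" using T FU.subspace_add[OF V] by (auto simp: V'_def)
  next
    fix c T assume T: "T \<in> V'"
    then show "fu c T \<in> V'" using FU.subspace_scale[OF V] by (auto simp: V'_def Dnsc) 
  qed
  have VB: "V \<subseteq> FU.span (act ` E)"
  proof
    fix T assume "T \<in> V"
    then obtain h where h: "h \<in> C" "T = act h" by (auto simp: V_def)
    have "T = (\<Sum>e\<in>E. fu (cf e h) (act e))" using expand[OF fu lin_act h(1)] h(2) by simp
    also have "\<dots> \<in> FU.span (act ` E)" by (intro FU.span_sum FU.span_scale FU.span_base) auto
    finally show "T \<in> FU.span (act ` E)" .
  qed
  \<comment> \<open>On a lift of e a the n-th power of x has leading coefficient e a for every n,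
    because e is idempotent.\<close>
  have "act \<one>\<^bsub>H\<^esub> \<notin> V'"
  proof
    assume "act \<one>\<^bsub>H\<^esub> \<in> V'"
    then obtain n where n: "(D ^^ n) (act \<one>\<^bsub>H\<^esub>) = 0" by (auto simp: V'_def)
    obtain a where a: "e a \<noteq> 0" using e(3) by (auto simp: fun_eq_iff)
    obtain a' where a': "red a' = e a" using red_surj by blast
    have "\<exists>c. (D ^^ n) (act \<one>\<^bsub>H\<^esub>) a' = hbn (n * m) c \<and> red c = e a"
    proof (induction n)
      case 0
      show ?case using a' by (intro exI[of _ a']) (simp add: act_one)
    next
      case (Suc n)
      then obtain c where c: "(D ^^ n) (act \<one>\<^bsub>H\<^esub>) a' = hbn (n * m) c" "red c = e a" by blast
      obtain d where d: "act x c = hbn m d" by (rule divs_obtain[OF x])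
      have "(D ^^ Suc n) (act \<one>\<^bsub>H\<^esub>) a' = hbn (Suc n * m) d"
        by (simp add: D_def[THEN fun_cong, THEN fun_cong] c act_hbn[OF xC] d hbn_hbn add.commute)
      moreover have "red d = e (e a)" using lead_eq[OF x d] e(1) c(2) by simp
      then have "red d = e a" using fun_cong[OF e(2), of a] by simp
      ultimately show ?case by blast
    qed
    then obtain c where c: "hbn (n * m) c = 0" "red c = e a" using n by auto
    then have "c = 0" using hbn_inj[of "n * m" c 0] by simp
    then show False using c a by simp
  qed
  then have "\<exists>l T. T \<in> V \<and> T \<notin> V' \<and> D T - fu l T \<in> V'"
    using E by (intro eigenvector_modulo[OF fu V V' _ VB, where ?x0.0 = "act \<one>\<^bsub>H\<^esub>"])
      (auto simp: DV Dadd Dsc, simp add: V_def)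
  then obtain l T where T: "T \<in> V" "T \<notin> V'" "D T - fu l T \<in> V'" by blast
  obtain n where n: "(D ^^ n) (D T - fu l T) = 0" using T(3) by (auto simp: V'_def)
  have "D T - fu l T = D T + fu (- l) T" by (simp add: fun_eq_iff fu_def)
  then have "(D ^^ n) (D T) + fu (- l) ((D ^^ n) T) = 0" using n by (simp only: Dnadd Dnsc)
  \<comment> \<open>Applying D^n removes the error in V' and leaves an exact eigenvector. It is
    nonzero since T lies outside V'.\<close>
  then have eig: "D ((D ^^ n) T) = fu l ((D ^^ n) T)"
    by (simp add: funpow_swap1 fun_eq_iff fu_def eq_neg_iff_add_eq_0)
  show False
  proof (cases "l = 0")
    case True
    then have "(D ^^ Suc n) T = 0" using eig by (simp add: fu_def fun_eq_iff)
    then show False using T(1,2) unfolding V'_def by blast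
  next
    case False
    \<comment> \<open>Each use of the eigenvalue equation with invertible l gains a factor
      \<hbar>^m, so the value lies in all powers of \<hbar>.\<close>
    have "(D ^^ n) T a \<in> dv j" for a j
    proof (induction j)
      case (Suc j)
      then obtain w where w: "(D ^^ n) T a = hbn j w" by (rule dvE)
      obtain d where d: "act x w = hbn m d" by (rule divs_obtain[OF x])
      have "sc l ((D ^^ n) T a) = hbn (j + m) d"
        using fun_cong[OF eig, of a] by (simp add: Da fu_def w act_hbn[OF xC] d hbn_hbn)
      then have "sc (inverse l) (sc l ((D ^^ n) T a)) \<in> dv (j + m)" using dvI dv_sc by metis
      then have "(D ^^ n) T a \<in> dv (j + m)" using False by simp
      then show ?case by (rule dv_mono) (use m in simp)
    qed simp
    then have "(D ^^ n) T = 0" using dv_eq_0 by (simp add: fun_eq_iff)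
    then show False using T(1,2) unfolding V'_def by blast
  qed
qed

theorem kernel_acts_trivially:
  assumes x: "x \<in> C" "\<And>g. g \<in> chars \<Longrightarrow> cg g x = 0"
  shows "act x a = 0"
proof (rule ccontr)
  assume "act x a \<noteq> 0"
  then obtain j where j: "act x a \<notin> dv j" using dv_eq_0 by blast
  have x1: "x \<in> divs (Suc 0)" using x divs_1_iff by blast
  \<comment> \<open>Divisibility is asked of the whole kernel, as \<open>lead_mul\<close> applies it
    to other elements than x. The nonzero value of x bounds such m by j.\<close>
  define P where "P = (\<lambda>m. divs (Suc 0) \<subseteq> divs m)"
  have bound: "m \<le> j" if "P m" for m
  proof (rule ccontr)
    assume "\<not> m \<le> j"
    moreover have "act x a \<in> dv m" using that x1 by (auto simp: P_def divs_def)
    ultimately show False using j dv_mono by (metis nat_le_linear)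
  qed
  have P1: "P (Suc 0)" by (simp add: P_def)
  define m where "m = Greatest P"
  have Pm: "P m" unfolding m_def by (rule GreatestI_nat[where P = P, OF P1]) (rule bound)
  have m: "m > 0" using Greatest_le_nat[of P "Suc 0" j, OF P1] bound by (auto simp: m_def)
  have "\<not> P (Suc m)" using Greatest_le_nat[of P "Suc m" j] bound by (auto simp: m_def)
  then obtain y where y: "y \<in> divs (Suc 0)" "y \<notin> divs (Suc m)" by (auto simp: P_def)
  have div: "divs (Suc 0) \<subseteq> divs m" using Pm by (simp add: P_def)
  define L where "L = lead m ` divs (Suc 0)"
  have "F.subspace L"
  proof (rule F.subspaceI)
    have "lead m \<zero>\<^bsub>H\<^esub> + lead m \<zero>\<^bsub>H\<^esub> = lead m \<zero>\<^bsub>H\<^esub>" and z: "\<zero>\<^bsub>H\<^esub> \<in> divs (Suc 0)"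
    proof -
      have "act \<zero>\<^bsub>H\<^esub> b = 0" for b using act_plus[of "\<zero>\<^bsub>H\<^esub>" "\<zero>\<^bsub>H\<^esub>" b] by simp
      then show z: "\<zero>\<^bsub>H\<^esub> \<in> divs (Suc 0)" by (simp add: divs_def)
      then show "lead m \<zero>\<^bsub>H\<^esub> + lead m \<zero>\<^bsub>H\<^esub> = lead m \<zero>\<^bsub>H\<^esub>" using lead_plus[of "\<zero>\<^bsub>H\<^esub>" m "\<zero>\<^bsub>H\<^esub>"] div by auto
    qed
    then have "lead m \<zero>\<^bsub>H\<^esub> = 0" by simp
    then show "0 \<in> L" unfolding L_def using z by (metis imageI)
  next
    fix T T' assume "T \<in> L" "T' \<in> L"
    then obtain u v where uv: "u \<in> divs (Suc 0)" "T = lead m u" "v \<in> divs (Suc 0)" "T' = lead m v" by (auto simp: L_def)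
    then have "T + T' = lead m (u \<oplus>\<^bsub>H\<^esub> v)" using lead_plus[OF subsetD[OF div uv(1)] subsetD[OF div uv(3)]] uv by simp
    then show "T + T' \<in> L" using divs_add[OF uv(1,3)] by (simp add: L_def)
  next
    fix c T assume "T \<in> L"
    then obtain u where u: "u \<in> divs (Suc 0)" "T = lead m u" by (auto simp: L_def)
    then have "fs c T = lead m (c \<odot>\<^bsub>H\<^esub> u)" using lead_smult[OF subsetD[OF div u(1)]] u by simp
    then show "fs c T \<in> L" using divs_smult[OF u(1)] by (simp add: L_def)
  qed
  moreover have "L \<subseteq> ops" using lead_in_ops[OF m div] by (auto simp: L_def)
  moreover have "L \<noteq> {0}"
  proof -
    obtain b where b: "act y b \<notin> dv (Suc m)" using y by (auto simp: divs_def)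
    have ym: "y \<in> divs m" using y(1) div by blast
    obtain c where c: "act y b = hbn m c" by (rule divs_obtain[OF ym])
    have "red c \<noteq> 0" using b c hbn_dv[of c "Suc 0" m] by (auto simp: dv_1)
    then have "lead m y \<noteq> 0" using lead_eq[OF ym c] by auto
    then show ?thesis using y(1) by (auto simp: L_def)
  qed
  \<comment> \<open>For h acting on A_0 as g, the product of h and u has leading operator g composed
    with that of u.\<close>
  moreover have "g \<circ> T \<in> L" if g: "g \<in> chars" and T: "T \<in> L" for g T
  proof -
    obtain u where u: "u \<in> divs (Suc 0)" "T = lead m u" using T by (auto simp: L_def)
    obtain h where h: "h \<in> C" "op h = g" using unit_vector[OF g] by blast
    have uC: "u \<in> C" and um: "u \<in> divs m" using u div by (auto simp: divs_def)
    have hu: "h \<otimes>\<^bsub>H\<^esub> u \<in> divs l" if "u \<in> divs l" for l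
      using that h uC by (auto simp: divs_def act_mult act_dv)
    have "g (T b) = lead m (h \<otimes>\<^bsub>H\<^esub> u) b" for b
    proof -
      obtain b' c where c: "red b' = b" "act u b' = hbn m c" "lead m u b = red c" by (rule leadE[OF um])
      have "act (h \<otimes>\<^bsub>H\<^esub> u) b' = hbn m (act h c)" by (simp add: act_mult h uC c act_hbn)
      from lead_eq[OF hu[OF um] this] show ?thesis using c u(2) op_red[OF h(1), of c] h(2) by simp
    qed
    then have "g \<circ> T = lead m (h \<otimes>\<^bsub>H\<^esub> u)" by (simp add: fun_eq_iff)
    then show ?thesis using hu[OF u(1)] by (simp add: L_def)
  qed
  ultimately obtain e where e: "e \<in> L" "e \<noteq> 0" "e \<circ> e = e" by (rule left_ideal_idempotent)
  then obtain z where "z \<in> divs (Suc 0)" "e = lead m z" by (auto simp: L_def)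
  then show False using no_idempotent_lead[OF m, of z e] div e by auto
qed

end

section \<open>Hopf quotients isomorphic to group algebras\<close>

lemma vector_space_pm_scale: "vector_space (pm_scale :: 'k::field \<Rightarrow> ('p \<Rightarrow>\<^sub>0 'k) \<Rightarrow> _)"
  by unfold_locales (simp_all add: poly_mapping_eq_iff fun_eq_iff lookup_add algebra_simps)

interpretation PM: vector_space "pm_scale :: 'k::field \<Rightarrow> ('p \<Rightarrow>\<^sub>0 'k) \<Rightarrow> _"
  by (rule vector_space_pm_scale)

lemma tensor_null_subset_cong:
  assumes "t \<in> tensor_null V W" "carrier V = carrier V'" "add V = add V'" "module.smult V = module.smult V'"
    and "carrier W = carrier W'" "add W = add W'" "module.smult W = module.smult W'"
  shows "t \<in> tensor_null V' W'"
  using assms by (induction rule: tensor_null.induct) (auto intro: tensor_null.intros)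

lemma tensor_null_cong:
  assumes "carrier V = carrier V'" "add V = add V'" "module.smult V = module.smult V'"
    and "carrier W = carrier W'" "add W = add W'" "module.smult W = module.smult W'"
  shows "tensor_null V W = tensor_null V' W'"
  using tensor_null_subset_cong[OF _ assms] tensor_null_subset_cong[OF _ assms[symmetric]] by blast

text \<open>Tensor classes see only carrier, addition and scalars. This transfers them from an
  algebra record to the Hopf record built on it.\<close>

lemma tensor_class_cong:
  assumes "carrier V = carrier V'" "add V = add V'" "module.smult V = module.smult V'"
    and "carrier W = carrier W'" "add W = add W'" "module.smult W = module.smult W'"
  shows "tensor_class V W t = tensor_class V' W' t"
  unfolding tensor_class_def tensor_null_cong[OF assms] assms(1,4) ..

lemma pm_eq_sum_single: "t = (\<Sum>p\<in>Poly_Mapping.keys t. Poly_Mapping.single p (Poly_Mapping.lookup t p))"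
  by (rule poly_mapping_eqI) (simp add: lookup_sum lookup_single when_def in_keys_iff)

lemma tensor_null_finsum_left:
  assumes V: "abelian_group V" "\<And>c x. x \<in> carrier V \<Longrightarrow> c \<odot>\<^bsub>V\<^esub> x \<in> carrier V" "\<And>x. x \<in> carrier V \<Longrightarrow> 0 \<odot>\<^bsub>V\<^esub> x = \<zero>\<^bsub>V\<^esub>"
    and "finite A" "\<And>a. a \<in> A \<Longrightarrow> v a \<in> carrier V" and y: "y \<in> carrier W"
  shows "Poly_Mapping.single (\<Oplus>\<^bsub>V\<^esub>a\<in>A. c a \<odot>\<^bsub>V\<^esub> v a, y) 1 - (\<Sum>a\<in>A. Poly_Mapping.single (v a, y) (c a)) \<in> tensor_null V W"
  using assms(4,5)
proof (induction A rule: finite_induct)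
  case empty
  interpret abelian_group V by fact
  show ?case using tensor_null.scale_left[OF zero_closed y, of 0] by (simp add: V)
next
  case (insert a A)
  interpret abelian_group V by fact
  let ?s = "\<Oplus>\<^bsub>V\<^esub>a\<in>A. c a \<odot>\<^bsub>V\<^esub> v a"
  have cl: "c a \<odot>\<^bsub>V\<^esub> v a \<in> carrier V" "?s \<in> carrier V" using insert V by auto
  have "(\<Oplus>\<^bsub>V\<^esub>a\<in>insert a A. c a \<odot>\<^bsub>V\<^esub> v a) = c a \<odot>\<^bsub>V\<^esub> v a \<oplus>\<^bsub>V\<^esub> ?s"
    using insert V by (intro finsum_insert) auto
  then have "Poly_Mapping.single (\<Oplus>\<^bsub>V\<^esub>a\<in>insert a A. c a \<odot>\<^bsub>V\<^esub> v a, y) 1 - (\<Sum>a\<in>insert a A. Poly_Mapping.single (v a, y) (c a)) =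
    (Poly_Mapping.single (c a \<odot>\<^bsub>V\<^esub> v a \<oplus>\<^bsub>V\<^esub> ?s, y) 1 - Poly_Mapping.single (c a \<odot>\<^bsub>V\<^esub> v a, y) 1 - Poly_Mapping.single (?s, y) 1)
    + (Poly_Mapping.single (c a \<odot>\<^bsub>V\<^esub> v a, y) 1 - Poly_Mapping.single (v a, y) (c a))
    + (Poly_Mapping.single (?s, y) 1 - (\<Sum>a\<in>A. Poly_Mapping.single (v a, y) (c a)))"
    using insert.hyps by simp
  also have "\<dots> \<in> tensor_null V W"
    using insert cl y by (intro tensor_null.add tensor_null.add_left tensor_null.scale_left insert.IH) auto
  finally show ?case .
qed

lemma tensor_null_finsum_right:
  assumes W: "abelian_group W" "\<And>c x. x \<in> carrier W \<Longrightarrow> c \<odot>\<^bsub>W\<^esub> x \<in> carrier W" "\<And>x. x \<in> carrier W \<Longrightarrow> 0 \<odot>\<^bsub>W\<^esub> x = \<zero>\<^bsub>W\<^esub>"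
    and "finite A" "\<And>a. a \<in> A \<Longrightarrow> v a \<in> carrier W" and y: "y \<in> carrier V"
  shows "Poly_Mapping.single (y, \<Oplus>\<^bsub>W\<^esub>a\<in>A. c a \<odot>\<^bsub>W\<^esub> v a) 1 - (\<Sum>a\<in>A. Poly_Mapping.single (y, v a) (c a)) \<in> tensor_null V W"
  using assms(4,5)
proof (induction A rule: finite_induct)
  case empty
  interpret abelian_group W by fact
  show ?case using tensor_null.scale_right[OF y zero_closed, of 0] by (simp add: W)
next
  case (insert a A)
  interpret abelian_group W by fact
  let ?s = "\<Oplus>\<^bsub>W\<^esub>a\<in>A. c a \<odot>\<^bsub>W\<^esub> v a"
  have cl: "c a \<odot>\<^bsub>W\<^esub> v a \<in> carrier W" "?s \<in> carrier W" using insert W by auto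
  have "(\<Oplus>\<^bsub>W\<^esub>a\<in>insert a A. c a \<odot>\<^bsub>W\<^esub> v a) = c a \<odot>\<^bsub>W\<^esub> v a \<oplus>\<^bsub>W\<^esub> ?s"
    using insert W by (intro finsum_insert) auto
  then have "Poly_Mapping.single (y, \<Oplus>\<^bsub>W\<^esub>a\<in>insert a A. c a \<odot>\<^bsub>W\<^esub> v a) 1 - (\<Sum>a\<in>insert a A. Poly_Mapping.single (y, v a) (c a)) =
    (Poly_Mapping.single (y, c a \<odot>\<^bsub>W\<^esub> v a \<oplus>\<^bsub>W\<^esub> ?s) 1 - Poly_Mapping.single (y, c a \<odot>\<^bsub>W\<^esub> v a) 1 - Poly_Mapping.single (y, ?s) 1)
    + (Poly_Mapping.single (y, c a \<odot>\<^bsub>W\<^esub> v a) 1 - Poly_Mapping.single (y, v a) (c a))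
    + (Poly_Mapping.single (y, ?s) 1 - (\<Sum>a\<in>A. Poly_Mapping.single (y, v a) (c a)))"
    using insert.hyps by simp
  also have "\<dots> \<in> tensor_null V W"
    using insert cl y by (intro tensor_null.add tensor_null.add_right tensor_null.scale_right insert.IH) auto
  finally show ?case .
qed

text \<open>A lift into a tensor product is computed on representatives; in this form the
  comultiplications of quotient and group algebra become comparable.\<close>

lemma tensor_lift_class:
  assumes "\<And>p. p \<in> Poly_Mapping.keys (SOME t. t \<in> T) \<Longrightarrow> Poly_Mapping.keys (\<tau> (fst p) (snd p)) \<subseteq> carrier V \<times> carrier W"
  shows "tensor_lift (tensor V W) (\<lambda>x y. tensor_class V W (\<tau> x y)) T = tensor_class V W (pm_sum pm_scale (SOME t. t \<in> T) \<tau>)"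
proof -
  interpret abelian_group "tensor V W" by (rule tensor_abelian_group)
  have "(\<Oplus>\<^bsub>tensor V W\<^esub>p\<in>A. c p \<odot>\<^bsub>tensor V W\<^esub> tensor_class V W (\<sigma> p)) = tensor_class V W (\<Sum>p\<in>A. pm_scale (c p) (\<sigma> p))"
    if "finite A" "\<And>p. p \<in> A \<Longrightarrow> Poly_Mapping.keys (\<sigma> p) \<subseteq> carrier V \<times> carrier W" for A c and \<sigma> :: "'x \<Rightarrow> _"
    using that
  proof (induction A rule: finite_induct)
    case empty
    then show ?case by (simp add: tensor_zero_class)
  next
    case (insert a A)
    have "(\<Oplus>\<^bsub>tensor V W\<^esub>p\<in>insert a A. c p \<odot>\<^bsub>tensor V W\<^esub> tensor_class V W (\<sigma> p)) =
        c a \<odot>\<^bsub>tensor V W\<^esub> tensor_class V W (\<sigma> a) \<oplus>\<^bsub>tensor V W\<^esub> (\<Oplus>\<^bsub>tensor V W\<^esub>p\<in>A. c p \<odot>\<^bsub>tensor V W\<^esub> tensor_class V W (\<sigma> p))"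
      using insert by (intro finsum_insert) (auto intro!: tensor_smult_closed tensor_class_carrier)
    also have "\<dots> = tensor_class V W (\<Sum>p\<in>insert a A. pm_scale (c p) (\<sigma> p))"
      using insert by (simp add: tensor_smult_class tensor_add_class keys_pm_scale_subset keys_sum_subset)
    finally show ?case .
  qed
  from this[of "Poly_Mapping.keys (SOME t. t \<in> T)" "\<lambda>p. \<tau> (fst p) (snd p)" "Poly_Mapping.lookup (SOME t. t \<in> T)"] assms
  show ?thesis unfolding tensor_lift_def pm_sum_def Let_def by simp
qed

lemma pm_sum_map_tensor_null:
  assumes f: "f \<in> linear_maps V V'" and g: "g \<in> linear_maps W W'" and t: "t \<in> tensor_null V W"
  shows "pm_sum pm_scale t (\<lambda>x y. Poly_Mapping.single (f x, g y) 1) \<in> tensor_null V' W'"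
  using t
proof induction
  case zero
  then show ?case by (simp add: tensor_null.zero)
next
  case (add s t)
  then show ?case by (simp add: PM.pm_sum_add tensor_null.add)
next
  case (scale t c)
  then show ?case by (simp add: PM.pm_sum_scale tensor_null.scale)
qed (use f g in \<open>auto simp: linear_maps_def PM.pm_sum_diff pm_scale_single intro: tensor_null.intros\<close>)

lemma tensor_class_single_sum:
  "(\<And>p. p \<in> A \<Longrightarrow> f p - g p \<in> tensor_null V W) \<Longrightarrow> (\<Sum>p\<in>A. pm_scale (c p) (f p)) - (\<Sum>p\<in>A. pm_scale (c p) (g p)) \<in> tensor_null V W"
  unfolding sum_subtractf[symmetric] PM.scale_right_diff_distrib[symmetric]
  by (intro tensor_null_sum tensor_null.scale)

text \<open>A surjective bialgebra map from H to the group algebra of a finite group, given by its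
  coordinates. Compatibility with the antipodes is derived in \<open>pi_antipode\<close>.\<close>

locale hopf_group_coefficients = hopf H
  for H :: "('k::field, 'h, 'm) hopf_scheme" +
  fixes G :: "('g, 'n) monoid_scheme" and \<pi> :: "'g \<Rightarrow> 'h \<Rightarrow> 'k"
  assumes group: "Group.group G" and finG: "finite (carrier G)"
    and pi_linear: "g \<in> carrier G \<Longrightarrow> linear_on H (*) (\<pi> g)"
    and pi_mult: "x \<in> C \<Longrightarrow> y \<in> C \<Longrightarrow> g \<in> carrier G \<Longrightarrow>
      \<pi> g (x \<otimes>\<^bsub>H\<^esub> y) = (\<Sum>a\<in>carrier G. \<Sum>b\<in>carrier G. if a \<otimes>\<^bsub>G\<^esub> b = g then \<pi> a x * \<pi> b y else 0)"
    and pi_one: "g \<in> carrier G \<Longrightarrow> \<pi> g \<one>\<^bsub>H\<^esub> = (if g = \<one>\<^bsub>G\<^esub> then 1 else 0)"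
    and pi_counit: "x \<in> C \<Longrightarrow> (\<Sum>g\<in>carrier G. \<pi> g x) = counit H x"
    and pi_comul: "x \<in> C \<Longrightarrow> g \<in> carrier G \<Longrightarrow> g' \<in> carrier G \<Longrightarrow>
      sw H (*) x (\<lambda>y z. \<pi> g y * \<pi> g' z) = (if g = g' then \<pi> g x else 0)"
    and pi_surj: "g \<in> carrier G \<Longrightarrow> \<exists>u\<in>C. \<forall>g'\<in>carrier G. \<pi> g' u = (if g' = g then 1 else 0)"
begin

interpretation GG: Group.group G by (rule group)

abbreviation "SK \<equiv> sw H ((*) :: 'k \<Rightarrow> 'k \<Rightarrow> 'k)"
abbreviation "linK \<equiv> linear_on H ((*) :: 'k \<Rightarrow> 'k \<Rightarrow> 'k)"

lemma SK_scale: "h \<in> C \<Longrightarrow> SK h (\<lambda>x y. c * b x y) = c * SK h b" "h \<in> C \<Longrightarrow> SK h (\<lambda>x y. b x y * c) = SK h b * c"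
  by (rule sw_map[symmetric]; simp add: algebra_simps)+

lemma SK_sum: "SK h (\<lambda>x y. \<Sum>j\<in>J. b j x y) = (\<Sum>j\<in>J. SK h (b j))"
  unfolding sw_def pm_sum_def sum_distrib_left by (rule sum.swap)

lemma linK_rules:
  "g \<in> carrier G \<Longrightarrow> linK (\<lambda>x. \<pi> g x)"
  "g \<in> carrier G \<Longrightarrow> linK (\<lambda>x. \<pi> g (antipode H x))"
  "linK F \<Longrightarrow> linK (\<lambda>x. F x * c)" "linK F \<Longrightarrow> linK (\<lambda>x. c * F x)"
  using pi_linear[of g] by (auto simp: linear_on_def algebra_simps antipode_add antipode_smult)

text \<open>The coordinates of S(h1) h2 = \<epsilon>(h) 1 determine only sums of
  \<open>q a b\<close> over a b = g. Convolving with a further coordinate \<pi> c isolates the term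
  with b = c, and summing over c removes that coordinate by the counit.\<close>

lemma pi_antipode:
  assumes h: "h \<in> C" and a: "a \<in> carrier G"
  shows "\<pi> a (antipode H h) = \<pi> (inv\<^bsub>G\<^esub> a) h"
proof -
  define q where "q = (\<lambda>a b h. SK h (\<lambda>x y. \<pi> a (antipode H x) * \<pi> b y))"
  have 1: "(\<Sum>a\<in>carrier G. \<Sum>b\<in>carrier G. if a \<otimes>\<^bsub>G\<^esub> b = g then q a b h else 0) = counit H h * (if g = \<one>\<^bsub>G\<^esub> then 1 else 0)"
    if h: "h \<in> C" and g: "g \<in> carrier G" for g h
  proof -
    have "SK h (\<lambda>x y. \<pi> g (antipode H x \<otimes>\<^bsub>H\<^esub> y)) =
        SK h (\<lambda>x y. \<Sum>a\<in>carrier G. \<Sum>b\<in>carrier G. (if a \<otimes>\<^bsub>G\<^esub> b = g then 1 else 0) * (\<pi> a (antipode H x) * \<pi> b y))"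
      by (rule sw_cong[OF h]) (auto simp: pi_mult g intro!: sum.cong)
    also have "\<dots> = (\<Sum>a\<in>carrier G. \<Sum>b\<in>carrier G. if a \<otimes>\<^bsub>G\<^esub> b = g then q a b h else 0)"
      by (auto simp: SK_sum SK_scale h q_def intro!: sum.cong)
    finally show ?thesis using sw_antipode_left[OF vector_space_mult h pi_linear[OF g]] g by (simp add: pi_one)
  qed
  have 2: "q a c h = (if a \<otimes>\<^bsub>G\<^esub> c = \<one>\<^bsub>G\<^esub> then \<pi> c h else 0)" if a: "a \<in> carrier G" and c: "c \<in> carrier G" for a c
  proof -
    define g where "g = a \<otimes>\<^bsub>G\<^esub> c"
    have g: "g \<in> carrier G" using a c by (simp add: g_def)
    \<comment> \<open>After coassociativity, \<open>pi_comul\<close> turns the two adjacent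
      coordinates into the condition b = c.\<close>
    have qc: "SK h (\<lambda>w z. q a b w * \<pi> c z) = (if b = c then q a c h else 0)" if a: "a \<in> carrier G" and b: "b \<in> carrier G" for a b
    proof -
      have "SK h (\<lambda>w z. q a b w * \<pi> c z) = SK h (\<lambda>w z. SK w (\<lambda>x y. \<pi> a (antipode H x) * \<pi> b y * \<pi> c z))"
        by (rule sw_cong[OF h]) (simp add: q_def SK_scale)
      also have "\<dots> = SK h (\<lambda>x v. SK v (\<lambda>y z. \<pi> a (antipode H x) * \<pi> b y * \<pi> c z))"
        by (rule sw_coassoc[OF vector_space_mult h]) (auto intro!: trilinear_onI linK_rules a b c)
      also have "\<dots> = SK h (\<lambda>x v. \<pi> a (antipode H x) * SK v (\<lambda>y z. \<pi> b y * \<pi> c z))"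
        by (rule sw_cong[OF h]) (simp add: SK_scale mult.assoc)
      also have "\<dots> = SK h (\<lambda>x v. \<pi> a (antipode H x) * (if b = c then \<pi> b v else 0))"
        by (rule sw_cong[OF h]) (simp add: pi_comul b c)
      also have "\<dots> = (if b = c then q a c h else 0)" by (auto simp: q_def sw_def pm_sum_def)
      finally show ?thesis .
    qed
    have "(\<Sum>a'\<in>carrier G. \<Sum>b\<in>carrier G. if a' \<otimes>\<^bsub>G\<^esub> b = g then (if b = c then q a' c h else 0) else 0) =
        (\<Sum>a'\<in>carrier G. \<Sum>b\<in>carrier G. (if a' \<otimes>\<^bsub>G\<^esub> b = g then 1 else 0) * SK h (\<lambda>w z. q a' b w * \<pi> c z))"
      by (auto simp: qc intro!: sum.cong)
    also have "\<dots> = SK h (\<lambda>w z. (\<Sum>a'\<in>carrier G. \<Sum>b\<in>carrier G. if a' \<otimes>\<^bsub>G\<^esub> b = g then q a' b w else 0) * \<pi> c z)"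
      unfolding SK_scale(1)[OF h, symmetric] SK_sum[symmetric] sum_distrib_right
      by (rule sw_cong[OF h]) (auto intro!: sum.cong)
    also have "\<dots> = SK h (\<lambda>w z. (if g = \<one>\<^bsub>G\<^esub> then 1 else 0) * (counit H w * \<pi> c z))"
      by (rule sw_cong[OF h]) (simp add: 1 g)
    also have "\<dots> = (if g = \<one>\<^bsub>G\<^esub> then \<pi> c h else 0)"
      unfolding SK_scale(1)[OF h] using sw_counit_left[OF vector_space_mult h pi_linear[OF c]] by simp
    also have "(\<Sum>a'\<in>carrier G. \<Sum>b\<in>carrier G. if a' \<otimes>\<^bsub>G\<^esub> b = g then (if b = c then q a' c h else 0) else 0) =
        (\<Sum>a'\<in>carrier G. \<Sum>b\<in>carrier G. if b = c then (if a' = a then q a c h else 0) else 0)"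
      using a c by (auto simp: g_def intro!: sum.cong)
    also have "\<dots> = q a c h" using finG a c by simp
    finally show ?thesis by (simp add: g_def)
  qed
  have "\<pi> a (antipode H h) = SK h (\<lambda>x y. counit H y * \<pi> a (antipode H x))"
    using sw_counit_right[OF vector_space_mult h linK_rules(2)[OF a]] by simp
  also have "\<dots> = SK h (\<lambda>x y. \<Sum>c\<in>carrier G. \<pi> a (antipode H x) * \<pi> c y)"
    by (rule sw_cong[OF h]) (simp add: pi_counit[symmetric] sum_distrib_left mult.commute)
  also have "\<dots> = (\<Sum>c\<in>carrier G. q a c h)" by (simp add: SK_sum q_def)
  also have "\<dots> = (\<Sum>c\<in>carrier G. if c = inv\<^bsub>G\<^esub> a then \<pi> (inv\<^bsub>G\<^esub> a) h else 0)"
    using a by (intro sum.cong refl) (auto simp: 2 intro: GG.inv_equality[symmetric] dest: GG.inv_equality GG.inv_comm)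
  also have "\<dots> = \<pi> (inv\<^bsub>G\<^esub> a) h" using finG a by simp
  finally show ?thesis .
qed

definition ker :: "'h set" where "ker = {x \<in> C. \<forall>g\<in>carrier G. \<pi> g x = 0}"

lemma pi_add: "g \<in> carrier G \<Longrightarrow> x \<in> C \<Longrightarrow> y \<in> C \<Longrightarrow> \<pi> g (x \<oplus>\<^bsub>H\<^esub> y) = \<pi> g x + \<pi> g y"
  and pi_smult: "g \<in> carrier G \<Longrightarrow> x \<in> C \<Longrightarrow> \<pi> g (c \<odot>\<^bsub>H\<^esub> x) = c * \<pi> g x"
  using pi_linear by (simp_all add: linear_on_def)

lemma smult_zero_left: "x \<in> C \<Longrightarrow> 0 \<odot>\<^bsub>H\<^esub> x = \<zero>\<^bsub>H\<^esub>"
  using smult_add_left[of x 0 0] by (metis add.l_cancel_one' add_0 smult_closed)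

lemma pi_zero: "g \<in> carrier G \<Longrightarrow> \<pi> g \<zero>\<^bsub>H\<^esub> = 0"
  by (metis add_cancel_left_left l_zero pi_add zero_closed)

lemma pi_minus: "g \<in> carrier G \<Longrightarrow> x \<in> C \<Longrightarrow> \<pi> g (\<ominus>\<^bsub>H\<^esub> x) = - \<pi> g x"
  using pi_add[of g x "\<ominus>\<^bsub>H\<^esub> x"] by (simp add: r_neg pi_zero eq_neg_iff_add_eq_0 add.commute)

lemma ideal_ker: "ideal ker H"
proof (rule idealI)
  show "ring H" by unfold_locales
  show "subgroup ker (add_monoid H)"
    by (rule add.subgroupI) (auto simp: ker_def pi_add pi_zero pi_minus a_inv_def[symmetric] intro!: exI[of _ "\<zero>\<^bsub>H\<^esub>"])
qed (auto simp: ker_def pi_mult intro!: sum.neutral)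

lemma abelian_group_H: "abelian_group H" by unfold_locales

lemma hopf_ideal_ker: "hopf_ideal H ker"
  unfolding hopf_ideal_def
proof (intro conjI ballI allI)
  show "ideal ker H" by (rule ideal_ker)
  fix x assume x: "x \<in> ker"
  then have xC: "x \<in> C" and x0: "\<And>g. g \<in> carrier G \<Longrightarrow> \<pi> g x = 0" by (auto simp: ker_def)
  show "c \<odot>\<^bsub>H\<^esub> x \<in> ker" for c using x by (auto simp: ker_def pi_smult)
  show "counit H x = 0" using pi_counit[OF xC] x0 by simp
  show "antipode H x \<in> ker" using xC x0 by (auto simp: ker_def pi_antipode)
  obtain u where u: "\<And>g. g \<in> carrier G \<Longrightarrow> u g \<in> C"
    and pu: "\<And>g g'. g \<in> carrier G \<Longrightarrow> g' \<in> carrier G \<Longrightarrow> \<pi> g' (u g) = (if g' = g then 1 else 0)"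
    using bchoice[of "carrier G" "\<lambda>g u. u \<in> C \<and> (\<forall>g'\<in>carrier G. \<pi> g' u = (if g' = g then 1 else 0))"] pi_surj by blast
  let ?t = "SOME t. t \<in> comul H x"
  note t = tensor_mem_SOME[OF comul_closed[OF xC]]
  \<comment> \<open>\<open>P h\<close> lifts the image of h through the \<open>u g\<close>, so that
    \<open>I h\<close>, the difference of h and \<open>P h\<close>, lies in the kernel.\<close>
  define P where "P = (\<lambda>h. \<Oplus>\<^bsub>H\<^esub>g\<in>carrier G. \<pi> g h \<odot>\<^bsub>H\<^esub> u g)"
  define I where "I = (\<lambda>h. h \<ominus>\<^bsub>H\<^esub> P h)"
  have PC: "P h \<in> C" for h unfolding P_def using u by (intro finsum_closed) auto
  have pP: "\<pi> g (P h) = \<pi> g h" if g: "g \<in> carrier G" for g h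
  proof -
    have "\<pi> g (P h) = (\<Sum>g'\<in>carrier G. \<pi> g (\<pi> g' h \<odot>\<^bsub>H\<^esub> u g'))"
      unfolding P_def using u by (intro finsum_linear[OF abelian_group_H pi_linear[OF g] _ vector_space_mult]) auto
    also have "\<dots> = (\<Sum>g'\<in>carrier G. if g' = g then \<pi> g h else 0)"
      using g u by (intro sum.cong refl) (auto simp: pi_smult pu)
    also have "\<dots> = \<pi> g h" using finG g by simp
    finally show ?thesis .
  qed
  have Iker: "I h \<in> ker" if "h \<in> C" for h
    using that PC by (auto simp: I_def ker_def a_minus_def pi_add pi_minus pP)
  \<comment> \<open>\<open>w g\<close> collects the second legs paired with \<open>u g\<close>; by
    \<open>pi_comul\<close> it lies in the kernel together with x.\<close>
  define w where "w = (\<lambda>g. \<Oplus>\<^bsub>H\<^esub>p\<in>Poly_Mapping.keys ?t. (Poly_Mapping.lookup ?t p * \<pi> g (fst p)) \<odot>\<^bsub>H\<^esub> snd p)"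
  have kt: "fst p \<in> C" "snd p \<in> C" if "p \<in> Poly_Mapping.keys ?t" for p using t(2) that by auto
  have wC: "w g \<in> C" for g unfolding w_def using kt by (intro finsum_closed) auto
  have wker: "w g \<in> ker" if g: "g \<in> carrier G" for g
  proof -
    have "\<pi> g' (w g) = 0" if g': "g' \<in> carrier G" for g'
    proof -
      have "\<pi> g' (w g) = (\<Sum>p\<in>Poly_Mapping.keys ?t. \<pi> g' ((Poly_Mapping.lookup ?t p * \<pi> g (fst p)) \<odot>\<^bsub>H\<^esub> snd p))"
        unfolding w_def using kt by (intro finsum_linear[OF abelian_group_H pi_linear[OF g'] _ vector_space_mult]) auto
      also have "\<dots> = SK x (\<lambda>y z. \<pi> g y * \<pi> g' z)"
        unfolding sw_def pm_sum_def using kt by (intro sum.cong refl) (simp add: pi_smult g' mult.assoc)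
      also have "\<dots> = 0" using pi_comul[OF xC g g'] x0 g by (simp split: if_splits)
      finally show ?thesis .
    qed
    then show ?thesis using wC by (simp add: ker_def)
  qed
  \<comment> \<open>The explicit representative that \<open>hopf_ideal\<close> asks for, with x1 = I
    x1 + P x1: the terms I x1 \<otimes> x2 have the first leg in the kernel, and the terms u g
    \<otimes> w g the second.\<close>
  define t' where "t' = (\<Sum>p\<in>Poly_Mapping.keys ?t. Poly_Mapping.single (I (fst p), snd p) (Poly_Mapping.lookup ?t p))
     + (\<Sum>g\<in>carrier G. Poly_Mapping.single (u g, w g) 1)"
  have "Poly_Mapping.keys t' \<subseteq> ker \<times> C \<union> C \<times> ker"
    unfolding t'_def using Iker kt u wker
    by (intro keys_add_subset keys_sum_subset) (auto split: if_splits)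
  moreover have "t' \<in> comul H x"
  proof -
    define m where "m = (\<lambda>p :: 'h \<times> 'h. Poly_Mapping.single (I (fst p), snd p) 1 + (\<Sum>g\<in>carrier G. Poly_Mapping.single (u g, snd p) (\<pi> g (fst p))))"
    have m: "Poly_Mapping.single p 1 - m p \<in> tensor_null H H" if p: "p \<in> Poly_Mapping.keys ?t" for p
    proof -
      have IC: "I (fst p) \<in> C" using Iker[OF kt(1)[OF p]] by (simp add: ker_def)
      have "fst p = I (fst p) \<oplus>\<^bsub>H\<^esub> P (fst p)"
        using kt(1)[OF p] PC by (simp add: I_def a_minus_def a_assoc l_neg)
      then have "Poly_Mapping.single p 1 - m p =
          (Poly_Mapping.single (I (fst p) \<oplus>\<^bsub>H\<^esub> P (fst p), snd p) 1 - Poly_Mapping.single (I (fst p), snd p) 1 - Poly_Mapping.single (P (fst p), snd p) 1)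
          + (Poly_Mapping.single (P (fst p), snd p) 1 - (\<Sum>g\<in>carrier G. Poly_Mapping.single (u g, snd p) (\<pi> g (fst p))))"
        by (simp add: m_def)
      also have "\<dots> \<in> tensor_null H H"
      proof (rule tensor_null.add)
        show "Poly_Mapping.single (I (fst p) \<oplus>\<^bsub>H\<^esub> P (fst p), snd p) 1 - Poly_Mapping.single (I (fst p), snd p) 1 - Poly_Mapping.single (P (fst p), snd p) 1 \<in> tensor_null H H"
          using IC PC kt(2)[OF p] by (rule tensor_null.add_left)
        show "Poly_Mapping.single (P (fst p), snd p) 1 - (\<Sum>g\<in>carrier G. Poly_Mapping.single (u g, snd p) (\<pi> g (fst p))) \<in> tensor_null H H"
          unfolding P_def using u kt(2)[OF p] finG by (intro tensor_null_finsum_left abelian_group_H smult_zero_left) auto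
      qed
      finally show ?thesis .
    qed
    have 1: "?t - (\<Sum>p\<in>Poly_Mapping.keys ?t. pm_scale (Poly_Mapping.lookup ?t p) (m p)) \<in> tensor_null H H"
      using tensor_class_single_sum[of "Poly_Mapping.keys ?t" "\<lambda>p. Poly_Mapping.single p 1" m H H "Poly_Mapping.lookup ?t"] m
      by (subst pm_eq_sum_single) (simp add: pm_scale_single)
    have 2: "(\<Sum>p\<in>Poly_Mapping.keys ?t. pm_scale (Poly_Mapping.lookup ?t p) (m p)) =
        (\<Sum>p\<in>Poly_Mapping.keys ?t. Poly_Mapping.single (I (fst p), snd p) (Poly_Mapping.lookup ?t p)) +
        (\<Sum>g\<in>carrier G. \<Sum>p\<in>Poly_Mapping.keys ?t. Poly_Mapping.single (u g, snd p) (Poly_Mapping.lookup ?t p * \<pi> g (fst p)))"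
      unfolding m_def PM.scale_right_distrib sum.distrib PM.scale_sum_right pm_scale_single by (subst sum.swap) simp
    have "(\<Sum>g\<in>carrier G. Poly_Mapping.single (u g, w g) 1) -
        (\<Sum>g\<in>carrier G. \<Sum>p\<in>Poly_Mapping.keys ?t. Poly_Mapping.single (u g, snd p) (Poly_Mapping.lookup ?t p * \<pi> g (fst p))) \<in> tensor_null H H"
      unfolding sum_subtractf[symmetric] w_def using u kt
      by (intro tensor_null_sum tensor_null_finsum_right abelian_group_H smult_zero_left) auto
    then have "t' - (\<Sum>p\<in>Poly_Mapping.keys ?t. pm_scale (Poly_Mapping.lookup ?t p) (m p)) \<in> tensor_null H H"
      unfolding t'_def 2 by simp
    from tensor_null_diff[OF this 1] have "t' - ?t \<in> tensor_null H H" by simp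
    moreover have "Poly_Mapping.keys t' \<subseteq> C \<times> C"
      using \<open>Poly_Mapping.keys t' \<subseteq> ker \<times> C \<union> C \<times> ker\<close> by (auto simp: ker_def)
    ultimately show ?thesis using t(3) by (auto simp: tensor_class_def)
  qed
  ultimately show "\<exists>t\<in>comul H x. Poly_Mapping.keys t \<subseteq> ker \<times> C \<union> C \<times> ker" by blast
qed

end

section \<open>The isomorphism of the Hopf quotient with the group algebra\<close>

lemma group_hopf_simps:
  fixes G :: "('g, 'm) monoid_scheme" and f f' :: "'g \<Rightarrow>\<^sub>0 'k::field"
  shows
  "carrier (group_hopf G) = {f :: 'g \<Rightarrow>\<^sub>0 'k. Poly_Mapping.keys f \<subseteq> carrier G}"
  "add (group_hopf G) = ((+) :: _ \<Rightarrow> _ \<Rightarrow> 'g \<Rightarrow>\<^sub>0 'k)" "\<zero>\<^bsub>group_hopf G\<^esub> = (0 :: 'g \<Rightarrow>\<^sub>0 'k)"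
  "\<one>\<^bsub>group_hopf G\<^esub> = Poly_Mapping.single \<one>\<^bsub>G\<^esub> (1 :: 'k)"
  "module.smult (group_hopf G) = (pm_scale :: 'k \<Rightarrow> ('g \<Rightarrow>\<^sub>0 'k) \<Rightarrow> _)"
  "f \<otimes>\<^bsub>group_hopf G\<^esub> f' = (\<Sum>g\<in>Poly_Mapping.keys f. \<Sum>g'\<in>Poly_Mapping.keys f'.
       Poly_Mapping.single (g \<otimes>\<^bsub>G\<^esub> g') (Poly_Mapping.lookup f g * Poly_Mapping.lookup f' g'))"
  "comul (group_hopf G) f = tensor_class (group_hopf G) (group_hopf G) (\<Sum>g\<in>Poly_Mapping.keys f.
        Poly_Mapping.single (Poly_Mapping.single g 1, Poly_Mapping.single g 1) (Poly_Mapping.lookup f g))"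
  "counit (group_hopf G) f = (\<Sum>g\<in>Poly_Mapping.keys f. Poly_Mapping.lookup f g)"
  "antipode (group_hopf G) f = (\<Sum>g\<in>Poly_Mapping.keys f. Poly_Mapping.single (inv\<^bsub>G\<^esub> g) (Poly_Mapping.lookup f g))"
proof -
  show s: "carrier (group_hopf G) = {f :: 'g \<Rightarrow>\<^sub>0 'k. Poly_Mapping.keys f \<subseteq> carrier G}"
    "add (group_hopf G) = ((+) :: _ \<Rightarrow> _ \<Rightarrow> 'g \<Rightarrow>\<^sub>0 'k)" "\<zero>\<^bsub>group_hopf G\<^esub> = (0 :: 'g \<Rightarrow>\<^sub>0 'k)"
    "\<one>\<^bsub>group_hopf G\<^esub> = Poly_Mapping.single \<one>\<^bsub>G\<^esub> (1 :: 'k)"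
    "module.smult (group_hopf G) = (pm_scale :: 'k \<Rightarrow> ('g \<Rightarrow>\<^sub>0 'k) \<Rightarrow> _)"
    "f \<otimes>\<^bsub>group_hopf G\<^esub> f' = (\<Sum>g\<in>Poly_Mapping.keys f. \<Sum>g'\<in>Poly_Mapping.keys f'.
       Poly_Mapping.single (g \<otimes>\<^bsub>G\<^esub> g') (Poly_Mapping.lookup f g * Poly_Mapping.lookup f' g'))"
    "counit (group_hopf G) f = (\<Sum>g\<in>Poly_Mapping.keys f. Poly_Mapping.lookup f g)"
    "antipode (group_hopf G) f = (\<Sum>g\<in>Poly_Mapping.keys f. Poly_Mapping.single (inv\<^bsub>G\<^esub> g) (Poly_Mapping.lookup f g))"
    by (simp_all add: group_hopf_def group_algebra_def Let_def module.defs hopf.defs)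
  have tc: "tensor_class (group_algebra G) (group_algebra G) t = tensor_class (group_hopf G) (group_hopf G) t"
    for t :: "(('g \<Rightarrow>\<^sub>0 'k) \<times> ('g \<Rightarrow>\<^sub>0 'k)) \<Rightarrow>\<^sub>0 'k"
    by (rule tensor_class_cong) (simp_all add: s, simp_all add: group_algebra_def)
  show "comul (group_hopf G) f = tensor_class (group_hopf G) (group_hopf G) (\<Sum>g\<in>Poly_Mapping.keys f.
        Poly_Mapping.single (Poly_Mapping.single g 1, Poly_Mapping.single g 1) (Poly_Mapping.lookup f g))"
    unfolding tc[symmetric] by (simp add: group_hopf_def Let_def module.defs hopf.defs)
qed

context hopf_group_coefficients
begin

interpretation GG: Group.group G by (rule group)
interpretation I: ideal ker H by (rule ideal_ker)

definition gr :: "'h \<Rightarrow> 'g \<Rightarrow>\<^sub>0 'k" where "gr x = (\<Sum>g\<in>carrier G. Poly_Mapping.single g (\<pi> g x))"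

lemma lookup_gr: "Poly_Mapping.lookup (gr x) g = (if g \<in> carrier G then \<pi> g x else 0)"
  using finG by (simp add: gr_def lookup_sum lookup_single when_def)

lemma keys_gr: "Poly_Mapping.keys (gr x) \<subseteq> carrier G"
  by (auto simp: in_keys_iff lookup_gr split: if_splits)

lemma sum_keys_gr:
  assumes "\<And>g. F g 0 = 0"
  shows "(\<Sum>g\<in>Poly_Mapping.keys (gr x). F g (Poly_Mapping.lookup (gr x) g)) = (\<Sum>g\<in>carrier G. F g (\<pi> g x))"
proof -
  have "(\<Sum>g\<in>Poly_Mapping.keys (gr x). F g (Poly_Mapping.lookup (gr x) g)) =
      (\<Sum>g\<in>carrier G. F g (Poly_Mapping.lookup (gr x) g))"
    using finG keys_gr assms by (intro sum.mono_neutral_left) (auto simp: in_keys_iff)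
  also have "\<dots> = (\<Sum>g\<in>carrier G. F g (\<pi> g x))" by (rule sum.cong) (simp_all add: lookup_gr)
  finally show ?thesis .
qed

lemma gr_add: "x \<in> C \<Longrightarrow> y \<in> C \<Longrightarrow> gr (x \<oplus>\<^bsub>H\<^esub> y) = gr x + gr y"
  by (rule poly_mapping_eqI) (simp add: lookup_gr lookup_add pi_add)

lemma gr_smult: "x \<in> C \<Longrightarrow> gr (c \<odot>\<^bsub>H\<^esub> x) = pm_scale c (gr x)"
  by (rule poly_mapping_eqI) (simp add: lookup_gr pi_smult)

lemma gr_mult: "x \<in> C \<Longrightarrow> y \<in> C \<Longrightarrow> gr (x \<otimes>\<^bsub>H\<^esub> y) = gr x \<otimes>\<^bsub>group_hopf G\<^esub> gr y"
proof (rule poly_mapping_eqI)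
  fix g assume x: "x \<in> C" and y: "y \<in> C"
  have "gr x \<otimes>\<^bsub>group_hopf G\<^esub> gr y = (\<Sum>a\<in>carrier G. \<Sum>b\<in>carrier G. Poly_Mapping.single (a \<otimes>\<^bsub>G\<^esub> b) (\<pi> a x * \<pi> b y))"
    unfolding group_hopf_simps
    by (subst sum_keys_gr[of "\<lambda>b c. Poly_Mapping.single (_ \<otimes>\<^bsub>G\<^esub> b) (_ * c)"], simp)
      (rule sum_keys_gr[of "\<lambda>a c. \<Sum>b\<in>carrier G. Poly_Mapping.single (a \<otimes>\<^bsub>G\<^esub> b) (c * \<pi> b y)"], simp)
  then show "Poly_Mapping.lookup (gr (x \<otimes>\<^bsub>H\<^esub> y)) g = Poly_Mapping.lookup (gr x \<otimes>\<^bsub>group_hopf G\<^esub> gr y) g"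
    using x y by (auto simp: lookup_gr lookup_sum lookup_single when_def pi_mult intro!: sum.neutral sum.cong)
qed

lemma gr_one: "gr \<one>\<^bsub>H\<^esub> = \<one>\<^bsub>group_hopf G\<^esub>"
  by (rule poly_mapping_eqI) (auto simp: lookup_gr group_hopf_simps lookup_single when_def pi_one)

abbreviation "Q \<equiv> quot_hopf H ker"

text \<open>Only the comultiplication takes work: it is defined with tensors over the plain quotient
  algebra, which have to be identified with tensors over \<open>Q\<close>.\<close>

lemma quot_simps:
  "carrier Q = a_rcosets\<^bsub>H\<^esub> ker" "add Q = set_add H" "\<one>\<^bsub>Q\<^esub> = ker +>\<^bsub>H\<^esub> \<one>\<^bsub>H\<^esub>" "monoid.mult Q = rcoset_mult H ker"
  "c \<odot>\<^bsub>Q\<^esub> X0 = (\<Union>x\<in>X0. ker +>\<^bsub>H\<^esub> (c \<odot>\<^bsub>H\<^esub> x))"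
  "counit Q X0 = counit H (SOME x. x \<in> X0)" "antipode Q X0 = ker +>\<^bsub>H\<^esub> antipode H (SOME x. x \<in> X0)"
  "comul Q X0 = tensor_lift (tensor Q Q) (\<lambda>x y. pure_tensor Q Q (ker +>\<^bsub>H\<^esub> x) (ker +>\<^bsub>H\<^esub> y)) (comul H (SOME x. x \<in> X0))"
proof -
  let ?A = "quot_algebra H ker"
  show s: "carrier Q = a_rcosets\<^bsub>H\<^esub> ker" "add Q = set_add H" "\<one>\<^bsub>Q\<^esub> = ker +>\<^bsub>H\<^esub> \<one>\<^bsub>H\<^esub>" "monoid.mult Q = rcoset_mult H ker"
    "c \<odot>\<^bsub>Q\<^esub> X0 = (\<Union>x\<in>X0. ker +>\<^bsub>H\<^esub> (c \<odot>\<^bsub>H\<^esub> x))"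
    "counit Q X0 = counit H (SOME x. x \<in> X0)" "antipode Q X0 = ker +>\<^bsub>H\<^esub> antipode H (SOME x. x \<in> X0)"
    by (simp_all add: quot_hopf_def quot_algebra_def FactRing_def Let_def ring.defs module.defs hopf.defs)
  have a: "carrier ?A = carrier Q" "add ?A = add Q" "module.smult ?A = module.smult Q"
    by (simp_all add: quot_hopf_def quot_algebra_def FactRing_def Let_def ring.defs module.defs hopf.defs)
  have tc: "tensor_class ?A ?A = tensor_class Q Q"
    by (rule ext, rule tensor_class_cong) (simp_all only: a)
  have "comul Q X0 = tensor_lift (tensor ?A ?A) (\<lambda>x y. pure_tensor ?A ?A (ker +>\<^bsub>H\<^esub> x) (ker +>\<^bsub>H\<^esub> y)) (comul H (SOME x. x \<in> X0))"
    by (simp add: quot_hopf_def Let_def module.defs hopf.defs)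
  moreover have "tensor_lift (tensor ?A ?A) f T = tensor_lift (tensor Q Q) f T" for f and T :: "('h \<times> 'h \<Rightarrow>\<^sub>0 'k) set"
  proof -
    have "carrier (tensor ?A ?A) = carrier (tensor Q Q)" "add (tensor ?A ?A) = add (tensor Q Q)"
      "zero (tensor ?A ?A) = zero (tensor Q Q)" "module.smult (tensor ?A ?A) = module.smult (tensor Q Q)"
      by (simp_all add: tensor_def tc a(1))
    then show ?thesis by (simp add: tensor_lift_def finsum_def finprod_def Let_def)
  qed
  moreover have "pure_tensor ?A ?A = pure_tensor Q Q" by (simp add: pure_tensor_def tc fun_eq_iff)
  ultimately show "comul Q X0 = tensor_lift (tensor Q Q) (\<lambda>x y. pure_tensor Q Q (ker +>\<^bsub>H\<^esub> x) (ker +>\<^bsub>H\<^esub> y)) (comul H (SOME x. x \<in> X0))"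
    by simp
qed

lemma coset_carrier: "x \<in> C \<Longrightarrow> ker +>\<^bsub>H\<^esub> x \<in> carrier Q"
  unfolding quot_simps by (rule a_rcosetsI[OF I.a_subset])

lemma quot_carrierE:
  assumes "X0 \<in> carrier Q"
  obtains x where "x \<in> C" "X0 = ker +>\<^bsub>H\<^esub> x"
  using assms unfolding quot_simps A_RCOSETS_def' by auto

lemma mem_coset:
  assumes "x \<in> C" "y \<in> ker +>\<^bsub>H\<^esub> x"
  shows "y \<in> C" "gr y = gr x"
proof -
  obtain k where k: "k \<in> ker" "y = k \<oplus>\<^bsub>H\<^esub> x" using assms(2) by (auto simp: a_r_coset_def')
  have kC: "k \<in> C" using k(1) unfolding ker_def by blast
  show "y \<in> C" unfolding k(2) using kC assms(1) by (rule a_closed)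
  have "\<pi> g k = 0" if "g \<in> carrier G" for g using k(1) that unfolding ker_def by blast
  then show "gr y = gr x"
    unfolding k(2) by (intro poly_mapping_eqI) (simp add: lookup_gr pi_add[OF _ kC assms(1)])
qed

lemma SOME_coset:
  assumes "X0 \<in> carrier Q"
  shows "(SOME x. x \<in> X0) \<in> C" "X0 = ker +>\<^bsub>H\<^esub> (SOME x. x \<in> X0)"
proof -
  obtain x where x: "x \<in> C" "X0 = ker +>\<^bsub>H\<^esub> x" using assms by (rule quot_carrierE)
  have "x \<in> X0" using I.a_rcos_self[OF x(1)] x(2) by simp
  then have m: "(SOME x. x \<in> X0) \<in> X0" by (rule someI)
  then show c: "(SOME x. x \<in> X0) \<in> C" using mem_coset(1) x by blast
  show "X0 = ker +>\<^bsub>H\<^esub> (SOME x. x \<in> X0)" using I.a_repr_independence'[OF _ x(1), of "SOME x. x \<in> X0"] m x(2) by simp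
qed

text \<open>It uses the same representative as the counit and antipode of the quotient, so these
  match without comparing representatives.\<close>

definition quot_map :: "'h set \<Rightarrow> 'g \<Rightarrow>\<^sub>0 'k" where "quot_map X0 = gr (SOME x. x \<in> X0)"

lemma quot_map_coset: "x \<in> C \<Longrightarrow> quot_map (ker +>\<^bsub>H\<^esub> x) = gr x"
  unfolding quot_map_def by (rule mem_coset(2)) (auto intro: someI I.a_rcos_self)

lemma quot_add: "x \<in> C \<Longrightarrow> y \<in> C \<Longrightarrow> (ker +>\<^bsub>H\<^esub> x) \<oplus>\<^bsub>Q\<^esub> (ker +>\<^bsub>H\<^esub> y) = ker +>\<^bsub>H\<^esub> (x \<oplus>\<^bsub>H\<^esub> y)"
  unfolding quot_simps by (rule I.a_rcos_sum)

lemma quot_mult: "x \<in> C \<Longrightarrow> y \<in> C \<Longrightarrow> (ker +>\<^bsub>H\<^esub> x) \<otimes>\<^bsub>Q\<^esub> (ker +>\<^bsub>H\<^esub> y) = ker +>\<^bsub>H\<^esub> (x \<otimes>\<^bsub>H\<^esub> y)"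
  unfolding quot_simps by (rule I.rcoset_mult_add)

lemma coset_eq_iff:
  assumes "x \<in> C" "y \<in> C"
  shows "ker +>\<^bsub>H\<^esub> x = ker +>\<^bsub>H\<^esub> y \<longleftrightarrow> gr x = gr y"
proof
  assume "ker +>\<^bsub>H\<^esub> x = ker +>\<^bsub>H\<^esub> y"
  then show "gr x = gr y" using mem_coset(2)[OF assms(2)] I.a_rcos_self[OF assms(1)] by simp
next
  assume eq: "gr x = gr y"
  have "\<pi> g x = \<pi> g y" if "g \<in> carrier G" for g
    using arg_cong[OF eq, of "\<lambda>t. Poly_Mapping.lookup t g"] that by (simp add: lookup_gr)
  then have "\<pi> g (x \<ominus>\<^bsub>H\<^esub> y) = 0" if "g \<in> carrier G" for g
    using that assms unfolding a_minus_def by (subst pi_add) (simp_all add: pi_minus)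
  then have "x \<ominus>\<^bsub>H\<^esub> y \<in> ker" using minus_closed[OF assms] unfolding ker_def by blast
  moreover have "x = (x \<ominus>\<^bsub>H\<^esub> y) \<oplus>\<^bsub>H\<^esub> y"
    unfolding a_minus_def using a_assoc[OF assms(1) a_inv_closed[OF assms(2)] assms(2)] assms by (simp add: l_neg)
  ultimately have "x \<in> ker +>\<^bsub>H\<^esub> y" unfolding a_r_coset_def' by blast
  then show "ker +>\<^bsub>H\<^esub> x = ker +>\<^bsub>H\<^esub> y" using I.a_repr_independence'[OF _ assms(2)] by simp
qed

lemma quot_smult:
  assumes x: "x \<in> C"
  shows "c \<odot>\<^bsub>Q\<^esub> (ker +>\<^bsub>H\<^esub> x) = ker +>\<^bsub>H\<^esub> (c \<odot>\<^bsub>H\<^esub> x)"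
proof -
  have "ker +>\<^bsub>H\<^esub> (c \<odot>\<^bsub>H\<^esub> y) = ker +>\<^bsub>H\<^esub> (c \<odot>\<^bsub>H\<^esub> x)" if "y \<in> ker +>\<^bsub>H\<^esub> x" for y
    using mem_coset[OF x that] x by (simp add: coset_eq_iff gr_smult)
  then show ?thesis unfolding quot_simps using I.a_rcos_self[OF x] by blast
qed

lemma quot_map_linear: "quot_map \<in> linear_maps Q (group_hopf G)"
  by (auto simp: linear_maps_def group_hopf_simps elim!: quot_carrierE
      simp: quot_add quot_smult quot_map_coset gr_add gr_smult dest: keys_gr[THEN subsetD])

lemma quot_map_algebra_iso: "quot_map \<in> algebra_isos Q (group_hopf G)"
proof -
  have "quot_map \<in> ring_hom Q (group_hopf G)"
  proof (rule ring_hom_memI)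
    show "quot_map X0 \<in> carrier (group_hopf G)" if "X0 \<in> carrier Q" for X0
      using quot_map_linear that by (auto simp: linear_maps_def)
    show "quot_map (X0 \<oplus>\<^bsub>Q\<^esub> Y0) = quot_map X0 \<oplus>\<^bsub>group_hopf G\<^esub> quot_map Y0" if "X0 \<in> carrier Q" "Y0 \<in> carrier Q" for X0 Y0
      using quot_map_linear that by (auto simp: linear_maps_def)
    show "quot_map (X0 \<otimes>\<^bsub>Q\<^esub> Y0) = quot_map X0 \<otimes>\<^bsub>group_hopf G\<^esub> quot_map Y0" if "X0 \<in> carrier Q" "Y0 \<in> carrier Q" for X0 Y0
      using that by (auto elim!: quot_carrierE simp: quot_mult quot_map_coset gr_mult)
    show "quot_map \<one>\<^bsub>Q\<^esub> = \<one>\<^bsub>group_hopf G\<^esub>"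
      by (simp add: quot_simps(3) quot_map_coset gr_one)
  qed
  moreover have "bij_betw quot_map (carrier Q) (carrier (group_hopf G))"
    unfolding bij_betw_def
  proof
    show "inj_on quot_map (carrier Q)"
    proof (rule inj_onI)
      fix X0 Y0 assume XY: "X0 \<in> carrier Q" "Y0 \<in> carrier Q" "quot_map X0 = quot_map Y0"
      obtain x where x: "x \<in> C" "X0 = ker +>\<^bsub>H\<^esub> x" using XY(1) by (rule quot_carrierE)
      obtain y where y: "y \<in> C" "Y0 = ker +>\<^bsub>H\<^esub> y" using XY(2) by (rule quot_carrierE)
      show "X0 = Y0" using XY(3) coset_eq_iff[OF x(1) y(1)] quot_map_coset x y by simp
    qed
    show "quot_map ` carrier Q = carrier (group_hopf G)"
    proof
      show "quot_map ` carrier Q \<subseteq> carrier (group_hopf G)"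
        using quot_map_linear by (auto simp: linear_maps_def)
      show "carrier (group_hopf G) \<subseteq> quot_map ` carrier Q"
      proof
        fix t :: "'g \<Rightarrow>\<^sub>0 'k" assume t: "t \<in> carrier (group_hopf G)"
        obtain u where u: "\<And>g. g \<in> carrier G \<Longrightarrow> u g \<in> C"
          and pu: "\<And>g g'. g \<in> carrier G \<Longrightarrow> g' \<in> carrier G \<Longrightarrow> \<pi> g' (u g) = (if g' = g then 1 else 0)"
          using bchoice[of "carrier G" "\<lambda>g u. u \<in> C \<and> (\<forall>g'\<in>carrier G. \<pi> g' u = (if g' = g then 1 else 0))"] pi_surj by blast
        define x where "x = (\<Oplus>\<^bsub>H\<^esub>g\<in>carrier G. Poly_Mapping.lookup t g \<odot>\<^bsub>H\<^esub> u g)"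
        have x: "x \<in> C" unfolding x_def using u by (intro finsum_closed) auto
        have "\<pi> g x = Poly_Mapping.lookup t g" if g: "g \<in> carrier G" for g
        proof -
          have "\<pi> g x = (\<Sum>g'\<in>carrier G. \<pi> g (Poly_Mapping.lookup t g' \<odot>\<^bsub>H\<^esub> u g'))"
            unfolding x_def using u by (intro finsum_linear[OF abelian_group_H pi_linear[OF g] _ vector_space_mult]) auto
          also have "\<dots> = (\<Sum>g'\<in>carrier G. if g' = g then Poly_Mapping.lookup t g else 0)"
            using g u by (intro sum.cong refl) (auto simp: pi_smult pu)
          finally show ?thesis using finG g by simp
        qed
        then have "gr x = t"
          using t by (intro poly_mapping_eqI) (auto simp: lookup_gr group_hopf_simps in_keys_iff)
        then show "t \<in> quot_map ` carrier Q" using x coset_carrier quot_map_coset by (metis imageI)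
      qed
    qed
  qed
  ultimately show ?thesis using quot_map_linear by (simp add: algebra_isos_def algebra_homs_def)
qed

lemma group_hopf_abelian: "abelian_group (group_hopf G :: ('k, 'g \<Rightarrow>\<^sub>0 'k) hopf)"
proof (rule abelian_groupI)
  fix x y :: "'g \<Rightarrow>\<^sub>0 'k"
  assume "x \<in> carrier (group_hopf G)"
  then show "\<exists>y\<in>carrier (group_hopf G). y \<oplus>\<^bsub>group_hopf G\<^esub> x = \<zero>\<^bsub>group_hopf G\<^esub>"
    by (intro bexI[of _ "- x"]) (auto simp: group_hopf_simps in_keys_iff)
qed (auto simp: group_hopf_simps add_ac intro: keys_add_subset[THEN subsetD])

lemma group_hopf_finsum:
  fixes v :: "'i \<Rightarrow> 'g \<Rightarrow>\<^sub>0 'k"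
  assumes "v \<in> A \<rightarrow> carrier (group_hopf G)"
  shows "(\<Oplus>\<^bsub>group_hopf G :: ('k, 'g \<Rightarrow>\<^sub>0 'k) hopf\<^esub>a\<in>A. v a) = sum v A"
proof -
  have "linear_on (group_hopf G :: ('k, 'g \<Rightarrow>\<^sub>0 'k) hopf) pm_scale (\<lambda>x. x)" by (simp add: linear_on_def group_hopf_simps)
  from finsum_linear[OF group_hopf_abelian this assms vector_space_pm_scale] show ?thesis .
qed

lemma gr_expand: "gr x = (\<Oplus>\<^bsub>group_hopf G\<^esub>g\<in>carrier G. \<pi> g x \<odot>\<^bsub>group_hopf G\<^esub> Poly_Mapping.single g 1)"
  by (subst group_hopf_finsum) (auto simp: group_hopf_simps pm_scale_single gr_def split: if_splits)

lemma single_gr_tensor_null: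
  "Poly_Mapping.single (gr x, gr y) 1 -
    (\<Sum>g\<in>carrier G. \<Sum>g'\<in>carrier G. Poly_Mapping.single (Poly_Mapping.single g 1, Poly_Mapping.single g' 1) (\<pi> g x * \<pi> g' y))
   \<in> tensor_null (group_hopf G) (group_hopf G)"
proof -
  let ?K = "group_hopf G :: ('k, 'g \<Rightarrow>\<^sub>0 'k) hopf"
  let ?e = "\<lambda>g. Poly_Mapping.single g (1 :: 'k)"
  have e: "?e g \<in> carrier ?K" if "g \<in> carrier G" for g using that by (simp add: group_hopf_simps)
  have sm: "c \<odot>\<^bsub>?K\<^esub> x \<in> carrier ?K" "0 \<odot>\<^bsub>?K\<^esub> x = \<zero>\<^bsub>?K\<^esub>" if "x \<in> carrier ?K" for c x
    using that keys_pm_scale[of c x] by (auto simp: group_hopf_simps)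
  have gy: "gr y \<in> carrier ?K" using keys_gr by (simp add: group_hopf_simps)
  have 1: "Poly_Mapping.single (gr x, gr y) 1 - (\<Sum>g\<in>carrier G. Poly_Mapping.single (?e g, gr y) (\<pi> g x)) \<in> tensor_null ?K ?K"
    unfolding gr_expand[of x] by (rule tensor_null_finsum_left[OF group_hopf_abelian sm finG e gy])
  have 2: "Poly_Mapping.single (?e g, gr y) (\<pi> g x) -
      (\<Sum>g'\<in>carrier G. Poly_Mapping.single (?e g, ?e g') (\<pi> g x * \<pi> g' y)) \<in> tensor_null ?K ?K" if g: "g \<in> carrier G" for g
  proof -
    have "Poly_Mapping.single (?e g, gr y) 1 - (\<Sum>g'\<in>carrier G. Poly_Mapping.single (?e g, ?e g') (\<pi> g' y)) \<in> tensor_null ?K ?K"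
      unfolding gr_expand[of y] by (rule tensor_null_finsum_right[OF group_hopf_abelian sm finG e e[OF g]])
    from tensor_null.scale[OF this, of "\<pi> g x"] show ?thesis
      by (simp add: PM.scale_right_diff_distrib PM.scale_sum_right pm_scale_single)
  qed
  have "Poly_Mapping.single (gr x, gr y) 1 -
    (\<Sum>g\<in>carrier G. \<Sum>g'\<in>carrier G. Poly_Mapping.single (?e g, ?e g') (\<pi> g x * \<pi> g' y)) =
    (Poly_Mapping.single (gr x, gr y) 1 - (\<Sum>g\<in>carrier G. Poly_Mapping.single (?e g, gr y) (\<pi> g x))) +
    (\<Sum>g\<in>carrier G. Poly_Mapping.single (?e g, gr y) (\<pi> g x) -
      (\<Sum>g'\<in>carrier G. Poly_Mapping.single (?e g, ?e g') (\<pi> g x * \<pi> g' y)))"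
    by (simp add: sum_subtractf)
  also have "\<dots> \<in> tensor_null ?K ?K" using 1 2 by (intro tensor_null.add tensor_null_sum)
  finally show ?thesis .
qed

text \<open>The chosen representative over the quotient differs from \<tau> by a null tensor, which
  stays null under \<open>quot_map\<close> in both legs. Expanded in group elements, only the
  diagonal remains by \<open>pi_comul\<close>.\<close>

lemma quot_map_comul:
  assumes X0: "X0 \<in> carrier Q"
  shows "comul (group_hopf G) (quot_map X0) =
    tensor_lift (tensor (group_hopf G) (group_hopf G)) (\<lambda>x y. pure_tensor (group_hopf G) (group_hopf G) (quot_map x) (quot_map y)) (comul Q X0)"
proof -
  let ?K = "group_hopf G :: ('k, 'g \<Rightarrow>\<^sub>0 'k) hopf"
  let ?e = "\<lambda>g. Poly_Mapping.single g (1 :: 'k)"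
  let ?\<phi> = "\<lambda>t. pm_sum pm_scale t (\<lambda>x y. Poly_Mapping.single (quot_map x, quot_map y) 1)"
  define x where "x = (SOME x. x \<in> X0)"
  have x: "x \<in> C" using SOME_coset(1)[OF X0] by (simp add: x_def)
  let ?t = "SOME t. t \<in> comul H x"
  have kt: "fst p \<in> C" "snd p \<in> C" if "p \<in> Poly_Mapping.keys ?t" for p using keys_comul[OF x that] .
  define \<tau> where "\<tau> = pm_sum pm_scale ?t (\<lambda>x y. Poly_Mapping.single (ker +>\<^bsub>H\<^esub> x, ker +>\<^bsub>H\<^esub> y) 1)"
  have cQ: "comul Q X0 = tensor_class Q Q \<tau>"
    unfolding quot_simps pure_tensor_def \<tau>_def x_def[symmetric]
    by (rule tensor_lift_class) (use kt coset_carrier in auto)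
  have k\<tau>: "Poly_Mapping.keys \<tau> \<subseteq> carrier Q \<times> carrier Q"
    unfolding \<tau>_def pm_sum_def using kt coset_carrier
    by (intro keys_sum_subset keys_pm_scale_subset) auto
  let ?t' = "SOME t. t \<in> tensor_class Q Q \<tau>"
  note t' = tensor_mem_SOME[OF tensor_class_carrier[OF k\<tau>]]
  have qm: "quot_map y \<in> carrier ?K" if "y \<in> carrier Q" for y
    using quot_map_linear that by (auto simp: linear_maps_def)
  have "tensor_lift (tensor ?K ?K) (\<lambda>x y. pure_tensor ?K ?K (quot_map x) (quot_map y)) (comul Q X0) = tensor_class ?K ?K (?\<phi> ?t')"
    unfolding cQ pure_tensor_def by (rule tensor_lift_class) (use t'(2) qm in auto)
  also have "\<dots> = tensor_class ?K ?K (\<Sum>p\<in>Poly_Mapping.keys ?t. pm_scale (Poly_Mapping.lookup ?t p) (Poly_Mapping.single (gr (fst p), gr (snd p)) 1))"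
  proof (rule tensor_class_eqI)
    have "?t' - \<tau> \<in> tensor_null Q Q" using t'(1) by (simp add: tensor_class_def)
    then have "?\<phi> (?t' - \<tau>) \<in> tensor_null ?K ?K" by (rule pm_sum_map_tensor_null[OF quot_map_linear quot_map_linear])
    moreover have "?\<phi> \<tau> = (\<Sum>p\<in>Poly_Mapping.keys ?t. pm_scale (Poly_Mapping.lookup ?t p) (Poly_Mapping.single (gr (fst p), gr (snd p)) 1))"
    proof -
      have \<phi>_sum: "?\<phi> (\<Sum>p\<in>A. pm_scale (c p) (f p)) = (\<Sum>p\<in>A. pm_scale (c p) (?\<phi> (f p)))" for A c and f :: "'h \<times> 'h \<Rightarrow> _"
        by (induction A rule: infinite_finite_induct) (auto simp: PM.pm_sum_add PM.pm_sum_scale)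
      show ?thesis unfolding \<tau>_def pm_sum_def[of pm_scale ?t] \<phi>_sum
        by (auto intro!: sum.cong simp: quot_map_coset kt)
    qed
    ultimately show "?\<phi> ?t' - (\<Sum>p\<in>Poly_Mapping.keys ?t. pm_scale (Poly_Mapping.lookup ?t p) (Poly_Mapping.single (gr (fst p), gr (snd p)) 1)) \<in> tensor_null ?K ?K"
      by (simp add: PM.pm_sum_diff)
  qed
  also have "\<dots> = tensor_class ?K ?K (\<Sum>p\<in>Poly_Mapping.keys ?t. pm_scale (Poly_Mapping.lookup ?t p)
      (\<Sum>g\<in>carrier G. \<Sum>g'\<in>carrier G. Poly_Mapping.single (?e g, ?e g') (\<pi> g (fst p) * \<pi> g' (snd p))))"
    by (rule tensor_class_eqI, rule tensor_class_single_sum) (rule single_gr_tensor_null)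
  also have "(\<Sum>p\<in>Poly_Mapping.keys ?t. pm_scale (Poly_Mapping.lookup ?t p)
      (\<Sum>g\<in>carrier G. \<Sum>g'\<in>carrier G. Poly_Mapping.single (?e g, ?e g') (\<pi> g (fst p) * \<pi> g' (snd p)))) =
      (\<Sum>g\<in>carrier G. \<Sum>g'\<in>carrier G. pm_scale (SK x (\<lambda>y z. \<pi> g y * \<pi> g' z)) (Poly_Mapping.single (?e g, ?e g') 1))"
    unfolding sw_def pm_sum_def PM.scale_sum_left PM.scale_sum_right
    by (subst sum.swap, rule sum.cong[OF refl], subst sum.swap) (simp add: pm_scale_single)
  also have "\<dots> = (\<Sum>g\<in>carrier G. \<Sum>g'\<in>carrier G. if g' = g then Poly_Mapping.single (?e g, ?e g) (\<pi> g x) else 0)"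
    by (intro sum.cong refl) (simp add: pi_comul[OF x] pm_scale_single)
  also have "\<dots> = (\<Sum>g\<in>carrier G. Poly_Mapping.single (?e g, ?e g) (\<pi> g x))" using finG by simp
  also have "tensor_class ?K ?K \<dots> = comul ?K (quot_map X0)"
    unfolding group_hopf_simps quot_map_def x_def[symmetric]
    by (subst sum_keys_gr[of "\<lambda>g. Poly_Mapping.single (?e g, ?e g)"]) simp_all
  finally show ?thesis by simp
qed

theorem quot_map_hopf_iso: "quot_map \<in> hopf_isos Q (group_hopf G)"
  unfolding hopf_isos_def
proof (intro CollectI conjI ballI)
  show "quot_map \<in> algebra_isos Q (group_hopf G)" by (rule quot_map_algebra_iso)
  fix X0 assume X0: "X0 \<in> carrier Q"
  show "comul (group_hopf G) (quot_map X0) =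
    tensor_lift (tensor (group_hopf G) (group_hopf G)) (\<lambda>x y. pure_tensor (group_hopf G) (group_hopf G) (quot_map x) (quot_map y)) (comul Q X0)"
    by (rule quot_map_comul[OF X0])
  let ?x = "SOME x. x \<in> X0"
  have x: "?x \<in> C" by (rule SOME_coset(1)[OF X0])
  show "counit (group_hopf G) (quot_map X0) = counit Q X0"
    unfolding group_hopf_simps quot_simps quot_map_def
    using sum_keys_gr[of "\<lambda>g c. c" ?x] pi_counit[OF x] by simp
  have "antipode (group_hopf G) (quot_map X0) = (\<Sum>g\<in>carrier G. Poly_Mapping.single (inv\<^bsub>G\<^esub> g) (\<pi> g ?x))"
    unfolding group_hopf_simps quot_map_def
    by (rule sum_keys_gr[of "\<lambda>g. Poly_Mapping.single (inv\<^bsub>G\<^esub> g)"]) simp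
  also have "\<dots> = (\<Sum>g\<in>carrier G. Poly_Mapping.single g (\<pi> (inv\<^bsub>G\<^esub> g) ?x))"
    by (rule sum.reindex_bij_witness[of _ "m_inv G" "m_inv G"]) auto
  also have "\<dots> = gr (antipode H ?x)"
    unfolding gr_def by (rule sum.cong) (simp_all add: pi_antipode x)
  also have "\<dots> = quot_map (antipode Q X0)"
    unfolding quot_simps using x by (simp add: quot_map_coset)
  finally show "antipode (group_hopf G) (quot_map X0) = quot_map (antipode Q X0)" .
qed

end

section \<open>A basis with linear coordinate functions\<close>

context hopf
begin

definition lincomb :: "'h set \<Rightarrow> ('h \<Rightarrow> 'k) \<Rightarrow> 'h" where
  "lincomb E c = (\<Oplus>\<^bsub>H\<^esub>e\<in>E. c e \<odot>\<^bsub>H\<^esub> e)"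

lemma
  assumes "finite E" "E \<subseteq> C"
  shows lincomb_closed: "lincomb E c \<in> C"
    and lincomb_add: "lincomb E (\<lambda>e. c e + d e) = lincomb E c \<oplus>\<^bsub>H\<^esub> lincomb E d"
    and lincomb_smult: "lincomb E (\<lambda>e. r * c e) = r \<odot>\<^bsub>H\<^esub> lincomb E c"
proof -
  have cl: "(\<lambda>e. c e \<odot>\<^bsub>H\<^esub> e) \<in> E \<rightarrow> C" for c using assms by auto
  show "lincomb E c \<in> C" unfolding lincomb_def by (rule finsum_closed[OF cl])
  show "lincomb E (\<lambda>e. c e + d e) = lincomb E c \<oplus>\<^bsub>H\<^esub> lincomb E d"
    unfolding lincomb_def finsum_addf[OF cl cl, symmetric]
    by (rule finsum_cong') (use assms in \<open>auto simp: smult_add_left\<close>)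
  have z: "r \<odot>\<^bsub>H\<^esub> \<zero>\<^bsub>H\<^esub> = \<zero>\<^bsub>H\<^esub>"
    using smult_add_right[of "\<zero>\<^bsub>H\<^esub>" "\<zero>\<^bsub>H\<^esub>" r] by (metis add.l_cancel_one' l_zero smult_closed zero_closed)
  show "lincomb E (\<lambda>e. r * c e) = r \<odot>\<^bsub>H\<^esub> lincomb E c"
    unfolding lincomb_def using assms
  proof (induction E rule: finite_induct)
    case (insert e E)
    have "(\<lambda>e. c e \<odot>\<^bsub>H\<^esub> e) \<in> E \<rightarrow> C" "(\<lambda>e. (r * c e) \<odot>\<^bsub>H\<^esub> e) \<in> E \<rightarrow> C" using insert.prems by auto
    then show ?case using insert by (simp add: smult_add_right smult_smult)
  qed (simp add: z)
qed

lemma lincomb_remove: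
  assumes "finite E" "E \<subseteq> C" "e \<in> E" "c e = 0"
  shows "lincomb E c = lincomb (E - {e}) c"
proof -
  have "e \<in> C" "(\<lambda>e. c e \<odot>\<^bsub>H\<^esub> e) \<in> E - {e} \<rightarrow> C" using assms by auto
  moreover have "0 \<odot>\<^bsub>H\<^esub> e = \<zero>\<^bsub>H\<^esub>"
    using smult_add_left[of e 0 0] \<open>e \<in> C\<close> by (metis add.l_cancel_one' add_0 smult_closed)
  ultimately show ?thesis
    unfolding lincomb_def using finsum_insert[of "E - {e}" e "\<lambda>e. c e \<odot>\<^bsub>H\<^esub> e"] assms
    by (simp add: insert_absorb)
qed

text \<open>In a spanning set of least cardinality no relation can involve e with nonzero
  coefficient, since e could then be dropped. Coordinates are therefore unique, hence
  linear.\<close>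

lemma finite_basis:
  assumes "finite_dimensional H"
  obtains E and cf :: "'h \<Rightarrow> 'h \<Rightarrow> 'k" where "finite E" "E \<subseteq> C" "\<And>e. e \<in> E \<Longrightarrow> linear_on H (*) (cf e)"
    "\<And>h. h \<in> C \<Longrightarrow> h = (\<Oplus>\<^bsub>H\<^esub>e\<in>E. cf e h \<odot>\<^bsub>H\<^esub> e)"
proof -
  define spans where "spans = (\<lambda>E. finite E \<and> E \<subseteq> C \<and> (\<forall>x\<in>C. \<exists>c. x = lincomb E c))"
  obtain E0 where "spans E0" using assms by (auto simp: finite_dimensional_def spans_def lincomb_def)
  then obtain E where E: "spans E" and min: "\<And>E'. spans E' \<Longrightarrow> card E \<le> card E'"
    using ex_has_least_nat[of spans E0 card] by blast
  have fin: "finite E" "E \<subseteq> C" and span: "\<And>x. x \<in> C \<Longrightarrow> \<exists>c. x = lincomb E c" using E by (auto simp: spans_def)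
  have indep: "c e = 0" if c: "lincomb E c = \<zero>\<^bsub>H\<^esub>" and e: "e \<in> E" for c e
  proof (rule ccontr)
    assume ne: "c e \<noteq> 0"
    have "\<exists>d. x = lincomb (E - {e}) d" if x: "x \<in> C" for x
    proof -
      obtain a where a: "x = lincomb E a" using span[OF x] by blast
      \<comment> \<open>The multiple of the relation is chosen to cancel the coordinate at
        e.\<close>
      define d where "d = (\<lambda>y. a y + (- (a e / c e)) * c y)"
      have "lincomb E d = x \<oplus>\<^bsub>H\<^esub> (- (a e / c e)) \<odot>\<^bsub>H\<^esub> \<zero>\<^bsub>H\<^esub>"
        unfolding d_def lincomb_add[OF fin] lincomb_smult[OF fin] by (simp only: a c)
      also have "(- (a e / c e)) \<odot>\<^bsub>H\<^esub> \<zero>\<^bsub>H\<^esub> = \<zero>\<^bsub>H\<^esub>"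
        using smult_add_right[of "\<zero>\<^bsub>H\<^esub>" "\<zero>\<^bsub>H\<^esub>" "- (a e / c e)"]
        by (metis add.l_cancel_one' l_zero smult_closed zero_closed)
      finally have "x = lincomb E d" using x by simp
      moreover have "d e = 0" using ne by (simp add: d_def)
      ultimately show ?thesis using lincomb_remove[OF fin e, of d] by blast
    qed
    then have "spans (E - {e})" using fin by (auto simp: spans_def)
    then have "card E \<le> card (E - {e})" by (rule min)
    moreover have "card (E - {e}) < card E" using fin(1) e by (intro psubset_card_mono) auto
    ultimately show False by simp
  qed
  obtain cf' where cf': "\<And>h. h \<in> C \<Longrightarrow> h = lincomb E (cf' h)" using span by metis
  have uniq: "c e = d e" if "lincomb E c = lincomb E d" "e \<in> E" for c d e
  proof -
    have "lincomb E (\<lambda>e. c e + (- 1) * d e) = lincomb E d \<oplus>\<^bsub>H\<^esub> (- 1) \<odot>\<^bsub>H\<^esub> lincomb E d"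
      unfolding lincomb_add[OF fin] lincomb_smult[OF fin] that(1) ..
    also have "\<dots> = lincomb E (\<lambda>e. 0 * d e)"
      unfolding lincomb_smult[OF fin, symmetric] lincomb_add[OF fin, symmetric] by simp
    also have "\<dots> = 0 \<odot>\<^bsub>H\<^esub> lincomb E d" by (rule lincomb_smult[OF fin])
    also have "\<dots> = \<zero>\<^bsub>H\<^esub>"
      using smult_add_left[OF lincomb_closed[OF fin], of 0 0 d] lincomb_closed[OF fin, of d]
      by (metis add.l_cancel_one' add_0 smult_closed)
    finally show ?thesis using indep[of "\<lambda>e. c e + (- 1) * d e" e] that(2) by simp
  qed
  have "linear_on H (*) (\<lambda>h. cf' h e)" if e: "e \<in> E" for e
    unfolding linear_on_def
  proof (intro conjI ballI allI)
    fix x y assume x: "x \<in> C" and y: "y \<in> C"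
    have "lincomb E (cf' (x \<oplus>\<^bsub>H\<^esub> y)) = lincomb E (\<lambda>e. cf' x e + cf' y e)"
      unfolding lincomb_add[OF fin] using cf' x y by (metis a_closed)
    then show "cf' (x \<oplus>\<^bsub>H\<^esub> y) e = cf' x e + cf' y e" using uniq e by blast
  next
    fix c x assume x: "x \<in> C"
    have "lincomb E (cf' (c \<odot>\<^bsub>H\<^esub> x)) = lincomb E (\<lambda>e. c * cf' x e)"
      unfolding lincomb_smult[OF fin] using cf' x by (metis smult_closed)
    then show "cf' (c \<odot>\<^bsub>H\<^esub> x) e = c * cf' x e" using uniq e by blast
  qed
  then show thesis using that[of E "\<lambda>e h. cf' h e"] fin cf' by (simp add: lincomb_def)
qed

end

section \<open>The character coordinates as a map to a group algebra\<close>

context closed_hopf_quantization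
begin

lemma cg_mult:
  assumes x: "x \<in> C" and y: "y \<in> C" and g: "g \<in> chars"
  shows "cg g (x \<otimes>\<^bsub>H\<^esub> y) = (\<Sum>a\<in>chars. \<Sum>b\<in>chars. if a \<circ> b = g then cg a x * cg b y else 0)"
proof (rule cg_unique[OF _ _ g])
  show "x \<otimes>\<^bsub>H\<^esub> y \<in> C" using x y by simp
  fix v
  have "op (x \<otimes>\<^bsub>H\<^esub> y) v = (\<Sum>a\<in>chars. s (cg a x) (a (\<Sum>b\<in>chars. s (cg b y) (b v))))"
    unfolding op_mult[OF x y] op_cg_apply[OF y] op_cg_apply[OF x] ..
  also have "\<dots> = (\<Sum>a\<in>chars. \<Sum>b\<in>chars. s (cg a x * cg b y) ((a \<circ> b) v))"
    by (intro sum.cong refl)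
      (simp add: inj_ring_homD(9)[OF chars_inj_ring_hom] charsD(5) S.scale_sum_right)
  also have "\<dots> = (\<Sum>a\<in>chars. \<Sum>b\<in>chars. \<Sum>g\<in>chars. s (if a \<circ> b = g then cg a x * cg b y else 0) (g v))"
  proof (intro sum.cong refl)
    fix a b assume ab: "a \<in> chars" "b \<in> chars"
    have "(\<Sum>g\<in>chars. s (if a \<circ> b = g then cg a x * cg b y else 0) (g v)) =
        (\<Sum>g\<in>chars. if g = a \<circ> b then s (cg a x * cg b y) ((a \<circ> b) v) else 0)"
      by (rule sum.cong) auto
    then show "s (cg a x * cg b y) ((a \<circ> b) v) = (\<Sum>g\<in>chars. s (if a \<circ> b = g then cg a x * cg b y else 0) (g v))"
      using finite_chars chars_comp[OF ab] by simp
  qed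
  also have "\<dots> = (\<Sum>g\<in>chars. \<Sum>a\<in>chars. \<Sum>b\<in>chars. s (if a \<circ> b = g then cg a x * cg b y else 0) (g v))"
    by (rule trans[OF sum.cong[OF refl sum.swap] sum.swap])
  finally show "op (x \<otimes>\<^bsub>H\<^esub> y) v = (\<Sum>g\<in>chars. s (\<Sum>a\<in>chars. \<Sum>b\<in>chars. if a \<circ> b = g then cg a x * cg b y else 0) (g v))"
    by (simp add: S.scale_sum_left)
qed

lemma cg_one: "g \<in> chars \<Longrightarrow> cg g \<one>\<^bsub>H\<^esub> = (if g = id then 1 else 0)"
proof -
  assume g: "g \<in> chars"
  show ?thesis
  proof (rule cg_unique[OF one_closed _ g])
    fix v
    have "(\<Sum>h\<in>chars. s (if h = id then 1 else 0) (h v)) = (\<Sum>h\<in>chars. if h = id then v else 0)"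
      by (rule sum.cong) auto
    then show "op \<one>\<^bsub>H\<^esub> v = (\<Sum>h\<in>chars. s (if h = id then 1 else 0) (h v))"
      using finite_chars chars_id by (simp add: op_one)
  qed
qed

text \<open>The characters are numbered because the group is required to consist of natural numbers:
  \<open>b\<close> is the numbering, \<open>i\<close> its inverse, and composition is transported
  along them.\<close>

theorem group_coefficients_exist:
  "\<exists>(G :: nat monoid) \<pi>. hopf_group_coefficients H G \<pi> \<and>
     (\<forall>x\<in>C. (\<forall>g\<in>carrier G. \<pi> g x = 0) \<longrightarrow> (\<forall>a. act x a = 0))"
proof -
  obtain b where b: "bij_betw b {0..<card chars} chars"
    using ex_bij_betw_nat_finite[OF finite_chars] by blast
  let ?N = "{0..<card chars}"
  define i where "i = inv_into ?N b"
  have bc: "b n \<in> chars" if "n \<in> ?N" for n using b that by (auto simp: bij_betw_def)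
  have ic: "i g \<in> ?N" and bi: "b (i g) = g" if "g \<in> chars" for g
    using inv_into_into[of g b ?N] f_inv_into_f[of g b ?N] that
    unfolding i_def bij_betw_imp_surj_on[OF b] by blast+
  have ib: "i (b n) = n" if "n \<in> ?N" for n using b that by (simp add: i_def bij_betw_def)
  have beq: "b m = g \<longleftrightarrow> m = i g" if "m \<in> ?N" "g \<in> chars" for m g using ib bi that by auto
  define G where "G = \<lparr>carrier = ?N, monoid.mult = (\<lambda>m n. i (b m \<circ> b n)), one = i id\<rparr>"
  have G: "carrier G = ?N" "m \<otimes>\<^bsub>G\<^esub> n = i (b m \<circ> b n)" "\<one>\<^bsub>G\<^esub> = i id" for m n by (simp_all add: G_def)
  have grp: "Group.group G"
  proof (rule groupI)
    fix m assume m: "m \<in> carrier G"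
    obtain g' where g': "g' \<in> chars" "g' \<circ> b m = id" using chars_inverse[OF bc] m by (metis G(1))
    then show "\<exists>n\<in>carrier G. n \<otimes>\<^bsub>G\<^esub> m = \<one>\<^bsub>G\<^esub>" using ic bi by (intro bexI[of _ "i g'"]) (auto simp: G)
  qed (use ic in \<open>auto simp: G bi bc chars_comp chars_id ib comp_assoc\<close>)
  have sum_G: "(\<Sum>n\<in>?N. f (b n)) = (\<Sum>g\<in>chars. f g)" for f :: "_ \<Rightarrow> 'k"
    by (rule sum.reindex_bij_betw[OF b])
  have "hopf_group_coefficients H G (\<lambda>n. cg (b n))"
  proof (intro hopf_group_coefficients.intro hopf_axioms hopf_group_coefficients_axioms.intro grp)
    show "finite (carrier G)" by (simp add: G)
    fix g assume g: "g \<in> carrier G"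
    then have bg: "b g \<in> chars" using bc by (simp add: G)
    show "linear_on H (*) (cg (b g))" by (rule linear_cg)
    show "cg (b g) \<one>\<^bsub>H\<^esub> = (if g = \<one>\<^bsub>G\<^esub> then 1 else 0)"
      using g by (simp add: cg_one[OF bg] G beq chars_id)
    show "\<exists>u\<in>C. \<forall>g'\<in>carrier G. cg (b g') u = (if g' = g then 1 else 0)"
    proof -
      obtain u where "u \<in> C" "\<And>g'. g' \<in> chars \<Longrightarrow> cg g' u = (if g' = b g then 1 else 0)"
        using unit_vector[OF bg] by blast
      then show ?thesis using g bc by (intro bexI[of _ u]) (auto simp: G beq ib)
    qed
    fix x y assume x: "x \<in> C" and y: "y \<in> C"
    have "cg (b g) (x \<otimes>\<^bsub>H\<^esub> y) = (\<Sum>m\<in>?N. \<Sum>n\<in>?N. if b m \<circ> b n = b g then cg (b m) x * cg (b n) y else 0)"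
      unfolding cg_mult[OF x y bg] sum_G[symmetric] ..
    also have "\<dots> = (\<Sum>m\<in>carrier G. \<Sum>n\<in>carrier G. if m \<otimes>\<^bsub>G\<^esub> n = g then cg (b m) x * cg (b n) y else 0)"
    proof (unfold G, intro sum.cong refl)
      fix m n assume mn: "m \<in> ?N" "n \<in> ?N"
      have "b m \<circ> b n \<in> chars" using mn bc chars_comp by blast
      then have "b m \<circ> b n = b g \<longleftrightarrow> i (b m \<circ> b n) = g" using beq[of g "b m \<circ> b n"] g by (auto simp: G)
      then show "(if b m \<circ> b n = b g then cg (b m) x * cg (b n) y else 0) = (if i (b m \<circ> b n) = g then cg (b m) x * cg (b n) y else 0)"
        by simp
    qed
    finally show "cg (b g) (x \<otimes>\<^bsub>H\<^esub> y) = (\<Sum>m\<in>carrier G. \<Sum>n\<in>carrier G. if m \<otimes>\<^bsub>G\<^esub> n = g then cg (b m) x * cg (b n) y else 0)" .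
  next
    fix x assume x: "x \<in> C"
    show "(\<Sum>g\<in>carrier G. cg (b g) x) = counit H x" unfolding G sum_G[of "\<lambda>g. cg g x"] by (rule cg_counit[OF x])
    fix g g' assume g: "g \<in> carrier G" "g' \<in> carrier G"
    then have "b g = b g' \<longleftrightarrow> g = g'" using ib by (metis G(1))
    then show "sw H (*) x (\<lambda>y z. cg (b g) y * cg (b g') z) = (if g = g' then cg (b g) x else 0)"
      using cg_comul[OF x bc bc, of g g'] g by (simp add: G)
  qed
  moreover have "act x a = 0" if "x \<in> C" "\<forall>n\<in>carrier G. cg (b n) x = 0" for x a
    using kernel_acts_trivially[OF that(1)] that(2) ic bi by (metis G(1))
  ultimately show ?thesis by blast
qed

end

section \<open>Transport of a quantum deformation to power series\<close>

lemma vector_space_type_algebra: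
  fixes s :: "'k::field \<Rightarrow> 'a::ring_1 \<Rightarrow> 'a"
  assumes "assoc_algebra (type_algebra s)"
  shows "vector_space s" and "s c a * b = s c (a * b)"
proof -
  interpret M: Module.module "ring_of_type_algebra :: 'k ring" "type_algebra s"
    using assms by (simp add: assoc_algebra_def)
  note d = type_algebra_def ring_of_type_algebra_def ring.defs module.defs
  show "vector_space s"
  proof
    fix a b x y
    show "s a (x + y) = s a x + s a y" using M.smult_r_distr[of a x y] by (simp add: d)
    show "s (a + b) x = s a x + s b x" using M.smult_l_distr[of a b x] by (simp add: d)
    show "s a (s b x) = s (a * b) x" using M.smult_assoc1[of a b x] by (simp add: d)
    show "s 1 x = x" using M.smult_one[of x] by (simp add: d)
  qed
  show "s c a * b = s c (a * b)" using assms by (simp add: assoc_algebra_def d)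
qed

locale deformation =
  fixes s :: "'k::field \<Rightarrow> 'a::idom \<Rightarrow> 'a" and A :: "('k fps, 'b, 'm) module_scheme"
    and \<theta> :: "'b set \<Rightarrow> 'a" and \<phi> :: "'b \<Rightarrow> 'a fps"
  assumes algebra_s: "assoc_algebra (type_algebra s)" and algebra_A: "assoc_algebra A"
    and phi_linear: "\<phi> \<in> linear_maps A (power_series_module s)"
    and phi_bij: "bij_betw \<phi> (carrier A) UNIV"
    and theta: "\<theta> \<in> algebra_isos (quot_algebra (const_algebra A) (hbar_ideal A)) (type_algebra s)"
begin

sublocale A: ring A using algebra_A by (simp add: assoc_algebra_def)

sublocale M: Module.module "ring_of_type_algebra :: 'k fps ring" A
  using algebra_A by (simp add: assoc_algebra_def)

sublocale S: vector_space s by (rule vector_space_type_algebra(1)[OF algebra_s])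

abbreviation "B \<equiv> carrier A"
abbreviation "K \<equiv> const_algebra A"
abbreviation "J \<equiv> hbar_ideal A"

lemma smult_closed [simp, intro]: "x \<in> B \<Longrightarrow> c \<odot>\<^bsub>A\<^esub> x \<in> B"
  using M.smult_closed[of c x] by (simp add: ring_of_type_algebra_def)

lemma smult_add_left: "x \<in> B \<Longrightarrow> (c + d) \<odot>\<^bsub>A\<^esub> x = c \<odot>\<^bsub>A\<^esub> x \<oplus>\<^bsub>A\<^esub> d \<odot>\<^bsub>A\<^esub> x"
  using M.smult_l_distr[of c d x] by (simp add: ring_of_type_algebra_def)

lemma smult_add_right: "x \<in> B \<Longrightarrow> y \<in> B \<Longrightarrow> c \<odot>\<^bsub>A\<^esub> (x \<oplus>\<^bsub>A\<^esub> y) = c \<odot>\<^bsub>A\<^esub> x \<oplus>\<^bsub>A\<^esub> c \<odot>\<^bsub>A\<^esub> y"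
  using M.smult_r_distr[of c x y] by (simp add: ring_of_type_algebra_def)

lemma smult_smult: "x \<in> B \<Longrightarrow> c \<odot>\<^bsub>A\<^esub> (d \<odot>\<^bsub>A\<^esub> x) = (c * d) \<odot>\<^bsub>A\<^esub> x"
  using M.smult_assoc1[of c d x] by (simp add: ring_of_type_algebra_def)

lemma smult_one: "x \<in> B \<Longrightarrow> 1 \<odot>\<^bsub>A\<^esub> x = x"
  using M.smult_one[of x] by (simp add: ring_of_type_algebra_def)

lemma smult_minus: "x \<in> B \<Longrightarrow> c \<odot>\<^bsub>A\<^esub> (\<ominus>\<^bsub>A\<^esub> x) = \<ominus>\<^bsub>A\<^esub> (c \<odot>\<^bsub>A\<^esub> x)"
  using M.smult_r_minus[of c x] by (simp add: ring_of_type_algebra_def)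

lemma smult_mult: "x \<in> B \<Longrightarrow> y \<in> B \<Longrightarrow> (c \<odot>\<^bsub>A\<^esub> x) \<otimes>\<^bsub>A\<^esub> y = c \<odot>\<^bsub>A\<^esub> (x \<otimes>\<^bsub>A\<^esub> y)"
    "x \<in> B \<Longrightarrow> y \<in> B \<Longrightarrow> x \<otimes>\<^bsub>A\<^esub> (c \<odot>\<^bsub>A\<^esub> y) = c \<odot>\<^bsub>A\<^esub> (x \<otimes>\<^bsub>A\<^esub> y)"
  using algebra_A by (simp_all add: assoc_algebra_def)

lemma const_algebra_simps [simp]:
  "carrier K = B" "x \<otimes>\<^bsub>K\<^esub> y = x \<otimes>\<^bsub>A\<^esub> y" "x \<oplus>\<^bsub>K\<^esub> y = x \<oplus>\<^bsub>A\<^esub> y" "\<one>\<^bsub>K\<^esub> = \<one>\<^bsub>A\<^esub>" "\<zero>\<^bsub>K\<^esub> = \<zero>\<^bsub>A\<^esub>"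
  "c \<odot>\<^bsub>K\<^esub> x = fps_const c \<odot>\<^bsub>A\<^esub> x"
  by (simp_all add: const_algebra_def ring.defs module.defs)

lemma a_r_coset_const_algebra [simp]: "J +>\<^bsub>K\<^esub> x = J +>\<^bsub>A\<^esub> x"
  by (simp add: a_r_coset_def')

lemma abelian_group_const_algebra: "abelian_group K"
  by (rule abelian_groupI) (auto simp: A.a_assoc intro: A.a_comm A.l_neg A.a_inv_closed)

lemma ring_const_algebra: "ring K"
  by (rule ringI[OF abelian_group_const_algebra])
    (auto intro!: monoidI simp: A.m_assoc A.l_distr A.r_distr)

lemma a_inv_const_algebra [simp]: "x \<in> B \<Longrightarrow> \<ominus>\<^bsub>K\<^esub> x = \<ominus>\<^bsub>A\<^esub> x"
  using abelian_group.minus_equality[OF abelian_group_const_algebra, of "\<ominus>\<^bsub>A\<^esub> x" x] by (simp add: A.l_neg)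

lemma hbar_idealI: "x \<in> B \<Longrightarrow> fps_X \<odot>\<^bsub>A\<^esub> x \<in> J"
  by (simp add: hbar_ideal_def)

lemma ideal_hbar: "ideal J K"
proof (rule idealI[OF ring_const_algebra])
  interpret K: ring K by (rule ring_const_algebra)
  show "subgroup J (add_monoid K)"
  proof (rule K.add.subgroupI)
    show "J \<subseteq> carrier K" by (auto simp: hbar_ideal_def)
    show "J \<noteq> {}" using hbar_idealI[OF A.zero_closed] by blast
    fix x assume "x \<in> J"
    then obtain x' where x: "x' \<in> B" "x = fps_X \<odot>\<^bsub>A\<^esub> x'" by (auto simp: hbar_ideal_def)
    then show "\<ominus>\<^bsub>K\<^esub> x \<in> J" using hbar_idealI[of "\<ominus>\<^bsub>A\<^esub> x'"] by (simp add: smult_minus)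
    fix y assume "y \<in> J"
    then obtain y' where y: "y' \<in> B" "y = fps_X \<odot>\<^bsub>A\<^esub> y'" by (auto simp: hbar_ideal_def)
    show "x \<oplus>\<^bsub>K\<^esub> y \<in> J" using x y hbar_idealI[of "x' \<oplus>\<^bsub>A\<^esub> y'"] by (simp add: smult_add_right)
  qed
qed (auto simp: hbar_ideal_def smult_mult)

sublocale J: ideal J K by (rule ideal_hbar)

lemma coset_smult:
  assumes x: "x \<in> B"
  shows "c \<odot>\<^bsub>quot_algebra K J\<^esub> (J +>\<^bsub>A\<^esub> x) = J +>\<^bsub>A\<^esub> (fps_const c \<odot>\<^bsub>A\<^esub> x)"
proof -
  have "J +>\<^bsub>K\<^esub> (fps_const c \<odot>\<^bsub>A\<^esub> y) = J +>\<^bsub>K\<^esub> (fps_const c \<odot>\<^bsub>A\<^esub> x)" if y: "y \<in> J +>\<^bsub>A\<^esub> x" for y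
  proof -
    obtain j where j: "j \<in> B" "y = fps_X \<odot>\<^bsub>A\<^esub> j \<oplus>\<^bsub>A\<^esub> x"
      using y by (auto simp: a_r_coset_def' hbar_ideal_def)
    have "fps_const c \<odot>\<^bsub>A\<^esub> y = fps_X \<odot>\<^bsub>A\<^esub> (fps_const c \<odot>\<^bsub>A\<^esub> j) \<oplus>\<^bsub>A\<^esub> fps_const c \<odot>\<^bsub>A\<^esub> x"
      using j x by (simp add: smult_add_right smult_smult mult.commute)
    then have mem: "fps_const c \<odot>\<^bsub>A\<^esub> y \<in> J +>\<^bsub>K\<^esub> (fps_const c \<odot>\<^bsub>A\<^esub> x)"
      using j hbar_idealI[of "fps_const c \<odot>\<^bsub>A\<^esub> j"] by (auto simp: a_r_coset_def')
    then show ?thesis using J.a_repr_independence[OF mem _ J.a_subgroup] x by simp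
  qed
  then have "(\<Union>y\<in>J +>\<^bsub>A\<^esub> x. J +>\<^bsub>K\<^esub> (fps_const c \<odot>\<^bsub>A\<^esub> y)) = (\<Union>y\<in>J +>\<^bsub>A\<^esub> x. J +>\<^bsub>K\<^esub> (fps_const c \<odot>\<^bsub>A\<^esub> x))"
    by (intro SUP_cong refl)
  also have "\<dots> = J +>\<^bsub>K\<^esub> (fps_const c \<odot>\<^bsub>A\<^esub> x)"
    using J.a_rcos_self[of x] x by (intro SUP_const) auto
  finally show ?thesis by (simp add: quot_algebra_def ring.defs module.defs)
qed

abbreviation "rd \<equiv> reduction A \<theta>"

lemma carrier_quot:
  "x \<in> B \<Longrightarrow> J +>\<^bsub>A\<^esub> x \<in> carrier (quot_algebra K J)"
  "carrier (quot_algebra K J) = (\<lambda>x. J +>\<^bsub>A\<^esub> x) ` B"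
  by (auto simp: quot_algebra_def ring.defs module.defs FactRing_def A_RCOSETS_def')

lemma theta_hom:
  assumes "X0 \<in> carrier (quot_algebra K J)" "Y0 \<in> carrier (quot_algebra K J)"
  shows "\<theta> (X0 \<oplus>\<^bsub>quot_algebra K J\<^esub> Y0) = \<theta> X0 + \<theta> Y0"
    and "\<theta> (X0 \<otimes>\<^bsub>quot_algebra K J\<^esub> Y0) = \<theta> X0 * \<theta> Y0"
    and "\<theta> (c \<odot>\<^bsub>quot_algebra K J\<^esub> X0) = s c (\<theta> X0)" and "\<theta> \<one>\<^bsub>quot_algebra K J\<^esub> = 1"
proof -
  have T: "x \<oplus>\<^bsub>type_algebra s\<^esub> y = x + y" "x \<otimes>\<^bsub>type_algebra s\<^esub> y = x * y"
    "c \<odot>\<^bsub>type_algebra s\<^esub> x = s c x" "\<one>\<^bsub>type_algebra s\<^esub> = 1" for x y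
    by (simp_all add: type_algebra_def ring_of_type_algebra_def ring.defs module.defs)
  have "\<theta> \<in> ring_hom (quot_algebra K J) (type_algebra s)" "\<theta> \<in> linear_maps (quot_algebra K J) (type_algebra s)"
    using theta by (simp_all add: algebra_isos_def algebra_homs_def)
  then show "\<theta> (X0 \<oplus>\<^bsub>quot_algebra K J\<^esub> Y0) = \<theta> X0 + \<theta> Y0"
    "\<theta> (X0 \<otimes>\<^bsub>quot_algebra K J\<^esub> Y0) = \<theta> X0 * \<theta> Y0"
    "\<theta> (c \<odot>\<^bsub>quot_algebra K J\<^esub> X0) = s c (\<theta> X0)" "\<theta> \<one>\<^bsub>quot_algebra K J\<^esub> = 1"
    using assms unfolding T[symmetric] by (simp_all add: ring_hom_def linear_maps_def)
qed

lemma
  assumes x: "x \<in> B" and y: "y \<in> B"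
  shows rd_add: "rd (x \<oplus>\<^bsub>A\<^esub> y) = rd x + rd y"
    and rd_mult: "rd (x \<otimes>\<^bsub>A\<^esub> y) = rd x * rd y"
proof -
  have "(J +>\<^bsub>A\<^esub> x) \<oplus>\<^bsub>quot_algebra K J\<^esub> (J +>\<^bsub>A\<^esub> y) = J +>\<^bsub>A\<^esub> (x \<oplus>\<^bsub>A\<^esub> y)"
    using J.a_rcos_sum[of x y] x y by (simp add: quot_algebra_def ring.defs module.defs FactRing_def)
  then show "rd (x \<oplus>\<^bsub>A\<^esub> y) = rd x + rd y"
    unfolding reduction_def using theta_hom(1)[OF carrier_quot(1)[OF x] carrier_quot(1)[OF y]] by simp
  have "(J +>\<^bsub>A\<^esub> x) \<otimes>\<^bsub>quot_algebra K J\<^esub> (J +>\<^bsub>A\<^esub> y) = J +>\<^bsub>A\<^esub> (x \<otimes>\<^bsub>A\<^esub> y)"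
    using J.rcoset_mult_add[of x y] x y by (simp add: quot_algebra_def ring.defs module.defs FactRing_def)
  then show "rd (x \<otimes>\<^bsub>A\<^esub> y) = rd x * rd y"
    unfolding reduction_def using theta_hom(2)[OF carrier_quot(1)[OF x] carrier_quot(1)[OF y]] by simp
qed

lemma rd_smult: "x \<in> B \<Longrightarrow> rd (fps_const c \<odot>\<^bsub>A\<^esub> x) = s c (rd x)"
  unfolding reduction_def using theta_hom(3)[OF carrier_quot(1) carrier_quot(1), of x x c] by (simp add: coset_smult)

lemma rd_one: "rd \<one>\<^bsub>A\<^esub> = 1"
  unfolding reduction_def using theta_hom(4)[OF carrier_quot(1) carrier_quot(1), of "\<one>\<^bsub>A\<^esub>" "\<one>\<^bsub>A\<^esub>"]
  by (simp add: quot_algebra_def ring.defs module.defs FactRing_def)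

lemma theta_bij: "bij_betw \<theta> (carrier (quot_algebra K J)) UNIV"
  using theta by (simp add: algebra_isos_def type_algebra_def
      ring_of_type_algebra_def ring.defs module.defs)

lemma rd_surj: "\<exists>x\<in>B. rd x = a"
proof -
  have "a \<in> \<theta> ` (\<lambda>x. J +>\<^bsub>A\<^esub> x) ` B"
    using bij_betw_imp_surj_on[OF theta_bij] unfolding carrier_quot(2) by blast
  then show ?thesis unfolding reduction_def by auto
qed

lemma rd_eq_0: "x \<in> B \<Longrightarrow> rd x = 0 \<longleftrightarrow> x \<in> J"
proof -
  assume x: "x \<in> B"
  have "rd \<zero>\<^bsub>A\<^esub> + rd \<zero>\<^bsub>A\<^esub> = rd \<zero>\<^bsub>A\<^esub>" using rd_add[of "\<zero>\<^bsub>A\<^esub>" "\<zero>\<^bsub>A\<^esub>"] by simp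
  then have "rd \<zero>\<^bsub>A\<^esub> = 0" by (simp only: add_cancel_left_left)
  then have "rd x = 0 \<longleftrightarrow> J +>\<^bsub>A\<^esub> x = J +>\<^bsub>A\<^esub> \<zero>\<^bsub>A\<^esub>"
    using inj_on_eq_iff[OF bij_betw_imp_inj_on[OF theta_bij] carrier_quot(1)[OF x] carrier_quot(1)[OF A.zero_closed]]
    by (simp add: reduction_def)
  also have "J +>\<^bsub>A\<^esub> \<zero>\<^bsub>A\<^esub> = J" using J.a_rcos_const[OF additive_subgroup.zero_closed[OF J.is_additive_subgroup]] by simp
  also have "J +>\<^bsub>A\<^esub> x = J \<longleftrightarrow> x \<in> J"
    using J.a_rcos_const[of x] J.a_rcos_self[of x] x by auto
  finally show ?thesis .
qed

section \<open>Structure transported along the module isomorphism\<close>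

definition psi :: "'a fps \<Rightarrow> 'b" (\<open>\<psi>\<close>) where "\<psi> = inv_into B \<phi>"

lemma psi_closed [simp, intro]: "\<psi> x \<in> B"
  using bij_betw_imp_surj_on[OF phi_bij] by (simp add: psi_def inv_into_into)

lemma phi_psi [simp]: "\<phi> (\<psi> x) = x"
  using bij_betw_imp_surj_on[OF phi_bij] by (simp add: psi_def f_inv_into_f)

lemma psi_phi [simp]: "x \<in> B \<Longrightarrow> \<psi> (\<phi> x) = x"
  using bij_betw_imp_inj_on[OF phi_bij] by (simp add: psi_def)

lemma phi_add: "x \<in> B \<Longrightarrow> y \<in> B \<Longrightarrow> \<phi> (x \<oplus>\<^bsub>A\<^esub> y) = \<phi> x + \<phi> y"
  using phi_linear by (simp add: linear_maps_def power_series_module_def type_algebra_def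
      ring_of_type_algebra_def ring.defs module.defs)

lemma phi_eq_iff: "x \<in> B \<Longrightarrow> \<phi> x = y \<longleftrightarrow> x = \<psi> y"
  by auto

lemma psi_add: "\<psi> (x + y) = \<psi> x \<oplus>\<^bsub>A\<^esub> \<psi> y"
  using phi_add[of "\<psi> x" "\<psi> y"] by (simp add: phi_eq_iff)

lemma phi_zero [simp]: "\<phi> \<zero>\<^bsub>A\<^esub> = 0"
proof -
  have "\<phi> \<zero>\<^bsub>A\<^esub> + \<phi> \<zero>\<^bsub>A\<^esub> = \<phi> \<zero>\<^bsub>A\<^esub>" using phi_add[of "\<zero>\<^bsub>A\<^esub>" "\<zero>\<^bsub>A\<^esub>"] by simp
  then show ?thesis by (simp only: add_cancel_left_left)
qed

lemma phi_minus: "x \<in> B \<Longrightarrow> y \<in> B \<Longrightarrow> \<phi> (x \<ominus>\<^bsub>A\<^esub> y) = \<phi> x - \<phi> y"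
  using phi_add[of "\<ominus>\<^bsub>A\<^esub> y" y] phi_add[of x "\<ominus>\<^bsub>A\<^esub> y"]
  by (simp add: A.minus_eq A.l_neg eq_neg_iff_add_eq_0[symmetric])

text \<open>The type of power series supplies the additive group that \<open>quantization\<close>
  expects. The product \<open>mul\<close> is that of A and in general differs from the product of
  power series.\<close>

definition "sc c x = \<phi> (fps_const c \<odot>\<^bsub>A\<^esub> \<psi> x)"
definition "mul x y = \<phi> (\<psi> x \<otimes>\<^bsub>A\<^esub> \<psi> y)"
definition "hb x = \<phi> (fps_X \<odot>\<^bsub>A\<^esub> \<psi> x)"

text \<open>The isomorphism is linear over k[[\<hbar>]], so \<hbar> acts as the variable;
  injectivity and separatedness become statements on power series.\<close>

lemma hb_eq: "hb x = fps_X * x"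
proof -
  have "hb x = Abs_fps (\<lambda>n. \<Sum>i\<le>n. s (fps_X $ i) (x $ (n - i)))"
    using phi_linear psi_closed[of x] unfolding hb_def
    by (simp add: linear_maps_def power_series_module_def type_algebra_def
      ring_of_type_algebra_def ring.defs module.defs del: psi_closed)
  also have "\<dots> = fps_X * x"
  proof (rule fps_ext)
    fix n
    have "s (fps_X $ i) y = (if i = 1 then y else 0)" for i y by (simp add: fps_X_def)
    then show "Abs_fps (\<lambda>n. \<Sum>i\<le>n. s (fps_X $ i) (x $ (n - i))) $ n = (fps_X * x) $ n"
      by (cases n) simp_all
  qed
  finally show ?thesis .
qed

lemma hb_power: "(hb ^^ n) x = fps_X ^ n * x"
  by (induction n) (simp_all add: hb_eq mult.assoc)

lemma vector_space_sc: "vector_space sc"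
proof
  fix a b x y
  show "sc a (x + y) = sc a x + sc a y" by (simp add: sc_def psi_add smult_add_right phi_add)
  show "sc (a + b) x = sc a x + sc b x" by (simp add: sc_def smult_add_left phi_add flip: fps_const_add)
  show "sc a (sc b x) = sc (a * b) x" by (simp add: sc_def smult_smult)
  show "sc 1 x = x" by (simp add: sc_def smult_one)
qed

lemma rd_psi_eq_0: "rd (\<psi> x) = 0 \<longleftrightarrow> x \<in> range hb"
proof -
  have "\<psi> x \<in> J \<longleftrightarrow> (\<exists>y\<in>B. \<psi> x = fps_X \<odot>\<^bsub>A\<^esub> y)" by (auto simp: hbar_ideal_def)
  also have "\<dots> \<longleftrightarrow> (\<exists>y. \<psi> x = fps_X \<odot>\<^bsub>A\<^esub> \<psi> y)" by (metis psi_closed psi_phi)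
  also have "\<dots> \<longleftrightarrow> (\<exists>y. x = hb y)" unfolding hb_def by (metis phi_psi psi_closed psi_phi smult_closed)
  finally show ?thesis by (auto simp: rd_eq_0)
qed

sublocale Q: quantization s sc mul "\<phi> \<one>\<^bsub>A\<^esub>" hb "\<lambda>x. rd (\<psi> x)"
proof (intro quantization.intro)
  show "vector_space s" "vector_space sc" by (rule S.vector_space_axioms vector_space_sc)+
  fix c a b
  show "s c a * b = s c (a * b)" by (rule vector_space_type_algebra(2)[OF algebra_s])
  fix x y z
  show "mul (x + y) z = mul x z + mul y z" "mul x (y + z) = mul x y + mul x z"
    by (simp_all add: mul_def psi_add A.l_distr A.r_distr phi_add)
  show "mul (mul x y) z = mul x (mul y z)" by (simp add: mul_def A.m_assoc)
  show "mul (\<phi> \<one>\<^bsub>A\<^esub>) x = x" "mul x (\<phi> \<one>\<^bsub>A\<^esub>) = x" by (simp_all add: mul_def)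
  show "mul (sc c x) y = sc c (mul x y)" "mul x (sc c y) = sc c (mul x y)"
    by (simp_all add: mul_def sc_def smult_mult)
  show "hb (x + y) = hb x + hb y" "hb x = hb y \<Longrightarrow> x = y" by (simp_all add: hb_eq algebra_simps)
  show "mul (hb x) y = hb (mul x y)" "mul x (hb y) = hb (mul x y)"
    by (simp_all add: mul_def hb_def smult_mult)
  show "hb (sc c x) = sc c (hb x)" by (simp add: sc_def hb_def smult_smult mult.commute)
  show "rd (\<psi> (x + y)) = rd (\<psi> x) + rd (\<psi> y)" "rd (\<psi> (mul x y)) = rd (\<psi> x) * rd (\<psi> y)"
    "rd (\<psi> (sc c x)) = s c (rd (\<psi> x))" "rd (\<psi> (\<phi> \<one>\<^bsub>A\<^esub>)) = 1"
    by (simp_all add: psi_add rd_add mul_def rd_mult sc_def rd_smult rd_one)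
  show "\<exists>x. rd (\<psi> x) = a" using rd_surj[of a] by (metis psi_phi)
  show "rd (\<psi> x) = 0 \<longleftrightarrow> x \<in> range hb" by (rule rd_psi_eq_0)
  \<comment> \<open>Divisibility by \<hbar>^(n+1) kills coefficient n.\<close>
  assume r: "\<And>n. x \<in> range (hb ^^ n)"
  show "x = 0"
  proof (rule fps_ext)
    fix n
    obtain y where "x = fps_X ^ Suc n * y" using r[of "Suc n"] unfolding hb_power by blast
    then show "x $ n = 0 $ n" by (simp only: fps_X_power_mult_nth) simp
  qed
qed

section \<open>Agreement of the two descriptions of the Poisson bracket\<close>

lemma poisson_bracket_eq: "poisson_bracket A \<theta> a b = Q.bracket a b"
proof -
  have "(\<exists>x\<in>B. \<exists>y\<in>B. \<exists>z\<in>B. rd x = a \<and> rd y = b \<and> (x \<otimes>\<^bsub>A\<^esub> y) \<ominus>\<^bsub>A\<^esub> (y \<otimes>\<^bsub>A\<^esub> x) = fps_X \<odot>\<^bsub>A\<^esub> z \<and> c = rd z) \<longleftrightarrow>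
      (\<exists>x y z. rd (\<psi> x) = a \<and> rd (\<psi> y) = b \<and> mul x y - mul y x = hb z \<and> c = rd (\<psi> z))" for c
  proof -
    have "(\<exists>x\<in>B. P x) \<longleftrightarrow> (\<exists>x. P (\<psi> x))" for P by (metis psi_closed psi_phi)
    moreover have "(\<psi> x \<otimes>\<^bsub>A\<^esub> \<psi> y) \<ominus>\<^bsub>A\<^esub> (\<psi> y \<otimes>\<^bsub>A\<^esub> \<psi> x) = fps_X \<odot>\<^bsub>A\<^esub> \<psi> z \<longleftrightarrow> mul x y - mul y x = hb z" for x y z
      unfolding mul_def hb_def phi_minus[symmetric, OF A.m_closed[OF psi_closed psi_closed] A.m_closed[OF psi_closed psi_closed]]
      by (rule inj_on_eq_iff[OF bij_betw_imp_inj_on[OF phi_bij], symmetric]) auto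
    ultimately show ?thesis by simp
  qed
  then show ?thesis by (simp add: poisson_bracket_def Q.bracket_def)
qed

text \<open>By the Leibniz rule, linearity over the constants amounts to killing them; k-linearity
  of the bracket is thus reduced to \<open>Pois_const\<close>.\<close>

lemma fract_derivation_iff:
  "fract_derivation s D \<longleftrightarrow> twisted_derivation (\<lambda>q. q) D \<and> (\<forall>c. D (fract_const s c) = 0)"
proof
  assume D: "fract_derivation s D"
  have tw: "twisted_derivation (\<lambda>q. q) D" using D by (simp add: fract_derivation_def twisted_derivation_def)
  have "D 1 = 0" using tw unfolding twisted_derivation_def by (metis add_cancel_right_right mult.right_neutral mult_1)
  moreover have "D (fract_const s c * 1) = fract_const s c * D 1" for c
    using D unfolding fract_derivation_def by blast
  ultimately show "twisted_derivation (\<lambda>q. q) D \<and> (\<forall>c. D (fract_const s c) = 0)" using tw by simp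
qed (simp add: fract_derivation_def twisted_derivation_def)

lemma fract_const_Fr: "fract_const s c = Fr (s c 1)"
  by (simp add: fract_const_def)

lemma bracket_const: "Q.bracket a (s c 1) = 0"
proof -
  have "Q.bracket a (1 * 1) = Q.bracket a 1 * 1 + 1 * Q.bracket a 1"
    using Q.biderivation_bracket unfolding biderivation_def by blast
  then have "Q.bracket a 1 = 0" by (simp only: mult_1 mult_1_right add_cancel_right_right)
  then show ?thesis by (simp add: Q.bracket_sc_right)
qed

lemma Pois_const: "Q.Pois f (fract_const s c) = 0" "Q.Pois (fract_const s c) f = 0"
proof -
  have "Q.Pois f (Fr (s c 1)) = 0" for f
  proof -
    obtain u v where f: "f = Fr u / Fr v" "v \<noteq> 0" by (rule fract_obtain)
    have z: "Q.Pois (Fr a) (Fr (s c 1)) = 0" for a by (simp add: Q.Pois_Fr(1) bracket_const Fr_eq_0_iff)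
    have "Q.Pois (f * Fr v) (Fr (s c 1)) = Q.Pois f (Fr (s c 1)) * Fr v + f * Q.Pois (Fr v) (Fr (s c 1))"
      using Q.Pois_left unfolding twisted_derivation_def by blast
    moreover have "f * Fr v = Fr u" using f by (simp add: Fr_eq_0_iff)
    ultimately show ?thesis using f(2) by (simp add: z Fr_eq_0_iff)
  qed
  then show "Q.Pois f (fract_const s c) = 0" "Q.Pois (fract_const s c) f = 0"
    using Q.Pois_antisym[of "fract_const s c" f] by (simp_all add: fract_const_Fr)
qed

text \<open>Uniqueness of the biderivation extending the bracket of A_0 resolves the definite
  description.\<close>

lemma fract_poisson_bracket_eq: "fract_poisson_bracket s A \<theta> = Q.Pois"
  unfolding fract_poisson_bracket_def
proof (rule the_equality)
  show "(\<forall>g. fract_derivation s (\<lambda>f. Q.Pois f g)) \<and> (\<forall>f. fract_derivation s (Q.Pois f)) \<and>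
     (\<forall>a b. Q.Pois (Fract a 1) (Fract b 1) = Fract (poisson_bracket A \<theta> a b) 1)"
    using Q.Pois_left Q.Pois_right Q.Pois_Fr(1)
    by (simp add: fract_derivation_iff Pois_const poisson_bracket_eq)
next
  fix P
  assume P: "(\<forall>g. fract_derivation s (\<lambda>f. P f g)) \<and> (\<forall>f. fract_derivation s (P f)) \<and>
     (\<forall>a b. P (Fract a 1) (Fract b 1) = Fract (poisson_bracket A \<theta> a b) 1)"
  show "P = Q.Pois"
    by (rule fract_bracket_eqI[OF Q.biderivation_bracket])
      (use P in \<open>simp_all add: fract_derivation_iff poisson_bracket_eq\<close>)
qed

section \<open>The transported action\<close>

context
  fixes H :: "('k, 'h, 'n) hopf_scheme" and act :: "'h \<Rightarrow> 'b \<Rightarrow> 'b"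
  assumes H: "hopf_algebra H" and action: "hopf_action H A act"
begin

interpretation H: hopf H by (rule hopf.intro[OF H])

definition "act_power h x = \<phi> (act h (\<psi> x))"

lemma linear_on_phi: "linear_on K sc \<phi>"
  by (simp add: linear_on_def phi_add sc_def)

lemma act_simps:
  assumes "h \<in> carrier H"
  shows "x \<in> B \<Longrightarrow> act h x \<in> B"
    and "x \<in> B \<Longrightarrow> y \<in> B \<Longrightarrow> act h (x \<oplus>\<^bsub>A\<^esub> y) = act h x \<oplus>\<^bsub>A\<^esub> act h y"
    and "x \<in> B \<Longrightarrow> act h (r \<odot>\<^bsub>A\<^esub> x) = r \<odot>\<^bsub>A\<^esub> act h x"
    and "x \<in> B \<Longrightarrow> y \<in> B \<Longrightarrow> act h (x \<otimes>\<^bsub>A\<^esub> y) = tensor_lift K (\<lambda>u v. act u x \<otimes>\<^bsub>A\<^esub> act v y) (comul H h)"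
    and "act h \<one>\<^bsub>A\<^esub> = fps_const (counit H h) \<odot>\<^bsub>A\<^esub> \<one>\<^bsub>A\<^esub>"
    and "x \<in> B \<Longrightarrow> g \<in> carrier H \<Longrightarrow> act (h \<oplus>\<^bsub>H\<^esub> g) x = act h x \<oplus>\<^bsub>A\<^esub> act g x"
    and "x \<in> B \<Longrightarrow> act (c \<odot>\<^bsub>H\<^esub> h) x = fps_const c \<odot>\<^bsub>A\<^esub> act h x"
    and "x \<in> B \<Longrightarrow> act \<one>\<^bsub>H\<^esub> x = x"
    and "x \<in> B \<Longrightarrow> g \<in> carrier H \<Longrightarrow> act (h \<otimes>\<^bsub>H\<^esub> g) x = act h (act g x)"
  using action assms by (auto simp: hopf_action_def linear_maps_def)

lemma hopf_quantization_act_power: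
  assumes "finite E" "E \<subseteq> carrier H" "\<And>e. e \<in> E \<Longrightarrow> linear_on H (*) (cf e)"
    "\<And>h. h \<in> carrier H \<Longrightarrow> h = (\<Oplus>\<^bsub>H\<^esub>e\<in>E. cf e h \<odot>\<^bsub>H\<^esub> e)"
  shows "hopf_quantization s sc mul (\<phi> \<one>\<^bsub>A\<^esub>) hb (\<lambda>x. rd (\<psi> x)) H act_power E cf"
proof (intro hopf_quantization.intro Q.quantization_axioms hopf_quantization_axioms.intro assms hopf.intro[OF H])
  fix a b c h assume h: "h \<in> carrier H"
  note [simp] = act_simps(1-3)[OF h]
  show "act_power h (a + b) = act_power h a + act_power h b" by (simp add: act_power_def psi_add phi_add)
  show "act_power h (hb a) = hb (act_power h a)" by (simp add: act_power_def hb_def)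
  show "act_power h (sc c a) = sc c (act_power h a)" by (simp add: act_power_def sc_def)
  show "act_power h (\<phi> \<one>\<^bsub>A\<^esub>) = sc (counit H h) (\<phi> \<one>\<^bsub>A\<^esub>)"
    by (simp add: act_power_def sc_def act_simps(5)[OF h])
  have "act_power h (mul a b) = \<phi> (tensor_lift K (\<lambda>x y. act x (\<psi> a) \<otimes>\<^bsub>A\<^esub> act y (\<psi> b)) (comul H h))"
    by (simp add: act_power_def mul_def act_simps(4)[OF h])
  also have "\<dots> = sw H sc h (\<lambda>x y. \<phi> (act x (\<psi> a) \<otimes>\<^bsub>A\<^esub> act y (\<psi> b)))"
    unfolding sw_def
    by (rule tensor_lift_linear[OF vector_space_sc abelian_group_const_algebra linear_on_phi])
      (use H.keys_comul[OF h] in \<open>auto simp: act_simps(1)\<close>)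
  also have "\<dots> = sw H sc h (\<lambda>x y. mul (act_power x a) (act_power y b))"
    by (rule H.sw_cong[OF h]) (simp add: mul_def act_power_def act_simps(1))
  finally show "act_power h (mul a b) = sw H sc h (\<lambda>x y. mul (act_power x a) (act_power y b))" .
  fix g assume g: "g \<in> carrier H"
  show "act_power (g \<otimes>\<^bsub>H\<^esub> h) a = act_power g (act_power h a)"
    by (simp add: act_power_def act_simps(9)[OF g _ h])
next
  fix a
  show "linear_on H sc (\<lambda>h. act_power h a)"
    by (simp add: linear_on_def act_power_def act_simps(1,6,7) phi_add sc_def)
  show "act_power \<one>\<^bsub>H\<^esub> a = a" by (simp add: act_power_def act_simps(8)[OF H.one_closed])
qed

end

end

theorem theorem3p3:
  fixes s :: "'k::{alg_closed_field, field_char_0} \<Rightarrow> 'a::idom \<Rightarrow> 'a"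
    and A :: "('k fps, 'b) module"
    and \<theta> :: "'b set \<Rightarrow> 'a"
    and H\<^sub>0 :: "('k, 'h) hopf"
    and act :: "'h \<Rightarrow> 'b \<Rightarrow> 'b"
  assumes "assoc_algebra (type_algebra s)"
    and "quantum_deformation s A \<theta>"
    and "hopf_algebra H\<^sub>0"
    and "finite_dimensional H\<^sub>0"
    and "hopf_action H\<^sub>0 A act"
    and "trivial_poisson_center s A \<theta>"
  shows "factors_through_group H\<^sub>0 A act"
proof -
  obtain \<phi> where "\<phi> \<in> linear_maps A (power_series_module s)"
    "bij_betw \<phi> (carrier A) (carrier (power_series_module s))"
    using assms(2) by (auto simp: quantum_deformation_def modules_isomorphic_def)
  moreover have "carrier (power_series_module s) = UNIV"
    by (simp add: power_series_module_def type_algebra_def ring_of_type_algebra_def ring.defs module.defs)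
  ultimately interpret deformation s A \<theta> \<phi>
    using assms(1,2) by unfold_locales (simp_all add: quantum_deformation_def)
  interpret H: hopf H\<^sub>0 by (rule hopf.intro[OF assms(3)])
  obtain E and cf where E: "finite E" "E \<subseteq> carrier H\<^sub>0" "\<And>e. e \<in> E \<Longrightarrow> linear_on H\<^sub>0 (*) (cf e)"
    "\<And>h. h \<in> carrier H\<^sub>0 \<Longrightarrow> h = (\<Oplus>\<^bsub>H\<^sub>0\<^esub>e\<in>E. cf e h \<odot>\<^bsub>H\<^sub>0\<^esub> e)"
    by (rule H.finite_basis[OF assms(4)]) blast
  interpret hopf_quantization s sc mul "\<phi> \<one>\<^bsub>A\<^esub>" hb "\<lambda>x. rd (psi x)" H\<^sub>0 "act_power act" E cf
    by (rule hopf_quantization_act_power[OF assms(3,5) E(1,2)]) (fact E)+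
  interpret closed_hopf_quantization s sc mul "\<phi> \<one>\<^bsub>A\<^esub>" hb "\<lambda>x. rd (psi x)" H\<^sub>0 "act_power act" E cf
  proof unfold_locales
    show "(of_nat n :: 'k) \<noteq> 0" if "n > 0" for n using that by simp
    show "\<exists>c. q = Fr (s c 1)" if "\<And>g. Q.Pois q g = 0" for q
    proof -
      have "q \<in> range (fract_const s)"
        using assms(6) that unfolding trivial_poisson_center_def fract_poisson_bracket_eq by blast
      then show ?thesis by (auto simp: fract_const_Fr)
    qed
  qed
  \<comment> \<open>The common kernel of these coordinates is the Hopf ideal sought.\<close>
  obtain G :: "nat monoid" and \<pi> where G: "hopf_group_coefficients H\<^sub>0 G \<pi>"
    "\<And>x a. x \<in> carrier H\<^sub>0 \<Longrightarrow> \<forall>g\<in>carrier G. \<pi> g x = 0 \<Longrightarrow> act_power act x a = 0"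
    using group_coefficients_exist by blast
  interpret G: hopf_group_coefficients H\<^sub>0 G \<pi> by (rule G(1))
  have "act h a = \<zero>\<^bsub>A\<^esub>" if h: "h \<in> G.ker" and a: "a \<in> carrier A" for h a
  proof -
    have hC: "h \<in> carrier H\<^sub>0" using h by (simp add: G.ker_def)
    have "\<phi> (act h a) = 0" using G(2)[of h "\<phi> a"] h a by (simp add: G.ker_def act_power_def[OF assms(3,5)])
    moreover have "act h a \<in> carrier A" by (rule act_simps(1)[OF assms(3,5) hC a])
    ultimately show ?thesis using phi_zero by (metis psi_phi A.zero_closed)
  qed
  then show ?thesis
    unfolding factors_through_group_def
    using G.hopf_ideal_ker G.group G.finG G.quot_map_hopf_iso by blast
qed

end
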